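(* Let $(\rho_n)_{n\ge1}$ be a sequence where each $\rho_n$ is a probability measure on $\mathbb{Y}_n$. Then $(\rho_n)$ is CLT-appropriate if and only if it satisfies a CLT as $n\to\infty$. In that case the numbers $a_k,b_{k,k'}$ are polynomials in the $c_i,d_{i,j}$ given by $$a_k=[z^{-1}]\,\frac{1}{k+1}\big(z^{-1}+zF_\rho(z)\big)^{k+1},$$ $$b_{k,k'}=[z^{-1}w^{-1}]\Big[\big(z^{-1}+zF_\rho(z)\big)^{k}\big(w^{-1}+wF_\rho(w)\big)^{k'}\Big(Q_\rho(z,w)-zw\,\partial_z\partial_w\Big(zwF_\rho(z)F_\rho(w)+\ln\Big(1-zw\frac{zF_\rho(z)-wF_\rho(w)}{z-w}\Big)\Big)\Big)\Big],$$ where $[z^{-1}]$, $[z^{-1}w^{-1}]$ denote coefficient extraction in formal Laurent series.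
   Context: For $n\ge1$, $\mathbb{Y}_n$ is the set of integer partitions of $n$. For $\lambda\in\mathbb{Y}_n$, $\chi_\lambda$ is the irreducible character of $S_n$ indexed by $\lambda$ and $\dim(\lambda)=\chi_\lambda(e)$. $S_\infty=\bigcup_m S_m$. For a probability measure $\rho$ on $\mathbb{Y}_n$ define $M_\rho:S_\infty\to\mathbb{R}$ by $M_\rho(\sigma)=\sum_{\lambda\in\mathbb{Y}_n}\rho(\lambda)\chi_\lambda(\tau)/\dim(\lambda)$ if $\sigma$ is conjugate in $S_\infty$ to some $\tau\in S_n$, and $0$ otherwise. The Young generating function is $$A_\rho(x_1,x_2,\dots)=\sum_{\vec i}M_\rho(\sigma_{\vec i})\prod_{k\ge1}n^{i_k(k-1)/2}\frac{x_k^{i_k}}{i_k!},$$ summing over finitely supported sequences $\vec i=(i_1,i_2,\dots)$ of nonnegative integers, with $\sigma_{\vec i}$ any permutation having exactly $i_k$ cycles of length $k$ for each $k\ge2$. $\ln A_\rho$ is a formal power series (constant term of $A_\rho$ is $1$); $\partial_i$ is the formal partial derivative in $x_i$, $|_{\vec x=0}$ takes the constant term. $(\rho_n)$ is CLT-appropriate if there are reals $(c_i)_{i\ge1}$, $(d_{i,j})_{i,j\ge1}$ with: $\lim_n\partial_i\ln A_{\rho_n}|_{\vec x=0}=c_i$; $\lim_n n\,\partial_i\partial_j\ln A_{\rho_n}|_{\vec x=0}=d_{i,j}$; and $\lim_n n^{r/2}\partial_{i_1}\cdots\partial_{i_r}\ln A_{\rho_n}|_{\vec x=0}=0$ for all $r\ge3$.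 Set $F_\rho(z)=\sum_{i\ge1}c_iz^{i-1}$ and $Q_\rho(z,w)=\sum_{i,j\ge1}d_{i,j}z^iw^j$. Transition measure of a partition $\lambda$ of $n$: $m_K[\lambda]=\sum_\square\frac{\dim(\lambda\cup\square)}{(n+1)\dim(\lambda)}\delta_{c(\square)}$, over cells $\square$ addable to $\lambda$, $c(\square)=s-r$ for a cell in row $r$, column $s$. For $\lambda\sim\rho_n$ let $X_k=n^{-k/2}\int x^k\,m_K[\lambda](dx)$; $\kappa$ denotes classical joint cumulants. $(\rho_n)$ satisfies a CLT if there are reals $(a_k)$, $(b_{k,k'})$ with $\lim_n\mathbb{E}[X_k]=a_k$, $\lim_n n\,\kappa(X_k,X_{k'})=b_{k,k'}$, and $\lim_n n^{r/2}\kappa(X_{k_1},\dots,X_{k_r})=0$ for all $r\ge3$. *)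

theory Defs
  imports "HOL-Analysis.Analysis" "HOL-Probability.Probability"
    "HOL-Combinatorics.Permutations" "HOL-Library.Disjoint_Sets" "HOL-Library.FuncSet"
    "HOL-Computational_Algebra.Formal_Laurent_Series"
begin

definition Part :: "nat \<Rightarrow> nat list set" where
  "Part n = {lam. sum_list lam = n \<and> 0 \<notin> set lam \<and> sorted_wrt (\<ge>) lam}"

text \<open>Irreducible character chi_lam evaluated on a permutation of cycle type mu
  (mu given as the list of its cycle lengths, fixed points included), defined by the
  Frobenius formula chi_lam(mu) = [x^(lam+delta)] a_delta(x) p_mu(x) in l = length lam
  variables, with the coefficient written out explicitly.\<close>
definition irr_char :: "nat list \<Rightarrow> nat list \<Rightarrow> int" where
  "irr_char lam mu =
    (let l = length lam; m = length mu; delta = (\<lambda>i::nat. l - 1 - i) in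
     (\<Sum>w | w permutes {..<l}.
        sign w * int (card {f \<in> {..<m} \<rightarrow>\<^sub>E {..<l}.
           \<forall>i<l. delta (w i) + (\<Sum>j | j < m \<and> f j = i. mu ! j) = lam ! i + delta i})))"

definition dimY :: "nat list \<Rightarrow> int" where
  "dimY lam = irr_char lam (replicate (sum_list lam) 1)"

text \<open>Multivariate formal power series in x_1, x_2, ...: coefficient functions on
  finitely supported multi-indices alpha :: nat => nat (alpha k = exponent of x_k).\<close>
type_synonym mfps = "(nat \<Rightarrow> nat) \<Rightarrow> real"

definition mfps_one :: mfps where
  "mfps_one alpha = (if (\<forall>k. alpha k = 0) then 1 else 0)"

definition mfps_mult :: "mfps \<Rightarrow> mfps \<Rightarrow> mfps" where
  "mfps_mult f g alpha = (\<Sum>beta\<in>{beta. \<forall>k. beta k \<le> alpha k}. f beta * g (\<lambda>k. alpha k - beta k))"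

primrec mfps_pow :: "mfps \<Rightarrow> nat \<Rightarrow> mfps" where
  "mfps_pow f 0 = mfps_one"
| "mfps_pow f (Suc m) = mfps_mult f (mfps_pow f m)"

text \<open>Formal logarithm of a series with constant term 1:
  ln A = sum_{m>=1} (-1)^(m-1) (A-1)^m / m; at a multi-index of total degree d only
  the terms m <= d can contribute since A - 1 has no constant term.\<close>
definition mfps_ln :: "mfps \<Rightarrow> mfps" where
  "mfps_ln A alpha =
     (let B = (\<lambda>beta. A beta - mfps_one beta); d = (\<Sum>k\<in>{k. alpha k \<noteq> 0}. alpha k) in
      (\<Sum>m\<in>{1..d}. (-1) ^ (m - 1) / real m * mfps_pow B m alpha))"

definition mindex :: "nat list \<Rightarrow> (nat \<Rightarrow> nat)" where
  "mindex is = (\<lambda>k. count_list is k)"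

definition mfps_pderiv0 :: "mfps \<Rightarrow> nat list \<Rightarrow> real" where
  "mfps_pderiv0 f is = f (mindex is) * (\<Prod>k\<in>set is. fact (mindex is k))"

text \<open>M_rho(sigma) for sigma with alpha k cycles of length k (k >= 2): sigma is conjugate
  in S_infinity into S_n iff sum_{k>=2} k alpha_k <= n, and then its conjugate in S_n has
  cycle type (k^(alpha k) for k >= 2, 1^(n - sum)).\<close>
definition M_rho :: "nat \<Rightarrow> nat list pmf \<Rightarrow> (nat \<Rightarrow> nat) \<Rightarrow> real" where
  "M_rho n rho alpha =
     (let s = (\<Sum>k\<in>{k. k \<ge> 2 \<and> alpha k \<noteq> 0}. k * alpha k) in
      if s \<le> n then
        (let mu = concat (map (\<lambda>k. replicate (alpha k) k) [2..<n+1]) @ replicate (n - s) 1 in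
         measure_pmf.expectation rho (\<lambda>lam. real_of_int (irr_char lam mu) / real_of_int (dimY lam)))
      else 0)"

definition youngA :: "nat \<Rightarrow> nat list pmf \<Rightarrow> mfps" where
  "youngA n rho alpha =
     (if alpha 0 = 0 \<and> finite {k. alpha k \<noteq> 0} then
        M_rho n rho alpha *
        (\<Prod>k\<in>{k. alpha k \<noteq> 0}. sqrt (real n) ^ (alpha k * (k - 1)) / fact (alpha k))
      else 0)"

definition clt_appropriate ::
  "(nat \<Rightarrow> nat list pmf) \<Rightarrow> (nat \<Rightarrow> real) \<Rightarrow> (nat \<Rightarrow> nat \<Rightarrow> real) \<Rightarrow> bool" where
  "clt_appropriate rho c d \<longleftrightarrow>
     (\<forall>i\<ge>1. (\<lambda>n. mfps_pderiv0 (mfps_ln (youngA n (rho n))) [i]) \<longlonglongrightarrow> c i) \<and>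
     (\<forall>i\<ge>1. \<forall>j\<ge>1. (\<lambda>n. real n * mfps_pderiv0 (mfps_ln (youngA n (rho n))) [i, j]) \<longlonglongrightarrow> d i j) \<and>
     (\<forall>is. length is \<ge> 3 \<longrightarrow> (\<forall>i\<in>set is. i \<ge> 1) \<longrightarrow>
        (\<lambda>n. sqrt (real n) ^ length is * mfps_pderiv0 (mfps_ln (youngA n (rho n))) is) \<longlonglongrightarrow> 0)"

definition row_len :: "nat list \<Rightarrow> nat \<Rightarrow> nat" where
  "row_len lam r = (if r < length lam then lam ! r else 0)"

definition addable_row :: "nat list \<Rightarrow> nat \<Rightarrow> bool" where
  "addable_row lam r \<longleftrightarrow> r \<le> length lam \<and> (r = 0 \<or> row_len lam (r - 1) > row_len lam r)"

definition add_cell :: "nat list \<Rightarrow> nat \<Rightarrow> nat list" where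
  "add_cell lam r = (if r < length lam then lam[r := lam ! r + 1] else lam @ [1])"

text \<open>Content c = s - r of the addable cell in row r+1, column row_len lam r + 1.\<close>
definition cell_content :: "nat list \<Rightarrow> nat \<Rightarrow> int" where
  "cell_content lam r = int (row_len lam r) - int r"

definition trans_moment :: "nat list \<Rightarrow> nat \<Rightarrow> real" where
  "trans_moment lam k =
     (\<Sum>r\<in>{r. addable_row lam r}.
        real_of_int (dimY (add_cell lam r)) / (real (sum_list lam + 1) * real_of_int (dimY lam))
        * real_of_int (cell_content lam r) ^ k)"

definition Xk :: "nat \<Rightarrow> nat \<Rightarrow> nat list \<Rightarrow> real" where
  "Xk n k lam = trans_moment lam k / sqrt (real n) ^ k"

definition joint_cumulant :: "nat list pmf \<Rightarrow> (nat list \<Rightarrow> real) list \<Rightarrow> real" where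
  "joint_cumulant rho Ys =
     (\<Sum>P | partition_on {..<length Ys} P.
        (-1) ^ (card P - 1) * fact (card P - 1) *
        (\<Prod>B\<in>P. measure_pmf.expectation rho (\<lambda>lam. \<Prod>j\<in>B. (Ys ! j) lam)))"

definition satisfies_clt ::
  "(nat \<Rightarrow> nat list pmf) \<Rightarrow> (nat \<Rightarrow> real) \<Rightarrow> (nat \<Rightarrow> nat \<Rightarrow> real) \<Rightarrow> bool" where
  "satisfies_clt rho a b \<longleftrightarrow>
     (\<forall>k\<ge>1. (\<lambda>n. measure_pmf.expectation (rho n) (Xk n k)) \<longlonglongrightarrow> a k) \<and>
     (\<forall>k\<ge>1. \<forall>k'\<ge>1. (\<lambda>n. real n * joint_cumulant (rho n) [Xk n k, Xk n k']) \<longlonglongrightarrow> b k k') \<and>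
     (\<forall>ks. length ks \<ge> 3 \<longrightarrow> (\<forall>k\<in>set ks. k \<ge> 1) \<longrightarrow>
        (\<lambda>n. sqrt (real n) ^ length ks * joint_cumulant (rho n) (map (Xk n) ks)) \<longlonglongrightarrow> 0)"

definition F_fps :: "(nat \<Rightarrow> real) \<Rightarrow> real fps" where
  "F_fps c = Abs_fps (\<lambda>m. c (Suc m))"

definition U_fls :: "(nat \<Rightarrow> real) \<Rightarrow> real fls" where
  "U_fls c = fls_X_inv + fls_X * fps_to_fls (F_fps c)"

definition clt_a :: "(nat \<Rightarrow> real) \<Rightarrow> nat \<Rightarrow> real" where
  "clt_a c k = fls_nth (U_fls c ^ (k + 1)) (-1) / real (k + 1)"

text \<open>Bivariate formal power series in z, w: G p q = coefficient of z^p w^q.\<close>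
type_synonym bfps = "nat \<Rightarrow> nat \<Rightarrow> real"

definition bfps_one :: bfps where "bfps_one p q = (if p = 0 \<and> q = 0 then 1 else 0)"

definition bfps_mult :: "bfps \<Rightarrow> bfps \<Rightarrow> bfps" where
  "bfps_mult f g p q = (\<Sum>a\<le>p. \<Sum>b\<le>q. f a b * g (p - a) (q - b))"

primrec bfps_pow :: "bfps \<Rightarrow> nat \<Rightarrow> bfps" where
  "bfps_pow f 0 = bfps_one"
| "bfps_pow f (Suc m) = bfps_mult f (bfps_pow f m)"

text \<open>ln(1 + B) for B with zero constant term.\<close>
definition bfps_ln1p :: "bfps \<Rightarrow> bfps" where
  "bfps_ln1p B p q = (\<Sum>m\<in>{1..p+q}. (-1) ^ (m - 1) / real m * bfps_pow B m p q)"

definition bfps_dz :: "bfps \<Rightarrow> bfps" where "bfps_dz G p q = real (Suc p) * G (Suc p) q"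
definition bfps_dw :: "bfps \<Rightarrow> bfps" where "bfps_dw G p q = real (Suc q) * G p (Suc q)"
definition bfps_z :: "bfps \<Rightarrow> bfps" where "bfps_z G p q = (if p = 0 then 0 else G (p - 1) q)"
definition bfps_w :: "bfps \<Rightarrow> bfps" where "bfps_w G p q = (if q = 0 then 0 else G p (q - 1))"

definition bfps_zmw :: bfps where
  "bfps_zmw p q = (if p = 1 \<and> q = 0 then 1 else if p = 0 \<and> q = 1 then -1 else 0)"

definition bfps_zFmwF :: "(nat \<Rightarrow> real) \<Rightarrow> bfps" where
  "bfps_zFmwF c p q = (if q = 0 \<and> p \<ge> 1 then c p else 0) - (if p = 0 \<and> q \<ge> 1 then c q else 0)"

definition bfps_zwFF :: "(nat \<Rightarrow> real) \<Rightarrow> bfps" where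
  "bfps_zwFF c p q = (if p \<ge> 1 \<and> q \<ge> 1 then c p * c q else 0)"

definition bfps_Q :: "(nat \<Rightarrow> nat \<Rightarrow> real) \<Rightarrow> bfps" where
  "bfps_Q d p q = (if p \<ge> 1 \<and> q \<ge> 1 then d p q else 0)"

text \<open>The quotient (z F(z) - w F(w)) / (z - w) in the ring of formal power series in z, w
  (the unique D with (z - w) D = z F(z) - w F(w); the ring is an integral domain).\<close>
definition bfps_quot :: "(nat \<Rightarrow> real) \<Rightarrow> bfps" where
  "bfps_quot c = (THE D. bfps_mult bfps_zmw D = bfps_zFmwF c)"

definition bfps_G :: "(nat \<Rightarrow> real) \<Rightarrow> bfps" where
  "bfps_G c = (\<lambda>p q. bfps_zwFF c p q +
      bfps_ln1p (\<lambda>p' q'. - bfps_z (bfps_w (bfps_quot c)) p' q') p q)"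

definition bfps_H :: "(nat \<Rightarrow> real) \<Rightarrow> (nat \<Rightarrow> nat \<Rightarrow> real) \<Rightarrow> bfps" where
  "bfps_H c d p q = bfps_Q d p q - bfps_z (bfps_w (bfps_dz (bfps_dw (bfps_G c)))) p q"

text \<open>[z^-1 w^-1] of U(z)^k U(w)^k' H(z,w): since U^k has no terms below z^-k and H is a
  power series, only finitely many products contribute.\<close>
definition clt_b :: "(nat \<Rightarrow> real) \<Rightarrow> (nat \<Rightarrow> nat \<Rightarrow> real) \<Rightarrow> nat \<Rightarrow> nat \<Rightarrow> real" where
  "clt_b c d k k' =
     (\<Sum>p<k. \<Sum>q<k'. fls_nth (U_fls c ^ k) (- 1 - int p) * fls_nth (U_fls c ^ k') (- 1 - int q) * bfps_H c d p q)"

end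

theory Submission imports Defs "HOL-Real_Asymp.Real_Asymp"
begin

text \<open>The transition measure of a partition is the spectral measure of the last Jucys--Murphy element,
  so its moments are eigenvalues, on irreducible characters, of operators built from the
  Nazarov--Sklyanin operator. Joint moments of the \<open>X\<^sub>k\<close> are therefore obtained by applying words in
  these operators to the averaged normalised character, that is, to the Young generating function.
  If its logarithm is asymptotically quadratic, then after centring and rescaling the generating
  function tends to a Gaussian series and each operator to a first-order one, and Wick's rule yields
  the limits of all cumulants; their explicit form comes from Laurent series with symbol
  \<open>z\<inverse> + z F(z)\<close>. Conversely, truncate the logarithm below a monomial \<open>\<nu>\<close>. The truncated series is
  covered by the first part, and the cumulant of the \<open>X\<close> with indices \<open>k + 1\<close>, \<open>k \<in> \<nu>\<close>, changes only by
  a multiple of the coefficient at \<open>\<nu>\<close>, so the coefficients converge by induction on \<open>\<nu>\<close>.\<close>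

section \<open>The Nazarov--Sklyanin operator on class functions\<close>

text \<open>The operator also multiplies by p_1, that is, it joins one of the remaining fixed
  points, and their number depends on n. An extra variable x_0 records this: the Young generating
  function is multiplied by (1 + x_0/n)^n, and multiplication by p_1 becomes differentiation in x_0.
  The mean 1 of this factor supplies the term z^-1 of the symbol, and its second logarithmic
  derivative -1/n the contribution of zw F(z) F(w) to the covariance. The first implication is
  proved for sequences of series rather than of measures, because the truncated series of the
  converse need not come from measures. A part k is detected by the index k + 1 because the leading
  contribution of the operator of order k + 1 climbs k levels and falls back to level 0, creating a
  cycle of length k. Cumulants are nonlinear, but the moments of all proper subwords are the same
  for the truncated and the full series, so only the top moments differ. Parts 1 are treated apart:
  the logarithm is x_1 plus a series free of x_1.\<close>

type_synonym class_fun = "nat multiset \<Rightarrow> real"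

text \<open>A class function is evaluated on multisets of cycle lengths. Under the characteristic map
  \<open>f \<mapsto> \<Sum> f(\<mu>) p\<^sub>\<mu> / z\<^sub>\<mu>\<close>, \<open>\<lambda>M. f (add_mset k M)\<close> is \<open>k \<partial>/\<partial>p\<^sub>k\<close> and \<open>psum g\<close> is \<open>\<Sum>\<^sub>j p\<^sub>j g\<^sub>j\<close>.\<close>

definition psum :: "(nat \<Rightarrow> class_fun) \<Rightarrow> class_fun" where
  "psum g M = (\<Sum>j\<in>#M. real j * g j (M - {#j#}))"

definition NS :: "(nat \<Rightarrow> class_fun) \<Rightarrow> nat \<Rightarrow> class_fun" where
  "NS h i M = (\<Sum>m<i. h m (add_mset (i - m) M)) + psum (\<lambda>j. h (i + j)) M"

definition vac :: "class_fun \<Rightarrow> nat \<Rightarrow> class_fun" where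
  "vac f i M = (if i = 0 then f M else 0)"

definition ind :: "(nat \<Rightarrow> class_fun) \<Rightarrow> class_fun" where
  "ind h = psum (\<lambda>j. h (j - 1))"

definition NS_moment :: "nat \<Rightarrow> class_fun \<Rightarrow> class_fun" where
  "NS_moment k f = (NS ^^ k) (vac f) 0"

definition NS_ind :: "nat \<Rightarrow> class_fun \<Rightarrow> class_fun" where
  "NS_ind k f = ind ((NS ^^ k) (vac f))"

definition cut_join :: "class_fun \<Rightarrow> class_fun" where
  "cut_join f M = (psum (\<lambda>k N. \<Sum>t=1..<k. f (add_mset t (add_mset (k - t) N))) M
     + psum (\<lambda>i. psum (\<lambda>j N. f (add_mset (i + j) N))) M) / 2"

section \<open>Rules for \<open>psum\<close> and Leibniz rules for the cut-and-join operator\<close>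

lemma psum_empty [simp]: "psum g {#} = 0"
  by (simp add: psum_def)

lemma psum_cong:
  assumes "\<And>j. j \<in># M \<Longrightarrow> j > 0 \<Longrightarrow> g j (M - {#j#}) = g' j (M - {#j#})"
  shows "psum g M = psum g' M"
  unfolding psum_def using assms by (intro arg_cong[where f = sum_mset] image_mset_cong) (metis gr0I mult_eq_0_iff of_nat_0)

lemma psum_add_mset:
  "psum g (add_mset k M) = real k * g k M + psum (\<lambda>j N. g j (add_mset k N)) M"
proof -
  have "(\<Sum>j\<in>#M. real j * g j (add_mset k M - {#j#})) = (\<Sum>j\<in>#M. real j * g j (add_mset k (M - {#j#})))"
    by (intro arg_cong[where f = sum_mset] image_mset_cong) (metis add_mset_remove_trivial add_mset_commute insert_DiffM)
  then show ?thesis by (simp add: psum_def)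
qed

lemma psum_add: "psum (\<lambda>j N. f j N + g j N) = (\<lambda>M. psum f M + psum g M)"
  by (rule ext) (simp add: psum_def distrib_left sum_mset.distrib)

lemma psum_mult: "psum (\<lambda>j N. c * f j N) = (\<lambda>M. c * psum f M)"
  by (rule ext) (simp add: psum_def sum_mset_distrib_left mult.left_commute)

lemma psum_zero [simp]: "psum (\<lambda>j N. 0) = (\<lambda>M. 0)"
  by (rule ext) (simp add: psum_def)

lemma psum_minus: "psum (\<lambda>j N. f j N - g j N) = (\<lambda>M. psum f M - psum g M)"
  using psum_add[of f "\<lambda>j N. (-1) * g j N"] by (simp only: psum_mult) simp

lemma psum_sum: "psum (\<lambda>j N. \<Sum>x\<in>A. f x j N) = (\<lambda>M. \<Sum>x\<in>A. psum (f x) M)"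
  by (induction A rule: infinite_finite_induct) (simp_all add: psum_add)

lemma psum_swap: "psum (\<lambda>i. psum (g i)) M = psum (\<lambda>j. psum (\<lambda>i. g i j)) M"
proof (induction M arbitrary: g)
  case (add k M)
  have "psum (\<lambda>i. psum (g i)) (add_mset k M) =
     real k * psum (g k) M + psum (\<lambda>i N. real k * g i k N) M + psum (\<lambda>i. psum (\<lambda>j N. g i j (add_mset k N))) M"
    by (simp add: psum_add_mset psum_add)
  also have "\<dots> = real k * psum (g k) M + psum (\<lambda>i N. real k * g i k N) M
     + psum (\<lambda>j. psum (\<lambda>i N. g i j (add_mset k N))) M"
    using add[of "\<lambda>i j N. g i j (add_mset k N)"] by simp
  also have "\<dots> = psum (\<lambda>j. psum (\<lambda>i. g i j)) (add_mset k M)"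
    by (simp add: psum_add_mset psum_add psum_mult)
  finally show ?case .
qed simp

text \<open>Pairing the summands at t and k - t replaces the weight t by its mean k / 2.\<close>

lemma sum_reflect_weights:
  fixes F :: "nat \<Rightarrow> real"
  assumes "\<And>t. 1 \<le> t \<Longrightarrow> t < k \<Longrightarrow> F (k - t) = F t"
  shows "(\<Sum>t=1..<k. real t * F t) = real k / 2 * (\<Sum>t=1..<k. F t)"
proof -
  have "(\<Sum>t=1..<k. real t * F t) = (\<Sum>t=1..<k. real (k - t) * F (k - t))"
    by (rule sum.reindex_bij_witness[where i = "\<lambda>t. k - t" and j = "\<lambda>t. k - t"]) auto
  also have "\<dots> = (\<Sum>t=1..<k. (real k - real t) * F t)"
    using assms by (intro sum.cong) (auto simp: of_nat_diff)
  finally have "2 * (\<Sum>t=1..<k. real t * F t) = real k * (\<Sum>t=1..<k. F t)"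
    by (simp add: left_diff_distrib sum_subtractf sum_distrib_left)
  then show ?thesis by simp
qed

lemma cut_join_add: "cut_join (\<lambda>N. f N + g N) M = cut_join f M + cut_join g M"
  by (simp add: cut_join_def sum.distrib psum_add add_divide_distrib)

lemma cut_join_mult: "cut_join (\<lambda>N. c * f N) M = c * cut_join f M"
  by (simp add: cut_join_def psum_mult distrib_left flip: sum_distrib_left)

lemma cut_join_zero [simp]: "cut_join (\<lambda>N. 0) M = 0"
  by (simp add: cut_join_def)

lemma cut_join_sum: "cut_join (\<lambda>N. \<Sum>x\<in>A. f x N) M = (\<Sum>x\<in>A. cut_join (f x) M)"
  by (induction A rule: infinite_finite_induct) (simp_all add: cut_join_add)

text \<open>Leibniz rule for a second-order operator applied to the sum of the p_j g_j. In the
  cutting part either of the two derivatives may hit the explicit p_j, which cancels the factor 1/2;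
  in the joining part the only derivative may hit it.\<close>

lemma cut_join_psum:
  "cut_join (psum g) M = psum (\<lambda>j. cut_join (g j)) M
     + psum (\<lambda>k N. \<Sum>t=1..<k. real t * g t (add_mset (k - t) N)) M
     + psum (\<lambda>i. psum (\<lambda>j N. real (i + j) * g (i + j) N)) M / 2"
proof -
  have 1: "(\<Sum>t=1..<k. psum g (add_mset t (add_mset (k - t) N))) =
      2 * (\<Sum>t=1..<k. real t * g t (add_mset (k - t) N))
      + psum (\<lambda>j N. \<Sum>t=1..<k. g j (add_mset t (add_mset (k - t) N))) N" for k N
  proof -
    have "(\<Sum>t=1..<k. real (k - t) * g (k - t) (add_mset t N)) = (\<Sum>t=1..<k. real t * g t (add_mset (k - t) N))"
      by (rule sum.reindex_bij_witness[where i = "\<lambda>t. k - t" and j = "\<lambda>t. k - t"]) auto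
    then show ?thesis
      by (simp add: psum_add_mset psum_sum sum.distrib)
  qed
  have 2: "psum g (add_mset (i + j) N) = real (i + j) * g (i + j) N + psum (\<lambda>m N. g m (add_mset (i + j) N)) N" for i j N
    by (simp add: psum_add_mset)
  have 3: "psum (\<lambda>k. psum (\<lambda>j N. \<Sum>t=1..<k. g j (add_mset t (add_mset (k - t) N)))) M
     = psum (\<lambda>j. psum (\<lambda>k N. \<Sum>t=1..<k. g j (add_mset t (add_mset (k - t) N)))) M"
    by (rule psum_swap)
  have 4: "psum (\<lambda>i. psum (\<lambda>j. psum (\<lambda>m N. g m (add_mset (i + j) N)))) M
     = psum (\<lambda>m. psum (\<lambda>i. psum (\<lambda>j N. g m (add_mset (i + j) N)))) M"
  proof -
    have "psum (\<lambda>j. psum (\<lambda>m N. g m (add_mset (i + j) N))) = psum (\<lambda>m. psum (\<lambda>j N. g m (add_mset (i + j) N)))" for i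
      by (rule ext, rule psum_swap)
    then show ?thesis by (simp only:) (rule psum_swap)
  qed
  have 5: "psum (\<lambda>k N. 2 * (\<Sum>t=1..<k. real t * g t (add_mset (k - t) N))) M
     = 2 * psum (\<lambda>k N. (\<Sum>t=1..<k. real t * g t (add_mset (k - t) N))) M"
    by (simp only: psum_mult)
  have 6: "psum (\<lambda>j. cut_join (g j)) M = (psum (\<lambda>j. psum (\<lambda>k N. \<Sum>t=1..<k. g j (add_mset t (add_mset (k - t) N)))) M
     + psum (\<lambda>m. psum (\<lambda>i. psum (\<lambda>j N. g m (add_mset (i + j) N)))) M) / 2"
  proof -
    have "psum (\<lambda>j. cut_join (g j)) M = psum (\<lambda>j N. (1/2) * (psum (\<lambda>k N. \<Sum>t=1..<k. g j (add_mset t (add_mset (k - t) N))) N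
     + psum (\<lambda>i. psum (\<lambda>m N. g j (add_mset (i + m) N))) N)) M"
      by (intro psum_cong) (simp add: cut_join_def)
    then show ?thesis by (simp only: psum_mult psum_add)
  qed
  show ?thesis
    unfolding cut_join_def[of "psum g"] 1 2 psum_add 3 4 5 6 by (simp add: field_simps)
qed

text \<open>Commutator with k d/dp_k: the derivative hits a factor p in front of the operator. The
  joining part has two such factors in symmetric roles, so the 1/2 survives only in the cutting
  part.\<close>

lemma cut_join_add_mset:
  "cut_join f (add_mset k M) = cut_join (\<lambda>N. f (add_mset k N)) M
     + real k * ((\<Sum>t=1..<k. f (add_mset t (add_mset (k - t) M))) / 2 + psum (\<lambda>j N. f (add_mset (j + k) N)) M)"
proof -
  have sw: "psum (\<lambda>i N. real k * f (add_mset (i + k) N)) M = real k * psum (\<lambda>i N. f (add_mset (i + k) N)) M"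
    by (simp add: psum_mult)
  have "psum (\<lambda>i. psum (\<lambda>j N. f (add_mset (i + j) N))) (add_mset k M)
     = real k * psum (\<lambda>j N. f (add_mset (j + k) N)) M + (real k * psum (\<lambda>i N. f (add_mset (i + k) N)) M
      + psum (\<lambda>i. psum (\<lambda>j N. f (add_mset k (add_mset (i + j) N)))) M)"
    by (simp add: psum_add_mset psum_add sw add.commute add_mset_commute)
  moreover have "psum (\<lambda>m N. \<Sum>t=1..<m. f (add_mset t (add_mset (m - t) N))) (add_mset k M)
     = real k * (\<Sum>t=1..<k. f (add_mset t (add_mset (k - t) M)))
      + psum (\<lambda>m N. \<Sum>t=1..<m. f (add_mset k (add_mset t (add_mset (m - t) N)))) M"
    by (simp add: psum_add_mset add_mset_commute)
  ultimately show ?thesis by (simp add: cut_join_def field_simps)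
qed

text \<open>In terms of the group algebra of the symmetric group on \<open>n + 1\<close> points, \<open>h i\<close> records the
  values at permutations whose cycle through \<open>n + 1\<close> has length \<open>i + 1\<close>; \<open>NS\<close> is then multiplication by
  the last Jucys--Murphy element, and \<open>cut_join_pointed\<close> multiplication by the sum of
  the transpositions fixing \<open>n + 1\<close>.\<close>

definition cut_join_pointed :: "(nat \<Rightarrow> class_fun) \<Rightarrow> nat \<Rightarrow> class_fun" where
  "cut_join_pointed h i M = cut_join (h i) M + (\<Sum>m<i. real m * h m (add_mset (i - m) M))
     + real i * psum (\<lambda>j. h (i + j)) M"

section \<open>Linearity, and commutation of the Jucys--Murphy element with the class sum of
  transpositions\<close>

lemma NS_add: "NS (\<lambda>i M. f i M + g i M) = (\<lambda>i M. NS f i M + NS g i M)"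
  by (rule ext)+ (simp add: NS_def sum.distrib psum_add)

lemma NS_mult: "NS (\<lambda>i M. c * f i M) = (\<lambda>i M. c * NS f i M)"
  by (rule ext)+ (simp add: NS_def psum_mult sum_distrib_left distrib_left)

lemma NS_zero [simp]: "NS (\<lambda>i M. 0) = (\<lambda>i M. 0)"
  by (rule ext)+ (simp add: NS_def)

lemma NS_pow_zero [simp]: "(NS ^^ k) (\<lambda>i M. 0) = (\<lambda>i M. 0)"
  by (induction k) auto

lemma NS_pow_add: "(NS ^^ k) (\<lambda>i M. f i M + g i M) = (\<lambda>i M. (NS ^^ k) f i M + (NS ^^ k) g i M)"
  by (induction k) (simp_all add: NS_add)

lemma NS_pow_mult: "(NS ^^ k) (\<lambda>i M. c * f i M) = (\<lambda>i M. c * (NS ^^ k) f i M)"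
  by (induction k) (simp_all add: NS_mult)

lemma NS_pow_sum: "(NS ^^ k) (\<lambda>i M. \<Sum>x\<in>A. f x i M) = (\<lambda>i M. \<Sum>x\<in>A. (NS ^^ k) (f x) i M)"
  by (induction A rule: infinite_finite_induct) (simp_all add: NS_pow_add)

lemma ind_add: "ind (\<lambda>i M. f i M + g i M) = (\<lambda>M. ind f M + ind g M)"
  by (simp add: ind_def psum_add)

lemma ind_mult: "ind (\<lambda>i M. c * f i M) = (\<lambda>M. c * ind f M)"
  by (simp add: ind_def psum_mult)

lemma ind_sum: "ind (\<lambda>i M. \<Sum>x\<in>A. f x i M) = (\<lambda>M. \<Sum>x\<in>A. ind (f x) M)"
  by (simp add: ind_def psum_sum)

lemma vac_add: "vac (\<lambda>M. f M + g M) = (\<lambda>i M. vac f i M + vac g i M)"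
  by (auto simp: vac_def fun_eq_iff)

lemma vac_mult: "vac (\<lambda>M. c * f M) = (\<lambda>i M. c * vac f i M)"
  by (auto simp: vac_def fun_eq_iff)

lemma vac_sum: "vac (\<lambda>M. \<Sum>x\<in>A. f x M) = (\<lambda>i M. \<Sum>x\<in>A. vac (f x) i M)"
  by (auto simp: vac_def fun_eq_iff)

lemma NS_moment_add: "NS_moment k (\<lambda>M. f M + g M) = (\<lambda>M. NS_moment k f M + NS_moment k g M)"
  by (simp add: NS_moment_def vac_add NS_pow_add)

lemma NS_moment_mult: "NS_moment k (\<lambda>M. c * f M) = (\<lambda>M. c * NS_moment k f M)"
  by (simp add: NS_moment_def vac_mult NS_pow_mult)

lemma NS_moment_sum: "NS_moment k (\<lambda>M. \<Sum>x\<in>A. f x M) = (\<lambda>M. \<Sum>x\<in>A. NS_moment k (f x) M)"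
  by (simp add: NS_moment_def vac_sum NS_pow_sum)

lemma NS_ind_mult: "NS_ind k (\<lambda>M. c * f M) = (\<lambda>M. c * NS_ind k f M)"
  by (simp add: NS_ind_def vac_mult NS_pow_mult ind_mult)

lemma NS_ind_sum: "NS_ind k (\<lambda>M. \<Sum>x\<in>A. f x M) = (\<lambda>M. \<Sum>x\<in>A. NS_ind k (f x) M)"
  by (simp add: NS_ind_def vac_sum NS_pow_sum ind_sum)

text \<open>The sum of all transpositions of n + 1 points is central, hence commutes with induction,
  and it consists of the transpositions fixing the last point and of those that make up the last
  Jucys--Murphy element.\<close>

lemma cut_join_ind: "cut_join (ind h) M = ind (\<lambda>i M. cut_join_pointed h i M + NS h i M) M"
proof -
  have a: "psum (\<lambda>k N. \<Sum>t=1..<k. real t * h (t - 1) (add_mset (k - t) N)) M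
    = psum (\<lambda>k N. (\<Sum>m<k-1. real m * h m (add_mset (k - 1 - m) N)) + (\<Sum>m<k-1. h m (add_mset (k - 1 - m) N))) M"
  proof (intro psum_cong)
    fix k and N :: "nat multiset"
    have "(\<Sum>t=1..<k. real t * h (t - 1) (add_mset (k - t) N)) = (\<Sum>m<k-1. real (Suc m) * h m (add_mset (k - 1 - m) N))"
      by (rule sum.reindex_bij_witness[where i = Suc and j = "\<lambda>t. t - 1"]) auto
    then show "(\<Sum>t=1..<k. real t * h (t - 1) (add_mset (k - t) N)) =
      (\<Sum>m<k-1. real m * h m (add_mset (k - 1 - m) N)) + (\<Sum>m<k-1. h m (add_mset (k - 1 - m) N))"
      by (simp add: sum.distrib[symmetric] algebra_simps)
  qed
  \<comment> \<open>By symmetry in i and j the weight i + j may be replaced by 2 i.\<close>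
  define Z where "Z = psum (\<lambda>i. psum (\<lambda>j N. real i * h (i + j - 1) N)) M"
  have Z': "psum (\<lambda>i. psum (\<lambda>j N. real j * h (i + j - 1) N)) M = Z"
    unfolding Z_def by (subst psum_swap) (simp add: add.commute)
  have b: "psum (\<lambda>i. psum (\<lambda>j N. real (i + j) * h (i + j - 1) N)) M = 2 * Z"
    using Z' by (simp add: distrib_right psum_add Z_def)
  have c: "psum (\<lambda>k N. real (k - 1) * psum (\<lambda>j. h (k - 1 + j)) N + psum (\<lambda>j. h (k - 1 + j)) N) M = Z"
    unfolding Z_def psum_def[of _ M]
  proof (intro arg_cong[where f = sum_mset] image_mset_cong)
    fix k
    show "real k * (real (k - 1) * psum (\<lambda>j. h (k - 1 + j)) (M - {#k#}) + psum (\<lambda>j. h (k - 1 + j)) (M - {#k#})) =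
         real k * psum (\<lambda>j N. real k * h (k + j - 1) N) (M - {#k#})"
      by (cases k) (simp_all add: psum_mult psum_add algebra_simps)
  qed
  show ?thesis
    unfolding ind_def cut_join_psum a b using c
    by (simp add: cut_join_pointed_def NS_def psum_add)
qed

text \<open>The last Jucys--Murphy element is a difference of two class sums, central in the larger
  and in the smaller group, so it commutes with the class sum of the smaller one. On class functions
  this becomes a comparison of weights: the Leibniz corrections from moving \<open>cut_join\<close>
  past \<open>NS\<close> match the differences between the weights m, i and p in
  \<open>cut_join_pointed\<close>.\<close>

lemma cut_join_pointed_NS: "cut_join_pointed (NS h) i M = NS (cut_join_pointed h) i M"
proof -
  let ?A = "\<lambda>p t. h p (add_mset t (add_mset (i - p - t) M))"
  let ?P = "\<lambda>p. psum (\<lambda>j N. h p (add_mset (i + j - p) N)) M"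
  have c1: "cut_join (NS h i) M = (\<Sum>m<i. cut_join (h m) (add_mset (i - m) M)
      - real (i - m) * ((\<Sum>t=1..<i-m. ?A m t) / 2 + ?P m))
    + psum (\<lambda>j. cut_join (h (i + j))) M
    + psum (\<lambda>k N. \<Sum>t=1..<k. real t * h (i + t) (add_mset (k - t) N)) M
    + psum (\<lambda>a. psum (\<lambda>b N. real (a + b) * h (i + (a + b)) N)) M / 2"
  proof -
    have "cut_join (NS h i) M = (\<Sum>m<i. cut_join (\<lambda>N. h m (add_mset (i - m) N)) M) + cut_join (psum (\<lambda>j. h (i + j))) M"
      unfolding NS_def by (simp add: cut_join_add cut_join_sum)
    moreover have "cut_join (\<lambda>N. h m (add_mset (i - m) N)) M = cut_join (h m) (add_mset (i - m) M)
      - real (i - m) * ((\<Sum>t=1..<i-m. ?A m t) / 2 + ?P m)" if "m < i" for m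
    proof -
      have "psum (\<lambda>j N. h m (add_mset (j + (i - m)) N)) M = ?P m"
        using that by (intro psum_cong) (simp add: add.commute)
      then show ?thesis using cut_join_add_mset[of "h m" "i - m" M] by simp
    qed
    ultimately show ?thesis by (simp add: cut_join_psum)
  qed
  \<comment> \<open>The weight i - p changes sign at p = i; the part beyond that point is the
    Leibniz term of \<open>cut_join_psum\<close>.\<close>
  have split: "(\<Sum>p<i+j. (real i - real p) * h p (add_mset (i + j - p) N))
     = (\<Sum>p<i. real (i - p) * h p (add_mset (i + j - p) N)) - (\<Sum>t=1..<j. real t * h (i + t) (add_mset (j - t) N))" for j N
  proof -
    have "(\<Sum>p<i+j. (real i - real p) * h p (add_mset (i + j - p) N))
     = (\<Sum>p<i. (real i - real p) * h p (add_mset (i + j - p) N)) + (\<Sum>t<j. - (real t * h (i + t) (add_mset (j - t) N)))"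
    proof -
      have "{..<i+j} = {..<i} \<union> {i..<i+j}" by auto
      moreover have "(\<Sum>p=i..<i+j. (real i - real p) * h p (add_mset (i + j - p) N)) = (\<Sum>t<j. - (real t * h (i + t) (add_mset (j - t) N)))"
        by (rule sum.reindex_bij_witness[where i = "\<lambda>t. i + t" and j = "\<lambda>p. p - i"]) (auto simp: of_nat_diff algebra_simps)
      ultimately show ?thesis by (simp add: sum.union_disjoint ivl_disj_int)
    qed
    moreover have "(\<Sum>t<j. - (real t * h (i + t) (add_mset (j - t) N))) = - (\<Sum>t=1..<j. real t * h (i + t) (add_mset (j - t) N))"
    proof -
      have "(\<Sum>t=1..<j. real t * h (i + t) (add_mset (j - t) N)) = (\<Sum>t<j. real t * h (i + t) (add_mset (j - t) N))"
        by (rule sum.mono_neutral_left) auto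
      then show ?thesis by (simp add: sum_negf)
    qed
    moreover have "(\<Sum>p<i. (real i - real p) * h p (add_mset (i + j - p) N)) = (\<Sum>p<i. real (i - p) * h p (add_mset (i + j - p) N))"
      by (intro sum.cong) auto
    ultimately show ?thesis by linarith
  qed
  \<comment> \<open>With t = m - p the function h p is evaluated at the parts t and i - p - t,
    symmetrically, so the weight t averages to (i - p) / 2.\<close>
  have d1: "(\<Sum>m<i. \<Sum>p<m. (real m - real p) * h p (add_mset (m - p) (add_mset (i - m) M)))
     = (\<Sum>m<i. real (i - m) * ((\<Sum>t=1..<i-m. ?A m t) / 2))"
  proof -
    have "(\<Sum>m<i. \<Sum>p<m. (real m - real p) * h p (add_mset (m - p) (add_mset (i - m) M)))
      = (\<Sum>p<i. \<Sum>m=p+1..<i. (real m - real p) * h p (add_mset (m - p) (add_mset (i - m) M)))"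
      by (simp add: sum.Sigma) (rule sum.reindex_bij_witness[where i = "\<lambda>(p,m). (m,p)" and j = "\<lambda>(p,m). (m,p)"], auto)
    also have "\<dots> = (\<Sum>p<i. \<Sum>t=1..<i-p. real t * ?A p t)"
    proof (rule sum.cong[OF refl])
      fix p assume "p \<in> {..<i}"
      then show "(\<Sum>m=p+1..<i. (real m - real p) * h p (add_mset (m - p) (add_mset (i - m) M))) = (\<Sum>t=1..<i-p. real t * ?A p t)"
        by (intro sum.reindex_bij_witness[where i = "\<lambda>t. p + t" and j = "\<lambda>m. m - p"]) (auto simp: of_nat_diff)
    qed
    also have "\<dots> = (\<Sum>p<i. real (i - p) / 2 * (\<Sum>t=1..<i-p. ?A p t))"
    proof (rule sum.cong[OF refl])
      fix p
      show "(\<Sum>t=1..<i-p. real t * ?A p t) = real (i - p) / 2 * (\<Sum>t=1..<i-p. ?A p t)"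
        by (rule sum_reflect_weights[where F = "?A p"]) (simp add: add_mset_commute)
    qed
    finally show ?thesis by simp
  qed
  have d2: "psum (\<lambda>j N. \<Sum>p<i+j. (real i - real p) * h p (add_mset (i + j - p) N)) M
     = (\<Sum>p<i. real (i - p) * ?P p) - psum (\<lambda>j N. \<Sum>t=1..<j. real t * h (i + t) (add_mset (j - t) N)) M"
    unfolding split psum_minus psum_sum by (simp add: psum_mult)
  have d3: "psum (\<lambda>a. psum (\<lambda>b N. real (a + b) * h (i + (a + b)) N)) M / 2 = psum (\<lambda>a. psum (\<lambda>b N. real a * h (i + a + b) N)) M"
  proof -
    have "psum (\<lambda>a. psum (\<lambda>b N. real b * h (i + a + b) N)) M = psum (\<lambda>a. psum (\<lambda>b N. real a * h (i + a + b) N)) M"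
      by (subst psum_swap) (simp add: ac_simps)
    then show ?thesis by (simp add: distrib_right psum_add add.assoc)
  qed
  define Y where "Y = (\<Sum>m<i. real m * psum (\<lambda>j. h (m + j)) (add_mset (i - m) M))"
  have L: "cut_join_pointed (NS h) i M = cut_join (NS h i) M
     + (\<Sum>m<i. \<Sum>p<m. real m * h p (add_mset (m - p) (add_mset (i - m) M))) + Y
     + (psum (\<lambda>j N. \<Sum>p<i+j. real i * h p (add_mset (i + j - p) N)) M + psum (\<lambda>a. psum (\<lambda>b N. real i * h (i + a + b) N)) M)"
    unfolding cut_join_pointed_def Y_def NS_def[of h]
    by (simp add: psum_add psum_mult sum.distrib distrib_left flip: sum_distrib_left)
  have R: "NS (cut_join_pointed h) i M = (\<Sum>m<i. cut_join (h m) (add_mset (i - m) M))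
     + (\<Sum>m<i. \<Sum>p<m. real p * h p (add_mset (m - p) (add_mset (i - m) M))) + Y
     + (psum (\<lambda>j. cut_join (h (i + j))) M
       + psum (\<lambda>j N. \<Sum>p<i+j. real p * h p (add_mset (i + j - p) N)) M + psum (\<lambda>a. psum (\<lambda>b N. real (i + a) * h (i + a + b) N)) M)"
    unfolding cut_join_pointed_def Y_def NS_def
    by (simp add: psum_add psum_mult sum.distrib del: of_nat_add)
  have e1: "(\<Sum>m<i. \<Sum>p<m. real m * h p (add_mset (m - p) (add_mset (i - m) M)))
     = (\<Sum>m<i. \<Sum>p<m. real p * h p (add_mset (m - p) (add_mset (i - m) M))) + (\<Sum>m<i. real (i - m) * ((\<Sum>t=1..<i-m. ?A m t) / 2))"
    unfolding d1[symmetric] by (simp add: left_diff_distrib sum_subtractf)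
  have e2: "psum (\<lambda>j N. \<Sum>p<i+j. real i * h p (add_mset (i + j - p) N)) M
     = psum (\<lambda>j N. \<Sum>p<i+j. real p * h p (add_mset (i + j - p) N)) M
      + (\<Sum>p<i. real (i - p) * ?P p) - psum (\<lambda>j N. \<Sum>t=1..<j. real t * h (i + t) (add_mset (j - t) N)) M"
    using d2 by (simp add: left_diff_distrib sum_subtractf psum_minus)
  have e3: "psum (\<lambda>a. psum (\<lambda>b N. real (i + a) * h (i + a + b) N)) M = psum (\<lambda>a. psum (\<lambda>b N. real i * h (i + a + b) N)) M
     + psum (\<lambda>a. psum (\<lambda>b N. real a * h (i + a + b) N)) M"
    by (simp add: distrib_right psum_add)
  have e4: "(\<Sum>m<i. cut_join (h m) (add_mset (i - m) M) - real (i - m) * ((\<Sum>t=1..<i-m. ?A m t) / 2 + ?P m))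
    = (\<Sum>m<i. cut_join (h m) (add_mset (i - m) M)) - (\<Sum>m<i. real (i - m) * ((\<Sum>t=1..<i-m. ?A m t) / 2))
      - (\<Sum>p<i. real (i - p) * ?P p)"
    unfolding distrib_left sum_subtractf sum.distrib by (rule diff_diff_eq[symmetric])
  show ?thesis
    using L R c1 e1 e2 e3 e4 d3 by linarith
qed

lemma cut_join_pointed_vac: "cut_join_pointed (vac f) = vac (cut_join f)"
proof (rule ext)+
  fix i M
  have "(\<Sum>m<i. real m * vac f m (add_mset (i - m) M)) = 0"
    by (intro sum.neutral) (auto simp: vac_def)
  moreover have "cut_join (vac f i) M = vac (cut_join f) i M"
    by (cases "i = 0") (simp_all add: vac_def fun_eq_iff cong: if_cong, simp_all add: vac_def[abs_def])
  moreover have "psum (\<lambda>j. vac f (i + j)) M = 0" if "i > 0"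
    using that by (simp add: vac_def[abs_def])
  ultimately show "cut_join_pointed (vac f) i M = vac (cut_join f) i M"
    by (cases "i = 0") (simp_all add: cut_join_pointed_def)
qed

lemma cut_join_pointed_NS_pow: "cut_join_pointed ((NS ^^ k) h) = (NS ^^ k) (cut_join_pointed h)"
  by (induction k) (simp_all add: cut_join_pointed_NS[abs_def])

text \<open>The additional Jucys--Murphy factor is the class sum of the larger group minus that of
  the smaller one, and the latter commutes with the other k factors and reaches f. Powers of
  \<open>NS\<close> are thus controlled by the cut-and-join operator, which is diagonal on
  characters.\<close>

lemma NS_ind_Suc: "NS_ind (Suc k) f M = cut_join (NS_ind k f) M - NS_ind k (cut_join f) M"
proof -
  have "cut_join (NS_ind k f) M = ind (cut_join_pointed ((NS ^^ k) (vac f))) M + ind (NS ((NS ^^ k) (vac f))) M"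
    unfolding NS_ind_def cut_join_ind ind_add ..
  then show ?thesis
    by (simp add: cut_join_pointed_NS_pow cut_join_pointed_vac NS_ind_def)
qed

section \<open>Commutators with the derivative in p_1 and a Newton recursion for the moments\<close>

definition NS_comm :: "nat \<Rightarrow> class_fun \<Rightarrow> class_fun" where
  "NS_comm k f M = NS_ind k f (add_mset 1 M) - NS_ind k (\<lambda>N. f (add_mset 1 N)) M"

definition lower :: "(nat \<Rightarrow> class_fun) \<Rightarrow> nat \<Rightarrow> class_fun" where
  "lower h i = h (Suc i)"

definition raise :: "(nat \<Rightarrow> class_fun) \<Rightarrow> nat \<Rightarrow> class_fun" where
  "raise h i M = (if i = 0 then 0 else h (i - 1) M)"

text \<open>The operator is of Toeplitz form in the level, so it commutes with the shift of levels
  up to a boundary term at level 0; that term is \<open>ind\<close>.\<close>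

lemma NS_raise: "NS (raise h) = (\<lambda>i M. raise (NS h) i M + vac (ind h) i M)"
proof (rule ext)+
  fix i M
  show "NS (raise h) i M = raise (NS h) i M + vac (ind h) i M"
  proof (cases i)
    case 0
    have "psum (raise h) M = psum (\<lambda>j. h (j - 1)) M"
      unfolding psum_def by (intro arg_cong[where f = sum_mset] image_mset_cong) (auto simp: raise_def)
    then show ?thesis using 0 by (simp add: NS_def vac_def ind_def raise_def)
  next
    case (Suc n)
    have "(\<Sum>m<i. raise h m (add_mset (i - m) M)) = (\<Sum>m<n. h m (add_mset (n - m) M))"
      unfolding Suc sum.lessThan_Suc_shift by (simp add: raise_def)
    moreover have "psum (\<lambda>j. raise h (i + j)) M = psum (\<lambda>j. h (n + j)) M"
      using Suc by (simp add: raise_def[abs_def])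
    ultimately show ?thesis using Suc by (simp add: NS_def vac_def raise_def)
  qed
qed

lemma vac_plus_raise_lower: "(\<lambda>i M. vac (h 0) i M + raise (lower h) i M) = h"
  by (auto simp: vac_def raise_def lower_def fun_eq_iff)

text \<open>Each commutation with the shift leaves one boundary term, and the term in which the
  shift has come out entirely vanishes at level 0.\<close>

lemma NS_pow_raise:
  "(NS ^^ j) (raise h) 0 M = (\<Sum>x<j. NS_moment x (ind ((NS ^^ (j - 1 - x)) h)) M)"
proof (induction j arbitrary: h)
  case (Suc j)
  have "(NS ^^ Suc j) (raise h) 0 M = (NS ^^ j) (NS (raise h)) 0 M"
    by (simp only: funpow_Suc_right comp_apply)
  also have "\<dots> = (\<Sum>x<j. NS_moment x (ind ((NS ^^ (j - 1 - x)) (NS h))) M) + NS_moment j (ind h) M"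
    unfolding NS_raise NS_pow_add Suc.IH NS_moment_def ..
  also have "(\<Sum>x<j. NS_moment x (ind ((NS ^^ (j - 1 - x)) (NS h))) M) = (\<Sum>x<j. NS_moment x (ind ((NS ^^ (j - x)) h)) M)"
  proof (rule sum.cong[OF refl])
    fix x assume "x \<in> {..<j}"
    then have "j - x = Suc (j - 1 - x)" by auto
    then have "(NS ^^ (j - x)) h = (NS ^^ (j - 1 - x)) (NS h)"
      by (simp only: funpow_Suc_right comp_apply)
    then show "NS_moment x (ind ((NS ^^ (j - 1 - x)) (NS h))) M = NS_moment x (ind ((NS ^^ (j - x)) h)) M"
      by simp
  qed
  finally show ?case by simp
qed (simp add: raise_def)

text \<open>The derivative in p_1 commutes with everything in \<open>NS\<close> except the explicit
  factor p_1, which stands in front of the entry one level higher.\<close>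

lemma NS_shift_one: "(\<lambda>i M. NS h i (add_mset 1 M)) = (\<lambda>i M. NS (\<lambda>i M. h i (add_mset 1 M)) i M + lower h i M)"
  by (rule ext)+ (simp add: NS_def psum_add_mset lower_def add_mset_commute)

lemma NS_pow_shift_one:
  "(\<lambda>i M. (NS ^^ k) h i (add_mset 1 M)) =
   (\<lambda>i M. (NS ^^ k) (\<lambda>i M. h i (add_mset 1 M)) i M + (\<Sum>x<k. (NS ^^ x) (lower ((NS ^^ (k - 1 - x)) h)) i M))"
proof (induction k)
  case (Suc k)
  have "(\<lambda>i M. (NS ^^ Suc k) h i (add_mset 1 M)) =
    (\<lambda>i M. NS (\<lambda>i M. (NS ^^ k) h i (add_mset 1 M)) i M + lower ((NS ^^ k) h) i M)"
    using NS_shift_one[of "(NS ^^ k) h"] by simp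
  also have "\<dots> = (\<lambda>i M. (NS ^^ Suc k) (\<lambda>i M. h i (add_mset 1 M)) i M
      + (\<Sum>x<k. (NS ^^ Suc x) (lower ((NS ^^ (k - 1 - x)) h)) i M) + lower ((NS ^^ k) h) i M)"
    unfolding Suc.IH NS_add using NS_pow_sum[of 1 "\<lambda>x. (NS ^^ x) (lower ((NS ^^ (k - 1 - x)) h))" "{..<k}"]
    by simp
  finally show ?case by (simp only: sum.lessThan_Suc_shift) (simp add: ac_simps)
qed simp

text \<open>Product rule for d/dp_1: it hits the factor p_1 of the outer \<open>ind\<close>, or the
  factor p_1 inside one of the k copies of \<open>NS\<close>.\<close>

lemma NS_comm_expand:
  "NS_comm k f M = NS_moment k f M + (\<Sum>x<k. ind ((NS ^^ x) (lower ((NS ^^ (k - 1 - x)) (vac f)))) M)"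
proof -
  have "NS_ind k f (add_mset 1 M) = ind (\<lambda>i M. (NS ^^ k) (vac f) i (add_mset 1 M)) M + (NS ^^ k) (vac f) 0 M"
    by (simp add: NS_ind_def ind_def psum_add_mset)
  also have "ind (\<lambda>i M. (NS ^^ k) (vac f) i (add_mset 1 M)) M = ind ((NS ^^ k) (\<lambda>i M. vac f i (add_mset 1 M))) M
    + (\<Sum>x<k. ind ((NS ^^ x) (lower ((NS ^^ (k - 1 - x)) (vac f)))) M)"
    by (subst NS_pow_shift_one) (simp add: ind_add ind_sum)
  also have "(\<lambda>i M. vac f i (add_mset 1 M)) = vac (\<lambda>N. f (add_mset 1 N))"
    by (auto simp: vac_def fun_eq_iff)
  finally show ?thesis by (simp add: NS_comm_def NS_ind_def NS_moment_def)
qed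

lemma sum_triangle:
  fixes F :: "nat \<Rightarrow> nat \<Rightarrow> real"
  shows "(\<Sum>m\<le>k. \<Sum>x<m. F m x) = (\<Sum>y<k. \<Sum>x<k-y. F (k - x) (k - x - 1 - y))"
proof -
  have "(\<Sum>m\<le>k. \<Sum>x<m. F m x) = (\<Sum>(m, x)\<in>(SIGMA m:{..k}. {..<m}). F m x)"
    by (simp add: sum.Sigma)
  also have "\<dots> = (\<Sum>(y, x)\<in>(SIGMA y:{..<k}. {..<k-y}). F (k - x) (k - x - 1 - y))"
    by (rule sum.reindex_bij_witness[where i = "\<lambda>(y, x). (k - x, k - x - 1 - y)" and j = "\<lambda>(m, x). (m - 1 - x, k - m)"]) auto
  finally show ?thesis by (simp add: sum.Sigma)
qed

text \<open>An operator form of Newton's identities, with \<open>NS_moment\<close> as complete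
  homogeneous functions and \<open>NS_comm\<close> as power sums. Cut the word after m < k steps and
  split the vector reached there into level 0 and the raised rest: applying the remaining steps to
  both parts gives the whole moment. The k cuts and the term from m = k make k + 1 copies.\<close>

lemma NS_newton: "(\<Sum>m\<le>k. NS_moment (k - m) (NS_comm m f) M) = real (k + 1) * NS_moment k f M"
proof -
  define h where "h y = lower ((NS ^^ y) (vac f))" for y
  have pow: "(NS ^^ (k - m)) ((NS ^^ m) (vac f)) 0 M = NS_moment k f M" if "m \<le> k" for m
    using that unfolding NS_moment_def by (metis comp_apply funpow_add le_add_diff_inverse2)
  have "(\<Sum>m\<le>k. NS_moment (k - m) (NS_comm m f) M)
     = (\<Sum>m\<le>k. NS_moment (k - m) (NS_moment m f) M)
      + (\<Sum>m\<le>k. \<Sum>x<m. NS_moment (k - m) (ind ((NS ^^ x) (h (m - 1 - x)))) M)"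
    unfolding NS_comm_expand[abs_def] NS_moment_add NS_moment_sum h_def by (simp add: sum.distrib)
  also have "(\<Sum>m\<le>k. \<Sum>x<m. NS_moment (k - m) (ind ((NS ^^ x) (h (m - 1 - x)))) M)
     = (\<Sum>y<k. \<Sum>x<k-y. NS_moment x (ind ((NS ^^ (k - y - 1 - x)) (h y))) M)"
    by (subst sum_triangle) (intro sum.cong refl, simp add: add.commute)
  also have "\<dots> = (\<Sum>y<k. (NS ^^ (k - y)) (raise (h y)) 0 M)"
    by (simp add: NS_pow_raise)
  also have "(\<Sum>m\<le>k. NS_moment (k - m) (NS_moment m f) M)
     = NS_moment k f M + (\<Sum>m<k. (NS ^^ (k - m)) (vac ((NS ^^ m) (vac f) 0)) 0 M)"
    by (simp add: lessThan_Suc_atMost[symmetric] NS_moment_def vac_def)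
  also have "NS_moment k f M + (\<Sum>m<k. (NS ^^ (k - m)) (vac ((NS ^^ m) (vac f) 0)) 0 M)
      + (\<Sum>y<k. (NS ^^ (k - y)) (raise (h y)) 0 M)
     = NS_moment k f M + (\<Sum>m<k. NS_moment k f M)"
  proof -
    have "(NS ^^ (k - m)) (vac ((NS ^^ m) (vac f) 0)) 0 M + (NS ^^ (k - m)) (raise (h m)) 0 M = NS_moment k f M" if "m < k" for m
    proof -
      have "(NS ^^ (k - m)) (vac ((NS ^^ m) (vac f) 0)) 0 M + (NS ^^ (k - m)) (raise (h m)) 0 M
        = (NS ^^ (k - m)) (\<lambda>i M. vac ((NS ^^ m) (vac f) 0) i M + raise (h m) i M) 0 M"
        unfolding NS_pow_add ..
      then show ?thesis
        unfolding h_def vac_plus_raise_lower using pow that by simp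
    qed
    then show ?thesis by (simp add: sum.distrib[symmetric] add.assoc)
  qed
  finally show ?thesis by (simp add: distrib_right)
qed

lemma NS_comm_0: "NS_comm 0 f = f"
  by (rule ext) (simp add: NS_comm_expand NS_moment_def vac_def)

lemma NS_moment_0: "NS_moment 0 f = f"
  by (rule ext) (simp add: NS_moment_def vac_def)

section \<open>The operators respect the number of permuted points\<close>

lemma cut_join_cong:
  assumes "\<And>N. sum_mset N = sum_mset M \<Longrightarrow> f N = g N"
  shows "cut_join f M = cut_join g M"
proof -
  have "psum (\<lambda>k N. \<Sum>t=1..<k. f (add_mset t (add_mset (k - t) N))) M
     = psum (\<lambda>k N. \<Sum>t=1..<k. g (add_mset t (add_mset (k - t) N))) M"
    by (intro psum_cong sum.cong refl assms) (auto dest!: multi_member_split)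
  moreover have "psum (\<lambda>i. psum (\<lambda>j N. f (add_mset (i + j) N))) M = psum (\<lambda>i. psum (\<lambda>j N. g (add_mset (i + j) N))) M"
    by (intro psum_cong assms) (auto dest!: multi_member_split)
  ultimately show ?thesis by (simp add: cut_join_def)
qed

lemma NS_cong:
  assumes "\<And>N m. sum_mset N + m = sum_mset M + i \<Longrightarrow> f m N = g m N"
  shows "NS f i M = NS g i M"
proof -
  have "f m (add_mset (i - m) M) = g m (add_mset (i - m) M)" if "m < i" for m
    using that by (intro assms) simp
  moreover have "psum (\<lambda>j. f (i + j)) M = psum (\<lambda>j. g (i + j)) M"
    by (intro psum_cong assms) (auto dest!: multi_member_split)
  ultimately show ?thesis by (simp add: NS_def)
qed

lemma NS_pow_cong:
  assumes "\<And>N m. sum_mset N + m = sum_mset M + i \<Longrightarrow> f m N = g m N"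
  shows "(NS ^^ k) f i M = (NS ^^ k) g i M"
  using assms by (induction k arbitrary: i M) (auto intro!: NS_cong)

lemma NS_moment_cong:
  assumes "\<And>N. sum_mset N = sum_mset M \<Longrightarrow> f N = g N"
  shows "NS_moment k f M = NS_moment k g M"
  unfolding NS_moment_def using assms by (intro NS_pow_cong) (auto simp: vac_def)

lemma NS_ind_cong:
  assumes "\<And>N. sum_mset N + 1 = sum_mset M \<Longrightarrow> f N = g N"
  shows "NS_ind k f M = NS_ind k g M"
  unfolding NS_ind_def ind_def psum_def
proof (intro arg_cong[where f = sum_mset] image_mset_cong)
  fix j assume j: "j \<in># M"
  show "real j * (NS ^^ k) (vac f) (j - 1) (M - {#j#}) = real j * (NS ^^ k) (vac g) (j - 1) (M - {#j#})"
  proof (cases "j = 0")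
    case False
    have "(NS ^^ k) (vac f) (j - 1) (M - {#j#}) = (NS ^^ k) (vac g) (j - 1) (M - {#j#})"
      using j False by (intro NS_pow_cong) (auto simp: vac_def intro!: assms dest!: multi_member_split)
    then show ?thesis by simp
  qed simp
qed

text \<open>At the identity all cycles have length 1, so \<open>ind\<close> sees only level 0, once
  for each of the n + 1 points.\<close>

lemma NS_ind_ones: "NS_ind k f (replicate_mset (Suc n) 1) = real (Suc n) * NS_moment k f (replicate_mset n 1)"
proof -
  have "ind h (replicate_mset (Suc n) 1) = real (Suc n) * h 0 (replicate_mset n 1)" for h
    by (simp add: ind_def psum_def algebra_simps)
  then show ?thesis by (simp add: NS_ind_def NS_moment_def)
qed

section \<open>Frobenius characters indexed by exponent vectors\<close>

text \<open>\<open>frob l v mu\<close> is the coefficient of \<open>x^v\<close> in \<open>a\<^sub>\<delta>(x) p\<^sub>\<mu>(x)\<close> in \<open>l\<close> variables; it vanishes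
  as soon as some exponent is negative.\<close>

primrec frob :: "nat \<Rightarrow> (nat \<Rightarrow> int) \<Rightarrow> nat list \<Rightarrow> real" where
  "frob l v [] = (\<Sum>w | w permutes {..<l}. if (\<forall>i<l. v i = int (l - 1 - w i)) then of_int (sign w) else 0)"
| "frob l v (j # mu) = (\<Sum>r<l. frob l (v(r := v r - int j)) mu)"

section \<open>Symmetry, antisymmetry and homogeneity of the Frobenius coefficients\<close>

lemma frob_swap: "frob l v (a # b # mu) = frob l v (b # a # mu)"
proof -
  have "frob l v (a # b # mu) = (\<Sum>r<l. \<Sum>s<l. frob l ((v(r := v r - int a))(s := (v(r := v r - int a)) s - int b)) mu)"
    by simp
  also have "\<dots> = (\<Sum>r<l. \<Sum>s<l. frob l ((v(s := v s - int b))(r := (v(s := v s - int b)) r - int a)) mu)"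
    by (intro sum.cong refl arg_cong[where f = "\<lambda>v. frob l v mu"]) auto
  also have "\<dots> = (\<Sum>s<l. \<Sum>r<l. frob l ((v(s := v s - int b))(r := (v(s := v s - int b)) r - int a)) mu)"
    by (rule sum.swap)
  finally show ?thesis by simp
qed

lemma frob_append_Cons: "frob l v (xs @ a # ys) = frob l v (a # xs @ ys)"
proof (induction xs arbitrary: v)
  case (Cons b xs)
  have "frob l v ((b # xs) @ a # ys) = frob l v (b # a # xs @ ys)" using Cons by simp
  also have "\<dots> = frob l v (a # b # xs @ ys)" by (rule frob_swap)
  finally show ?case by simp
qed simp

lemma frob_mset_cong: "mset mu = mset nu \<Longrightarrow> frob l v mu = frob l v nu"
proof (induction mu arbitrary: v nu)
  case (Cons a mu)
  then have "a \<in> set nu" by (metis list.set_intros(1) mset_eq_setD)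
  then obtain xs ys where nu: "nu = xs @ a # ys" by (meson split_list)
  then have "mset mu = mset (xs @ ys)" using Cons.prems by simp
  then have "frob l w mu = frob l w (xs @ ys)" for w by (rule Cons.IH)
  then show ?case by (simp add: nu frob_append_Cons)
qed simp

text \<open>Exchanging two variables changes the sign of the alternant and fixes the power
  sums.\<close>

lemma frob_transpose:
  assumes "r < l" "s < l" "r \<noteq> s"
  shows "frob l (v \<circ> Transposition.transpose r s) mu = - frob l v mu"
proof (induction mu arbitrary: v)
  case Nil
  let ?t = "Transposition.transpose r s"
  have t: "?t permutes {..<l}" using assms by (simp add: permutes_swap_id)
  have "frob l (v \<circ> ?t) [] = (\<Sum>w | w permutes {..<l}.
      if (\<forall>i<l. (v \<circ> ?t) i = int (l - 1 - (w \<circ> ?t) i)) then of_int (sign (w \<circ> ?t)) else 0)"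
    unfolding frob.simps by (rule sum_permutations_compose_right[OF t])
  also have "\<dots> = (\<Sum>w | w permutes {..<l}. if (\<forall>i<l. v i = int (l - 1 - w i)) then - of_int (sign w) else 0)"
  proof (intro sum.cong refl)
    fix w assume "w \<in> {w. w permutes {..<l}}"
    then have "sign (w \<circ> ?t) = - sign w"
      using assms t by (simp add: sign_compose permutes_imp_permutation[of "{..<l}"] sign_swap_id)
    moreover have "(\<forall>i<l. (v \<circ> ?t) i = int (l - 1 - (w \<circ> ?t) i)) \<longleftrightarrow> (\<forall>i<l. v i = int (l - 1 - w i))"
    proof -
      have "(\<forall>i\<in>{..<l}. v (?t i) = int (l - 1 - w (?t i))) \<longleftrightarrow> (\<forall>i\<in>?t ` {..<l}. v i = int (l - 1 - w i))"
        by blast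
      then show ?thesis using permutes_image[OF t] by (simp add: Ball_def)
    qed
    ultimately show "(if (\<forall>i<l. (v \<circ> ?t) i = int (l - 1 - (w \<circ> ?t) i)) then of_int (sign (w \<circ> ?t)) else 0) =
      (if (\<forall>i<l. v i = int (l - 1 - w i)) then - of_int (sign w) else (0::real))" by simp
  qed
  also have "\<dots> = - frob l v []"
    by (simp add: sum_negf[symmetric] if_distrib[of uminus] cong: if_cong)
  finally show ?case .
next
  case (Cons j mu)
  let ?t = "Transposition.transpose r s"
  have t: "?t permutes {..<l}" using assms by (simp add: permutes_swap_id)
  have upd: "(v \<circ> ?t)(q := (v \<circ> ?t) q - int j) = (v(?t q := v (?t q) - int j)) \<circ> ?t" for q
    by (auto simp: fun_eq_iff Transposition.transpose_def)
  have "frob l (v \<circ> ?t) (j # mu) = (\<Sum>q<l. frob l ((v(?t q := v (?t q) - int j)) \<circ> ?t) mu)"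
    by (simp only: frob.simps upd)
  also have "\<dots> = - (\<Sum>q<l. frob l (v(?t q := v (?t q) - int j)) mu)"
    unfolding Cons.IH sum_negf ..
  also have "(\<Sum>q<l. frob l (v(?t q := v (?t q) - int j)) mu) = (\<Sum>q<l. frob l (v(q := v q - int j)) mu)"
  proof -
    define g where "g q = frob l (v(q := v q - int j)) mu" for q
    have "sum g {..<l} = sum (g \<circ> ?t) {..<l}" by (rule sum.permute[OF t])
    then show ?thesis unfolding g_def comp_def by (rule sym)
  qed
  finally show ?case by simp
qed

lemma frob_repeat:
  assumes "r < l" "s < l" "r \<noteq> s" "v r = v s"
  shows "frob l v mu = 0"
proof -
  have "v \<circ> Transposition.transpose r s = v" using assms(4) by (auto simp: fun_eq_iff Transposition.transpose_def)
  then show ?thesis using frob_transpose[OF assms(1-3), of v mu] by simp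
qed

lemma frob_neg: "r < l \<Longrightarrow> v r < 0 \<Longrightarrow> frob l v mu = 0"
proof (induction mu arbitrary: v)
  case Nil
  then have "\<not> (\<forall>i<l. v i = int (l - 1 - w i))" for w
    by (metis of_nat_less_0_iff)
  then show ?case unfolding frob.simps by (intro sum.neutral ballI if_not_P)
next
  case (Cons j mu)
  show ?case unfolding frob.simps
    using Cons by (intro sum.neutral ballI Cons.IH) auto
qed

text \<open>Homogeneity: the alternant has degree 0 + 1 + ... + (l - 1), and the power sums
  contribute the sum of the parts.\<close>

lemma frob_size: "frob l v mu \<noteq> 0 \<Longrightarrow> (\<Sum>i<l. v i) = (\<Sum>i<l. int i) + int (sum_list mu)"
proof (induction mu arbitrary: v)
  case Nil
  then obtain w where w: "w permutes {..<l}" "\<forall>i<l. v i = int (l - 1 - w i)"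
    unfolding frob.simps by (auto elim!: sum.not_neutral_contains_not_neutral split: if_splits)
  have "(\<Sum>i<l. v i) = (\<Sum>i<l. int (l - 1 - w i))" using w by simp
  also have "\<dots> = (\<Sum>i<l. int (l - 1 - i))"
    using sum.permute[OF w(1), of "\<lambda>i. int (l - 1 - i)"] by (simp add: comp_def)
  also have "\<dots> = (\<Sum>i<l. int i)"
    by (rule sum.reindex_bij_witness[where i = "\<lambda>i. l - 1 - i" and j = "\<lambda>i. l - 1 - i"]) auto
  finally show ?case by simp
next
  case (Cons j mu)
  then have "(\<Sum>r<l. frob l (v(r := v r - int j)) mu) \<noteq> 0" by (simp only: frob.simps) simp
  then obtain r where r: "r < l" "frob l (v(r := v r - int j)) mu \<noteq> 0"
    by (auto elim: sum.not_neutral_contains_not_neutral)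
  have "(\<Sum>i<l. (v(r := v r - int j)) i) = (\<Sum>i<l. v i - (if i = r then int j else 0))"
    by (intro sum.cong) auto
  also have "\<dots> = (\<Sum>i<l. v i) - int j" using r(1) by (simp add: sum_subtractf)
  finally show ?case using Cons.IH[OF r(2)] by simp
qed

section \<open>Frobenius coefficients as class functions; adding rim hooks\<close>

definition frob_fun :: "nat \<Rightarrow> (nat \<Rightarrow> int) \<Rightarrow> class_fun" where
  "frob_fun l v M = frob l v (sorted_list_of_multiset M)"

lemma frob_fun_mset: "frob_fun l v (mset mu) = frob l v mu"
  unfolding frob_fun_def by (rule frob_mset_cong) simp

lemma frob_fun_add_mset: "frob_fun l v (add_mset j M) = (\<Sum>r<l. frob_fun l (v(r := v r - int j)) M)"
proof -
  have "frob_fun l v (mset (j # sorted_list_of_multiset M)) = (\<Sum>r<l. frob_fun l (v(r := v r - int j)) M)"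
    by (simp only: frob_fun_mset frob.simps) (simp only: frob_fun_def)
  then show ?thesis by simp
qed

lemma frob_fun_transpose:
  "r < l \<Longrightarrow> s < l \<Longrightarrow> r \<noteq> s \<Longrightarrow> frob_fun l (v \<circ> Transposition.transpose r s) M = - frob_fun l v M"
  unfolding frob_fun_def by (rule frob_transpose)

lemma frob_fun_repeat: "r < l \<Longrightarrow> s < l \<Longrightarrow> r \<noteq> s \<Longrightarrow> v r = v s \<Longrightarrow> frob_fun l v M = 0"
  unfolding frob_fun_def by (rule frob_repeat)

lemma frob_fun_neg: "r < l \<Longrightarrow> v r < 0 \<Longrightarrow> frob_fun l v M = 0"
  unfolding frob_fun_def by (rule frob_neg)

lemma frob_fun_size: "frob_fun l v M \<noteq> 0 \<Longrightarrow> (\<Sum>i<l. v i) = (\<Sum>i<l. int i) + int (sum_mset M)"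
  unfolding frob_fun_def using frob_size by (metis mset_sorted_list_of_multiset sum_mset_sum_list)

lemma sum_distinct_ge:
  fixes A :: "nat set"
  assumes "finite A"
  shows "(\<Sum>i<card A. i) \<le> \<Sum>A"
  using assms
proof (induction rule: finite_linorder_max_induct)
  case (insert b A)
  have "card A \<le> card {..<b}" using insert by (intro card_mono) auto
  then have "card A \<le> b" by simp
  moreover have "b \<notin> A" using insert by auto
  ultimately show ?case using insert by simp
qed simp

text \<open>The vacuum condition: either \<open>v\<close> has a repeated entry (and then its character vanishes), or all
  values below \<open>K\<close> are taken, i.e. the partition has at least \<open>K\<close> empty rows.\<close>

definition vacuum :: "nat \<Rightarrow> nat \<Rightarrow> (nat \<Rightarrow> int) \<Rightarrow> bool" where
  "vacuum l K v \<longleftrightarrow> (\<forall>r<l. 0 \<le> v r) \<and>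
     ((\<exists>r<l. \<exists>s<l. r \<noteq> s \<and> v r = v s) \<or> (\<forall>x. 0 \<le> x \<and> x < int K \<longrightarrow> (\<exists>r<l. v r = x)))"

text \<open>A row that starts below K lands on a value occupied by another row, which gives a
  repetition; a row that starts at K or above takes no value below K away.\<close>

lemma vacuum_lower:
  assumes "vacuum l K v" "r < l" "int j \<le> v r" "\<not> (\<exists>r<l. \<exists>s<l. r \<noteq> s \<and> v r = v s)"
  shows "vacuum l K (v(r := v r - int j))"
proof -
  have cov: "\<And>x. 0 \<le> x \<Longrightarrow> x < int K \<Longrightarrow> \<exists>r<l. v r = x" and nn: "\<forall>r<l. 0 \<le> v r"
    using assms by (auto simp: vacuum_def)
  let ?u = "v(r := v r - int j)"
  have "(\<exists>r<l. \<exists>s<l. r \<noteq> s \<and> ?u r = ?u s) \<or> (\<forall>x. 0 \<le> x \<and> x < int K \<longrightarrow> (\<exists>r<l. ?u r = x))"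
  proof (cases "v r < int K \<and> j > 0")
    case True
    then obtain s where "s < l" "v s = v r - int j" using cov[of "v r - int j"] assms(3) by auto
    then have "s \<noteq> r" "?u r = ?u s" using True by auto
    then show ?thesis using \<open>s < l\<close> \<open>r < l\<close> by blast
  next
    case False
    have "\<exists>s<l. ?u s = x" if x: "0 \<le> x" "x < int K" for x
    proof -
      obtain s where s: "s < l" "v s = x" using cov x by blast
      then show ?thesis using False x by (cases "s = r") auto
    qed
    then show ?thesis by blast
  qed
  moreover have "\<forall>r<l. 0 \<le> ?u r" using nn assms(3) by auto
  ultimately show ?thesis by (simp add: vacuum_def)
qed

text \<open>A row raised from below K runs into an occupied value. The row with value K itself may
  move and free that value, hence the drop from \<open>Suc K\<close> to K.\<close>

lemma vacuum_raise:
  assumes "vacuum l (Suc K) v" "r < l" "\<not> (\<exists>r<l. \<exists>s<l. r \<noteq> s \<and> v r = v s)"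
  shows "vacuum l K (v(r := v r + 1))"
proof -
  have cov: "\<And>x. 0 \<le> x \<Longrightarrow> x < int (Suc K) \<Longrightarrow> \<exists>r<l. v r = x" and nn: "\<forall>r<l. 0 \<le> v r"
    using assms by (auto simp: vacuum_def)
  let ?u = "v(r := v r + 1)"
  have "(\<exists>r<l. \<exists>s<l. r \<noteq> s \<and> ?u r = ?u s) \<or> (\<forall>x. 0 \<le> x \<and> x < int K \<longrightarrow> (\<exists>r<l. ?u r = x))"
  proof (cases "v r < int K")
    case True
    then obtain s where "s < l" "v s = v r + 1" using cov[of "v r + 1"] nn assms(2) by fastforce
    then have "s \<noteq> r" "?u r = ?u s" by auto
    then show ?thesis using \<open>s < l\<close> \<open>r < l\<close> by blast
  next
    case False
    have "\<exists>s<l. ?u s = x" if x: "0 \<le> x" "x < int K" for x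
    proof -
      obtain s where s: "s < l" "v s = x" using cov[of x] x by auto
      then show ?thesis using False x by (cases "s = r") auto
    qed
    then show ?thesis by blast
  qed
  moreover have "\<forall>r<l. 0 \<le> ?u r" using nn by auto
  ultimately show ?thesis by (simp add: vacuum_def)
qed

text \<open>Unless one of the two equal rows is moved, the repetition persists; the two remaining
  terms differ by a transposition.\<close>

lemma frob_fun_create_repeat:
  assumes "a < l" "b < l" "a \<noteq> b" "v a = v b"
  shows "(\<Sum>s<l. frob_fun l (v(s := v s + k)) M) = 0"
proof -
  have "(\<Sum>s<l. frob_fun l (v(s := v s + k)) M) = (\<Sum>s\<in>{a, b}. frob_fun l (v(s := v s + k)) M)"
    using assms by (intro sum.mono_neutral_right) (auto intro!: frob_fun_repeat[of a l b])
  moreover have "v(b := v b + k) = v(a := v a + k) \<circ> Transposition.transpose a b"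
    using assms by (auto simp: fun_eq_iff Transposition.transpose_def)
  then have "frob_fun l (v(b := v b + k)) M = - frob_fun l (v(a := v a + k)) M"
    using frob_fun_transpose[OF assms(1-3)] by simp
  ultimately show ?thesis using assms(3) by simp
qed

text \<open>Distinct non-negative exponents sum to at least 0 + ... + (l - 1), so k further units
  exceed the degree allowed by homogeneity.\<close>

lemma frob_fun_create_small:
  assumes nn: "\<forall>r<l. 0 \<le> v r" and dist: "\<not> (\<exists>r<l. \<exists>s<l. r \<noteq> s \<and> v r = v s)"
    and s: "s < l" and sm: "sum_mset M < k"
  shows "frob_fun l (v(s := v s + int k)) M = 0"
proof (rule ccontr)
  assume "frob_fun l (v(s := v s + int k)) M \<noteq> 0"
  then have "(\<Sum>i<l. (v(s := v s + int k)) i) = (\<Sum>i<l. int i) + int (sum_mset M)"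
    by (rule frob_fun_size)
  moreover have "(\<Sum>i<l. (v(s := v s + int k)) i) = (\<Sum>i<l. v i + (if i = s then int k else 0))"
    by (intro sum.cong) auto
  ultimately have "(\<Sum>i<l. v i) + int k = (\<Sum>i<l. int i) + int (sum_mset M)"
    using s by (simp add: sum.distrib del: of_nat_sum_mset)
  moreover have "(\<Sum>i<l. int i) \<le> (\<Sum>i<l. v i)"
  proof -
    have inj: "inj_on (\<lambda>i. nat (v i)) {..<l}"
      using dist nn by (auto simp: inj_on_def) (metis eq_nat_nat_iff)
    have "(\<Sum>i<l. i) \<le> \<Sum>((\<lambda>i. nat (v i)) ` {..<l})"
      using sum_distinct_ge[of "(\<lambda>i. nat (v i)) ` {..<l}"] by (simp add: card_image[OF inj])
    also have "\<dots> = (\<Sum>i<l. nat (v i))" by (simp add: sum.reindex[OF inj])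
    finally have "int (\<Sum>i<l. i) \<le> int (\<Sum>i<l. nat (v i))" by (simp only: of_nat_le_iff)
    then show ?thesis using nn by simp
  qed
  ultimately show False using sm by linarith
qed

text \<open>The Murnaghan--Nakayama rule for multiplication by p_k: the sum over s adds signed rim
  hooks. It amounts to the Heisenberg relation between removing j and adding k, so the proof
  commutes the two for each part j of M and collects boundary terms. A rim hook of size k may occupy
  k new rows, which is why k is bounded by the depth K of the vacuum unless both sides vanish by
  degree.\<close>

lemma frob_fun_create:
  assumes "vacuum l K v" "k \<ge> 1" "k \<le> K \<or> sum_mset M < k"
  shows "(\<Sum>s<l. frob_fun l (v(s := v s + int k)) M) = real (k * count M k) * frob_fun l v (M - {#k#})"
proof (cases "\<exists>r<l. \<exists>s<l. r \<noteq> s \<and> v r = v s")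
  case True
  then obtain a b where ab: "a < l" "b < l" "a \<noteq> b" "v a = v b" by blast
  show ?thesis unfolding frob_fun_create_repeat[OF ab] frob_fun_repeat[of a l b v, OF ab] by simp
next
  case dist: False
  show ?thesis
  proof (cases "k \<le> K")
    case False
    then have sm: "sum_mset M < k" using assms by auto
    then have "k \<notin># M" by (auto dest!: multi_member_split)
    moreover have "frob_fun l (v(s := v s + int k)) M = 0" if "s < l" for s
      using assms(1) dist that sm by (intro frob_fun_create_small) (auto simp: vacuum_def)
    ultimately show ?thesis by (simp add: not_in_iff)
  next
    case True
    from assms(1) dist show ?thesis
    proof (induction M arbitrary: v)
      case empty
      have "frob_fun l (v(s := v s + int k)) {#} = 0" if "s < l" for s
        using empty that \<open>k \<ge> 1\<close> by (intro frob_fun_create_small) (auto simp: vacuum_def)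
      then have "(\<Sum>s<l. frob_fun l (v(s := v s + int k)) {#}) = 0" by (intro sum.neutral) blast
      then show ?case by (simp only:) simp
    next
      case (add j M)
      note nn = add.prems(1)[unfolded vacuum_def, THEN conjunct1]
      have cov: "\<exists>r<l. v r = x" if "0 \<le> x" "x < int K" for x
        using add.prems that by (auto simp: vacuum_def)
      define u where "u r = v(r := v r - int j)" for r
      have "(\<Sum>s<l. frob_fun l (v(s := v s + int k)) (add_mset j M))
         = (\<Sum>s<l. \<Sum>r<l. frob_fun l ((u r)(s := u r s + int k)) M)"
        unfolding frob_fun_add_mset u_def
        by (intro sum.cong refl arg_cong[where f = "\<lambda>v. frob_fun l v M"]) auto
      also have "\<dots> = (\<Sum>r<l. \<Sum>s<l. frob_fun l ((u r)(s := u r s + int k)) M)"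
        by (rule sum.swap)
      \<comment> \<open>If j exceeds v r, removing j makes the exponent of row r negative, and only
        adding k to the same row can repair this.\<close>
      also have "\<dots> = (\<Sum>r<l. real (k * count M k) * frob_fun l (u r) (M - {#k#})
          + (if v r < int j then frob_fun l (v(r := v r + int k - int j)) M else 0))"
      proof (intro sum.cong refl)
        fix r assume "r \<in> {..<l}"
        then have r: "r < l" by simp
        show "(\<Sum>s<l. frob_fun l ((u r)(s := u r s + int k)) M) = real (k * count M k) * frob_fun l (u r) (M - {#k#})
          + (if v r < int j then frob_fun l (v(r := v r + int k - int j)) M else 0)"
        proof (cases "v r < int j")
          case True
          have z: "frob_fun l (u r) N = 0" for N
            using r True by (intro frob_fun_neg[of r]) (auto simp: u_def)
          have "(\<Sum>s<l. frob_fun l ((u r)(s := u r s + int k)) M) = (\<Sum>s\<in>{r}. frob_fun l ((u r)(s := u r s + int k)) M)"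
            using r True by (intro sum.mono_neutral_right) (auto intro!: frob_fun_neg[of r] simp: u_def)
          then show ?thesis using True by (simp add: z) (simp add: u_def algebra_simps)
        next
          case False
          then have vac: "vacuum l K (u r)"
            unfolding u_def using add.prems r by (intro vacuum_lower) auto
          have "(\<Sum>s<l. frob_fun l ((u r)(s := u r s + int k)) M) = real (k * count M k) * frob_fun l (u r) (M - {#k#})"
          proof (cases "\<exists>a<l. \<exists>b<l. a \<noteq> b \<and> u r a = u r b")
            case True
            then obtain a b where ab: "a < l" "b < l" "a \<noteq> b" "u r a = u r b" by blast
            show ?thesis unfolding frob_fun_create_repeat[OF ab] frob_fun_repeat[of a l b "u r", OF ab] by simp
          next
            case False
            then show ?thesis using add.IH vac by blast
          qed
          then show ?thesis using False by simp
        qed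
      qed
      also have "\<dots> = real (k * count M k) * (\<Sum>r<l. frob_fun l (u r) (M - {#k#}))
          + (\<Sum>r<l. if v r < int j then frob_fun l (v(r := v r + int k - int j)) M else 0)"
        by (simp add: sum.distrib sum_distrib_left)
      also have "\<dots> = real (k * count (add_mset j M) k) * frob_fun l v (add_mset j M - {#k#})"
      proof (cases "j = k")
        case eq: True
        \<comment> \<open>Distinctness and the vacuum put exactly one row at each of the values 0,
          ..., k - 1; this is the constant k of the commutation relation.\<close>
        have "card {r. r < l \<and> v r < int k} = k"
        proof -
          have inj: "inj_on v {r. r < l \<and> v r < int k}" using add.prems by (auto simp: inj_on_def)
          have "v ` {r. r < l \<and> v r < int k} = {0..<int k}"
            using nn cov True by (force simp: image_iff)
          then show ?thesis using card_image[OF inj] by simp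
        qed
        then have "(\<Sum>r<l. if v r < int j then frob_fun l (v(r := v r + int k - int j)) M else 0) = real k * frob_fun l v M"
          using eq by (simp add: sum.If_cases Int_def conj_commute)
        moreover have "real (count M k) * (\<Sum>r<l. frob_fun l (u r) (M - {#k#})) = real (count M k) * frob_fun l v M"
        proof (cases "k \<in># M")
          case True
          then show ?thesis
            using frob_fun_add_mset[of l v k "M - {#k#}"] eq by (simp add: u_def)
        qed (simp add: not_in_iff)
        ultimately show ?thesis using eq by (simp add: algebra_simps)
      next
        case neq: False
        \<comment> \<open>For j different from k the repaired value is less than k, hence occupied
          by another row.\<close>
        have "frob_fun l (v(r := v r + int k - int j)) M = 0" if r: "r < l" "v r < int j" for r
        proof (cases "v r + int k - int j < 0")
          case True
          then show ?thesis using r by (intro frob_fun_neg[of r]) auto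
        next
          case False
          then obtain s where s: "s < l" "v s = v r + int k - int j"
            using cov[of "v r + int k - int j"] r(2) \<open>k \<le> K\<close> by auto
          then have "s \<noteq> r" using neq by auto
          then show ?thesis using s r by (intro frob_fun_repeat[of r l s]) auto
        qed
        then have "(\<Sum>r<l. if v r < int j then frob_fun l (v(r := v r + int k - int j)) M else 0) = 0"
          by (intro sum.neutral) auto
        moreover have "real (count M k) * (\<Sum>r<l. frob_fun l (u r) (M - {#k#})) = real (count M k) * frob_fun l v (add_mset j M - {#k#})"
        proof (cases "k \<in># M")
          case True
          then have "add_mset j M - {#k#} = add_mset j (M - {#k#})" using neq by simp
          then show ?thesis by (simp add: u_def frob_fun_add_mset)
        qed (simp add: not_in_iff)
        ultimately show ?thesis using neq by (simp add: algebra_simps)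
      qed
      finally show ?case .
    qed
  qed
qed

section \<open>Characters as eigenfunctions of the class sum of transpositions\<close>

lemma psum_as_sum:
  assumes "\<And>j. j \<in># M \<Longrightarrow> j \<le> J"
  shows "psum g M = (\<Sum>j=1..J. real (j * count M j) * g j (M - {#j#}))"
proof -
  have "(\<Sum>j\<in>#M. F j) = (\<Sum>j\<in>{..J}. real (count M j) * F j)" for F
    using assms
  proof (induction M)
    case (add k M)
    have "(\<Sum>j\<in>{..J}. real (count (add_mset k M) j) * F j)
      = (\<Sum>j\<in>{..J}. real (count M j) * F j + (if j = k then F k else 0))"
      by (intro sum.cong) (auto simp: distrib_right)
    then show ?case using add by (simp add: sum.distrib)
  qed simp
  then have "psum g M = (\<Sum>j\<in>{..J}. real (count M j) * (real j * g j (M - {#j#})))"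
    by (simp add: psum_def)
  also have "\<dots> = (\<Sum>j=1..J. real (count M j) * (real j * g j (M - {#j#})))"
    by (rule sum.mono_neutral_right) auto
  finally show ?thesis by (simp add: mult_ac)
qed

lemma sum_antisym_int:
  fixes f :: "int \<Rightarrow> real"
  assumes anti: "\<And>a. f (c - a) = - f a" and supp: "\<And>a. f a \<noteq> 0 \<Longrightarrow> p \<le> a \<and> a \<le> q"
    and A: "{p..q} \<subseteq> A" "finite A"
  shows "sum f A = 0"
proof -
  have "sum f A = sum f {x\<in>A. f x \<noteq> 0}"
    using A by (intro sum.mono_neutral_right) auto
  also have "{x\<in>A. f x \<noteq> 0} = {x. f x \<noteq> 0}" using supp A by force
  finally have e: "sum f A = sum f {x. f x \<noteq> 0}" .
  have "sum f {x. f x \<noteq> 0} = sum (\<lambda>x. - f x) {x. f x \<noteq> 0}"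
    using anti by (intro sum.reindex_bij_witness[where i = "\<lambda>a. c - a" and j = "\<lambda>a. c - a"]) auto
  then show ?thesis unfolding e by (simp add: sum_negf)
qed

text \<open>Summing over all ways of moving \<open>k\<close> units out of rows \<open>r\<close> and \<open>s\<close> gives zero by antisymmetry.\<close>

lemma frob_fun_two_rows:
  fixes M :: "nat multiset"
  assumes rs: "r < l" "s < l" "r \<noteq> s" and J: "v r \<le> int J" "v s \<le> int J" and k: "k \<ge> 1"
  defines "f \<equiv> \<lambda>a. frob_fun l (v(r := v r - a, s := v s - (int k - a))) M"
  shows "(\<Sum>j=1..J. f (- int j)) + f 0 + (\<Sum>t=1..<k. f (int t)) + f (int k) + (\<Sum>j=1..J. f (int k + int j)) = 0"
proof -
  have anti: "f (v r - v s + int k - a) = - f a" for a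
  proof -
    have "v(r := v r - (v r - v s + int k - a), s := v s - (int k - (v r - v s + int k - a)))
      = v(r := v r - a, s := v s - (int k - a)) \<circ> Transposition.transpose r s"
      using rs by (auto simp: fun_eq_iff Transposition.transpose_def)
    then show ?thesis unfolding f_def using frob_fun_transpose[OF rs] by metis
  qed
  have supp: "int k - v s \<le> a \<and> a \<le> v r" if "f a \<noteq> 0" for a
  proof -
    have "\<not> v r - a < 0"
    proof
      assume "v r - a < 0"
      then have "f a = 0" unfolding f_def using rs by (intro frob_fun_neg[of r]) auto
      then show False using that by simp
    qed
    moreover have "\<not> v s - (int k - a) < 0"
    proof
      assume "v s - (int k - a) < 0"
      then have "f a = 0" unfolding f_def using rs by (intro frob_fun_neg[of s]) auto
      then show False using that by simp
    qed
    ultimately show ?thesis by linarith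
  qed
  have "sum f {- int J .. int J + int k} = 0"
    using J by (intro sum_antisym_int[where f = f, OF anti supp]) auto
  moreover have "sum f {- int J .. int J + int k}
     = sum f {- int J .. -1} + f 0 + sum f {1..int k - 1} + f (int k) + sum f {int k + 1..int J + int k}"
  proof -
    have "{- int J .. int J + int k} = {- int J .. -1} \<union> ({0} \<union> ({1..int k - 1} \<union> ({int k} \<union> {int k + 1..int J + int k})))"
      using k by auto
    then show ?thesis using k by (simp add: sum.union_disjoint Int_def)
  qed
  moreover have "sum f {- int J .. -1} = (\<Sum>j=1..J. f (- int j))"
    by (rule sum.reindex_bij_witness[where i = "\<lambda>j. - int j" and j = "\<lambda>a. nat (- a)"]) auto
  moreover have "sum f {1..int k - 1} = (\<Sum>t=1..<k. f (int t))"
    by (rule sum.reindex_bij_witness[where i = int and j = nat]) auto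
  moreover have "sum f {int k + 1..int J + int k} = (\<Sum>j=1..J. f (int k + int j))"
    by (rule sum.reindex_bij_witness[where i = "\<lambda>j. int k + int j" and j = "\<lambda>a. nat (a - int k)"]) auto
  ultimately show ?thesis by simp
qed

text \<open>The sum of the contents of all boxes: raising a row from x to x + 1 adds x - l + 1, the
  content of the new box, and the subtracted sum makes the empty partition have value 0.\<close>

definition content_sum :: "nat \<Rightarrow> (nat \<Rightarrow> int) \<Rightarrow> real" where
  "content_sum l v = (\<Sum>r<l. (of_int (v r))\<^sup>2 / 2 - (real l - 1/2) * of_int (v r))
     - (\<Sum>i<l. (real i)\<^sup>2 / 2 - (real l - 1/2) * real i)"

lemma content_sum_upd:
  assumes "r < l"
  shows "content_sum l (v(r := x)) = content_sum l v
    + ((of_int x)\<^sup>2 / 2 - (real l - 1/2) * of_int x) - ((of_int (v r))\<^sup>2 / 2 - (real l - 1/2) * of_int (v r))"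
proof -
  let ?q = "\<lambda>y::int. (of_int y)\<^sup>2 / 2 - (real l - 1/2) * of_int y"
  have "(\<Sum>i<l. ?q ((v(r := x)) i)) = ?q x + (\<Sum>i\<in>{..<l}-{r}. ?q ((v(r := x)) i))"
    using assms by (subst sum.remove[of _ r]) auto
  also have "(\<Sum>i\<in>{..<l}-{r}. ?q ((v(r := x)) i)) = (\<Sum>i\<in>{..<l}-{r}. ?q (v i))"
    by (intro sum.cong) auto
  also have "\<dots> = (\<Sum>i<l. ?q (v i)) - ?q (v r)"
    using assms by (subst (2) sum.remove[of _ r]) auto
  finally show ?thesis unfolding content_sum_def by linarith
qed

text \<open>Expanding the cycles on the left gives diagonal terms, where one row loses k, and
  off-diagonal terms, where two rows lose a and k - a. Antisymmetry evaluates the off-diagonal terms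
  together, and counting the diagonal ones yields the coefficient on the right, which times k is the
  drop of \<open>content_sum\<close> when row r loses k.\<close>

lemma frob_fun_boundary:
  assumes vac: "vacuum l K v" and dist: "\<not> (\<exists>r<l. \<exists>s<l. r \<noteq> s \<and> v r = v s)"
    and M: "sum_mset M \<le> K" and k: "k \<ge> 1"
  shows "(\<Sum>t=1..<k. frob_fun l v (add_mset t (add_mset (k - t) M))) / 2 + psum (\<lambda>j N. frob_fun l v (add_mset (j + k) N)) M
    = (\<Sum>r<l. (of_int (v r) - real k / 2 - real l + 1/2) * frob_fun l (v(r := v r - int k)) M)"
proof -
  have nn: "\<forall>r<l. 0 \<le> v r" using vac by (simp add: vacuum_def)
  \<comment> \<open>\<open>J\<close> bounds all rows and all parts, so sums over j up to
    \<open>J\<close> contain every nonzero term.\<close>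
  define J where "J = sum_mset M + (\<Sum>r<l. nat (v r))"
  have J: "v r \<le> int J" if "r < l" for r
  proof -
    have "nat (v r) \<le> (\<Sum>r<l. nat (v r))" using that by (intro member_le_sum) auto
    then have "nat (v r) \<le> J" unfolding J_def by linarith
    then show ?thesis by linarith
  qed
  have JM: "j \<le> J" if "j \<in># M" for j
    using that by (auto simp: J_def dest!: multi_member_split)
  define U where "U r = frob_fun l (v(r := v r - int k)) M" for r
  define G where "G r s a = frob_fun l (v(r := v r - a, s := v s - (int k - a))) M" for r s a
  let ?O = "SIGMA r:{..<l}. {..<l} - {r}"
  have p1: "psum (\<lambda>j N. frob_fun l v (add_mset (j + k) N)) M
     = (\<Sum>r<l. (of_int (v r) - real k) * U r) + (\<Sum>(r,s)\<in>?O. \<Sum>j=1..J. G r s (int k + int j))"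
  proof -
    have "psum (\<lambda>j N. frob_fun l v (add_mset (j + k) N)) M
       = (\<Sum>r<l. \<Sum>j=1..J. real (j * count M j) * frob_fun l (v(r := v r - int (j + k))) (M - {#j#}))"
      unfolding frob_fun_add_mset psum_sum using psum_as_sum[OF JM] by simp
    also have "\<dots> = (\<Sum>r<l. (of_int (v r) - real k) * U r + (\<Sum>s\<in>{..<l}-{r}. \<Sum>j=1..J. G r s (int k + int j)))"
    proof (rule sum.cong[OF refl])
      fix r assume "r \<in> {..<l}"
      then have r: "r < l" by simp
      have "(\<Sum>j=1..J. real (j * count M j) * frob_fun l (v(r := v r - int (j + k))) (M - {#j#}))
        = (\<Sum>j=1..J. (if int (j + k) \<le> v r then U r else 0) + (\<Sum>s\<in>{..<l}-{r}. G r s (int k + int j)))"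
      proof (rule sum.cong[OF refl])
        fix j assume "j \<in> {1..J}"
        then have j: "j \<ge> 1" by simp
        let ?w = "v(r := v r - int (j + k))"
        have G: "frob_fun l (?w(s := ?w s + int j)) M = G r s (int k + int j)" if "s \<noteq> r" for s
          using that by (simp add: G_def algebra_simps)
        show "real (j * count M j) * frob_fun l ?w (M - {#j#})
          = (if int (j + k) \<le> v r then U r else 0) + (\<Sum>s\<in>{..<l}-{r}. G r s (int k + int j))"
        proof (cases "int (j + k) \<le> v r")
          case True
          have "vacuum l K ?w" using vac r True dist by (intro vacuum_lower) auto
          moreover have "j \<le> K \<or> sum_mset M < j" using M by linarith
          ultimately have "real (j * count M j) * frob_fun l ?w (M - {#j#}) = (\<Sum>s<l. frob_fun l (?w(s := ?w s + int j)) M)"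
            using frob_fun_create[of l K ?w j M] j by (simp only:)
          also have "\<dots> = frob_fun l (?w(r := ?w r + int j)) M + (\<Sum>s\<in>{..<l}-{r}. frob_fun l (?w(s := ?w s + int j)) M)"
            using r by (intro sum.remove) auto
          also have "?w(r := ?w r + int j) = v(r := v r - int k)" by simp
          also have "(\<Sum>s\<in>{..<l}-{r}. frob_fun l (?w(s := ?w s + int j)) M) = (\<Sum>s\<in>{..<l}-{r}. G r s (int k + int j))"
            by (rule sum.cong[OF refl]) (rule G, simp)
          finally show ?thesis unfolding U_def if_P[OF True] .
        next
          case False
          have "frob_fun l ?w (M - {#j#}) = 0" using r False by (intro frob_fun_neg[of r]) auto
          moreover have "G r s (int k + int j) = 0" if "s \<noteq> r" for s
            unfolding G_def using r False that by (intro frob_fun_neg[of r]) auto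
          ultimately show ?thesis using False by simp
        qed
      qed
      also have "\<dots> = (\<Sum>j=1..J. if int (j + k) \<le> v r then U r else 0) + (\<Sum>s\<in>{..<l}-{r}. \<Sum>j=1..J. G r s (int k + int j))"
        by (simp only: sum.distrib) (subst sum.swap, rule refl)
      \<comment> \<open>Row r can lose j + k and regain j for v r - k values of j.\<close>
      also have "(\<Sum>j=1..J. if int (j + k) \<le> v r then U r else 0) = (of_int (v r) - real k) * U r"
      proof (cases "int k \<le> v r")
        case True
        have "(\<Sum>j=1..J. if int (j + k) \<le> v r then U r else 0) = (\<Sum>j\<in>{1..nat (v r - int k)}. U r)"
          using J[OF r] by (intro sum.mono_neutral_cong_right) (auto simp: le_nat_iff)
        then show ?thesis using True by simp
      next
        case False
        then have z: "U r = 0" unfolding U_def using r by (intro frob_fun_neg[of r]) auto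
        show ?thesis unfolding z by simp
      qed
      finally show "(\<Sum>j=1..J. real (j * count M j) * frob_fun l (v(r := v r - int (j + k))) (M - {#j#}))
        = (of_int (v r) - real k) * U r + (\<Sum>s\<in>{..<l}-{r}. \<Sum>j=1..J. G r s (int k + int j))" .
    qed
    finally have "psum (\<lambda>j N. frob_fun l v (add_mset (j + k) N)) M
       = (\<Sum>r<l. (of_int (v r) - real k) * U r) + (\<Sum>r<l. \<Sum>s\<in>{..<l}-{r}. \<Sum>j=1..J. G r s (int k + int j))"
      by (simp only: sum.distrib)
    also have "(\<Sum>r<l. \<Sum>s\<in>{..<l}-{r}. \<Sum>j=1..J. G r s (int k + int j)) = (\<Sum>(r,s)\<in>?O. \<Sum>j=1..J. G r s (int k + int j))"
      by (rule sum.Sigma) auto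
    finally show ?thesis .
  qed
  have p2: "(\<Sum>t=1..<k. frob_fun l v (add_mset t (add_mset (k - t) M)))
     = real (k - 1) * (\<Sum>r<l. U r) + (\<Sum>(r,s)\<in>?O. \<Sum>t=1..<k. G r s (int t))"
  proof -
    have "frob_fun l v (add_mset t (add_mset (k - t) M)) = (\<Sum>r<l. U r) + (\<Sum>(r,s)\<in>?O. G r s (int t))" if t: "t \<in> {1..<k}" for t
    proof -
      have "frob_fun l v (add_mset t (add_mset (k - t) M))
        = (\<Sum>r<l. \<Sum>s<l. frob_fun l ((v(r := v r - int t))(s := (v(r := v r - int t)) s - int (k - t))) M)"
        by (simp only: frob_fun_add_mset)
      also have "\<dots> = (\<Sum>r<l. U r + (\<Sum>s\<in>{..<l}-{r}. G r s (int t)))"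
      proof (rule sum.cong[OF refl])
        fix r assume "r \<in> {..<l}"
        let ?h = "\<lambda>s. frob_fun l ((v(r := v r - int t))(s := (v(r := v r - int t)) s - int (k - t))) M"
        have "(\<Sum>s<l. ?h s) = ?h r + (\<Sum>s\<in>{..<l}-{r}. ?h s)"
          using \<open>r \<in> {..<l}\<close> by (intro sum.remove) auto
        also have "?h r = U r" using t by (simp add: U_def of_nat_diff)
        also have "(\<Sum>s\<in>{..<l}-{r}. ?h s) = (\<Sum>s\<in>{..<l}-{r}. G r s (int t))"
          using t by (intro sum.cong refl) (simp add: G_def of_nat_diff)
        finally show "(\<Sum>s<l. ?h s) = U r + (\<Sum>s\<in>{..<l}-{r}. G r s (int t))" .
      qed
      finally show ?thesis by (simp add: sum.distrib sum.Sigma)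
    qed
    then have "(\<Sum>t=1..<k. frob_fun l v (add_mset t (add_mset (k - t) M))) = (\<Sum>t=1..<k. (\<Sum>r<l. U r) + (\<Sum>(r,s)\<in>?O. G r s (int t)))"
      by (intro sum.cong) auto
    also have "\<dots> = real (k - 1) * (\<Sum>r<l. U r) + (\<Sum>t=1..<k. \<Sum>(r,s)\<in>?O. G r s (int t))"
      by (simp add: sum.distrib)
    also have "(\<Sum>t=1..<k. \<Sum>(r,s)\<in>?O. G r s (int t)) = (\<Sum>(r,s)\<in>?O. \<Sum>t=1..<k. G r s (int t))"
      by (subst sum.swap) (simp add: case_prod_beta)
    finally show ?thesis .
  qed
  \<comment> \<open>Exchanging the two rows replaces a by k - a.\<close>
  have p3: "(\<Sum>(r,s)\<in>?O. \<Sum>j=1..J. G r s (- int j)) = (\<Sum>(r,s)\<in>?O. \<Sum>j=1..J. G r s (int k + int j))"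
  proof (rule sum.reindex_bij_witness[where i = "\<lambda>(r,s). (s,r)" and j = "\<lambda>(r,s). (s,r)"])
    fix a assume "a \<in> ?O"
    then obtain x y where a: "a = (x, y)" "x \<noteq> y" by auto
    then have "G y x (int k + int j) = G x y (- int j)" for j
      by (simp add: G_def fun_upd_twist algebra_simps)
    then show "(case case a of (r, s) \<Rightarrow> (s, r) of (r, s) \<Rightarrow> \<Sum>j=1..J. G r s (int k + int j)) =
         (case a of (r, s) \<Rightarrow> \<Sum>j=1..J. G r s (- int j))" using a by simp
  qed auto
  \<comment> \<open>At a = 0 and a = k one of the two rows stays unchanged and can be chosen in l -
    1 ways.\<close>
  have p4: "(\<Sum>(r,s)\<in>?O. G r s 0) = real (l - 1) * (\<Sum>r<l. U r)" "(\<Sum>(r,s)\<in>?O. G r s (int k)) = real (l - 1) * (\<Sum>r<l. U r)"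
  proof -
    have Gk: "G r s (int k) = U r" if "s \<noteq> r" for r s
    proof -
      have "v(r := v r - int k, s := v s - (int k - int k)) = v(r := v r - int k)"
        using that by (auto simp: fun_eq_iff)
      then show ?thesis unfolding G_def U_def by (rule arg_cong[where f = "\<lambda>v. frob_fun l v M"])
    qed
    have G0: "G r s 0 = U s" if "s \<noteq> r" for r s
      using that by (simp add: G_def U_def)
    have c: "(\<Sum>(r,s)\<in>?O. U r) = real (l - 1) * (\<Sum>r<l. U r)"
      by (simp add: sum.Sigma[symmetric] sum_distrib_left)
    have "(\<Sum>(r,s)\<in>?O. G r s (int k)) = (\<Sum>(r,s)\<in>?O. U r)"
    proof (rule sum.cong[OF refl])
      fix x assume "x \<in> ?O"
      then obtain r s where "x = (r, s)" "s \<noteq> r" by auto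
      then show "(case x of (r, s) \<Rightarrow> G r s (int k)) = (case x of (r, s) \<Rightarrow> U r)" using Gk[of s r] by simp
    qed
    then show "(\<Sum>(r,s)\<in>?O. G r s (int k)) = real (l - 1) * (\<Sum>r<l. U r)" using c by simp
    have "(\<Sum>(r,s)\<in>?O. G r s 0) = (\<Sum>(r,s)\<in>?O. U r)"
    proof (rule sum.reindex_bij_witness[where i = "\<lambda>(r,s). (s,r)" and j = "\<lambda>(r,s). (s,r)"])
      fix x assume "x \<in> ?O"
      then obtain r s where "x = (r, s)" "s \<noteq> r" by auto
      then show "(case case x of (r, s) \<Rightarrow> (s, r) of (r, s) \<Rightarrow> U r) = (case x of (r, s) \<Rightarrow> G r s 0)" using G0[of s r] by simp
    qed auto
    then show "(\<Sum>(r,s)\<in>?O. G r s 0) = real (l - 1) * (\<Sum>r<l. U r)" using c by simp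
  qed
  have "(\<Sum>(r,s)\<in>?O. (\<Sum>j=1..J. G r s (- int j)) + G r s 0 + (\<Sum>t=1..<k. G r s (int t)) + G r s (int k) + (\<Sum>j=1..J. G r s (int k + int j))) = 0"
  proof (rule sum.neutral, rule ballI)
    fix x assume "x \<in> ?O"
    then obtain r s where x: "x = (r, s)" "r < l" "s < l" "r \<noteq> s" by auto
    show "(case x of (r, s) \<Rightarrow> (\<Sum>j=1..J. G r s (- int j)) + G r s 0 + (\<Sum>t=1..<k. G r s (int t)) + G r s (int k) + (\<Sum>j=1..J. G r s (int k + int j))) = 0"
      unfolding x(1) prod.case G_def by (rule frob_fun_two_rows[OF x(2-4) J[OF x(2)] J[OF x(3)] k])
  qed
  then have "(\<Sum>(r,s)\<in>?O. \<Sum>j=1..J. G r s (- int j)) + (\<Sum>(r,s)\<in>?O. G r s 0) + (\<Sum>(r,s)\<in>?O. \<Sum>t=1..<k. G r s (int t))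
     + (\<Sum>(r,s)\<in>?O. G r s (int k)) + (\<Sum>(r,s)\<in>?O. \<Sum>j=1..J. G r s (int k + int j)) = 0"
    unfolding case_prod_unfold sum.distrib .
  then have off: "(\<Sum>(r,s)\<in>?O. \<Sum>t=1..<k. G r s (int t)) / 2 + (\<Sum>(r,s)\<in>?O. \<Sum>j=1..J. G r s (int k + int j)) = - real (l - 1) * (\<Sum>r<l. U r)"
    unfolding p3 p4 by (simp add: field_simps)
  have "(\<Sum>r<l. (of_int (v r) - real k / 2 - real l + 1/2) * U r)
     = (\<Sum>r<l. (of_int (v r) - real k) * U r + ((real k - 1) / 2 - (real l - 1)) * U r)"
    by (intro sum.cong) (auto simp: field_simps)
  also have "\<dots> = (\<Sum>r<l. (of_int (v r) - real k) * U r) + ((real k - 1) / 2 - (real l - 1)) * (\<Sum>r<l. U r)"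
    by (simp only: sum.distrib sum_distrib_left)
  also have "\<dots> = (\<Sum>r<l. (of_int (v r) - real k) * U r) + real (k - 1) * (\<Sum>r<l. U r) / 2 - real (l - 1) * (\<Sum>r<l. U r)"
  proof (cases "l = 0")
    case False
    then show ?thesis using k by (simp add: of_nat_diff algebra_simps)
  qed simp
  finally show ?thesis unfolding p1 p2 U_def[symmetric] using off by (simp add: field_simps)
qed

text \<open>Induction on the cycles: taking out a cycle of length k produces the commutator of
  \<open>cut_join_add_mset\<close>, and \<open>frob_fun_boundary\<close> shows that it makes up for
  the change of the content sum.\<close>

lemma cut_join_frob_fun:
  assumes "vacuum l K v" "sum_mset M \<le> K"
  shows "cut_join (frob_fun l v) M = content_sum l v * frob_fun l v M"
  using assms
proof (induction M arbitrary: v)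
  case empty
  show ?case
  proof (cases "frob_fun l v {#} = 0")
    case False
    then have "(\<Sum>w | w permutes {..<l}. if \<forall>i<l. v i = int (l - 1 - w i) then of_int (sign w) else (0::real)) \<noteq> 0"
      by (simp add: frob_fun_def)
    then obtain w where w: "w permutes {..<l}" "\<forall>i<l. v i = int (l - 1 - w i)"
      by (auto elim!: sum.not_neutral_contains_not_neutral split: if_splits)
    let ?q = "\<lambda>i. (real i)\<^sup>2 / 2 - (real l - 1/2) * real i"
    have "(\<Sum>r<l. (of_int (v r))\<^sup>2 / 2 - (real l - 1/2) * of_int (v r)) = (\<Sum>r<l. ?q (l - 1 - w r))"
      using w by (intro sum.cong) auto
    also have "\<dots> = (\<Sum>r<l. ?q (l - 1 - r))"
      using sum.permute[OF w(1), of "\<lambda>r. ?q (l - 1 - r)"] by (simp add: comp_def)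
    also have "\<dots> = (\<Sum>r<l. ?q r)"
      by (rule sum.reindex_bij_witness[where i = "\<lambda>i. l - 1 - i" and j = "\<lambda>i. l - 1 - i"]) auto
    finally have "content_sum l v = 0" unfolding content_sum_def by simp
    then show ?thesis by (simp add: cut_join_def)
  qed (simp add: cut_join_def)
next
  case (add k M)
  show ?case
  proof (cases "\<exists>r<l. \<exists>s<l. r \<noteq> s \<and> v r = v s")
    case True
    then have "frob_fun l v = (\<lambda>N. 0)" by (auto intro: frob_fun_repeat)
    then show ?thesis by simp
  next
    case dist: False
    have M: "sum_mset M \<le> K" using add.prems by simp
    let ?u = "\<lambda>r. v(r := v r - int k)"
    have IH: "cut_join (frob_fun l (?u r)) M = content_sum l (?u r) * frob_fun l (?u r) M" if r: "r < l" for r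
    proof (cases "int k \<le> v r")
      case True
      show ?thesis by (rule add.IH[OF vacuum_lower[OF add.prems(1) r True dist] M])
    next
      case False
      then have "frob_fun l (?u r) = (\<lambda>N. 0)" using r by (intro ext frob_fun_neg[of r]) auto
      then show ?thesis by simp
    qed
    have "cut_join (frob_fun l v) (add_mset k M) = (\<Sum>r<l. content_sum l (?u r) * frob_fun l (?u r) M)
      + real k * ((\<Sum>t=1..<k. frob_fun l v (add_mset t (add_mset (k - t) M))) / 2 + psum (\<lambda>j N. frob_fun l v (add_mset (j + k) N)) M)"
      unfolding cut_join_add_mset frob_fun_add_mset[of l v k, abs_def] using IH
      by (simp add: cut_join_sum)
    also have "real k * ((\<Sum>t=1..<k. frob_fun l v (add_mset t (add_mset (k - t) M))) / 2 + psum (\<lambda>j N. frob_fun l v (add_mset (j + k) N)) M)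
      = (\<Sum>r<l. real k * (of_int (v r) - real k / 2 - real l + 1/2) * frob_fun l (?u r) M)"
    proof (cases "k = 0")
      case False
      then show ?thesis
        using frob_fun_boundary[OF add.prems(1) dist M, of k] by (simp add: sum_distrib_left mult.assoc)
    qed simp
    also have "(\<Sum>r<l. content_sum l (?u r) * frob_fun l (?u r) M) + \<dots> = (\<Sum>r<l. content_sum l v * frob_fun l (?u r) M)"
      unfolding sum.distrib[symmetric]
      by (intro sum.cong refl) (simp add: content_sum_upd field_simps power2_eq_square)
    finally show ?thesis by (simp add: frob_fun_add_mset sum_distrib_left)
  qed
qed

text \<open>Branching rule with Jucys--Murphy eigenvalues: induction adds a box, and every factor
  \<open>NS\<close> contributes its content. In the step through \<open>NS_ind_Suc\<close> the
  content appears as the difference of the content sums after and before adding the box.\<close>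

lemma NS_ind_frob_fun:
  assumes "vacuum l K v" "sum_mset M + 1 \<le> K"
  shows "NS_ind k (frob_fun l v) M = (\<Sum>r<l. (of_int (v r) - real l + 1) ^ k * frob_fun l (v(r := v r + 1)) M)"
  using assms(2)
proof (induction k arbitrary: M)
  case 0
  have "NS_ind 0 (frob_fun l v) M = (\<Sum>j\<in>#M. if j = 1 then frob_fun l v (M - {#1#}) else 0)"
    unfolding NS_ind_def ind_def psum_def
    by (intro arg_cong[where f = sum_mset] image_mset_cong) (auto simp: vac_def)
  also have "\<dots> = real (1 * count M 1) * frob_fun l v (M - {#1#})"
    by (simp add: sum_mset_delta mult.commute)
  also have "\<dots> = (\<Sum>s<l. frob_fun l (v(s := v s + int 1)) M)"
    using 0 assms(1) by (intro frob_fun_create[symmetric]) auto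
  finally show ?case by (simp only: power_0 mult_1 of_nat_1)
next
  case (Suc k)
  let ?c = "\<lambda>r. of_int (v r) - real l + 1"
  have "cut_join (NS_ind k (frob_fun l v)) M = cut_join (\<lambda>N. \<Sum>r<l. ?c r ^ k * frob_fun l (v(r := v r + 1)) N) M"
    using Suc.prems by (intro cut_join_cong Suc.IH) simp
  also have "\<dots> = (\<Sum>r<l. ?c r ^ k * cut_join (frob_fun l (v(r := v r + 1))) M)"
    by (simp only: cut_join_sum cut_join_mult)
  also have "\<dots> = (\<Sum>r<l. ?c r ^ k * (content_sum l v + ?c r) * frob_fun l (v(r := v r + 1)) M)"
  proof (cases "\<exists>r<l. \<exists>s<l. r \<noteq> s \<and> v r = v s")
    case True
    then obtain a b where ab: "a < l" "b < l" "a \<noteq> b" "v a = v b" by blast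
    \<comment> \<open>With a repetition only the rows a and b contribute, with opposite signs and
      equal contents.\<close>
    define g where "g r = (if r = a then - 1 else if r = b then 1 else (0::real))" for r
    have e: "frob_fun l (v(r := v r + 1)) N = g r * frob_fun l (v(b := v b + 1)) N" if "r < l" for r N
    proof -
      have "v(a := v a + 1) = v(b := v b + 1) \<circ> Transposition.transpose a b"
        using ab by (auto simp: fun_eq_iff Transposition.transpose_def)
      then have "frob_fun l (v(a := v a + 1)) N = - frob_fun l (v(b := v b + 1)) N"
        using frob_fun_transpose[OF ab(1-3)] by simp
      moreover have "frob_fun l (v(r := v r + 1)) N = 0" if "r \<noteq> a" "r \<noteq> b"
        using ab that by (intro frob_fun_repeat[of a l b]) auto
      ultimately show ?thesis using ab(3) by (auto simp: g_def simp del: fun_upd_apply)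
    qed
    have e': "frob_fun l (v(r := v r + 1)) = (\<lambda>N. g r * frob_fun l (v(b := v b + 1)) N)" if "r < l" for r
      using e[OF that] by blast
    have z: "(\<Sum>r<l. F (v r) * g r) = 0" for F :: "int \<Rightarrow> real"
    proof -
      have "(\<Sum>r<l. F (v r) * g r) = (\<Sum>r\<in>{a, b}. F (v r) * g r)"
        using ab by (intro sum.mono_neutral_right) (auto simp: g_def)
      then show ?thesis using ab by (simp add: g_def)
    qed
    have "(\<Sum>r<l. ?c r ^ k * cut_join (frob_fun l (v(r := v r + 1))) M)
       = (\<Sum>r<l. (?c r ^ k * g r) * cut_join (frob_fun l (v(b := v b + 1))) M)"
      by (intro sum.cong refl) (simp add: e' cut_join_mult mult.assoc del: fun_upd_apply)
    also have "\<dots> = 0" using z[of "\<lambda>x. (of_int x - real l + 1) ^ k"] by (simp flip: sum_distrib_right)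
    finally have 1: "(\<Sum>r<l. ?c r ^ k * cut_join (frob_fun l (v(r := v r + 1))) M) = 0" .
    have "(\<Sum>r<l. ?c r ^ k * (content_sum l v + ?c r) * frob_fun l (v(r := v r + 1)) M)
       = (\<Sum>r<l. (?c r ^ k * (content_sum l v + ?c r) * g r) * frob_fun l (v(b := v b + 1)) M)"
      by (intro sum.cong refl) (simp add: e' mult.assoc del: fun_upd_apply)
    also have "\<dots> = 0" using z[of "\<lambda>x. (of_int x - real l + 1) ^ k * (content_sum l v + (of_int x - real l + 1))"]
      by (simp flip: sum_distrib_right)
    finally show ?thesis using 1 by simp
  next
    case False
    have vac: "vacuum l (K - 1) (v(r := v r + 1))" if "r < l" for r
    proof -
      have "Suc (K - 1) = K" using Suc by simp
      then show ?thesis using vacuum_raise[of l "K - 1" v r] assms(1) that False by simp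
    qed
    have "cut_join (frob_fun l (v(r := v r + 1))) M = (content_sum l v + ?c r) * frob_fun l (v(r := v r + 1)) M" if "r < l" for r
    proof -
      have "content_sum l (v(r := v r + 1)) = content_sum l v + ?c r"
        using content_sum_upd[OF that, of v "v r + 1"] by (simp add: power2_eq_square field_simps)
      moreover have "sum_mset M \<le> K - 1" using Suc.prems by simp
      ultimately show ?thesis using cut_join_frob_fun[OF vac[OF that], of M] by simp
    qed
    then show ?thesis by (simp add: mult.assoc)
  qed
  finally have a: "cut_join (NS_ind k (frob_fun l v)) M
     = (\<Sum>r<l. ?c r ^ k * (content_sum l v + ?c r) * frob_fun l (v(r := v r + 1)) M)" .
  have "NS_ind k (cut_join (frob_fun l v)) M = NS_ind k (\<lambda>N. content_sum l v * frob_fun l v N) M"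
    using Suc.prems assms(1) by (intro NS_ind_cong cut_join_frob_fun) auto
  also have "\<dots> = content_sum l v * (\<Sum>r<l. ?c r ^ k * frob_fun l (v(r := v r + 1)) M)"
    unfolding NS_ind_mult Suc.IH[OF Suc.prems] ..
  finally have b: "NS_ind k (cut_join (frob_fun l v)) M = content_sum l v * (\<Sum>r<l. ?c r ^ k * frob_fun l (v(r := v r + 1)) M)" .
  define F where "F r = frob_fun l (v(r := v r + 1)) M" for r
  show ?case
    unfolding NS_ind_Suc a b sum_distrib_left sum_subtractf[symmetric] F_def[symmetric]
    by (intro sum.cong refl) (simp add: algebra_simps)
qed

text \<open>Adding and removing boxes in different rows commute, so only the diagonal terms are
  left. After cancellation between rows with neighbouring values the scalar is the power sum of the
  contents of the addable boxes minus that of the removable ones, that is, of Kerov's interlacing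
  coordinates.\<close>

lemma NS_comm_frob_fun:
  assumes "vacuum l K v" "sum_mset M + 2 \<le> K"
  shows "NS_comm m (frob_fun l v) M
    = ((\<Sum>r<l. (of_int (v r) - real l + 1) ^ m) - (\<Sum>r<l. if v r \<ge> 1 then (of_int (v r) - real l) ^ m else 0)) * frob_fun l v M"
proof (cases "\<exists>r<l. \<exists>s<l. r \<noteq> s \<and> v r = v s")
  case True
  then have "frob_fun l v = (\<lambda>N. 0)" by (auto intro: frob_fun_repeat)
  moreover have "NS_comm m (\<lambda>N. 0) M = 0"
    using NS_ind_mult[of m 0 "\<lambda>N. 0"] by (simp add: NS_comm_def)
  ultimately show ?thesis by simp
next
  case dist: False
  let ?c = "\<lambda>r. of_int (v r) - real l + 1"
  define G where "G r s = frob_fun l (v(r := v r + 1, s := (v(r := v r + 1)) s - 1)) M" for r s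
  have "NS_ind m (frob_fun l v) (add_mset 1 M) = (\<Sum>r<l. ?c r ^ m * frob_fun l (v(r := v r + 1)) (add_mset 1 M))"
    using assms by (intro NS_ind_frob_fun[of l K]) auto
  also have "\<dots> = (\<Sum>r<l. \<Sum>s<l. ?c r ^ m * G r s)"
    unfolding frob_fun_add_mset G_def sum_distrib_left by simp
  finally have 1: "NS_ind m (frob_fun l v) (add_mset 1 M) = (\<Sum>r<l. \<Sum>s<l. ?c r ^ m * G r s)" .
  have "NS_ind m (\<lambda>N. frob_fun l v (add_mset 1 N)) M = (\<Sum>s<l. NS_ind m (frob_fun l (v(s := v s - 1))) M)"
    unfolding frob_fun_add_mset NS_ind_sum by simp
  also have "\<dots> = (\<Sum>s<l. \<Sum>r<l. if r = s then (if v s \<ge> 1 then (of_int (v s) - real l) ^ m * frob_fun l v M else 0) else ?c r ^ m * G r s)"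
  proof (rule sum.cong[OF refl])
    fix s assume "s \<in> {..<l}"
    then have s: "s < l" by simp
    have Gs: "G r s = frob_fun l ((v(s := v s - 1))(r := (v(s := v s - 1)) r + 1)) M" if "r \<noteq> s" for r
      using that by (simp add: G_def fun_upd_twist)
    show "NS_ind m (frob_fun l (v(s := v s - 1))) M
      = (\<Sum>r<l. if r = s then (if v s \<ge> 1 then (of_int (v s) - real l) ^ m * frob_fun l v M else 0) else ?c r ^ m * G r s)"
    proof (cases "v s \<ge> 1")
      case True
      have "vacuum l K (v(s := v s - 1))"
        using vacuum_lower[OF assms(1) s, of 1] True dist by simp
      then have "NS_ind m (frob_fun l (v(s := v s - 1))) M
        = (\<Sum>r<l. (of_int ((v(s := v s - 1)) r) - real l + 1) ^ m * frob_fun l ((v(s := v s - 1))(r := (v(s := v s - 1)) r + 1)) M)"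
        using assms by (intro NS_ind_frob_fun[of l K]) auto
      also have "\<dots> = (\<Sum>r<l. if r = s then (if v s \<ge> 1 then (of_int (v s) - real l) ^ m * frob_fun l v M else 0) else ?c r ^ m * G r s)"
      proof (rule sum.cong[OF refl])
        fix r
        show "(of_int ((v(s := v s - 1)) r) - real l + 1) ^ m * frob_fun l ((v(s := v s - 1))(r := (v(s := v s - 1)) r + 1)) M
          = (if r = s then (if v s \<ge> 1 then (of_int (v s) - real l) ^ m * frob_fun l v M else 0) else ?c r ^ m * G r s)"
        proof (cases "r = s")
          case True
          then show ?thesis using \<open>v s \<ge> 1\<close> by simp
        next
          case False
          then show ?thesis using Gs[OF False] by (simp only: fun_upd_apply if_False)
        qed
      qed
      finally show ?thesis .
    next
      case False
      have z: "frob_fun l (v(s := v s - 1)) = (\<lambda>N. 0)"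
        using s False by (intro ext frob_fun_neg[of s]) auto
      have "G r s = 0" if "r \<noteq> s" for r
        unfolding G_def using s False that by (intro frob_fun_neg[of s]) auto
      moreover have "NS_ind m (\<lambda>N. 0) M = 0" using NS_ind_mult[of m 0 "\<lambda>N. 0"] by simp
      ultimately show ?thesis using False unfolding z by (simp cong: if_cong)
    qed
  qed
  also have "\<dots> = (\<Sum>r<l. \<Sum>s<l. if r = s then (if v s \<ge> 1 then (of_int (v s) - real l) ^ m * frob_fun l v M else 0) else ?c r ^ m * G r s)"
    by (rule sum.swap)
  finally have 2: "NS_ind m (\<lambda>N. frob_fun l v (add_mset 1 N)) M = \<dots>" .
  have "NS_comm m (frob_fun l v) M
     = (\<Sum>r<l. \<Sum>s<l. if r = s then ?c r ^ m * frob_fun l v M - (if v s \<ge> 1 then (of_int (v s) - real l) ^ m * frob_fun l v M else 0) else 0)"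
    unfolding NS_comm_def 1 2 sum_subtractf[symmetric]
    by (intro sum.cong refl) (auto simp: G_def)
  also have "\<dots> = (\<Sum>r<l. ?c r ^ m * frob_fun l v M - (if v r \<ge> 1 then (of_int (v r) - real l) ^ m * frob_fun l v M else 0))"
    by (intro sum.cong refl) simp
  also have "\<dots> = (\<Sum>r<l. (?c r ^ m - (if v r \<ge> 1 then (of_int (v r) - real l) ^ m else 0)) * frob_fun l v M)"
    by (intro sum.cong refl) (simp add: left_diff_distrib)
  finally show ?thesis by (simp only: sum_distrib_right[symmetric] sum_subtractf)
qed

text \<open>In \<open>NS_newton\<close> the term m = 0 is the moment itself and the others are
  shorter moments with scalar factors, so the moments are diagonal as well. The eigenvalue is not
  computed from this recursion but read off in the next theorem.\<close>

lemma NS_moment_frob_fun_ex: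
  assumes "vacuum l K v"
  shows "\<exists>t. \<forall>M. sum_mset M + 2 \<le> K \<longrightarrow> NS_moment k (frob_fun l v) M = t * frob_fun l v M"
proof (induction k rule: less_induct)
  case (less k)
  show ?case
  proof (cases "k = 0")
    case True
    then show ?thesis by (intro exI[of _ 1]) (simp add: NS_moment_0)
  next
    case False
    define cc where "cc m = (\<Sum>r<l. (of_int (v r) - real l + 1) ^ m) - (\<Sum>r<l. if v r \<ge> 1 then (of_int (v r) - real l) ^ m else 0)" for m
    obtain t where t: "\<And>j M. j < k \<Longrightarrow> sum_mset M + 2 \<le> K \<Longrightarrow> NS_moment j (frob_fun l v) M = t j * frob_fun l v M"
      using less by metis
    have "NS_moment k (frob_fun l v) M = ((\<Sum>m=1..k. cc m * t (k - m)) / real k) * frob_fun l v M" if M: "sum_mset M + 2 \<le> K" for M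
    proof -
      have "NS_moment (k - m) (NS_comm m (frob_fun l v)) M = cc m * t (k - m) * frob_fun l v M" if "m \<in> {1..k}" for m
      proof -
        have "NS_moment (k - m) (NS_comm m (frob_fun l v)) M = NS_moment (k - m) (\<lambda>N. cc m * frob_fun l v N) M"
          unfolding cc_def using M assms by (intro NS_moment_cong NS_comm_frob_fun) auto
        then show ?thesis unfolding NS_moment_mult using t[of "k - m" M] that M False by simp
      qed
      then have "(\<Sum>m=1..k. NS_moment (k - m) (NS_comm m (frob_fun l v)) M) = (\<Sum>m=1..k. cc m * t (k - m)) * frob_fun l v M"
        by (simp add: sum_distrib_right)
      moreover have "(\<Sum>m\<le>k. NS_moment (k - m) (NS_comm m (frob_fun l v)) M)
        = NS_moment k (frob_fun l v) M + (\<Sum>m=1..k. NS_moment (k - m) (NS_comm m (frob_fun l v)) M)"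
      proof -
        have "{..k} = insert 0 {1..k}" by auto
        then show ?thesis by (simp add: NS_comm_0)
      qed
      ultimately have "real k * NS_moment k (frob_fun l v) M = (\<Sum>m=1..k. cc m * t (k - m)) * frob_fun l v M"
        using NS_newton[of k "frob_fun l v" M] by (simp add: algebra_simps)
      then show ?thesis using False by (simp add: field_simps)
    qed
    then show ?thesis by blast
  qed
qed

text \<open>The eigenvalue is found at the identity, where \<open>NS_ind_ones\<close> and the
  branching rule evaluate the same induced function.\<close>

theorem NS_moment_frob_fun:
  assumes vac: "vacuum l K v" and n: "n + 2 \<le> K" and M: "sum_mset M = n"
    and dim: "frob_fun l v (replicate_mset n 1) \<noteq> 0"
  shows "NS_moment k (frob_fun l v) M
    = (\<Sum>r<l. (of_int (v r) - real l + 1) ^ k * frob_fun l (v(r := v r + 1)) (replicate_mset (Suc n) 1))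
      / (real (Suc n) * frob_fun l v (replicate_mset n 1)) * frob_fun l v M"
proof -
  obtain t where t: "\<And>M. sum_mset M + 2 \<le> K \<Longrightarrow> NS_moment k (frob_fun l v) M = t * frob_fun l v M"
    using NS_moment_frob_fun_ex[OF vac] by blast
  define D where "D = frob_fun l v (replicate_mset n 1)"
  define A where "A = (\<Sum>r<l. (of_int (v r) - real l + 1) ^ k * frob_fun l (v(r := v r + 1)) (replicate_mset (Suc n) 1))"
  have "real (Suc n) * (t * D) = NS_ind k (frob_fun l v) (replicate_mset (Suc n) 1)"
    unfolding NS_ind_ones D_def using t[of "replicate_mset n 1"] n by simp
  also have "\<dots> = A"
    unfolding A_def using n by (intro NS_ind_frob_fun[OF vac]) simp
  finally have "t = A / (real (Suc n) * D)"
    using dim unfolding D_def[symmetric] by (simp add: eq_divide_eq mult_ac del: of_nat_Suc)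
  then show ?thesis using t[of M] M n unfolding A_def D_def by simp
qed

section \<open>Transition measures as eigenvalues\<close>

lemma frob_cong: "(\<And>r. r < l \<Longrightarrow> v r = v' r) \<Longrightarrow> frob l v mu = frob l v' mu"
proof (induction mu arbitrary: v v')
  case Nil
  then show ?case by (simp cong: conj_cong all_cong)
next
  case (Cons j mu)
  show ?case unfolding frob.simps using Cons.prems
    by (intro sum.cong refl Cons.IH) auto
qed

definition frob_choices :: "nat \<Rightarrow> (nat \<Rightarrow> nat) \<Rightarrow> (nat \<Rightarrow> int) \<Rightarrow> nat list \<Rightarrow> (nat \<Rightarrow> nat) set" where
  "frob_choices l w v mu = {f \<in> {..<length mu} \<rightarrow>\<^sub>E {..<l}.
     \<forall>i<l. int (l - 1 - w i) + (\<Sum>q<length mu. if f q = i then int (mu ! q) else 0) = v i}"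

lemma finite_frob_choices: "finite (frob_choices l w v mu)"
  unfolding frob_choices_def by (rule finite_subset[of _ "{..<length mu} \<rightarrow>\<^sub>E {..<l}"]) (auto intro: finite_PiE)

text \<open>Condition on the row r that receives the last part; the other parts must fill that row
  up to j less.\<close>

lemma card_frob_choices_snoc:
  "card (frob_choices l w v (mu @ [j])) = (\<Sum>r<l. card (frob_choices l w (v(r := v r - int j)) mu))"
proof -
  let ?m = "length mu"
  let ?S = "\<lambda>r. frob_choices l w (v(r := v r - int j)) mu"
  have sum_eq: "(\<Sum>q<length (mu @ [j]). if (f(?m := r)) q = i then int ((mu @ [j]) ! q) else 0)
     = (\<Sum>q<?m. if f q = i then int (mu ! q) else 0) + (if r = i then int j else 0)" for f r i
  proof -
    have "(\<Sum>q<?m. if (f(?m := r)) q = i then int ((mu @ [j]) ! q) else 0) = (\<Sum>q<?m. if f q = i then int (mu ! q) else 0)"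
      by (intro sum.cong) (auto simp: nth_append)
    then show ?thesis by simp
  qed
  have "bij_betw (\<lambda>(r, f). f(?m := r)) (SIGMA r:{..<l}. ?S r) (frob_choices l w v (mu @ [j]))"
  proof (rule bij_betw_byWitness[where f' = "\<lambda>f. (f ?m, f(?m := undefined))"])
    show "\<forall>a\<in>SIGMA r:{..<l}. ?S r. ((case a of (r, f) \<Rightarrow> f(?m := r)) ?m, (case a of (r, f) \<Rightarrow> f(?m := r))(?m := undefined)) = a"
      by (auto simp: frob_choices_def PiE_def extensional_def fun_eq_iff)
    show "\<forall>f\<in>frob_choices l w v (mu @ [j]). (case (f ?m, f(?m := undefined)) of (r, f) \<Rightarrow> f(?m := r)) = f"
      by auto
    show "(\<lambda>(r, f). f(?m := r)) ` (SIGMA r:{..<l}. ?S r) \<subseteq> frob_choices l w v (mu @ [j])"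
    proof (rule image_subsetI)
      fix x assume "x \<in> (SIGMA r:{..<l}. ?S r)"
      then obtain r f where x: "x = (r, f)" and r: "r \<in> {..<l}" and f: "f \<in> ?S r" by auto
      have "f(?m := r) \<in> {..<length (mu @ [j])} \<rightarrow>\<^sub>E {..<l}"
        using r f by (auto simp: frob_choices_def PiE_def extensional_def Pi_def less_Suc_eq)
      moreover have "int (l - 1 - w i) + (\<Sum>q<length (mu @ [j]). if (f(?m := r)) q = i then int ((mu @ [j]) ! q) else 0) = v i" if "i < l" for i
        unfolding sum_eq using f that by (auto simp: frob_choices_def split: if_splits)
      ultimately show "(case x of (r, f) \<Rightarrow> f(?m := r)) \<in> frob_choices l w v (mu @ [j])"
        unfolding frob_choices_def x prod.case by blast
    qed
    show "(\<lambda>f. (f ?m, f(?m := undefined))) ` frob_choices l w v (mu @ [j]) \<subseteq> (SIGMA r:{..<l}. ?S r)"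
    proof (rule image_subsetI)
      fix f assume f: "f \<in> frob_choices l w v (mu @ [j])"
      let ?g = "f(?m := undefined)"
      have r: "f ?m < l" using f by (auto simp: frob_choices_def)
      have fg: "f = ?g(?m := f ?m)" by simp
      have "?g \<in> {..<?m} \<rightarrow>\<^sub>E {..<l}"
        using f by (auto simp: frob_choices_def PiE_def extensional_def Pi_def)
      moreover have "int (l - 1 - w i) + (\<Sum>q<?m. if ?g q = i then int (mu ! q) else 0) = (v(f ?m := v (f ?m) - int j)) i" if "i < l" for i
      proof -
        have "int (l - 1 - w i) + (\<Sum>q<length (mu @ [j]). if (?g(?m := f ?m)) q = i then int ((mu @ [j]) ! q) else 0) = v i"
          using f that fg by (auto simp: frob_choices_def)
        then show ?thesis unfolding sum_eq by (auto split: if_splits)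
      qed
      ultimately show "(f ?m, ?g) \<in> (SIGMA r:{..<l}. ?S r)" using r by (simp add: frob_choices_def)
    qed
  qed
  then have "card (SIGMA r:{..<l}. ?S r) = card (frob_choices l w v (mu @ [j]))" by (rule bij_betw_same_card)
  then show ?thesis by (simp add: card_SigmaI finite_frob_choices)
qed

lemma frob_explicit:
  "frob l v mu = (\<Sum>w | w permutes {..<l}. of_int (sign w) * real (card (frob_choices l w v mu)))"
proof (induction mu arbitrary: v rule: rev_induct)
  case Nil
  have "frob_choices l w v [] = (if \<forall>i<l. v i = int (l - 1 - w i) then {\<lambda>x. undefined} else {})" for w
    by (auto simp: frob_choices_def)
  then have c: "real (card (frob_choices l w v [])) = (if \<forall>i<l. v i = int (l - 1 - w i) then 1 else 0)" for w
    by (simp only: if_distrib[of card] if_distrib[of real]) simp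
  show ?case unfolding c frob.simps by (intro sum.cong refl) simp
next
  case (snoc j mu)
  have "frob l v (mu @ [j]) = (\<Sum>r<l. frob l (v(r := v r - int j)) mu)"
    by (simp add: frob_append_Cons)
  also have "\<dots> = (\<Sum>w | w permutes {..<l}. \<Sum>r<l. of_int (sign w) * real (card (frob_choices l w (v(r := v r - int j)) mu)))"
    unfolding snoc by (rule sum.swap)
  finally show ?case by (simp add: card_frob_choices_snoc sum_distrib_left)
qed

lemma irr_char_frob: "real_of_int (irr_char lam mu) = frob (length lam) (\<lambda>i. int (lam ! i + (length lam - 1 - i))) mu"
proof -
  have "{f \<in> {..<length mu} \<rightarrow>\<^sub>E {..<length lam}. \<forall>i<length lam.
      length lam - 1 - w i + (\<Sum>j | j < length mu \<and> f j = i. mu ! j) = lam ! i + (length lam - 1 - i)}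
    = frob_choices (length lam) w (\<lambda>i. int (lam ! i + (length lam - 1 - i))) mu" for w
  proof -
    have eqv: "(int (length lam - 1 - w i) + (\<Sum>q<length mu. if f q = i then int (mu ! q) else 0) = int (lam ! i + (length lam - 1 - i)))
      \<longleftrightarrow> (length lam - 1 - w i + (\<Sum>j | j < length mu \<and> f j = i. mu ! j) = lam ! i + (length lam - 1 - i))" for f i
    proof -
      have "(\<Sum>q<length mu. if f q = i then int (mu ! q) else 0) = int (\<Sum>j | j < length mu \<and> f j = i. mu ! j)"
        by (simp add: sum.If_cases Int_def)
      then show ?thesis by (simp only: of_nat_add[symmetric] of_nat_eq_iff)
    qed
    show ?thesis unfolding frob_choices_def eqv ..
  qed
  then show ?thesis unfolding irr_char_def Let_def frob_explicit by simp
qed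

text \<open>An additional empty row has exponent 0, so no part can be placed in it and the alternant
  must give it its smallest exponent. Such padding creates the vacuum required by the eigenvalue
  computation.\<close>

lemma frob_extend:
  assumes "0 \<notin> set mu"
  shows "frob (Suc l) (\<lambda>r. if r < l then v r + 1 else 0) mu = frob l v mu"
  using assms
proof (induction mu arbitrary: v)
  case Nil
  let ?V = "\<lambda>r. if r < l then v r + 1 else 0"
  have sub: "{w. w permutes {..<l}} \<subseteq> {w. w permutes {..<Suc l}}"
    by (auto intro: permutes_subset)
  have "frob l v [] = (\<Sum>w | w permutes {..<l}. if \<forall>i<Suc l. ?V i = int (Suc l - 1 - w i) then of_int (sign w) else 0)"
    unfolding frob.simps
  proof (intro sum.cong refl if_cong)
    fix w assume "w \<in> {w. w permutes {..<l}}"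
    then have w: "w permutes {..<l}" by simp
    then have "w l = l" by (simp add: permutes_not_in)
    moreover have "(v i = int (l - 1 - w i)) = (v i + 1 = int (l - w i))" if "i < l" for i
    proof -
      have "w i < l" using permutes_in_image[OF w, of i] that by simp
      then show ?thesis by auto
    qed
    ultimately show "(\<forall>i<l. v i = int (l - 1 - w i)) = (\<forall>i<Suc l. ?V i = int (Suc l - 1 - w i))"
      by (auto simp: less_Suc_eq)
  qed
  also have "\<dots> = frob (Suc l) ?V []"
    unfolding frob.simps
  proof (rule sum.mono_neutral_left)
    show "\<forall>w\<in>{w. w permutes {..<Suc l}} - {w. w permutes {..<l}}.
      (if \<forall>i<Suc l. ?V i = int (Suc l - 1 - w i) then of_int (sign w) else 0) = (0::real)"
    proof
      fix w assume w: "w \<in> {w. w permutes {..<Suc l}} - {w. w permutes {..<l}}"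
      have "\<not> (\<forall>i<Suc l. ?V i = int (Suc l - 1 - w i))"
      proof
        assume "\<forall>i<Suc l. ?V i = int (Suc l - 1 - w i)"
        then have "int (l - w l) = 0" by (metis diff_Suc_1 lessI less_irrefl)
        moreover have "w l < Suc l" using w permutes_in_image[of w "{..<Suc l}" l] by auto
        ultimately have "w l = l" by simp
        then have "w permutes {..<l}"
          using w permutes_superset[of w "{..<Suc l}" "{..<l}"] by (auto simp: less_Suc_eq)
        then show False using w by simp
      qed
      then show "(if \<forall>i<Suc l. ?V i = int (Suc l - 1 - w i) then of_int (sign w) else 0) = (0::real)"
        by (rule if_not_P)
    qed
  qed (use sub in \<open>auto simp: finite_permutations\<close>)
  finally show ?case ..
next
  case (Cons j mu)
  let ?V = "\<lambda>v r. if r < l then v r + 1 else (0::int)"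
  have "frob (Suc l) (?V v) (j # mu) = (\<Sum>r<l. frob (Suc l) ((?V v)(r := ?V v r - int j)) mu) + frob (Suc l) ((?V v)(l := ?V v l - int j)) mu"
    by simp
  also have "frob (Suc l) ((?V v)(l := ?V v l - int j)) mu = 0"
    using Cons.prems by (intro frob_neg[of l]) auto
  also have "(\<Sum>r<l. frob (Suc l) ((?V v)(r := ?V v r - int j)) mu) = (\<Sum>r<l. frob (Suc l) (?V (v(r := v r - int j))) mu)"
    by (intro sum.cong refl frob_cong) auto
  also have "\<dots> = (\<Sum>r<l. frob l (v(r := v r - int j)) mu)"
    using Cons.prems by (intro sum.cong refl Cons.IH) simp
  finally show ?case by (simp only: frob.simps add_0_right)
qed

definition exponents :: "nat \<Rightarrow> nat list \<Rightarrow> nat \<Rightarrow> int" where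
  "exponents l lam r = int (row_len lam r) + int (l - 1 - r)"

lemma frob_exponents:
  assumes "length lam \<le> l" "0 \<notin> set mu"
  shows "frob l (exponents l lam) mu = real_of_int (irr_char lam mu)"
  using assms(1)
proof (induction l rule: dec_induct)
  case base
  then show ?case unfolding irr_char_frob by (intro frob_cong) (simp add: exponents_def row_len_def)
next
  case (step l)
  have "frob (Suc l) (exponents (Suc l) lam) mu = frob (Suc l) (\<lambda>r. if r < l then exponents l lam r + 1 else 0) mu"
    using step by (intro frob_cong) (auto simp: exponents_def row_len_def)
  then show ?case using step frob_extend[OF assms(2)] by simp
qed

section \<open>Positivity of dimensions\<close>

definition strict_dec :: "nat \<Rightarrow> (nat \<Rightarrow> int) \<Rightarrow> bool" where
  "strict_dec l v \<longleftrightarrow> (\<forall>r. Suc r < l \<longrightarrow> v (Suc r) < v r) \<and> (\<forall>r<l. 0 \<le> v r)"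

lemma strict_dec_ge: "strict_dec l v \<Longrightarrow> r < l \<Longrightarrow> int (l - 1 - r) \<le> v r"
proof (induction "l - 1 - r" arbitrary: r)
  case 0
  then show ?case by (simp add: strict_dec_def)
next
  case (Suc d)
  then have "int (l - 1 - Suc r) \<le> v (Suc r)" by (intro Suc.hyps(1)) auto
  moreover have "v (Suc r) < v r" using Suc by (auto simp: strict_dec_def)
  ultimately show ?case using Suc by linarith
qed

text \<open>The coefficient counts the ways of removing all boxes one by one: lowering a row keeps
  the exponents strictly decreasing or else contributes 0, and some row can always be
  lowered.\<close>

lemma frob_dim_pos:
  assumes "strict_dec l v" "(\<Sum>r<l. v r) = (\<Sum>r<l. int r) + int k"
  shows "frob l v (replicate k 1) > 0"
  using assms
proof (induction k arbitrary: v)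
  case 0
  have s0: "(\<Sum>r<l. int r) = (\<Sum>r<l. int (l - 1 - r))"
    by (rule sum.reindex_bij_witness[where i = "\<lambda>i. l - 1 - i" and j = "\<lambda>i. l - 1 - i"]) auto
  have v: "v r = int (l - 1 - r)" if "r < l" for r
  proof (rule ccontr)
    assume "v r \<noteq> int (l - 1 - r)"
    then have "int (l - 1 - r) < v r" using strict_dec_ge[OF 0(1) that] by simp
    then have "(\<Sum>r<l. int (l - 1 - r)) < (\<Sum>r<l. v r)"
      using strict_dec_ge[OF 0(1)] that by (intro sum_strict_mono_ex1) auto
    then show False using 0(2) s0 by simp
  qed
  have "frob l v [] = (\<Sum>w | w permutes {..<l}. if w = id then 1 else 0)"
    unfolding frob.simps
  proof (intro sum.cong refl)
    fix w assume "w \<in> {w. w permutes {..<l}}"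
    then have w: "w permutes {..<l}" by simp
    have "(\<forall>i<l. v i = int (l - 1 - w i)) \<longleftrightarrow> w = id"
    proof
      assume a: "\<forall>i<l. v i = int (l - 1 - w i)"
      show "w = id"
      proof
        fix i
        show "w i = id i"
        proof (cases "i < l")
          case True
          then have "w i < l" using permutes_in_image[OF w, of i] by simp
          then show ?thesis using a v[OF True] True by auto
        qed (use w in \<open>simp add: permutes_not_in\<close>)
      qed
    qed (use v in auto)
    then show "(if \<forall>i<l. v i = int (l - 1 - w i) then real_of_int (sign w) else 0) = (if w = id then 1 else 0)"
      by simp
  qed
  also have "\<dots> = 1" by (simp add: permutes_id finite_permutations)
  finally show ?case by simp
next
  case (Suc k)
  have nonneg: "frob l (v(r := v r - 1)) (replicate k 1) \<ge> 0
     \<and> (strict_dec l (v(r := v r - 1)) \<longrightarrow> frob l (v(r := v r - 1)) (replicate k 1) > 0)" if r: "r < l" for r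
  proof (cases "strict_dec l (v(r := v r - 1))")
    case True
    have "(\<Sum>i<l. (v(r := v r - 1)) i) = (\<Sum>i<l. v i - (if i = r then 1 else 0))"
      by (intro sum.cong) auto
    then have "(\<Sum>i<l. (v(r := v r - 1)) i) = (\<Sum>r<l. int r) + int k"
      using Suc.prems r by (simp add: sum_subtractf)
    then have "frob l (v(r := v r - 1)) (replicate k 1) > 0" using Suc.IH[OF True] by blast
    then show ?thesis by simp
  next
    case False
    have "frob l (v(r := v r - 1)) (replicate k 1) = 0"
    proof (cases "v r = 0")
      case True
      then show ?thesis using r by (intro frob_neg[of r]) auto
    next
      case nz: False
      obtain q where q: "Suc q < l" "\<not> (v(r := v r - 1)) (Suc q) < (v(r := v r - 1)) q"
      proof -
        have nn: "\<forall>q<l. 0 \<le> v q" using Suc.prems(1) by (simp add: strict_dec_def)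
        then have "0 < v r" using nz r by (simp add: order_less_le)
        then have "\<forall>q<l. 0 \<le> (v(r := v r - 1)) q" using nn by simp
        then show ?thesis using False that unfolding strict_dec_def by blast
      qed
      have "v (Suc q) < v q" using q Suc.prems(1) by (auto simp: strict_dec_def)
      then have "q = r" "v (Suc r) = v r - 1" using q by (auto split: if_splits)
      then show ?thesis using q by (intro frob_repeat[of r l "Suc r"]) auto
    qed
    then show ?thesis using False by simp
  qed
  obtain r where r: "r < l" "strict_dec l (v(r := v r - 1))"
  proof -
    \<comment> \<open>The last row lying above its minimal value can be lowered without a
      collision.\<close>
    let ?P = "\<lambda>r. r < l \<and> int (l - 1 - r) < v r"
    have "\<exists>r. ?P r"
    proof (rule ccontr)
      assume "\<not> (\<exists>r. ?P r)"
      then have "(\<Sum>r<l. v r) \<le> (\<Sum>r<l. int (l - 1 - r))" by (intro sum_mono) force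
      also have "\<dots> = (\<Sum>r<l. int r)"
        by (rule sum.reindex_bij_witness[where i = "\<lambda>i. l - 1 - i" and j = "\<lambda>i. l - 1 - i"]) auto
      finally show False using Suc.prems(2) by simp
    qed
    moreover have fin: "finite {r. ?P r}" by simp
    ultimately have "Max {r. ?P r} \<in> {r. ?P r}" by (intro Max_in) auto
    then obtain r where r: "?P r" and "r = Max {r. ?P r}" by blast
    then have max: "s \<le> r" if "?P s" for s using Max_ge[OF fin] that by simp
    have "strict_dec l (v(r := v r - 1))"
      unfolding strict_dec_def
    proof (intro conjI allI impI)
      fix q assume q: "Suc q < l"
      have "v (Suc q) < v q" using Suc.prems(1) q by (auto simp: strict_dec_def)
      moreover have "v (Suc r) < v r - 1" if "q = r"
      proof -
        have "v (Suc r) \<le> int (l - 1 - Suc r)" using max[of "Suc r"] q that by force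
        then show ?thesis using r q that by linarith
      qed
      ultimately show "(v(r := v r - 1)) (Suc q) < (v(r := v r - 1)) q" by auto
    next
      fix q assume "q < l"
      then show "0 \<le> (v(r := v r - 1)) q" using Suc.prems(1) r by (auto simp: strict_dec_def)
    qed
    then show ?thesis using r that by blast
  qed
  have "frob l v (replicate (Suc k) 1) = (\<Sum>r<l. frob l (v(r := v r - 1)) (replicate k 1))"
    by simp
  also have "\<dots> > 0"
    using nonneg r by (intro sum_pos2[of _ r]) auto
  finally show ?case .
qed

section \<open>Exponent vectors of partitions, and the characters they define\<close>

lemma Part_row_len_mono:
  assumes "lam \<in> Part n" "r \<le> s"
  shows "row_len lam s \<le> row_len lam r"
proof (cases "s < length lam \<and> r \<noteq> s")
  case True
  then show ?thesis using assms unfolding Part_def row_len_def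
    by (auto simp: sorted_wrt_iff_nth_less)
qed (auto simp: row_len_def)

lemma Part_length: "lam \<in> Part n \<Longrightarrow> length lam \<le> n"
proof -
  have "0 \<notin> set xs \<Longrightarrow> length xs \<le> sum_list xs" for xs :: "nat list"
    by (induction xs) auto
  then show "lam \<in> Part n \<Longrightarrow> length lam \<le> n" by (auto simp: Part_def)
qed

lemma strict_dec_exponents: "lam \<in> Part n \<Longrightarrow> strict_dec l (exponents l lam)"
  unfolding strict_dec_def
proof (intro conjI allI impI)
  fix r assume "lam \<in> Part n" "Suc r < l"
  then show "exponents l lam (Suc r) < exponents l lam r"
    using Part_row_len_mono[of lam n r "Suc r"] by (simp add: exponents_def)
qed (simp add: exponents_def)

lemma vacuum_exponents: "vacuum l (l - length lam) (exponents l lam)"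
proof -
  have "\<exists>r<l. exponents l lam r = x" if "0 \<le> x" "x < int (l - length lam)" for x
    using that by (intro exI[of _ "l - 1 - nat x"]) (auto simp: exponents_def row_len_def)
  moreover have "\<forall>r<l. 0 \<le> exponents l lam r" by (simp add: exponents_def)
  ultimately show ?thesis unfolding vacuum_def by blast
qed

lemma sum_row_len: "length lam \<le> l \<Longrightarrow> (\<Sum>r<l. row_len lam r) = sum_list lam"
proof -
  assume "length lam \<le> l"
  then have "(\<Sum>r<l. row_len lam r) = (\<Sum>r<length lam. row_len lam r)"
    by (intro sum.mono_neutral_right) (auto simp: row_len_def)
  also have "\<dots> = sum_list lam" by (simp add: sum_list_sum_nth row_len_def atLeast0LessThan)
  finally show ?thesis .
qed

lemma sum_exponents:
  assumes "length lam \<le> l"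
  shows "(\<Sum>r<l. exponents l lam r) = (\<Sum>r<l. int r) + int (sum_list lam)"
proof -
  have "(\<Sum>r<l. int (l - 1 - r)) = (\<Sum>r<l. int r)"
    by (rule sum.reindex_bij_witness[where i = "\<lambda>i. l - 1 - i" and j = "\<lambda>i. l - 1 - i"]) auto
  then show ?thesis
    by (simp add: exponents_def sum.distrib flip: sum_row_len[OF assms] of_nat_sum)
qed

lemma dimY_pos:
  assumes "lam \<in> Part n"
  shows "dimY lam > 0"
proof -
  have "frob (length lam) (exponents (length lam) lam) (replicate (sum_list lam) 1) > 0"
    using sum_exponents[of lam "length lam"] by (intro frob_dim_pos strict_dec_exponents[OF assms]) auto
  then show ?thesis unfolding dimY_def by (subst (asm) frob_exponents) auto
qed

text \<open>A partition of n has at most n rows, so this number of variables leaves at least n + 2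
  empty rows, the depth asked for by \<open>NS_moment_frob_fun\<close>.\<close>

definition chi :: "nat list \<Rightarrow> class_fun" where
  "chi lam = frob_fun (2 * sum_list lam + 2) (exponents (2 * sum_list lam + 2) lam)"

lemma chi_irr_char:
  assumes "lam \<in> Part n" "0 \<notin> set mu"
  shows "chi lam (mset mu) = real_of_int (irr_char lam mu)"
  unfolding chi_def frob_fun_mset using assms Part_length[OF assms(1)]
  by (intro frob_exponents) (auto simp: Part_def)

lemma chi_size: "lam \<in> Part n \<Longrightarrow> chi lam M \<noteq> 0 \<Longrightarrow> sum_mset M = n"
proof -
  assume lam: "lam \<in> Part n" and "chi lam M \<noteq> 0"
  then have "(\<Sum>i<2 * n + 2. exponents (2 * n + 2) lam i) = (\<Sum>i<2 * n + 2. int i) + int (sum_mset M)"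
    unfolding chi_def by (intro frob_fun_size) (auto simp: Part_def)
  moreover have "(\<Sum>i<2 * n + 2. exponents (2 * n + 2) lam i) = (\<Sum>i<2 * n + 2. int i) + int n"
    using sum_exponents[of lam "2 * n + 2"] Part_length[OF lam] lam by (auto simp: Part_def)
  ultimately have "int (sum_mset M) = int n" by linarith
  then show ?thesis by (simp only: of_nat_eq_iff)
qed

lemma row_len_add_cell: "r \<le> length lam \<Longrightarrow> row_len (add_cell lam r) s = row_len lam s + (if s = r then 1 else 0)"
  by (auto simp: row_len_def add_cell_def nth_append nth_list_update)

text \<open>The eigenvalue of \<open>NS_moment_frob_fun\<close> is already a sum over rows of
  content powers and dimensions; the rows that are not addable drop out because raising them repeats
  an exponent.\<close>

lemma NS_moment_chi:
  assumes lam: "lam \<in> Part n"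
  shows "NS_moment k (chi lam) M = trans_moment lam k * chi lam M"
proof (cases "sum_mset M = n")
  case False
  have "NS_moment k (chi lam) M = NS_moment k (\<lambda>N. 0 * chi lam N) M"
    using False chi_size[OF lam] by (intro NS_moment_cong) (metis mult_zero_left)
  then show ?thesis using False chi_size[OF lam, of M] unfolding NS_moment_mult by auto
next
  case True
  define l where "l = 2 * n + 2"
  define v where "v = exponents l lam"
  have len: "length lam \<le> n" and sl: "sum_list lam = n" using lam Part_length by (auto simp: Part_def)
  have chi: "chi lam = frob_fun l v" by (simp add: chi_def l_def v_def sl)
  have dim: "frob_fun l v (replicate_mset n 1) = real_of_int (dimY lam)"
    using chi_irr_char[OF lam, of "replicate n 1"] by (simp add: chi dimY_def sl)
  have up: "frob_fun l (v(r := v r + 1)) (replicate_mset (Suc n) 1) = (if addable_row lam r then real_of_int (dimY (add_cell lam r)) else 0)"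
    if r: "r < l" for r
  proof (cases "addable_row lam r")
    case True
    then have rl: "r \<le> length lam" by (simp add: addable_row_def)
    have "sum_list (add_cell lam r) = Suc n"
    proof -
      have "length (add_cell lam r) \<le> l" using rl len by (auto simp: add_cell_def l_def)
      then have "sum_list (add_cell lam r) = (\<Sum>s<l. row_len lam s + (if s = r then 1 else 0))"
        using sum_row_len[of "add_cell lam r" l] row_len_add_cell[OF rl] by simp
      also have "\<dots> = Suc n" using r sum_row_len[of lam l] len sl by (simp add: sum.distrib l_def)
      finally show ?thesis .
    qed
    moreover have "frob_fun l (v(r := v r + 1)) (replicate_mset (Suc n) 1) = frob l (exponents l (add_cell lam r)) (replicate (Suc n) 1)"
    proof -
      have "frob_fun l (v(r := v r + 1)) (mset (replicate (Suc n) 1)) = frob l (exponents l (add_cell lam r)) (replicate (Suc n) 1)"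
        unfolding frob_fun_mset
        by (intro frob_cong) (simp add: v_def exponents_def row_len_add_cell[OF rl])
      then show ?thesis by (simp only: mset_replicate)
    qed
    moreover have "length (add_cell lam r) \<le> l" using rl len by (auto simp: add_cell_def l_def)
    ultimately show ?thesis using True by (simp only: if_True dimY_def) (rule frob_exponents, auto)
  next
    case False
    have r0: "r \<noteq> 0" using False by (auto simp: addable_row_def)
    have "row_len lam (r - 1) = row_len lam r"
    proof (cases "r \<le> length lam")
      case True
      then show ?thesis using False r0 Part_row_len_mono[OF lam, of "r - 1" r] by (auto simp: addable_row_def)
    qed (simp add: row_len_def)
    then have "v (r - 1) = v r + 1" using r r0 by (simp add: v_def exponents_def)
    then have "frob_fun l (v(r := v r + 1)) (replicate_mset (Suc n) 1) = 0"
      using r r0 by (intro frob_fun_repeat[of r l "r - 1"]) auto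
    then show ?thesis using False by simp
  qed
  have "vacuum l (l - length lam) v" unfolding v_def by (rule vacuum_exponents)
  moreover have "n + 2 \<le> l - length lam" using len by (simp add: l_def)
  moreover have "frob_fun l v (replicate_mset n 1) \<noteq> 0" using dim dimY_pos[OF lam] by simp
  ultimately have "NS_moment k (chi lam) M
    = (\<Sum>r<l. (of_int (v r) - real l + 1) ^ k * frob_fun l (v(r := v r + 1)) (replicate_mset (Suc n) 1))
      / (real (Suc n) * real_of_int (dimY lam)) * chi lam M"
    unfolding chi dim[symmetric] using True by (intro NS_moment_frob_fun) auto
  also have "(\<Sum>r<l. (of_int (v r) - real l + 1) ^ k * frob_fun l (v(r := v r + 1)) (replicate_mset (Suc n) 1))
    = (\<Sum>r<l. if addable_row lam r then real_of_int (cell_content lam r) ^ k * real_of_int (dimY (add_cell lam r)) else 0)"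
  proof (intro sum.cong refl)
    fix r assume "r \<in> {..<l}"
    then have r: "r < l" by simp
    have "of_int (v r) - real l + 1 = real_of_int (cell_content lam r)"
      using r by (simp add: v_def exponents_def cell_content_def of_nat_diff)
    then show "(of_int (v r) - real l + 1) ^ k * frob_fun l (v(r := v r + 1)) (replicate_mset (Suc n) 1)
      = (if addable_row lam r then real_of_int (cell_content lam r) ^ k * real_of_int (dimY (add_cell lam r)) else 0)"
      unfolding up[OF r] by simp
  qed
  also have "\<dots> = (\<Sum>r\<in>{r. addable_row lam r}. real_of_int (cell_content lam r) ^ k * real_of_int (dimY (add_cell lam r)))"
    using len by (intro sum.mono_neutral_cong_right) (auto simp: addable_row_def l_def)
  also have "\<dots> / (real (Suc n) * real_of_int (dimY lam)) = trans_moment lam k"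
    unfolding trans_moment_def sl sum_divide_distrib by (intro sum.cong) (auto simp: mult_ac)
  finally show ?thesis .
qed

section \<open>Formal power series in infinitely many variables\<close>

text \<open>Monomials are multisets of variable indices, so that differentiation by the \<open>k\<close>-th variable
  acts through \<open>add_mset k\<close>.\<close>

typedef mps = "UNIV :: (nat multiset \<Rightarrow> real) set"
  morphisms coef Mps ..

lemma coef_Mps [simp]: "coef (Mps f) = f"
  by (simp add: Mps_inverse)

lemma mps_eqI: "(\<And>M. coef f M = coef g M) \<Longrightarrow> f = g"
  by (metis coef_inject ext)

lemma finite_submsets [simp]: "finite {N. N \<subseteq># M}"
proof (induction M)
  case (add k M)
  have "{N. N \<subseteq># add_mset k M} \<subseteq> {N. N \<subseteq># M} \<union> add_mset k ` {N. N \<subseteq># M}"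
  proof
    fix N assume "N \<in> {N. N \<subseteq># add_mset k M}"
    then have N: "N \<subseteq># add_mset k M" by simp
    show "N \<in> {N. N \<subseteq># M} \<union> add_mset k ` {N. N \<subseteq># M}"
    proof (cases "k \<in># N")
      case True
      then obtain N' where "N = add_mset k N'" by (meson multi_member_split)
      then show ?thesis using N by auto
    next
      case False
      have "count N a \<le> count M a" for a
        using mset_subset_eq_count[OF N, of a] False by (cases "a = k") (auto simp: not_in_iff)
      then show ?thesis by (simp add: mset_subset_eqI)
    qed
  qed
  then show ?case using add finite_subset by blast
qed simp

instantiation mps :: comm_ring_1
begin

definition "0 = Mps (\<lambda>M. 0)"
definition "1 = Mps (\<lambda>M. if M = {#} then 1 else 0)"
definition "f + g = Mps (\<lambda>M. coef f M + coef g M)"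
definition "f - g = Mps (\<lambda>M. coef f M - coef g M)"
definition "- f = Mps (\<lambda>M. - coef f M)"
definition "f * g = Mps (\<lambda>M. \<Sum>N\<in>{N. N \<subseteq># M}. coef f N * coef g (M - N))"

lemma mult_commute_aux: "f * g = g * (f :: mps)"
proof (rule mps_eqI)
  fix M
  have "(\<Sum>N\<in>{N. N \<subseteq># M}. coef f N * coef g (M - N)) = (\<Sum>N\<in>{N. N \<subseteq># M}. coef g N * coef f (M - N))"
    by (rule sum.reindex_bij_witness[where i = "\<lambda>N. M - N" and j = "\<lambda>N. M - N"])
      (auto simp: subset_mset.diff_diff_right)
  then show "coef (f * g) M = coef (g * f) M" by (simp add: times_mps_def)
qed

instance
proof
  fix f g h :: mps
  show "f + g + h = f + (g + h)" "f + g = g + f" "0 + f = f" "- f + f = 0" "f - g = f + - g"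
    by (simp_all add: coef_inverse plus_mps_def zero_mps_def uminus_mps_def minus_mps_def algebra_simps)
  show "f * g = g * f" by (rule mult_commute_aux)
  show "(f + g) * h = f * h + g * h"
    by (simp add: plus_mps_def times_mps_def distrib_right sum.distrib)
  show "(0::mps) \<noteq> 1"
    by (simp add: zero_mps_def one_mps_def Mps_inject fun_eq_iff)
  show "1 * f = f"
  proof (rule mps_eqI)
    fix M
    have "(\<Sum>N\<in>{N. N \<subseteq># M}. (if N = {#} then 1 else 0) * coef f (M - N)) = (\<Sum>N\<in>{{#}}. (if N = {#} then 1 else 0) * coef f (M - N))"
      by (rule sum.mono_neutral_right) auto
    then show "coef (1 * f) M = coef f M" by (simp add: one_mps_def times_mps_def)
  qed
  show "f * g * h = f * (g * h)"
  proof (rule mps_eqI)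
    fix M
    have "coef (f * g * h) M = (\<Sum>N\<in>{N. N \<subseteq># M}. \<Sum>P\<in>{P. P \<subseteq># N}. coef f P * coef g (N - P) * coef h (M - N))"
      by (simp add: times_mps_def sum_distrib_right)
    also have "\<dots> = (\<Sum>(N, P)\<in>(SIGMA N:{N. N \<subseteq># M}. {P. P \<subseteq># N}). coef f P * coef g (N - P) * coef h (M - N))"
      by (rule sum.Sigma) auto
    also have "\<dots> = (\<Sum>(P, Q)\<in>(SIGMA P:{P. P \<subseteq># M}. {Q. Q \<subseteq># M - P}). coef f P * (coef g Q * coef h (M - P - Q)))"
    proof (rule sum.reindex_bij_witness[where i = "\<lambda>(P, Q). (P + Q, P)" and j = "\<lambda>(N, P). (P, N - P)"])
      fix b assume "b \<in> (SIGMA P:{P. P \<subseteq># M}. {Q. Q \<subseteq># M - P})"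
      then obtain P Q where b: "b = (P, Q)" "P \<subseteq># M" "Q \<subseteq># M - P" by auto
      then have "P + Q \<subseteq># M" by (simp add: subset_mset.le_diff_conv2 add.commute)
      then show "(case b of (P, Q) \<Rightarrow> (P + Q, P)) \<in> (SIGMA N:{N. N \<subseteq># M}. {P. P \<subseteq># N})" using b by auto
    next
      fix a assume "a \<in> (SIGMA N:{N. N \<subseteq># M}. {P. P \<subseteq># N})"
      then obtain N P where a: "a = (N, P)" "N \<subseteq># M" "P \<subseteq># N" by auto
      then obtain Q R where "N = P + Q" "M = P + Q + R"
        by (metis mset_subset_eq_exists_conv)
      then show "(case a of (N, P) \<Rightarrow> (P, N - P)) \<in> (SIGMA P:{P. P \<subseteq># M}. {Q. Q \<subseteq># M - P})"
        and "(case (case a of (N, P) \<Rightarrow> (P, N - P)) of (P, Q) \<Rightarrow> coef f P * (coef g Q * coef h (M - P - Q)))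
        = (case a of (N, P) \<Rightarrow> coef f P * coef g (N - P) * coef h (M - N))"
        using a(1) by (simp_all add: add.assoc)
    qed auto
    also have "\<dots> = (\<Sum>P\<in>{P. P \<subseteq># M}. \<Sum>Q\<in>{Q. Q \<subseteq># M - P}. coef f P * (coef g Q * coef h (M - P - Q)))"
      by (rule sum.Sigma[symmetric]) auto
    finally show "coef (f * g * h) M = coef (f * (g * h)) M"
      by (simp add: times_mps_def sum_distrib_left)
  qed
qed

end

lemma coef_simps [simp]:
  "coef 0 M = 0" "coef 1 M = (if M = {#} then 1 else 0)" "coef (f + g) M = coef f M + coef g M"
  "coef (f - g) M = coef f M - coef g M" "coef (- f) M = - coef f M"
  by (simp_all add: zero_mps_def one_mps_def plus_mps_def minus_mps_def uminus_mps_def)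

lemma coef_mult: "coef (f * g) M = (\<Sum>N\<in>{N. N \<subseteq># M}. coef f N * coef g (M - N))"
  by (simp add: times_mps_def)

lemma coef_mult_empty [simp]: "coef (f * g) {#} = coef f {#} * coef g {#}"
  by (simp add: coef_mult)

lemma coef_sum: "coef (\<Sum>x\<in>A. f x) M = (\<Sum>x\<in>A. coef (f x) M)"
  by (induction A rule: infinite_finite_induct) auto

section \<open>Constants, partial derivatives and linear forms\<close>

definition cst :: "real \<Rightarrow> mps" where
  "cst c = Mps (\<lambda>M. if M = {#} then c else 0)"

lemma coef_cst: "coef (cst c) M = (if M = {#} then c else 0)"
  by (simp add: cst_def)

lemma coef_cst_mult [simp]: "coef (cst c * f) M = c * coef f M"
proof -
  have "coef (cst c * f) M = (\<Sum>N\<in>{{#}}. coef (cst c) N * coef f (M - N))"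
    unfolding coef_mult by (rule sum.mono_neutral_right) (auto simp: coef_cst)
  then show ?thesis by (simp add: coef_cst)
qed

lemma cst_add: "cst (a + b) = cst a + cst b"
  by (rule mps_eqI) (simp add: coef_cst)

lemma cst_mult: "cst (a * b) = cst a * cst b"
  by (rule mps_eqI) (simp add: coef_cst)

lemma cst_0 [simp]: "cst 0 = 0" and cst_1 [simp]: "cst 1 = 1"
  by (auto intro!: mps_eqI simp: coef_cst)

definition pd :: "nat \<Rightarrow> mps \<Rightarrow> mps" where
  "pd k f = Mps (\<lambda>M. real (count M k + 1) * coef f (add_mset k M))"

lemma coef_pd: "coef (pd k f) M = real (count M k + 1) * coef f (add_mset k M)"
  by (simp add: pd_def)

lemma pd_add [simp]: "pd k (f + g) = pd k f + pd k g"
  by (rule mps_eqI) (simp add: coef_pd algebra_simps)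

lemma pd_0 [simp]: "pd k 0 = 0"
  by (rule mps_eqI) (simp add: coef_pd)

lemma pd_sum: "pd k (\<Sum>x\<in>A. f x) = (\<Sum>x\<in>A. pd k (f x))"
  by (induction A rule: infinite_finite_induct) auto

lemma pd_cst [simp]: "pd k (cst c) = 0"
  by (rule mps_eqI) (simp add: coef_pd coef_cst)

lemma pd_1 [simp]: "pd k 1 = 0"
  by (rule mps_eqI) (simp add: coef_pd)

text \<open>The exponent of variable k is the sum of its exponents in the two factors; each of the
  two terms of the rule carries one of these summands as weight.\<close>

lemma pd_mult: "pd k (f * g) = pd k f * g + f * pd k g"
proof (rule mps_eqI)
  fix M
  have half: "(\<Sum>N\<in>{N. N \<subseteq># add_mset k M}. real (count N k) * (coef f N * coef g (add_mset k M - N))) = coef (pd k f * g) M" for f g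
  proof -
    have "(\<Sum>N\<in>{N. N \<subseteq># add_mset k M}. real (count N k) * (coef f N * coef g (add_mset k M - N)))
      = (\<Sum>N\<in>{N. N \<subseteq># add_mset k M \<and> k \<in># N}. real (count N k) * (coef f N * coef g (add_mset k M - N)))"
      by (rule sum.mono_neutral_right) (auto simp: not_in_iff intro: rev_finite_subset[OF finite_submsets])
    also have "\<dots> = (\<Sum>N\<in>{N. N \<subseteq># M}. real (count N k + 1) * (coef f (add_mset k N) * coef g (M - N)))"
      by (rule sum.reindex_bij_witness[where i = "add_mset k" and j = "\<lambda>N. N - {#k#}"])
        (auto dest!: multi_member_split)
    finally show ?thesis by (simp add: coef_mult coef_pd mult.assoc)
  qed
  have "coef (pd k (f * g)) M = (\<Sum>N\<in>{N. N \<subseteq># add_mset k M}. real (count M k + 1) * (coef f N * coef g (add_mset k M - N)))"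
    by (simp add: coef_pd coef_mult sum_distrib_left)
  also have "\<dots> = (\<Sum>N\<in>{N. N \<subseteq># add_mset k M}. real (count N k) * (coef f N * coef g (add_mset k M - N)))
     + (\<Sum>N\<in>{N. N \<subseteq># add_mset k M}. real (count (add_mset k M - N) k) * (coef f N * coef g (add_mset k M - N)))"
  proof -
    have "real (count M k + 1) = real (count N k) + real (count (add_mset k M - N) k)" if "N \<subseteq># add_mset k M" for N
    proof -
      have "count N k \<le> count (add_mset k M) k" using that by (rule mset_subset_eq_count)
      then show ?thesis by simp
    qed
    then show ?thesis unfolding sum.distrib[symmetric] distrib_right[symmetric]
      by (intro sum.cong refl) (metis mem_Collect_eq)
  qed
  also have "(\<Sum>N\<in>{N. N \<subseteq># add_mset k M}. real (count (add_mset k M - N) k) * (coef f N * coef g (add_mset k M - N)))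
     = (\<Sum>N\<in>{N. N \<subseteq># add_mset k M}. real (count N k) * (coef g N * coef f (add_mset k M - N)))"
    by (rule sum.reindex_bij_witness[where i = "\<lambda>N. add_mset k M - N" and j = "\<lambda>N. add_mset k M - N"])
      (auto simp: subset_mset.diff_diff_right)
  finally show "coef (pd k (f * g)) M = coef (pd k f * g + f * pd k g) M"
    unfolding half by (simp add: mult.commute)
qed

lemma pd_power: "pd k (f ^ Suc m) = cst (real (Suc m)) * f ^ m * pd k f"
proof (induction m)
  case (Suc m)
  have "pd k (f ^ Suc (Suc m)) = pd k f * f ^ Suc m + f * pd k (f ^ Suc m)"
    by (simp only: power_Suc[of f "Suc m"] pd_mult)
  also have "\<dots> = (1 + cst (real (Suc m))) * f ^ Suc m * pd k f"
    unfolding Suc by (simp add: algebra_simps)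
  also have "1 + cst (real (Suc m)) = cst (real (Suc (Suc m)))"
    by (rule mps_eqI) (simp add: coef_cst)
  finally show ?case .
qed simp

lemma pd_eq_0_imp:
  assumes "\<And>k. pd k f = 0"
  shows "f = cst (coef f {#})"
proof (rule mps_eqI)
  fix M
  show "coef f M = coef (cst (coef f {#})) M"
  proof (cases M)
    case (add k N)
    have "coef (pd k f) N = 0" using assms by simp
    then show ?thesis using add by (simp add: coef_pd coef_cst)
  qed (simp add: coef_cst)
qed

text \<open>The series \<open>\<Sum>\<^sub>j x\<^sub>j g\<^sub>j\<close>.\<close>

definition xsum :: "(nat \<Rightarrow> mps) \<Rightarrow> mps" where
  "xsum g = Mps (\<lambda>M. \<Sum>j\<in>set_mset M. coef (g j) (M - {#j#}))"

lemma coef_xsum: "coef (xsum g) M = (\<Sum>j\<in>set_mset M. coef (g j) (M - {#j#}))"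
  by (simp add: xsum_def)

lemma xsum_mult: "xsum g * f = xsum (\<lambda>j. g j * f)"
proof (rule mps_eqI)
  fix M
  have "coef (xsum g * f) M = (\<Sum>N\<in>{N. N \<subseteq># M}. \<Sum>j\<in>set_mset N. coef (g j) (N - {#j#}) * coef f (M - N))"
    by (simp add: coef_mult coef_xsum sum_distrib_right)
  also have "\<dots> = (\<Sum>(N, j)\<in>(SIGMA N:{N. N \<subseteq># M}. set_mset N). coef (g j) (N - {#j#}) * coef f (M - N))"
    by (rule sum.Sigma) auto
  also have "\<dots> = (\<Sum>(j, N)\<in>(SIGMA j:set_mset M. {N. N \<subseteq># M - {#j#}}). coef (g j) N * coef f (M - {#j#} - N))"
  proof (rule sum.reindex_bij_witness[where i = "\<lambda>(j, N). (add_mset j N, j)" and j = "\<lambda>(N, j). (j, N - {#j#})"])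
    fix b assume "b \<in> (SIGMA j:set_mset M. {N. N \<subseteq># M - {#j#}})"
    then obtain j N where b: "b = (j, N)" "j \<in># M" "N \<subseteq># M - {#j#}" by auto
    then show "(case b of (j, N) \<Rightarrow> (add_mset j N, j)) \<in> (SIGMA N:{N. N \<subseteq># M}. set_mset N)"
      by (auto simp: insert_subset_eq_iff)
  next
    fix a assume "a \<in> (SIGMA N:{N. N \<subseteq># M}. set_mset N)"
    then obtain N j where a: "a = (N, j)" "N \<subseteq># M" "j \<in># N" by auto
    then obtain N' where N': "N = add_mset j N'" by (meson multi_member_split)
    then show "(case a of (N, j) \<Rightarrow> (j, N - {#j#})) \<in> (SIGMA j:set_mset M. {N. N \<subseteq># M - {#j#}})"
      using a by (auto simp: insert_subset_eq_iff)
    show "(case (case a of (N, j) \<Rightarrow> (j, N - {#j#})) of (j, N) \<Rightarrow> coef (g j) N * coef f (M - {#j#} - N))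
      = (case a of (N, j) \<Rightarrow> coef (g j) (N - {#j#}) * coef f (M - N))"
      using a N' by simp
  qed auto
  also have "\<dots> = (\<Sum>j\<in>set_mset M. \<Sum>N\<in>{N. N \<subseteq># M - {#j#}}. coef (g j) N * coef f (M - {#j#} - N))"
    by (rule sum.Sigma[symmetric]) auto
  finally show "coef (xsum g * f) M = coef (xsum (\<lambda>j. g j * f)) M"
    by (simp add: coef_mult coef_xsum)
qed

lemma pd_xsum: "pd k (xsum g) = xsum (\<lambda>j. pd k (g j)) + g k"
proof (rule mps_eqI)
  fix M
  define A where "A = set_mset M - {k}"
  have fin: "finite A" "k \<notin> A" by (auto simp: A_def)
  have "coef (pd k (xsum g)) M = real (count M k + 1) * (\<Sum>j\<in>insert k A. coef (g j) (add_mset k M - {#j#}))"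
    by (simp add: coef_pd coef_xsum A_def)
  also have "\<dots> = real (count M k + 1) * coef (g k) M + (\<Sum>j\<in>A. real (count M k + 1) * coef (g j) (add_mset k M - {#j#}))"
    using fin by (simp add: distrib_left sum_distrib_left)
  also have "(\<Sum>j\<in>A. real (count M k + 1) * coef (g j) (add_mset k M - {#j#})) = (\<Sum>j\<in>A. coef (pd k (g j)) (M - {#j#}))"
    by (intro sum.cong) (auto simp: A_def coef_pd)
  also have "real (count M k + 1) * coef (g k) M + (\<Sum>j\<in>A. coef (pd k (g j)) (M - {#j#})) = coef (xsum (\<lambda>j. pd k (g j))) M + coef (g k) M"
  proof (cases "k \<in># M")
    case True
    then have "set_mset M = insert k A" by (auto simp: A_def)
    moreover have "coef (pd k (g k)) (M - {#k#}) = real (count M k) * coef (g k) M"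
      using True by (auto simp: coef_pd dest!: multi_member_split)
    ultimately show ?thesis using fin by (simp add: coef_xsum algebra_simps)
  next
    case False
    then have "set_mset M = A" "count M k = 0" by (auto simp: A_def not_in_iff)
    then show ?thesis by (simp add: coef_xsum)
  qed
  finally show "coef (pd k (xsum g)) M = coef (xsum (\<lambda>j. pd k (g j)) + g k) M" by simp
qed

definition lin :: "(nat \<Rightarrow> real) \<Rightarrow> mps" where
  "lin t = xsum (\<lambda>j. cst (t j))"

lemma lin_mult: "lin t * f = xsum (\<lambda>j. cst (t j) * f)"
  by (simp add: lin_def xsum_mult)

lemma pd_lin [simp]: "pd k (lin t) = cst (t k)"
proof -
  have "xsum (\<lambda>j. 0) = 0" by (rule mps_eqI) (simp add: coef_xsum)
  then show ?thesis by (simp add: lin_def pd_xsum)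
qed

lemma coef_xsum_empty [simp]: "coef (xsum g) {#} = 0"
  by (simp add: coef_xsum)

lemma coef_lin_empty [simp]: "coef (lin t) {#} = 0"
  by (simp add: lin_def)

subsection \<open>Logarithm and exponential\<close>

lemma coef_power_eq_0:
  assumes "coef f {#} = 0" "size M < m"
  shows "coef (f ^ m) M = 0"
  using assms(2)
proof (induction m arbitrary: M)
  case (Suc m)
  have "coef f N * coef (f ^ m) (M - N) = 0" if N: "N \<subseteq># M" for N
  proof (cases "N = {#}")
    case False
    then have "size (M - N) < m"
      using Suc.prems N size_Diff_submset[OF N] by (simp add: nonempty_has_size)
        (metis diff_less less_Suc_eq_le order_less_le_trans nat_less_le nonempty_has_size not_less size_mset_mono le_less_trans subset_mset.le_zero_eq)
    then show ?thesis using Suc.IH by simp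
  qed (simp add: assms(1))
  then show ?case unfolding power_Suc coef_mult by (intro sum.neutral) blast
qed simp

lemma coef_mult_cong:
  assumes "\<And>N. N \<subseteq># M \<Longrightarrow> coef f N = coef f' N" "\<And>N. N \<subseteq># M \<Longrightarrow> coef g N = coef g' N"
  shows "coef (f * g) M = coef (f' * g') M"
  unfolding coef_mult using assms by (intro sum.cong refl) simp

text \<open>If f has no constant term, powers beyond the degree of the monomial do not reach it, so
  the finite sum is the whole exponential series. \<open>mln\<close> uses the same cutoff.\<close>

definition mexp :: "mps \<Rightarrow> mps" where
  "mexp f = Mps (\<lambda>M. \<Sum>m\<le>size M. coef (f ^ m) M / fact m)"

lemma coef_mexp:
  assumes "coef f {#} = 0" "size M \<le> K"
  shows "coef (mexp f) M = coef (\<Sum>m\<le>K. cst (1 / fact m) * f ^ m) M"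
proof -
  have "(\<Sum>m\<le>size M. coef (f ^ m) M / fact m) = (\<Sum>m\<le>K. coef (f ^ m) M / fact m)"
    using assms by (intro sum.mono_neutral_left) (auto simp: coef_power_eq_0)
  then show ?thesis by (simp add: mexp_def coef_sum)
qed

lemma coef_mexp_empty [simp]: "coef (mexp f) {#} = 1"
  by (simp add: mexp_def)

lemma pd_mexp:
  assumes "coef f {#} = 0"
  shows "pd k (mexp f) = mexp f * pd k f"
proof (rule mps_eqI)
  fix M :: "nat multiset"
  let ?K = "size M"
  have "coef (pd k (mexp f)) M = coef (pd k (\<Sum>m\<le>Suc ?K. cst (1 / fact m) * f ^ m)) M"
    unfolding coef_pd using coef_mexp[OF assms, of "add_mset k M" "Suc ?K"] by simp
  also have "pd k (\<Sum>m\<le>Suc ?K. cst (1 / fact m) * f ^ m) = (\<Sum>m\<le>?K. cst (1 / fact m) * f ^ m) * pd k f"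
  proof -
    have "pd k (\<Sum>m\<le>Suc ?K. cst (1 / fact m) * f ^ m) = (\<Sum>m\<le>?K. cst (1 / fact (Suc m)) * pd k (f ^ Suc m))"
      by (simp add: pd_sum pd_mult sum.atMost_Suc_shift del: sum.atMost_Suc power_Suc fact_Suc)
    also have "\<dots> = (\<Sum>m\<le>?K. cst (1 / fact m) * f ^ m * pd k f)"
    proof (rule sum.cong[OF refl])
      fix m
      have "cst (1 / fact (Suc m)) * pd k (f ^ Suc m) = cst (1 / fact (Suc m) * real (Suc m)) * f ^ m * pd k f"
        unfolding pd_power cst_mult by (simp add: mult.assoc)
      also have "1 / fact (Suc m) * real (Suc m) = 1 / fact m" by (simp only: fact_Suc) (simp del: of_nat_Suc)
      finally show "cst (1 / fact (Suc m)) * pd k (f ^ Suc m) = cst (1 / fact m) * f ^ m * pd k f" .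
    qed
    finally show ?thesis by (simp add: sum_distrib_right)
  qed
  also have "coef ((\<Sum>m\<le>?K. cst (1 / fact m) * f ^ m) * pd k f) M = coef (mexp f * pd k f) M"
    by (intro coef_mult_cong coef_mexp[OF assms, symmetric] size_mset_mono refl)
  finally show "coef (pd k (mexp f)) M = coef (mexp f * pd k f) M" .
qed

definition mln :: "mps \<Rightarrow> mps" where
  "mln f = Mps (\<lambda>M. \<Sum>m\<in>{1..size M}. (-1) ^ (m - 1) / real m * coef ((f - 1) ^ m) M)"

lemma coef_mln_empty [simp]: "coef (mln f) {#} = 0"
  by (simp add: mln_def)

text \<open>The derivative of the truncated logarithm is a finite geometric sum in 1 - f. Multiplied
  by f it telescopes, and the remainder is of too high a degree to be seen at M.\<close>

lemma pd_mln:
  assumes "coef f {#} = 1"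
  shows "pd k f = f * pd k (mln f)"
proof (rule mps_eqI)
  fix M :: "nat multiset"
  define B where "B = f - 1"
  have B0: "coef B {#} = 0" using assms by (simp add: B_def)
  let ?K = "Suc (size M)"
  have ln: "coef (mln f) N = coef (\<Sum>m<?K. cst ((-1) ^ m / real (Suc m)) * B ^ Suc m) N" if "size N \<le> ?K" for N
  proof -
    have "coef (mln f) N = (\<Sum>m\<in>{1..?K}. (-1) ^ (m - 1) / real m * coef (B ^ m) N)"
      unfolding mln_def B_def[symmetric] coef_Mps using that B0
      by (intro sum.mono_neutral_left) (auto simp: coef_power_eq_0)
    also have "\<dots> = (\<Sum>m<?K. (-1) ^ m / real (Suc m) * coef (B ^ Suc m) N)"
      by (rule sum.reindex_bij_witness[where i = Suc and j = "\<lambda>m. m - 1"]) auto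
    finally show ?thesis by (simp only: coef_sum coef_cst_mult)
  qed
  have pk: "coef (pd k (mln f)) N = coef ((\<Sum>m<?K. (- B) ^ m) * pd k f) N" if "N \<subseteq># M" for N
  proof -
    have "size (add_mset k N) \<le> ?K" using size_mset_mono[OF that] by simp
    then have "coef (pd k (mln f)) N = coef (pd k (\<Sum>m<?K. cst ((-1) ^ m / real (Suc m)) * B ^ Suc m)) N"
      unfolding coef_pd using ln by (simp only:)
    also have "pd k (\<Sum>m<?K. cst ((-1) ^ m / real (Suc m)) * B ^ Suc m) = (\<Sum>m<?K. (- B) ^ m * pd k f)"
      unfolding pd_sum
    proof (rule sum.cong[OF refl])
      fix m
      have "pd k (cst ((-1) ^ m / real (Suc m)) * B ^ Suc m) = cst ((-1) ^ m / real (Suc m) * real (Suc m)) * B ^ m * pd k B"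
        unfolding pd_mult pd_power cst_mult by (simp add: mult.assoc)
      also have "(-1) ^ m / real (Suc m) * real (Suc m) = (-1) ^ m" by simp
      also have "cst ((-1) ^ m) * B ^ m = (- B) ^ m"
      proof (induction m)
        case (Suc m)
        have "cst ((-1) ^ Suc m) = - cst ((-1) ^ m)" by (rule mps_eqI) (simp add: coef_cst)
        then show ?case by (simp add: mult.left_commute flip: Suc)
      qed simp
      also have "pd k B = pd k f"
      proof -
        have "f = B + 1" by (simp add: B_def)
        then have "pd k f = pd k B + pd k 1" by (metis pd_add)
        then show ?thesis by simp
      qed
      finally show "pd k (cst ((-1) ^ m / real (Suc m)) * B ^ Suc m) = (- B) ^ m * pd k f" .
    qed
    finally show ?thesis by (simp only: sum_distrib_right)
  qed
  have "coef (f * pd k (mln f)) M = coef (f * ((\<Sum>m<?K. (- B) ^ m) * pd k f)) M"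
    by (intro coef_mult_cong pk) auto
  also have "f * ((\<Sum>m<?K. (- B) ^ m) * pd k f) = pd k f - (- B) ^ ?K * pd k f"
  proof -
    have "(1 - (- B)) * (\<Sum>m<?K. (- B) ^ m) = 1 - (- B) ^ ?K"
      by (rule one_diff_power_eq[symmetric])
    then have "f * (\<Sum>m<?K. (- B) ^ m) = 1 - (- B) ^ ?K" by (simp add: B_def)
    then show ?thesis by (simp only: mult.assoc[symmetric] left_diff_distrib mult_1)
  qed
  also have "coef (pd k f - (- B) ^ ?K * pd k f) M = coef (pd k f) M"
  proof -
    have "coef ((- B) ^ ?K) N = 0" if "N \<subseteq># M" for N
      using B0 size_mset_mono[OF that] by (intro coef_power_eq_0) auto
    then show ?thesis by (simp add: coef_mult)
  qed
  finally show "coef (pd k f) M = coef (f * pd k (mln f)) M" by simp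
qed

lemma pd_cst_mult [simp]: "pd k (cst c * f) = cst c * pd k f"
  by (simp add: pd_mult)

lemma xsum_add: "xsum (\<lambda>j. f j + g j) = xsum f + xsum g"
  by (rule mps_eqI) (simp add: coef_xsum sum.distrib)

lemma xsum_cst_mult: "xsum (\<lambda>j. cst c * f j) = cst c * xsum f"
  by (rule mps_eqI) (simp add: coef_xsum sum_distrib_left)

lemma xsum_mult_right: "f * xsum g = xsum (\<lambda>j. f * g j)"
  using xsum_mult[of g f] by (simp add: mult.commute)

lemma lin_add: "lin a + lin b = lin (\<lambda>i. a i + b i)"
  unfolding lin_def by (simp add: xsum_add cst_add)

lemma lin_cst: "cst c * lin a = lin (\<lambda>i. c * a i)"
  unfolding lin_def by (simp add: xsum_cst_mult[symmetric] cst_mult)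

lemma lin_sum: "finite A \<Longrightarrow> (\<Sum>x\<in>A. lin (f x)) = lin (\<lambda>i. \<Sum>x\<in>A. f x i)"
proof (induction A rule: finite_induct)
  case empty
  show ?case by (rule mps_eqI) (simp add: lin_def coef_xsum)
qed (simp add: lin_add)

subsection \<open>Rescaling and exponential shifts\<close>

definition dil :: "real \<Rightarrow> mps \<Rightarrow> mps" where
  "dil s f = Mps (\<lambda>M. s ^ size M * coef f M)"

lemma coef_dil: "coef (dil s f) M = s ^ size M * coef f M"
  by (simp add: dil_def)

lemma dil_mult: "dil s (f * g) = dil s f * dil s g"
proof (rule mps_eqI)
  fix M
  have "s ^ size M * (coef f N * coef g (M - N)) = s ^ size N * coef f N * (s ^ size (M - N) * coef g (M - N))"
    if "N \<subseteq># M" for N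
  proof -
    have "size M = size N + size (M - N)" using that by (simp add: size_Diff_submset size_mset_mono)
    then have "s ^ size M = s ^ size N * s ^ size (M - N)" by (simp add: power_add)
    then show ?thesis by simp
  qed
  then show "coef (dil s (f * g)) M = coef (dil s f * dil s g) M"
    unfolding coef_dil coef_mult sum_distrib_left by (intro sum.cong refl) blast
qed

lemma dil_add: "dil s (f + g) = dil s f + dil s g"
  by (rule mps_eqI) (simp add: coef_dil algebra_simps)

lemma dil_0 [simp]: "dil s 0 = 0"
  by (rule mps_eqI) (simp add: coef_dil)

lemma dil_sum: "dil s (\<Sum>x\<in>A. f x) = (\<Sum>x\<in>A. dil s (f x))"
  by (induction A rule: infinite_finite_induct) (simp_all add: dil_add)

lemma cst_sum: "cst (\<Sum>x\<in>A. f x) = (\<Sum>x\<in>A. cst (f x))"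
  by (induction A rule: infinite_finite_induct) (simp_all add: cst_add)

lemma dil_cst [simp]: "dil s (cst c) = cst c"
  by (rule mps_eqI) (simp add: coef_dil coef_cst)

lemma dil_dil: "dil s (dil t f) = dil (s * t) f"
  by (rule mps_eqI) (simp add: coef_dil power_mult_distrib)

lemma dil_1 [simp]: "dil 1 f = f"
  by (rule mps_eqI) (simp add: coef_dil)

lemma pd_dil: "pd k (dil s f) = cst s * dil s (pd k f)"
  by (rule mps_eqI) (simp add: coef_pd coef_dil)

lemma xsum_dil: "cst s * xsum (\<lambda>j. dil s (g j)) = dil s (xsum g)"
proof (rule mps_eqI)
  fix M
  have "s * (s ^ size (M - {#j#}) * coef (g j) (M - {#j#})) = s ^ size M * coef (g j) (M - {#j#})" if "j \<in># M" for j
    using that by (auto dest!: multi_member_split)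
  then show "coef (cst s * xsum (\<lambda>j. dil s (g j))) M = coef (dil s (xsum g)) M"
    unfolding coef_dil coef_xsum coef_cst_mult sum_distrib_left by (intro sum.cong refl) blast
qed

text \<open>Multiplication by this series adds c_k to the logarithmic derivative in variable k, so
  its inverse centres a series at its means.\<close>

definition eshift :: "(nat \<Rightarrow> real) \<Rightarrow> mps" where
  "eshift c = mexp (lin c)"

lemma pd_eshift: "pd k (eshift c) = cst (c k) * eshift c"
  by (simp add: eshift_def pd_mexp mult.commute)

lemma coef_eshift_empty [simp]: "coef (eshift c) {#} = 1"
  by (simp add: eshift_def)

lemma eshift_inverse: "eshift c * eshift (\<lambda>k. - c k) = 1"
proof -
  have "cst (- x) = - cst x" for x by (rule mps_eqI) (simp add: coef_cst)
  then have "pd k (eshift c * eshift (\<lambda>k. - c k)) = 0" for k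
    by (simp add: pd_mult pd_eshift mult_ac)
  from pd_eq_0_imp[OF this] show ?thesis by simp
qed

subsection \<open>The operator on power series\<close>

text \<open>\<open>NSx 0 1 (1/n)\<close> is the rescaled Nazarov--Sklyanin operator acting on generating functions: variable \<open>k \<ge> 1\<close>
  is dual to a cycle of length \<open>k\<close>, variable \<open>0\<close> is dual to multiplication by \<open>p\<^sub>1\<close>. Conjugating by
  \<open>eshift c\<close> and rescaling by \<open>sqrt n\<close> gives \<open>NSx c t t\<close> with \<open>t = 1/sqrt n\<close>.\<close>

definition NSx :: "(nat \<Rightarrow> real) \<Rightarrow> real \<Rightarrow> real \<Rightarrow> (nat \<Rightarrow> mps) \<Rightarrow> nat \<Rightarrow> mps" where
  "NSx c t u h i = (\<Sum>m<i. cst (c (i - m)) * h m + cst t * pd (i - m) (h m))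
     + (cst (c 0) * h (Suc i) + cst t * pd 0 (h (Suc i))) + cst u * xsum (\<lambda>j. cst (real j) * h (i + j))"

definition vacx :: "mps \<Rightarrow> nat \<Rightarrow> mps" where
  "vacx f i = (if i = 0 then f else 0)"

definition NSx_moment :: "(nat \<Rightarrow> real) \<Rightarrow> real \<Rightarrow> real \<Rightarrow> nat \<Rightarrow> mps \<Rightarrow> mps" where
  "NSx_moment c t u k f = (NSx c t u ^^ k) (vacx f) 0"

text \<open>Moving a derivative inside \<open>eshift c\<close> adds c to it; moving inside the
  dilation multiplies derivatives by t and divides variables by t. The weights 1 and t^2 are thereby
  balanced to t and t.\<close>

lemma NSx_conj:
  assumes "t \<noteq> 0"
  shows "NSx (\<lambda>k. 0) 1 (t\<^sup>2) (\<lambda>i. eshift c * dil t (h i)) i = eshift c * dil t (NSx c t t h i)"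
proof -
  have pd: "pd k (eshift c * dil t f) = eshift c * dil t (cst (c k) * f + cst t * pd k f)" for k f
    by (simp add: pd_mult pd_eshift pd_dil dil_add dil_mult algebra_simps)
  have "cst (t\<^sup>2) * xsum (\<lambda>j. cst (real j) * (eshift c * dil t (h (i + j)))) = eshift c * dil t (cst t * xsum (\<lambda>j. cst (real j) * h (i + j)))"
  proof -
    have "cst (t\<^sup>2) * xsum (\<lambda>j. cst (real j) * (eshift c * dil t (h (i + j))))
       = cst t * eshift c * (cst t * xsum (\<lambda>j. dil t (cst (real j) * h (i + j))))"
      by (simp add: power2_eq_square cst_mult xsum_mult_right dil_mult mult_ac)
    then show ?thesis unfolding xsum_dil by (simp add: dil_mult mult_ac)
  qed
  then show ?thesis
    unfolding NSx_def pd by (simp add: dil_add distrib_left sum_distrib_left dil_sum)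
qed

lemma NSx_pow_conj:
  assumes "t \<noteq> 0"
  shows "(NSx (\<lambda>k. 0) 1 (t\<^sup>2) ^^ k) (\<lambda>i. eshift c * dil t (h i)) = (\<lambda>i. eshift c * dil t ((NSx c t t ^^ k) h i))"
  by (induction k) (auto simp: NSx_conj[OF assms])

lemma NSx_moment_conj:
  assumes "t \<noteq> 0"
  shows "NSx_moment (\<lambda>k. 0) 1 (t\<^sup>2) k (eshift c * dil t f) = eshift c * dil t (NSx_moment c t t k f)"
proof -
  have "vacx (eshift c * dil t f) = (\<lambda>i. eshift c * dil t (vacx f i))" by (auto simp: vacx_def)
  then show ?thesis by (simp add: NSx_moment_def NSx_pow_conj[OF assms])
qed

subsection \<open>Coefficientwise convergence\<close>

definition mps_tends :: "(nat \<Rightarrow> mps) \<Rightarrow> mps \<Rightarrow> bool" where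
  "mps_tends F f \<longleftrightarrow> (\<forall>M. (\<lambda>n. coef (F n) M) \<longlonglongrightarrow> coef f M)"

lemma mps_tends_add: "mps_tends F f \<Longrightarrow> mps_tends G g \<Longrightarrow> mps_tends (\<lambda>n. F n + G n) (f + g)"
  by (auto simp: mps_tends_def intro: tendsto_add)

lemma mps_tends_sum: "(\<And>x. x \<in> A \<Longrightarrow> mps_tends (\<lambda>n. F n x) (f x)) \<Longrightarrow> mps_tends (\<lambda>n. \<Sum>x\<in>A. F n x) (\<Sum>x\<in>A. f x)"
  by (auto simp: mps_tends_def coef_sum intro: tendsto_sum)

lemma mps_tends_mult: "mps_tends F f \<Longrightarrow> mps_tends G g \<Longrightarrow> mps_tends (\<lambda>n. F n * G n) (f * g)"
  by (auto simp: mps_tends_def coef_mult intro!: tendsto_sum tendsto_mult)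

lemma mps_tends_pd: "mps_tends F f \<Longrightarrow> mps_tends (\<lambda>n. pd k (F n)) (pd k f)"
  by (auto simp: mps_tends_def coef_pd intro!: tendsto_mult)

lemma mps_tends_xsum: "(\<And>j. mps_tends (\<lambda>n. G n j) (g j)) \<Longrightarrow> mps_tends (\<lambda>n. xsum (G n)) (xsum g)"
  by (auto simp: mps_tends_def coef_xsum intro!: tendsto_sum)

lemma mps_tends_cst: "c \<longlonglongrightarrow> c' \<Longrightarrow> mps_tends (\<lambda>n. cst (c n)) (cst c')"
  by (auto simp: mps_tends_def coef_cst)

lemma mps_tends_const: "mps_tends (\<lambda>n. f) f"
  by (simp add: mps_tends_def)

lemmas mps_tends_intros = mps_tends_add mps_tends_sum mps_tends_mult mps_tends_pd mps_tends_xsum mps_tends_cst mps_tends_const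

lemma mps_tends_cong:
  assumes "\<And>n. n \<ge> 1 \<Longrightarrow> F n = G n" "mps_tends F f"
  shows "mps_tends G f"
  unfolding mps_tends_def
proof
  fix M
  have "(\<lambda>n. coef (F n) M) \<longlonglongrightarrow> coef f M" using assms(2) by (simp add: mps_tends_def)
  moreover have "\<forall>\<^sub>F n in sequentially. coef (F n) M = coef (G n) M"
    using assms(1) by (intro eventually_sequentiallyI[of 1]) simp
  ultimately show "(\<lambda>n. coef (G n) M) \<longlonglongrightarrow> coef f M" by (rule Lim_transform_eventually)
qed

lemma mps_tends_unique: "mps_tends F f \<Longrightarrow> mps_tends F g \<Longrightarrow> f = g"
  by (auto intro!: mps_eqI simp: mps_tends_def dest: LIMSEQ_unique)

subsection \<open>Linearisation around the scalar operator\<close>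

text \<open>Toeplitz operator on the half-line with symbol c_0 z^-1 + sum of the c_k z^k, to which
  \<open>NSx c t t\<close> reduces at t = 0.\<close>

definition toep :: "(nat \<Rightarrow> real) \<Rightarrow> (nat \<Rightarrow> real) \<Rightarrow> nat \<Rightarrow> real" where
  "toep c w i = (\<Sum>m<i. c (i - m) * w m) + c 0 * w (Suc i)"

definition toep_pow :: "(nat \<Rightarrow> real) \<Rightarrow> nat \<Rightarrow> nat \<Rightarrow> real" where
  "toep_pow c k = (toep c ^^ k) (\<lambda>i. if i = 0 then 1 else 0)"

definition toepx :: "(nat \<Rightarrow> real) \<Rightarrow> (nat \<Rightarrow> mps) \<Rightarrow> nat \<Rightarrow> mps" where
  "toepx c h i = (\<Sum>m<i. cst (c (i - m)) * h m) + cst (c 0) * h (Suc i)"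

definition NSx_lin :: "(nat \<Rightarrow> mps) \<Rightarrow> nat \<Rightarrow> mps" where
  "NSx_lin h i = (\<Sum>m<i. pd (i - m) (h m)) + pd 0 (h (Suc i)) + xsum (\<lambda>j. cst (real j) * h (i + j))"

lemma NSx_split: "NSx c t t h i = toepx c h i + cst t * NSx_lin h i"
  by (simp add: NSx_def toepx_def NSx_lin_def sum.distrib sum_distrib_left algebra_simps)

lemma toepx_scalar: "toepx c (\<lambda>i. cst (w i) * f) i = cst (toep c w i) * f"
  by (simp add: toepx_def toep_def cst_add cst_mult cst_sum sum_distrib_right mult.assoc distrib_right)

text \<open>Derivative of the k-th power of \<open>NSx c t t\<close>, applied to the vacuum, at t =
  0; the recursion is the product rule.\<close>

primrec NSx_resp :: "(nat \<Rightarrow> real) \<Rightarrow> nat \<Rightarrow> mps \<Rightarrow> nat \<Rightarrow> mps" where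
  "NSx_resp c 0 f = (\<lambda>i. 0)"
| "NSx_resp c (Suc k) f = (\<lambda>i. toepx c (NSx_resp c k f) i + NSx_lin (\<lambda>i. cst (toep_pow c k i) * f) i)"

lemma toepx_linear:
  "toepx c (\<lambda>i. g i + cst t * h i) i = toepx c g i + cst t * toepx c h i"
  by (simp add: toepx_def sum.distrib sum_distrib_left algebra_simps)

text \<open>\<open>Z\<close> is the exact difference quotient in t. It obeys the recursion of
  \<open>NSx_resp\<close> with the full vector in place of its scalar part, so a limit can be taken
  inside the recursion.\<close>

lemma NSx_pow_expand:
  fixes c :: "nat \<Rightarrow> real" and f :: mps
  assumes "t \<noteq> 0"
  defines "Z \<equiv> \<lambda>k i. cst (1 / t) * ((NSx c t t ^^ k) (vacx f) i - cst (toep_pow c k i) * f)"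
  shows "(NSx c t t ^^ k) (vacx f) i = cst (toep_pow c k i) * f + cst t * Z k i"
    and "Z (Suc k) i = toepx c (Z k) i + NSx_lin ((NSx c t t ^^ k) (vacx f)) i"
    and "Z 0 i = 0"
proof -
  have tt: "cst t * (cst (1 / t) * g) = g" for g
    using assms(1) by (simp add: cst_mult[symmetric] mult.assoc[symmetric])
  show e: "(NSx c t t ^^ k) (vacx f) i = cst (toep_pow c k i) * f + cst t * Z k i" for k i
    unfolding Z_def tt by simp
  have "(NSx c t t ^^ Suc k) (vacx f) i = toepx c ((NSx c t t ^^ k) (vacx f)) i + cst t * NSx_lin ((NSx c t t ^^ k) (vacx f)) i"
    by (simp add: NSx_split)
  also have "toepx c ((NSx c t t ^^ k) (vacx f)) i = cst (toep_pow c (Suc k) i) * f + cst t * toepx c (Z k) i"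
    unfolding e[of k, abs_def] toepx_linear toepx_scalar by (simp add: toep_pow_def)
  finally have "cst t * Z (Suc k) i = cst t * (toepx c (Z k) i + NSx_lin ((NSx c t t ^^ k) (vacx f)) i)"
    unfolding e by (simp add: algebra_simps)
  then have "cst (1 / t) * (cst t * Z (Suc k) i) = cst (1 / t) * (cst t * (toepx c (Z k) i + NSx_lin ((NSx c t t ^^ k) (vacx f)) i))"
    by simp
  then show "Z (Suc k) i = toepx c (Z k) i + NSx_lin ((NSx c t t ^^ k) (vacx f)) i"
    by (simp only: mult.left_commute[of "cst (1 / t)"] tt)
  show "Z 0 i = 0" by (simp add: Z_def toep_pow_def vacx_def)
qed

lemma tendsto_toep_pow:
  assumes "\<And>j. (\<lambda>n. c n j) \<longlonglongrightarrow> c' j"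
  shows "(\<lambda>n. toep_pow (c n) k i) \<longlonglongrightarrow> toep_pow c' k i"
proof (induction k arbitrary: i)
  case (Suc k)
  have "(\<lambda>n. toep (c n) (toep_pow (c n) k) i) \<longlonglongrightarrow> toep c' (toep_pow c' k) i"
    unfolding toep_def by (intro tendsto_intros assms Suc)
  then show ?case by (simp add: toep_pow_def)
qed (simp add: toep_pow_def)

text \<open>As t n tends to 0, the full vector in the recursion of the difference quotient tends to
  its scalar part, which turns the recursion into that of \<open>NSx_resp\<close>.\<close>

lemma NSx_moment_tends:
  assumes c: "\<And>j. (\<lambda>n. c n j) \<longlonglongrightarrow> c' j" and F: "mps_tends F f"
    and t: "\<And>n. n \<ge> 1 \<Longrightarrow> t n \<noteq> 0" "t \<longlonglongrightarrow> 0"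
  shows "mps_tends (\<lambda>n. cst (1 / t n) * (NSx_moment (c n) (t n) (t n) k (F n) - cst (toep_pow (c n) k 0) * F n))
     (NSx_resp c' k f 0)"
proof -
  define V where "V k n i = (NSx (c n) (t n) (t n) ^^ k) (vacx (F n)) i" for k n i
  define Z where "Z k n i = cst (1 / t n) * (V k n i - cst (toep_pow (c n) k i) * F n)" for k n i
  have V: "V k n i = cst (toep_pow (c n) k i) * F n + cst (t n) * Z k n i"
    and Zs: "Z (Suc k) n i = toepx (c n) (Z k n) i + NSx_lin (V k n) i" and Z0: "Z 0 n i = 0" if "n \<ge> 1" for k n i
    using NSx_pow_expand[OF t(1)[OF that], where c = "c n" and f = "F n"] unfolding Z_def V_def by blast+
  have Zt: "mps_tends (\<lambda>n. Z k n i) (NSx_resp c' k f i)" for i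
  proof (induction k arbitrary: i)
    case 0
    have "mps_tends (\<lambda>n. 0) (NSx_resp c' 0 f i)" by (simp add: mps_tends_const)
    then show ?case by (rule mps_tends_cong[rotated]) (simp_all add: Z0)
  next
    case (Suc k)
    have "mps_tends (\<lambda>n. cst (toep_pow (c n) k i) * F n + cst (t n) * Z k n i) (cst (toep_pow c' k i) * f + cst 0 * NSx_resp c' k f i)" for i
      by (intro mps_tends_intros tendsto_toep_pow c F t Suc)
    then have Vt: "mps_tends (\<lambda>n. V k n i) (cst (toep_pow c' k i) * f)" for i
      by (intro mps_tends_cong[OF V[symmetric]]) simp_all
    have "mps_tends (\<lambda>n. toepx (c n) (Z k n) i + NSx_lin (V k n) i) (NSx_resp c' (Suc k) f i)"
      unfolding NSx_resp.simps toepx_def NSx_lin_def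
      by (intro mps_tends_intros c Suc Vt)
    then show ?case by (rule mps_tends_cong[rotated]) (simp add: Zs)
  qed
  show ?thesis using Zt[of 0] unfolding Z_def V_def NSx_moment_def .
qed

text \<open>\<open>resp_pd c k j\<close> and \<open>resp_x c k j\<close> are the derivatives of the vector \<open>toep_pow c k\<close> in the directions of the
  \<open>j\<close>-th subdiagonal and the \<open>j\<close>-th superdiagonal.\<close>

primrec resp_pd :: "(nat \<Rightarrow> real) \<Rightarrow> nat \<Rightarrow> nat \<Rightarrow> nat \<Rightarrow> real" where
  "resp_pd c 0 j = (\<lambda>i. 0)"
| "resp_pd c (Suc k) j = (\<lambda>i. toep c (resp_pd c k j) i + (if j \<le> i then toep_pow c k (i - j) else 0))"

primrec resp_x :: "(nat \<Rightarrow> real) \<Rightarrow> nat \<Rightarrow> nat \<Rightarrow> nat \<Rightarrow> real" where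
  "resp_x c 0 j = (\<lambda>i. 0)"
| "resp_x c (Suc k) j = (\<lambda>i. toep c (resp_x c k j) i + toep_pow c k (i + j))"

text \<open>The response is linear in the perturbation: \<open>pd j\<close> perturbs the j-th
  subdiagonal, the variable j with weight j the j-th superdiagonal, and \<open>pd 0\<close> the
  first superdiagonal. The bound on J reflects that each other step descends by at most one level,
  so longer jumps cannot end at level i.\<close>

lemma NSx_resp_expand:
  assumes "i + k \<le> J"
  shows "NSx_resp c k f i = (\<Sum>j=1..J. cst (resp_pd c k j i) * pd j f) + cst (resp_x c k 1 i) * pd 0 f
     + lin (\<lambda>j. real j * resp_x c k j i) * f"
  using assms
proof (induction k arbitrary: i)
  case 0
  have "lin (\<lambda>j. 0) = 0" by (rule mps_eqI) (simp add: lin_def coef_xsum)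
  then show ?case by simp
next
  case (Suc k)
  let ?E = "\<lambda>i. (\<Sum>j=1..J. cst (resp_pd c k j i) * pd j f) + cst (resp_x c k 1 i) * pd 0 f
     + lin (\<lambda>j. real j * resp_x c k j i) * f"
  have "toepx c (NSx_resp c k f) i = toepx c ?E i"
    unfolding toepx_def using Suc by (intro arg_cong2[where f = "(+)"] sum.cong refl arg_cong2[where f = "(*)"]) auto
  also have "\<dots> = (\<Sum>j=1..J. cst (toep c (resp_pd c k j) i) * pd j f) + cst (toep c (resp_x c k 1) i) * pd 0 f
     + lin (\<lambda>j. real j * toep c (resp_x c k j) i) * f"
  proof -
    have a: "toepx c (\<lambda>i. f i + g i + h i) i = toepx c f i + toepx c g i + toepx c h i" for f g h
      by (simp add: toepx_def sum.distrib algebra_simps)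
    have b: "toepx c (\<lambda>i. \<Sum>j\<in>A. f j i) i = (\<Sum>j\<in>A. toepx c (f j) i)" for f and A :: "nat set"
      by (induction A rule: infinite_finite_induct) (simp_all add: toepx_def sum.distrib algebra_simps)
    have d: "toepx c (\<lambda>i. lin (\<lambda>j. real j * resp_x c k j i) * f) i = lin (\<lambda>j. real j * toep c (resp_x c k j) i) * f"
    proof -
      have "toepx c (\<lambda>i. lin (\<lambda>j. real j * resp_x c k j i) * f) i
        = ((\<Sum>m<i. cst (c (i - m)) * lin (\<lambda>j. real j * resp_x c k j m)) + cst (c 0) * lin (\<lambda>j. real j * resp_x c k j (Suc i))) * f"
        by (simp add: toepx_def sum_distrib_right distrib_right mult.assoc)
      also have "(\<Sum>m<i. cst (c (i - m)) * lin (\<lambda>j. real j * resp_x c k j m)) + cst (c 0) * lin (\<lambda>j. real j * resp_x c k j (Suc i))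
        = lin (\<lambda>j. real j * toep c (resp_x c k j) i)"
        unfolding lin_cst by (simp add: lin_sum lin_add toep_def sum_distrib_left distrib_left mult_ac)
      finally show ?thesis .
    qed
    show ?thesis unfolding a b d toepx_scalar ..
  qed
  finally have 1: "toepx c (NSx_resp c k f) i = \<dots>" .
  have 2: "(\<Sum>m<i. pd (i - m) (cst (toep_pow c k m) * f)) = (\<Sum>j=1..J. cst (if j \<le> i then toep_pow c k (i - j) else 0) * pd j f)"
  proof -
    have "(\<Sum>m<i. pd (i - m) (cst (toep_pow c k m) * f)) = (\<Sum>j=1..i. cst (toep_pow c k (i - j)) * pd j f)"
      by (rule sum.reindex_bij_witness[where i = "\<lambda>j. i - j" and j = "\<lambda>m. i - m"]) auto
    also have "\<dots> = (\<Sum>j=1..J. cst (if j \<le> i then toep_pow c k (i - j) else 0) * pd j f)"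
      using Suc.prems by (intro sum.mono_neutral_cong_left) auto
    finally show ?thesis .
  qed
  have 3: "xsum (\<lambda>j. cst (real j) * (cst (toep_pow c k (i + j)) * f)) = lin (\<lambda>j. real j * toep_pow c k (i + j)) * f"
    by (simp add: lin_mult cst_mult mult.assoc)
  show ?case
    unfolding NSx_resp.simps 1 NSx_lin_def pd_cst_mult 2[unfolded pd_cst_mult] 3 resp_pd.simps resp_x.simps cst_add distrib_right
      distrib_left lin_add[symmetric] sum.distrib
    by (simp only: add_ac Suc_eq_plus1)
qed

text \<open>The coefficients of the limiting first-order operator: \<open>lin_pd\<close> multiplies \<open>pd j\<close>, \<open>lin_x\<close> multiplies the \<open>j\<close>-th variable.\<close>

definition lin_pd :: "(nat \<Rightarrow> real) \<Rightarrow> nat \<Rightarrow> nat \<Rightarrow> real" where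
  "lin_pd c k j = (if j = 0 then resp_x c k 1 0 else resp_pd c k j 0)"

definition lin_x :: "(nat \<Rightarrow> real) \<Rightarrow> nat \<Rightarrow> nat \<Rightarrow> real" where
  "lin_x c k j = real j * resp_x c k j 0"

definition lin_op :: "(nat \<Rightarrow> real) \<Rightarrow> nat \<Rightarrow> mps \<Rightarrow> mps" where
  "lin_op c k f = (\<Sum>j\<le>k. cst (lin_pd c k j) * pd j f) + lin (lin_x c k) * f"

lemma NSx_resp_lin_op: "NSx_resp c k f 0 = lin_op c k f"
proof -
  have "(\<Sum>j\<le>k. cst (lin_pd c k j) * pd j f) = cst (lin_pd c k 0) * pd 0 f + (\<Sum>j=1..k. cst (lin_pd c k j) * pd j f)"
    by (simp add: atMost_atLeast0 sum.atLeast_Suc_atMost)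
  also have "(\<Sum>j=1..k. cst (lin_pd c k j) * pd j f) = (\<Sum>j=1..k. cst (resp_pd c k j 0) * pd j f)"
    by (intro sum.cong) (auto simp: lin_pd_def)
  finally show ?thesis
    using NSx_resp_expand[of 0 k k c f] by (simp add: lin_op_def lin_pd_def lin_x_def[abs_def])
qed

lemma lin_op_lin_mult:
  "lin_op c k (lin t * f) = lin t * lin_op c k f + cst (\<Sum>j\<le>k. lin_pd c k j * t j) * f"
proof -
  have "(\<Sum>j\<le>k. cst (lin_pd c k j) * pd j (lin t * f))
     = (\<Sum>j\<le>k. cst (lin_pd c k j * t j) * f) + (\<Sum>j\<le>k. lin t * (cst (lin_pd c k j) * pd j f))"
    unfolding pd_mult pd_lin by (simp add: distrib_left sum.distrib cst_mult mult_ac)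
  then show ?thesis
    unfolding lin_op_def by (simp add: cst_sum sum_distrib_right sum_distrib_left algebra_simps)
qed

lemma lin_op_add: "lin_op c k (f + g) = lin_op c k f + lin_op c k g"
  by (simp add: lin_op_def distrib_left sum.distrib algebra_simps)

lemma lin_op_cst: "lin_op c k (cst a * f) = cst a * lin_op c k f"
  by (simp add: lin_op_def distrib_left sum_distrib_left mult.left_commute)

lemma lin_op_0 [simp]: "lin_op c k 0 = 0"
  by (simp add: lin_op_def)

lemma lin_op_sum: "lin_op c k (\<Sum>x\<in>A. f x) = (\<Sum>x\<in>A. lin_op c k (f x))"
  by (induction A rule: infinite_finite_induct) (simp_all add: lin_op_add)

text \<open>The commutator of a first-order operator with a linear form is a scalar, so pulling the
  form out of the word leaves one term for each letter, with that letter deleted.\<close>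

lemma lin_ops_lin_mult:
  "foldr (lin_op c) ks (lin t * f) = lin t * foldr (lin_op c) ks f
     + (\<Sum>p<length ks. cst (\<Sum>j\<le>ks ! p. lin_pd c (ks ! p) j * t j) * foldr (lin_op c) (take p ks @ drop (Suc p) ks) f)"
proof (induction ks)
  case (Cons k ks)
  show ?case
    unfolding foldr.simps comp_apply Cons.IH lin_op_add lin_op_lin_mult lin_op_sum lin_op_cst
      length_Cons sum.lessThan_Suc_shift
    by (simp add: algebra_simps)
qed simp

text \<open>\<open>g\<close> is the moment generating series of a centred Gaussian family with covariance \<open>C\<close>.\<close>

definition gaussian :: "(nat \<Rightarrow> nat \<Rightarrow> real) \<Rightarrow> mps \<Rightarrow> bool" where
  "gaussian C g \<longleftrightarrow> coef g {#} = 1 \<and> (\<forall>k. pd k g = lin (C k) * g)"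

text \<open>On a Gaussian series the operator k' becomes multiplication by a linear form; this is
  the scalar that arises when the form is commuted past the operator k.\<close>

definition lin_cov :: "(nat \<Rightarrow> real) \<Rightarrow> (nat \<Rightarrow> nat \<Rightarrow> real) \<Rightarrow> nat \<Rightarrow> nat \<Rightarrow> real" where
  "lin_cov c C k k' = (\<Sum>j\<le>k. lin_pd c k j * ((\<Sum>i\<le>k'. lin_pd c k' i * C i j) + lin_x c k' j))"

lemma lin_op_gaussian:
  assumes "gaussian C g"
  shows "lin_op c k g = lin (\<lambda>j. (\<Sum>i\<le>k. lin_pd c k i * C i j) + lin_x c k j) * g"
proof -
  have "lin_op c k g = ((\<Sum>i\<le>k. cst (lin_pd c k i) * lin (C i)) + lin (lin_x c k)) * g"
    using assms by (simp add: lin_op_def gaussian_def sum_distrib_right distrib_right mult.assoc)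
  then show ?thesis by (simp add: lin_cst lin_sum lin_add)
qed

text \<open>The innermost operator acts on g as a linear form. Pulled out to the left it vanishes at
  the origin, and only the contractions remain.\<close>

theorem gaussian_wick:
  assumes "gaussian C g"
  shows "coef (foldr (lin_op c) (ks @ [k]) g) {#}
    = (\<Sum>p<length ks. lin_cov c C (ks ! p) k * coef (foldr (lin_op c) (take p ks @ drop (Suc p) ks) g) {#})"
  by (simp add: lin_op_gaussian[OF assms] lin_ops_lin_mult coef_sum lin_cov_def coef_cst)

subsection \<open>The limit of the centred generating series\<close>

text \<open>The equations for the derivatives determine every coefficient of S from coefficients of
  smaller degree, so convergence of the logarithmic derivatives passes to S, and the limit solves
  the limiting equations.\<close>

lemma gaussian_limit:
  assumes pd: "\<And>n k. n \<ge> 1 \<Longrightarrow> pd k (S n) = S n * L n k" and S1: "\<And>n. n \<ge> 1 \<Longrightarrow> coef (S n) {#} = 1"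
    and L: "\<And>k. mps_tends (\<lambda>n. L n k) (lin (C k))"
  shows "\<exists>g. gaussian C g \<and> mps_tends S g"
proof -
  have "convergent (\<lambda>n. coef (S n) M)" for M
  proof (induction "size M" arbitrary: M rule: less_induct)
    case less
    show ?case
    proof (cases M)
      case empty
      have "(\<lambda>n. coef (S n) M) \<longlonglongrightarrow> 1"
        using S1 by (intro tendsto_eventually eventually_sequentiallyI[of 1]) (simp add: empty)
      then show ?thesis by (rule convergentI)
    next
      case (add k N)
      have "convergent (\<lambda>n. (\<Sum>P\<in>{P. P \<subseteq># N}. coef (S n) P * coef (L n k) (N - P)) / real (count N k + 1))"
      proof -
        have "\<exists>s. (\<lambda>n. coef (S n) P) \<longlonglongrightarrow> s" if "P \<subseteq># N" for P
          using less[of P] size_mset_mono[OF that] add by (auto simp: convergent_def)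
        then obtain s where s: "\<And>P. P \<subseteq># N \<Longrightarrow> (\<lambda>n. coef (S n) P) \<longlonglongrightarrow> s P" by metis
        have "(\<lambda>n. (\<Sum>P\<in>{P. P \<subseteq># N}. coef (S n) P * coef (L n k) (N - P)) / real (count N k + 1))
          \<longlonglongrightarrow> (\<Sum>P\<in>{P. P \<subseteq># N}. s P * coef (lin (C k)) (N - P)) / real (count N k + 1)"
          using L s unfolding mps_tends_def by (intro tendsto_intros) auto
        then show ?thesis by (rule convergentI)
      qed
      moreover have "\<forall>\<^sub>F n in sequentially. (\<Sum>P\<in>{P. P \<subseteq># N}. coef (S n) P * coef (L n k) (N - P)) / real (count N k + 1) = coef (S n) M"
      proof (rule eventually_sequentiallyI[of 1])
        fix n :: nat assume "1 \<le> n"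
        then have "coef (pd k (S n)) N = coef (S n * L n k) N" using pd by simp
        then show "(\<Sum>P\<in>{P. P \<subseteq># N}. coef (S n) P * coef (L n k) (N - P)) / real (count N k + 1) = coef (S n) M"
          by (simp add: coef_pd coef_mult add field_simps)
      qed
      ultimately show ?thesis by (simp add: convergent_cong)
    qed
  qed
  then have t: "mps_tends S (Mps (\<lambda>M. lim (\<lambda>n. coef (S n) M)))"
    by (simp add: mps_tends_def convergent_LIMSEQ_iff)
  define g where "g = Mps (\<lambda>M. lim (\<lambda>n. coef (S n) M))"
  have tg: "mps_tends S g" using t by (simp add: g_def)
  have "pd k g = lin (C k) * g" for k
  proof (rule mps_tends_unique)
    show "mps_tends (\<lambda>n. pd k (S n)) (pd k g)" by (intro mps_tends_intros tg)
    have "mps_tends (\<lambda>n. L n k * S n) (lin (C k) * g)" by (intro mps_tends_intros tg L)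
    then show "mps_tends (\<lambda>n. pd k (S n)) (lin (C k) * g)"
      by (rule mps_tends_cong[rotated]) (simp add: pd mult.commute)
  qed
  moreover have "coef g {#} = 1"
  proof -
    have "(\<lambda>n. coef (S n) {#}) \<longlonglongrightarrow> 1" using S1 by (intro tendsto_eventually eventually_sequentiallyI[of 1]) simp
    moreover have "(\<lambda>n. coef (S n) {#}) \<longlonglongrightarrow> coef g {#}" using tg by (simp add: mps_tends_def)
    ultimately show ?thesis by (rule LIMSEQ_unique[symmetric])
  qed
  ultimately show ?thesis using tg by (auto simp: gaussian_def)
qed

definition cop :: "nat \<Rightarrow> (nat \<Rightarrow> real) \<Rightarrow> nat \<Rightarrow> mps \<Rightarrow> mps" where
  "cop n c k f = cst (sqrt (real n)) * (NSx_moment (\<lambda>k. 0) 1 (1 / real n) k f - cst (toep_pow c k 0) * f)"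

text \<open>The second limit hypothesis says that the centred and rescaled logarithmic derivatives
  become linear. Centring uses the means at n and not their limits, since sqrt n times the
  difference of the two may fail to converge.\<close>

theorem centred_moments_limit:
  fixes A :: "nat \<Rightarrow> mps" and G :: "nat \<Rightarrow> nat \<Rightarrow> mps"
  assumes pd: "\<And>n k. n \<ge> 1 \<Longrightarrow> pd k (A n) = A n * G n k" and A1: "\<And>n. n \<ge> 1 \<Longrightarrow> coef (A n) {#} = 1"
    and c: "\<And>k. (\<lambda>n. coef (G n k) {#}) \<longlonglongrightarrow> c k"
    and C: "\<And>k M. M \<noteq> {#} \<Longrightarrow> (\<lambda>n. sqrt (real n) ^ (size M + 1) * coef (G n k) M) \<longlonglongrightarrow> coef (lin (C k)) M"
  shows "\<exists>g. gaussian C g \<and> (\<forall>ks. (\<lambda>n. coef (foldr (cop n (\<lambda>k. coef (G n k) {#})) ks (A n)) {#})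
     \<longlonglongrightarrow> coef (foldr (lin_op c) ks g) {#})"
proof -
  define r where "r n = sqrt (real n)" for n :: nat
  have r: "r n > 0" "r n * r n = real n" if "n \<ge> 1" for n using that by (auto simp: r_def)
  define cn where "cn n k = coef (G n k) {#}" for n k
  define S where "S n = dil (r n) (eshift (\<lambda>k. - cn n k) * A n)" for n
  define L where "L n k = cst (r n) * dil (r n) (G n k - cst (cn n k))" for n k
  have cm: "cst (- x) = - cst x" for x by (rule mps_eqI) (simp add: coef_cst)
  have "pd k (S n) = S n * L n k" if "n \<ge> 1" for n k
  proof -
    have "pd k (eshift (\<lambda>k. - cn n k) * A n) = (eshift (\<lambda>k. - cn n k) * A n) * (G n k - cst (cn n k))"
      unfolding pd_mult pd_eshift pd[OF that] cm by (simp add: algebra_simps)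
    then show ?thesis unfolding S_def L_def pd_dil by (simp add: dil_mult mult_ac)
  qed
  moreover have "coef (S n) {#} = 1" if "n \<ge> 1" for n
    using A1[OF that] by (simp add: S_def coef_dil)
  moreover have "mps_tends (\<lambda>n. L n k) (lin (C k))" for k
    unfolding mps_tends_def
  proof
    fix M
    show "(\<lambda>n. coef (L n k) M) \<longlonglongrightarrow> coef (lin (C k)) M"
    proof (cases "M = {#}")
      case True
      then show ?thesis by (simp add: L_def coef_dil cn_def coef_cst)
    next
      case False
      then show ?thesis using C[OF False, of k] by (simp add: L_def coef_dil coef_cst r_def mult.assoc)
    qed
  qed
  ultimately obtain g where g: "gaussian C g" "mps_tends S g" using gaussian_limit[of S L C] by blast
  have AS: "A n = eshift (cn n) * dil (1 / r n) (S n)" if "n \<ge> 1" for n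
  proof -
    have "dil (1 / r n) (S n) = eshift (\<lambda>k. - cn n k) * A n" using r[OF that] by (simp add: S_def dil_dil)
    then show ?thesis using eshift_inverse[of "cn n"] by (simp add: mult.assoc[symmetric])
  qed
  define X where "X n k f = cst (r n) * (NSx_moment (cn n) (1 / r n) (1 / r n) k f - cst (toep_pow (cn n) k 0) * f)" for n k f
  have conj: "foldr (cop n (cn n)) ks (eshift (cn n) * dil (1 / r n) f) = eshift (cn n) * dil (1 / r n) (foldr (X n) ks f)"
    if n: "n \<ge> 1" for n ks f
  proof (induction ks)
    case (Cons k ks)
    have rr: "1 / real n = (1 / r n)\<^sup>2" using r[OF n] by (simp add: power2_eq_square)
    have "cop n (cn n) k (eshift (cn n) * dil (1 / r n) h) = eshift (cn n) * dil (1 / r n) (X n k h)" for h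
    proof -
      have dm: "dil s (f - g) = dil s f - dil s g" for s f g
        by (rule mps_eqI) (simp add: coef_dil algebra_simps)
      have "NSx_moment (\<lambda>k. 0) 1 (1 / real n) k (eshift (cn n) * dil (1 / r n) h)
        = eshift (cn n) * dil (1 / r n) (NSx_moment (cn n) (1 / r n) (1 / r n) k h)"
        unfolding rr using r[OF n] by (intro NSx_moment_conj) simp
      then show ?thesis unfolding cop_def X_def r_def[symmetric] dil_mult dm by (simp add: dil_mult dm algebra_simps)
    qed
    then show ?case using Cons by simp
  qed simp
  have "mps_tends (\<lambda>n. foldr (X n) ks (S n)) (foldr (lin_op c) ks g)" for ks
  proof (induction ks)
    case (Cons k ks)
    have lim0: "(\<lambda>n. 1 / r n) \<longlonglongrightarrow> 0" unfolding r_def by real_asymp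
    have "1 / r n \<noteq> 0" if "n \<ge> 1" for n using r[OF that] by simp
    from NSx_moment_tends[of cn c "\<lambda>n. foldr (X n) ks (S n)", OF _ Cons.IH this lim0]
    have "mps_tends (\<lambda>n. cst (1 / (1 / r n)) * (NSx_moment (cn n) (1 / r n) (1 / r n) k (foldr (X n) ks (S n)) - cst (toep_pow (cn n) k 0) * foldr (X n) ks (S n)))
      (NSx_resp c k (foldr (lin_op c) ks g) 0)"
      using c by (simp add: cn_def)
    then show ?case by (simp add: X_def[of _ k] NSx_resp_lin_op)
  qed (simp add: g)
  then have lim: "(\<lambda>n. coef (foldr (X n) ks (S n)) {#}) \<longlonglongrightarrow> coef (foldr (lin_op c) ks g) {#}" for ks
    by (simp add: mps_tends_def)
  have "\<forall>\<^sub>F n in sequentially. coef (foldr (X n) ks (S n)) {#} = coef (foldr (cop n (cn n)) ks (A n)) {#}" for ks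
    by (rule eventually_sequentiallyI[of 1]) (simp add: AS conj coef_dil)
  then have "(\<lambda>n. coef (foldr (cop n (cn n)) ks (A n)) {#}) \<longlonglongrightarrow> coef (foldr (lin_op c) ks g) {#}" for ks
    by (rule Lim_transform_eventually[OF lim])
  then show ?thesis using g(1) unfolding cn_def by blast
qed

section \<open>Identification of the limits\<close>

subsection \<open>The half-line walk as a Laurent series\<close>

lemma X_pow_dvd_iff: "fps_X ^ N dvd (f :: real fps) \<longleftrightarrow> (\<forall>n<N. fps_nth f n = 0)"
proof
  assume "fps_X ^ N dvd f"
  then obtain h where "f = fps_X ^ N * h" by (elim dvdE)
  then show "\<forall>n<N. fps_nth f n = 0" by (simp add: fps_X_power_mult_nth)
next
  assume z: "\<forall>n<N. fps_nth f n = 0"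
  have "f = fps_X ^ N * fps_shift N f"
    using z by (intro fps_ext) (simp add: fps_X_power_mult_nth)
  then show "fps_X ^ N dvd f" by (metis dvd_triv_left)
qed

lemma fps_eq_0_if_dvd:
  assumes "\<And>N. fps_X ^ N dvd (f :: real fps)"
  shows "f = 0"
  using assms unfolding X_pow_dvd_iff by (intro fps_ext) (metis fps_zero_nth lessI)

lemma fls_X_times_X_inv_aux: "fls_X * (fls_X_inv * f) = (f :: real fls)"
  by (simp add: mult.assoc[symmetric] fls_X_times_conv_shift(1))

lemma fls_X_times_nth: "fls_nth (fls_X * f) n = fls_nth (f :: real fls) (n - 1)"
  by (simp add: fls_X_times_conv_shift(1))

lemma fls_X_inv_times_nth: "fls_nth (fls_X_inv * f) n = fls_nth (f :: real fls) (n + 1)"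
  by (simp add: fls_X_inv_times_conv_shift(1))

text \<open>After multiplication by z^a both factors are power series, and the coefficient is an
  ordinary convolution; indices beyond s + a contribute 0.\<close>

lemma fls_power_times_fps_nth:
  fixes u :: "real fls"
  assumes low: "\<And>q. q < - int a \<Longrightarrow> fls_nth (u ^ a) q = 0" and N: "s + int a < int N"
  shows "fls_nth (u ^ a * fps_to_fls f) s = (\<Sum>i<N. fls_nth (u ^ a) (s - int i) * fps_nth f i)"
proof -
  define g where "g = fls_X ^ a * u ^ a"
  have gn: "fls_nth g q = fls_nth (u ^ a) (q - int a)" for q
    by (simp add: g_def fls_X_power_times_conv_shift)
  define h where "h = Abs_fps (\<lambda>i. fls_nth g (int i))"
  have gh: "g = fps_to_fls h" using low by (intro fls_eqI) (auto simp: h_def gn)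
  have "fls_nth (u ^ a * fps_to_fls f) s = fls_nth (fls_X ^ a * (u ^ a * fps_to_fls f)) (s + int a)"
    by (simp add: fls_X_power_times_conv_shift)
  also have "fls_X ^ a * (u ^ a * fps_to_fls f) = fps_to_fls (h * f)"
    by (simp add: fls_times_fps_to_fls flip: gh) (simp add: g_def mult.assoc)
  finally have e: "fls_nth (u ^ a * fps_to_fls f) s = fls_nth (fps_to_fls (h * f)) (s + int a)" .
  show ?thesis
  proof (cases "s + int a < 0")
    case True
    have "(\<Sum>i<N. fls_nth (u ^ a) (s - int i) * fps_nth f i) = 0"
      using True by (intro sum.neutral) (auto intro: low)
    then show ?thesis unfolding e using True by simp
  next
    case False
    define b where "b = nat (s + int a)"
    have b: "s + int a = int b" using False by (simp add: b_def)
    have "fls_nth (fps_to_fls (h * f)) (s + int a) = (\<Sum>i=0..b. fps_nth f i * fps_nth h (b - i))"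
      unfolding b by (simp add: fps_mult_nth mult.commute[of h])
    also have "\<dots> = (\<Sum>i=0..b. fls_nth (u ^ a) (s - int i) * fps_nth f i)"
    proof (intro sum.cong refl)
      fix i assume "i \<in> {0..b}"
      then have "int (b - i) - int a = s - int i" using b by (simp add: of_nat_diff)
      then show "fps_nth f i * fps_nth h (b - i) = fls_nth (u ^ a) (s - int i) * fps_nth f i"
        by (simp add: h_def gn)
    qed
    also have "\<dots> = (\<Sum>i<N. fls_nth (u ^ a) (s - int i) * fps_nth f i)"
    proof (rule sum.mono_neutral_left)
      show "\<forall>i\<in>{..<N} - {0..b}. fls_nth (u ^ a) (s - int i) * fps_nth f i = 0"
        using b by (auto intro!: low)
      show "{0..b} \<subseteq> {..<N}" using b N by auto
    qed simp
    finally show ?thesis unfolding e .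
  qed
qed

context
  fixes c :: "nat \<Rightarrow> real"
  assumes c0: "c 0 = 1"
begin

abbreviation "Usym \<equiv> U_fls c"

lemma Usym_eq: "Usym = fls_X_inv + fps_to_fls (fps_X * F_fps c)"
  by (simp add: U_fls_def fls_times_fps_to_fls)

lemma toep_fps: "Abs_fps (toep c w) = fps_X * F_fps c * Abs_fps w + fps_shift 1 (Abs_fps w)"
proof (rule fps_ext)
  fix n
  have "(\<Sum>m<n. c (n - m) * w m) = fps_nth (fps_X * (F_fps c * Abs_fps w)) n"
  proof (cases n)
    case (Suc n')
    have "(\<Sum>m<n. c (n - m) * w m) = (\<Sum>i=0..n'. c (Suc i) * w (n' - i))"
      unfolding Suc by (rule sum.reindex_bij_witness[where i = "\<lambda>i. n' - i" and j = "\<lambda>m. n' - m"]) (auto simp: Suc_diff_le)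
    also have "\<dots> = fps_nth (fps_X * (F_fps c * Abs_fps w)) n"
      by (simp only: Suc fps_X_mult_nth) (simp add: fps_mult_nth F_fps_def)
    finally show ?thesis .
  qed simp
  then show "fps_nth (Abs_fps (toep c w)) n = fps_nth (fps_X * F_fps c * Abs_fps w + fps_shift 1 (Abs_fps w)) n"
    by (simp add: toep_def c0 mult.assoc)
qed

lemma X_inv_times_fps:
  fixes f :: "real fps"
  shows "fls_X_inv * fps_to_fls f = fps_to_fls (fps_shift 1 f) + fls_const (fps_nth f 0) * fls_X_inv"
proof (rule fls_eqI)
  fix n :: int
  show "fls_nth (fls_X_inv * fps_to_fls f) n = fls_nth (fps_to_fls (fps_shift 1 f) + fls_const (fps_nth f 0) * fls_X_inv) n"
    by (auto simp: fls_X_inv_times_nth nat_add_distrib)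
qed

text \<open>Multiplication by the symbol differs from the Toeplitz operator only in the coefficient
  that falls below z^0.\<close>

lemma toep_fls: "Usym * fps_to_fls (Abs_fps w) = fps_to_fls (Abs_fps (toep c w)) + fls_const (w 0) * fls_X_inv"
  unfolding toep_fps Usym_eq distrib_right X_inv_times_fps by (simp add: fls_times_fps_to_fls)

abbreviation "M0 k \<equiv> toep_pow c k 0"

definition Wf :: "nat \<Rightarrow> real fls" where "Wf k = fps_to_fls (Abs_fps (toep_pow c k))"

lemma Wf_Suc: "Wf (Suc k) = Usym * Wf k - fls_const (M0 k) * fls_X_inv"
  unfolding Wf_def toep_fls by (simp add: toep_pow_def)

lemma Wf_0: "Wf 0 = 1"
proof -
  have "Abs_fps (toep_pow c 0) = 1" by (rule fps_ext) (simp add: toep_pow_def)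
  then show ?thesis by (simp add: Wf_def)
qed

lemma Wf_eq: "Wf k = Usym ^ k - fls_X_inv * (\<Sum>m<k. fls_const (M0 m) * Usym ^ (k - 1 - m))"
proof (induction k)
  case (Suc k)
  have "Usym * (\<Sum>m<k. fls_const (M0 m) * Usym ^ (k - 1 - m)) = (\<Sum>m<k. fls_const (M0 m) * Usym ^ (k - m))"
    unfolding sum_distrib_left
  proof (rule sum.cong[OF refl])
    fix m assume "m \<in> {..<k}"
    then have "k - m = Suc (k - 1 - m)" by auto
    then show "Usym * (fls_const (M0 m) * Usym ^ (k - 1 - m)) = fls_const (M0 m) * Usym ^ (k - m)"
      by (simp only: power_Suc mult.left_commute)
  qed
  then show ?case unfolding Wf_Suc Suc by (simp add: algebra_simps)
qed (simp add: Wf_0)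

text \<open>Pairing with z U' extracts the constant coefficient, since U' starts with -z^-2. In the
  induction the coefficient lost below z^0 contributes the residue of U^x U', a multiple of a
  derivative, hence 0.\<close>

lemma toep_iter_residue:
  "(toep c ^^ x) w 0 = - fls_nth (fls_X * fps_to_fls (Abs_fps w) * Usym ^ x * fls_deriv Usym) (-1)"
proof (induction x arbitrary: w)
  case 0
  have "fls_X * fps_to_fls (Abs_fps w) * fls_deriv Usym = - (fls_X_inv * fps_to_fls (Abs_fps w)) + fps_to_fls (fps_X * Abs_fps w * fps_deriv (fps_X * F_fps c))"
    unfolding Usym_eq by (simp add: fls_deriv_fps_to_fls fls_times_fps_to_fls algebra_simps power2_eq_square fls_X_times_X_inv_aux)
  then show ?case by (simp add: fls_X_inv_times_nth)
next
  case (Suc x)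
  let ?h = "fps_to_fls (Abs_fps w)"
  have "(toep c ^^ Suc x) w 0 = (toep c ^^ x) (toep c w) 0" by (simp only: funpow_Suc_right comp_apply)
  also have "\<dots> = - fls_nth (fls_X * (Usym * ?h - fls_const (w 0) * fls_X_inv) * Usym ^ x * fls_deriv Usym) (-1)"
    unfolding Suc toep_fls by simp
  also have "fls_X * (Usym * ?h - fls_const (w 0) * fls_X_inv) * Usym ^ x * fls_deriv Usym
     = fls_X * ?h * Usym ^ Suc x * fls_deriv Usym - fls_const (w 0) * (Usym ^ x * fls_deriv Usym)"
    by (simp add: algebra_simps fls_X_times_X_inv_aux)
  also have "fls_nth \<dots> (-1) = fls_nth (fls_X * ?h * Usym ^ Suc x * fls_deriv Usym) (-1)"
  proof -
    have "fls_nth (Usym ^ x * fls_deriv Usym) (-1) = 0"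
    proof -
      have "of_nat (Suc x) * (Usym ^ x * fls_deriv Usym) = fls_deriv (Usym ^ Suc x)"
        by (simp add: fls_deriv_power del: power_Suc)
      then have "fls_nth (of_nat (Suc x) * (Usym ^ x * fls_deriv Usym)) (-1) = 0"
        by (simp only: fls_deriv_residue)
      then show ?thesis by (simp add: fls_of_nat del: of_nat_Suc)
    qed
    then show ?thesis by simp
  qed
  finally show ?case .
qed

text \<open>Integration by parts in the residue formula, as (k + 1) U^k U' is the derivative of
  U^(k+1).\<close>

lemma toep_pow_0_eq: "M0 k = clt_a c k"
proof -
  have "M0 k = - fls_nth (fls_X * Usym ^ k * fls_deriv Usym) (-1)"
  proof -
    have "Abs_fps (\<lambda>i. if i = 0 then 1 else 0) = (1 :: real fps)" by (rule fps_ext) simp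
    then show ?thesis unfolding toep_pow_def toep_iter_residue by simp
  qed
  also have "real (Suc k) * \<dots> = - fls_nth (fls_X * fls_deriv (Usym ^ Suc k)) (-1)"
  proof -
    have "fls_X * fls_deriv (Usym ^ Suc k) = of_nat (Suc k) * (fls_X * Usym ^ k * fls_deriv Usym)"
      by (simp add: fls_deriv_power mult_ac del: power_Suc of_nat_Suc)
    then show ?thesis by (simp only: fls_of_nat fls_mult_const_nth)
  qed
  also have "\<dots> = fls_nth (Usym ^ Suc k) (-1)" by (simp add: fls_X_times_nth del: power_Suc)
  finally show ?thesis by (simp add: clt_a_def field_simps)
qed

subsection \<open>Generating series in the exponent\<close>

definition Dg :: "int \<Rightarrow> real fps" where "Dg s = Abs_fps (\<lambda>k. fls_nth (Usym ^ k) s)"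
definition wg :: "nat \<Rightarrow> real fps" where "wg i = Abs_fps (\<lambda>k. toep_pow c k i)"
text \<open>The compositional inverse of 1 / U: it satisfies U(gg) = 1 / x, as \<open>gg_eq\<close>
  shows.\<close>

definition gg :: "real fps" where "gg = fps_X * wg 0"

lemma gg_0 [simp]: "fps_nth gg 0 = 0" by (simp add: gg_def)

lemma X_pow_dvd_gg: "fps_X ^ N dvd gg ^ N"
  by (simp add: gg_def power_mult_distrib)

lemma gg_mult_Dg_nth: "fps_nth (gg * Dg s) k = (\<Sum>m<k. M0 m * fls_nth (Usym ^ (k - 1 - m)) s)"
proof (cases k)
  case (Suc k')
  show ?thesis
    by (simp only: Suc gg_def mult.assoc fps_X_mult_nth) (simp add: fps_mult_nth wg_def Dg_def lessThan_Suc_atMost atLeast0AtMost)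
qed (simp add: gg_def mult.assoc)

lemma Wf_nth: "fls_nth (Wf k) s = fps_nth (Dg s - gg * Dg (s + 1)) k"
  unfolding Wf_eq fps_sub_nth gg_mult_Dg_nth
  by (simp add: Dg_def fls_X_inv_times_nth fls_nth_sum)

lemma wg_eq: "wg i = Dg (int i) - gg * Dg (int i + 1)"
  by (rule fps_ext) (simp only: Wf_nth[symmetric], simp add: wg_def Wf_def)

text \<open>\<open>Wf k\<close> is a power series, so its coefficients at negative exponents vanish;
  this makes the negative coefficients of the powers of U geometric in gg.\<close>

lemma Dg_neg_step: "s < 0 \<Longrightarrow> Dg s = gg * Dg (s + 1)"
proof -
  assume "s < 0"
  then have "Dg s - gg * Dg (s + 1) = 0"
    by (intro fps_ext) (simp only: Wf_nth[symmetric], simp add: Wf_def)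
  then show ?thesis by simp
qed

lemma Dg_neg: "Dg (- int i) = gg ^ i * Dg 0"
proof (induction i)
  case (Suc i)
  have "Dg (- int (Suc i)) = gg * Dg (- int i)" using Dg_neg_step[of "- int (Suc i)"] by simp
  then show ?case using Suc by (simp add: mult.assoc)
qed simp

lemma Dg_neg': "Dg (- 1 - int i) = gg ^ Suc i * Dg 0"
  using Dg_neg[of "Suc i"] by (simp add: algebra_simps)

lemma Dg_0_0: "fps_nth (Dg 0) 0 = 1" by (simp add: Dg_def)

lemma Dg_0_unit: "is_unit (Dg 0)" using Dg_0_0 by simp

lemma Dg_0_nz: "Dg 0 \<noteq> 0" using Dg_0_0 by auto

lemma Usym_pow_low: "q < - int a \<Longrightarrow> fls_nth (Usym ^ a) q = 0"
proof -
  assume q: "q < - int a"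
  have "Dg q = gg ^ nat (- q) * Dg 0" using Dg_neg[of "nat (- q)"] q by simp
  moreover have "fps_X ^ nat (- q) dvd gg ^ nat (- q) * Dg 0" by (intro dvd_mult2 X_pow_dvd_gg)
  ultimately have "fps_nth (Dg q) a = 0" using q unfolding X_pow_dvd_iff by simp
  then show ?thesis by (simp add: Dg_def)
qed

lemma wg_telescope: "(\<Sum>m<N. gg ^ m * wg (m + j)) = Dg (int j) - gg ^ N * Dg (int (N + j))"
  by (induction N) (simp_all add: wg_eq algebra_simps)

text \<open>A response vector is determined by the requirement that its generating series has no
  negative powers.\<close>

lemma response_0:
  assumes r0: "\<And>i. r 0 i = 0" and rs: "\<And>k i. r (Suc k) i = toep c (r k) i + s k i"
  shows "fps_X ^ N dvd ((\<Sum>i<N. gg ^ Suc i * Abs_fps (\<lambda>k. s k i)) - Abs_fps (\<lambda>k. r k 0))"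
proof -
  define V where "V k = fps_to_fls (Abs_fps (r k))" for k
  define sf where "sf k = fps_to_fls (Abs_fps (s k))" for k
  have Vs: "V (Suc k) = Usym * V k - fls_const (r k 0) * fls_X_inv + sf k" for k
  proof -
    have "Abs_fps (r (Suc k)) = Abs_fps (toep c (r k)) + Abs_fps (s k)" by (rule fps_ext) (simp add: rs)
    then show ?thesis unfolding V_def sf_def toep_fls by simp
  qed
  have V: "V k = (\<Sum>m<k. Usym ^ (k - 1 - m) * (sf m - fls_const (r m 0) * fls_X_inv))" for k
  proof (induction k)
    case 0
    have "Abs_fps (r 0) = 0" by (rule fps_ext) (simp add: r0)
    then show ?case by (simp add: V_def)
  next
    case (Suc k)
    have "Usym * V k = (\<Sum>m<k. Usym ^ (k - m) * (sf m - fls_const (r m 0) * fls_X_inv))"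
      unfolding Suc sum_distrib_left
    proof (rule sum.cong[OF refl])
      fix m assume "m \<in> {..<k}"
      then have "k - m = Suc (k - 1 - m)" by auto
      then show "Usym * (Usym ^ (k - 1 - m) * (sf m - fls_const (r m 0) * fls_X_inv)) = Usym ^ (k - m) * (sf m - fls_const (r m 0) * fls_X_inv)"
        by (simp only: power_Suc mult.assoc)
    qed
    then show ?case unfolding Vs by (simp add: algebra_simps)
  qed
  have res: "fls_nth (Usym ^ a * fps_to_fls f) (-1) = (\<Sum>i<N. fls_nth (Usym ^ a) (- 1 - int i) * fps_nth f i)" if "a \<le> N" for a N f
  proof -
    show ?thesis using that by (intro fls_power_times_fps_nth Usym_pow_low) auto
  qed
  \<comment> \<open>This is the vanishing of the z^-1 coefficient of \<open>V k\<close>.\<close>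
  have eq: "(\<Sum>m<k. \<Sum>i<N. fls_nth (Usym ^ (k - 1 - m)) (- 1 - int i) * s m i) = (\<Sum>m<k. r m 0 * fls_nth (Usym ^ (k - 1 - m)) 0)" if "k \<le> N" for k
  proof -
    have "0 = fls_nth (V k) (-1)" by (simp add: V_def)
    also have "\<dots> = (\<Sum>m<k. fls_nth (Usym ^ (k - 1 - m) * sf m) (-1) - r m 0 * fls_nth (Usym ^ (k - 1 - m)) 0)"
    proof -
      have "Usym ^ a * (sf m - fls_const (r m 0) * fls_X_inv) = Usym ^ a * sf m - fls_const (r m 0) * (fls_X_inv * Usym ^ a)" for a m
        by (simp add: algebra_simps)
      then show ?thesis unfolding V by (simp add: fls_nth_sum fls_X_inv_times_nth)
    qed
    finally show ?thesis using that unfolding sf_def by (simp add: res[of _ N] sum_subtractf)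
  qed
  \<comment> \<open>Both sides of \<open>eq\<close> are convolutions, so they become products of
    generating series with \<open>Dg 0\<close> as common factor. The sum over i may stop at N,
    because later powers of gg are divisible by x^N.\<close>
  have "fps_X ^ N dvd Dg 0 * ((\<Sum>i<N. gg ^ Suc i * Abs_fps (\<lambda>k. s k i)) - Abs_fps (\<lambda>k. r k 0))"
    unfolding X_pow_dvd_iff
  proof (intro allI impI)
    fix n assume n: "n < N"
    have e1: "Dg 0 * (\<Sum>i<N. gg ^ Suc i * Abs_fps (\<lambda>k. s k i)) = (\<Sum>i<N. Dg (- 1 - int i) * Abs_fps (\<lambda>k. s k i))"
      unfolding Dg_neg' sum_distrib_left by (intro sum.cong refl) (simp only: mult_ac)
    have "fps_nth (\<Sum>i<N. Dg (- 1 - int i) * Abs_fps (\<lambda>k. s k i)) n = (\<Sum>i<N. \<Sum>m\<le>n. fls_nth (Usym ^ (n - m)) (- 1 - int i) * s m i)"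
      unfolding fps_sum_nth
    proof (rule sum.cong[OF refl])
      fix i
      have "fps_nth (Dg (- 1 - int i) * Abs_fps (\<lambda>k. s k i)) n = fps_nth (Abs_fps (\<lambda>k. s k i) * Dg (- 1 - int i)) n"
        by (simp only: mult.commute)
      then show "fps_nth (Dg (- 1 - int i) * Abs_fps (\<lambda>k. s k i)) n = (\<Sum>m\<le>n. fls_nth (Usym ^ (n - m)) (- 1 - int i) * s m i)"
        by (simp add: fps_mult_nth Dg_def atLeast0AtMost mult.commute)
    qed
    also have "\<dots> = (\<Sum>m\<le>n. \<Sum>i<N. fls_nth (Usym ^ (n - m)) (- 1 - int i) * s m i)" by (rule sum.swap)
    also have "\<dots> = (\<Sum>m\<le>n. r m 0 * fls_nth (Usym ^ (n - m)) 0)"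
      using eq[of "Suc n"] n by (simp add: lessThan_Suc_atMost)
    also have "\<dots> = fps_nth (Abs_fps (\<lambda>k. r k 0) * Dg 0) n" by (simp add: fps_mult_nth Dg_def atLeast0AtMost)
    finally show "fps_nth (Dg 0 * ((\<Sum>i<N. gg ^ Suc i * Abs_fps (\<lambda>k. s k i)) - Abs_fps (\<lambda>k. r k 0))) n = 0"
      unfolding right_diff_distrib e1 by (simp add: mult.commute)
  qed
  then show ?thesis using Dg_0_unit by (simp add: dvd_mult_unit_iff')
qed

text \<open>Here the source is the vector \<open>toep_pow c k\<close> shifted by j. The weighted sum
  telescopes by \<open>wg_telescope\<close>, with a remainder divisible by arbitrarily high powers
  of x.\<close>

lemma resp_x_0: "Abs_fps (\<lambda>k. resp_x c k j 0) = gg * Dg (int j)"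
proof -
  have "fps_X ^ N dvd (gg * Dg (int j) - Abs_fps (\<lambda>k. resp_x c k j 0))" for N
  proof -
    have "fps_X ^ N dvd ((\<Sum>i<N. gg ^ Suc i * Abs_fps (\<lambda>k. toep_pow c k (i + j))) - Abs_fps (\<lambda>k. resp_x c k j 0))"
      by (rule response_0) simp_all
    moreover have "(\<Sum>i<N. gg ^ Suc i * Abs_fps (\<lambda>k. toep_pow c k (i + j))) = gg * (Dg (int j) - gg ^ N * Dg (int (N + j)))"
      unfolding wg_telescope[symmetric] wg_def by (simp add: sum_distrib_left mult.assoc)
    moreover have "fps_X ^ N dvd gg ^ N * (gg * Dg (int (N + j)))" by (intro dvd_mult2 X_pow_dvd_gg)
    ultimately have "fps_X ^ N dvd (gg * (Dg (int j) - gg ^ N * Dg (int (N + j))) - Abs_fps (\<lambda>k. resp_x c k j 0)) + gg ^ N * (gg * Dg (int (N + j)))"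
      by (intro dvd_add) simp_all
    then show ?thesis by (simp add: algebra_simps)
  qed
  from fps_eq_0_if_dvd[OF this] show ?thesis by simp
qed

text \<open>The opposite shift delays the source by j entries, which costs the factor gg^(j+1) of
  \<open>Dg_neg'\<close>.\<close>

lemma resp_pd_0: "Abs_fps (\<lambda>k. resp_pd c k j 0) = Dg (- 1 - int j)"
proof -
  have "fps_X ^ N dvd (Dg (- 1 - int j) - Abs_fps (\<lambda>k. resp_pd c k j 0))" for N
  proof -
    let ?L = "N + j"
    have "fps_X ^ ?L dvd ((\<Sum>i<?L. gg ^ Suc i * Abs_fps (\<lambda>k. if j \<le> i then toep_pow c k (i - j) else 0)) - Abs_fps (\<lambda>k. resp_pd c k j 0))"
      by (rule response_0) simp_all
    moreover have "(\<Sum>i<?L. gg ^ Suc i * Abs_fps (\<lambda>k. if j \<le> i then toep_pow c k (i - j) else 0)) = gg ^ Suc j * (Dg 0 - gg ^ N * Dg (int N))"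
    proof -
      have "(\<Sum>i<?L. gg ^ Suc i * Abs_fps (\<lambda>k. if j \<le> i then toep_pow c k (i - j) else 0)) = (\<Sum>i\<in>{j..<?L}. gg ^ Suc i * wg (i - j))"
      proof (rule sum.mono_neutral_cong_right)
        show "\<forall>i\<in>{..<?L} - {j..<?L}. gg ^ Suc i * Abs_fps (\<lambda>k. if j \<le> i then toep_pow c k (i - j) else 0) = 0"
        proof
          fix i assume "i \<in> {..<?L} - {j..<?L}"
          then have "Abs_fps (\<lambda>k. if j \<le> i then toep_pow c k (i - j) else 0) = 0" by (intro fps_ext) auto
          then show "gg ^ Suc i * Abs_fps (\<lambda>k. if j \<le> i then toep_pow c k (i - j) else 0) = 0" by simp
        qed
      qed (auto simp: wg_def)
      also have "\<dots> = (\<Sum>m<N. gg ^ Suc (m + j) * wg m)"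
        by (rule sum.reindex_bij_witness[where i = "\<lambda>m. m + j" and j = "\<lambda>i. i - j"]) auto
      also have "\<dots> = gg ^ Suc j * (\<Sum>m<N. gg ^ m * wg (m + 0))"
        by (simp add: sum_distrib_left power_add mult_ac)
      finally show ?thesis unfolding wg_telescope by simp
    qed
    ultimately have "fps_X ^ ?L dvd gg ^ Suc j * (Dg 0 - gg ^ N * Dg (int N)) - Abs_fps (\<lambda>k. resp_pd c k j 0)"
      by (simp only:)
    then have "fps_X ^ N dvd gg ^ Suc j * (Dg 0 - gg ^ N * Dg (int N)) - Abs_fps (\<lambda>k. resp_pd c k j 0)"
      by (rule dvd_trans[rotated]) (simp add: le_imp_power_dvd)
    moreover have "fps_X ^ N dvd gg ^ N * (gg ^ Suc j * Dg (int N))" by (intro dvd_mult2 X_pow_dvd_gg)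
    ultimately have "fps_X ^ N dvd (gg ^ Suc j * (Dg 0 - gg ^ N * Dg (int N)) - Abs_fps (\<lambda>k. resp_pd c k j 0)) + gg ^ N * (gg ^ Suc j * Dg (int N))"
      by (intro dvd_add)
    then show ?thesis unfolding Dg_neg' by (simp add: algebra_simps)
  qed
  from fps_eq_0_if_dvd[OF this] show ?thesis by simp
qed

lemma gg_compose_nth: "fps_nth (h * fps_compose a gg) k = (\<Sum>i\<le>k. fps_nth a i * fps_nth (h * gg ^ i) k)"
proof -
  have gz: "fps_nth (gg ^ i) m = 0" if "m < i" for i m
    using X_pow_dvd_gg[of i] that unfolding X_pow_dvd_iff by simp
  have "fps_nth (fps_compose a gg) m = (\<Sum>i\<le>k. fps_nth a i * fps_nth (gg ^ i) m)" if "m \<le> k" for m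
  proof -
    have "(\<Sum>i=0..m. fps_nth a i * fps_nth (gg ^ i) m) = (\<Sum>i\<le>k. fps_nth a i * fps_nth (gg ^ i) m)"
      using that by (intro sum.mono_neutral_left) (auto simp: gz)
    then show ?thesis by (simp add: fps_compose_nth)
  qed
  then have "fps_nth (h * fps_compose a gg) k = (\<Sum>m=0..k. \<Sum>i\<le>k. fps_nth a i * (fps_nth h m * fps_nth (gg ^ i) (k - m)))"
    by (simp add: fps_mult_nth sum_distrib_left mult.left_commute)
  also have "\<dots> = (\<Sum>i\<le>k. \<Sum>m=0..k. fps_nth a i * (fps_nth h m * fps_nth (gg ^ i) (k - m)))"
    by (rule sum.swap)
  finally show ?thesis by (simp add: fps_mult_nth sum_distrib_left)
qed

text \<open>A form of Lagrange inversion: powers of U at non-positive exponents are encoded by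
  powers of the inverse series gg.\<close>

lemma Dg0_gg_nth: "fps_nth (Dg 0 * gg ^ i) k = fls_nth (Usym ^ k) (- int i)"
  using arg_cong[OF Dg_neg[of i], of "\<lambda>f. fps_nth f k"] by (simp add: Dg_def mult.commute)

lemma Usym_pow_Suc_nth:
  assumes "s + int k < int N"
  shows "fls_nth (Usym ^ Suc k) s = fls_nth (Usym ^ k) (s + 1) + (\<Sum>j=1..<N. c j * fls_nth (Usym ^ k) (s - int j))"
proof -
  have "Usym ^ Suc k = fls_X_inv * Usym ^ k + Usym ^ k * fps_to_fls (fps_X * F_fps c)"
    unfolding power_Suc by (subst (1) Usym_eq) (simp add: algebra_simps)
  then have "fls_nth (Usym ^ Suc k) s = fls_nth (Usym ^ k) (s + 1) + (\<Sum>j<N. fls_nth (Usym ^ k) (s - int j) * fps_nth (fps_X * F_fps c) j)"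
    using fls_power_times_fps_nth[OF Usym_pow_low assms, of "fps_X * F_fps c"] by (simp add: fls_X_inv_times_nth)
  also have "(\<Sum>j<N. fls_nth (Usym ^ k) (s - int j) * fps_nth (fps_X * F_fps c) j) = (\<Sum>j=1..<N. c j * fls_nth (Usym ^ k) (s - int j))"
    by (rule sum.mono_neutral_cong_right) (auto simp: F_fps_def)
  finally show ?thesis .
qed

definition gam :: "nat \<Rightarrow> real fps" where "gam p = Abs_fps (\<lambda>i. c (p + i))"
text \<open>With w = gg and p at least 1 this is the coefficient of z^p in zw (z F(z) - w F(w)) / (z
  - w), and \<open>Bd p\<close> is the same for its image under w d/dw.\<close>

definition Bc :: "nat \<Rightarrow> real fps" where "Bc p = fps_compose (Abs_fps (\<lambda>q. if q = 0 then 0 else c (p + q - 1))) gg"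
definition Bd :: "nat \<Rightarrow> real fps" where "Bd p = fps_compose (Abs_fps (\<lambda>q. real q * c (p + q - 1))) gg"

lemma X_compose: "fps_compose (fps_X * f) gg = gg * fps_compose f gg"
  by (simp add: fps_compose_mult_distrib)

lemma Bc_gam: "Bc p = gg * fps_compose (gam p) gg"
proof -
  have "Abs_fps (\<lambda>q. if q = 0 then 0 else c (p + q - 1)) = fps_X * gam p"
    by (rule fps_ext) (simp add: gam_def)
  then show ?thesis by (simp add: Bc_def X_compose)
qed

lemma Bc_step: "Bc p = gg * (fps_const (c p) + Bc (Suc p))"
proof -
  have "gam p = fps_const (c p) + fps_X * gam (Suc p)"
    by (rule fps_ext) (auto simp: gam_def)
  then have "fps_compose (gam p) gg = fps_const (c p) + gg * fps_compose (gam (Suc p)) gg"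
    by (simp add: fps_compose_add_distrib X_compose)
  then show ?thesis by (simp add: Bc_gam)
qed

lemma Bd_step: "Bd p = Bc p + gg * Bd (Suc p)"
proof -
  have "Abs_fps (\<lambda>q. real q * c (p + q - 1)) = Abs_fps (\<lambda>q. if q = 0 then 0 else c (p + q - 1)) + fps_X * Abs_fps (\<lambda>q. real q * c (Suc p + q - 1))"
  proof (rule fps_ext)
    fix q
    show "fps_nth (Abs_fps (\<lambda>q. real q * c (p + q - 1))) q =
      fps_nth (Abs_fps (\<lambda>q. if q = 0 then 0 else c (p + q - 1)) + fps_X * Abs_fps (\<lambda>q. real q * c (Suc p + q - 1))) q"
      by (cases q) (simp_all add: algebra_simps)
  qed
  then show ?thesis by (simp add: Bd_def Bc_def fps_compose_add_distrib X_compose)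
qed

text \<open>One further factor U. The coefficients of U^k at exponents at most 0 are infinitely many
  sources, summed up by substituting gg.\<close>

lemma Dg_pos_rec:
  assumes "p \<ge> 1"
  shows "Dg (int p) = fps_X * (Dg (int (Suc p)) + (\<Sum>i=1..<p. fps_const (c (p - i)) * Dg (int i)) + Dg 0 * fps_compose (gam p) gg)"
proof (rule fps_ext)
  fix n
  show "fps_nth (Dg (int p)) n = fps_nth (fps_X * (Dg (int (Suc p)) + (\<Sum>i=1..<p. fps_const (c (p - i)) * Dg (int i)) + Dg 0 * fps_compose (gam p) gg)) n"
  proof (cases n)
    case 0
    then show ?thesis using assms by (simp add: Dg_def)
  next
    case (Suc k)
    have "fps_nth (Dg (int p)) n = fls_nth (Usym ^ k) (int p + 1) + (\<Sum>j=1..<p + Suc k. c j * fls_nth (Usym ^ k) (int p - int j))"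
      unfolding Dg_def fps_nth_Abs_fps Suc by (rule Usym_pow_Suc_nth) simp
    also have "{1..<p + Suc k} = {1..<p} \<union> {p..<p + Suc k}" using assms by auto
    also have "(\<Sum>j\<in>{1..<p} \<union> {p..<p + Suc k}. c j * fls_nth (Usym ^ k) (int p - int j))
      = (\<Sum>j=1..<p. c j * fls_nth (Usym ^ k) (int p - int j)) + (\<Sum>j=p..<p + Suc k. c j * fls_nth (Usym ^ k) (int p - int j))"
      by (rule sum.union_disjoint) auto
    also have "(\<Sum>j=1..<p. c j * fls_nth (Usym ^ k) (int p - int j)) = (\<Sum>i=1..<p. c (p - i) * fls_nth (Usym ^ k) (int i))"
      by (rule sum.reindex_bij_witness[where i = "\<lambda>i. p - i" and j = "\<lambda>i. p - i"]) (auto simp: of_nat_diff)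
    also have "(\<Sum>j=p..<p + Suc k. c j * fls_nth (Usym ^ k) (int p - int j)) = (\<Sum>i\<le>k. c (p + i) * fls_nth (Usym ^ k) (- int i))"
      by (rule sum.reindex_bij_witness[where i = "\<lambda>i. p + i" and j = "\<lambda>i. i - p"]) auto
    also have "\<dots> = fps_nth (Dg 0 * fps_compose (gam p) gg) k"
      unfolding gg_compose_nth Dg0_gg_nth by (simp add: gam_def)
    finally show ?thesis
      unfolding Suc fps_X_mult_nth by (simp add: Dg_def fps_sum_nth add_ac)
  qed
qed

text \<open>This is U(gg) = 1 / x multiplied by x gg. It comes from comparing \<open>Dg (-1)\<close>
  = gg \<open>Dg 0\<close> with the expansion of one more factor U.\<close>

lemma gg_eq: "gg = fps_X * (1 + gg * Bc 1)"
proof -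
  have "Dg (-1) = fps_X * (Dg 0 + Dg 0 * gg ^ 2 * fps_compose (gam 1) gg)"
  proof (rule fps_ext)
    fix n
    show "fps_nth (Dg (-1)) n = fps_nth (fps_X * (Dg 0 + Dg 0 * gg ^ 2 * fps_compose (gam 1) gg)) n"
    proof (cases n)
      case 0
      then show ?thesis by (simp add: Dg_def)
    next
      case (Suc k)
      have "fps_nth (Dg (-1)) n = fls_nth (Usym ^ k) (-1 + 1) + (\<Sum>j=1..<k + 2. c j * fls_nth (Usym ^ k) (-1 - int j))"
        unfolding Dg_def fps_nth_Abs_fps Suc by (rule Usym_pow_Suc_nth) simp
      also have "(\<Sum>j=1..<k + 2. c j * fls_nth (Usym ^ k) (-1 - int j)) = (\<Sum>i\<le>k. c (1 + i) * fls_nth (Usym ^ k) (- int (i + 2)))"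
        by (rule sum.reindex_bij_witness[where i = "\<lambda>i. 1 + i" and j = "\<lambda>i. i - 1"]) (auto simp: algebra_simps)
      also have "\<dots> = fps_nth (Dg 0 * gg ^ 2 * fps_compose (gam 1) gg) k"
      proof -
        have "Dg 0 * gg ^ 2 * gg ^ i = Dg 0 * gg ^ (i + 2)" for i by (simp add: power_add power2_eq_square mult_ac)
        then show ?thesis unfolding gg_compose_nth by (simp only: Dg0_gg_nth) (simp add: gam_def)
      qed
      finally show ?thesis unfolding Suc fps_X_mult_nth by (simp add: Dg_def)
    qed
  qed
  moreover have "Dg (-1) = gg * Dg 0" using Dg_neg[of 1] by simp
  ultimately have "Dg 0 * gg = Dg 0 * (fps_X * (1 + gg * Bc 1))"
    by (simp add: Bc_gam power2_eq_square algebra_simps)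
  then show ?thesis using Dg_0_nz by simp
qed

text \<open>The rows of a logarithmic derivative obey the same recursion, compare
  \<open>log_coef_row\<close>; this is how the logarithm enters the covariance. The defect satisfies
  R p = gg R (p + 1), so it is divisible by every power of x.\<close>

lemma Dg_pos:
  assumes "p \<ge> 1"
  shows "Dg (int p) = (\<Sum>i=1..<p. Dg (int i) * Bc (p - i)) + Dg 0 * Bd p"
proof -
  define R where "R p = Dg (int p) - (\<Sum>i=1..<p. Dg (int i) * Bc (p - i)) - Dg 0 * Bd p" for p
  have step: "R p = gg * R (Suc p)" if p: "p \<ge> 1" for p
  proof -
    define S where "S = (\<Sum>i=1..<p. fps_const (c (p - i)) * Dg (int i))"
    define T where "T = (\<Sum>i=1..<p. Dg (int i) * Bc (Suc p - i))"
    define G where "G = fps_compose (gam p) gg"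
    have a: "(\<Sum>i=1..<p. Dg (int i) * Bc (p - i)) = gg * (S + T)"
    proof -
      have "Dg (int i) * Bc (p - i) = gg * (fps_const (c (p - i)) * Dg (int i) + Dg (int i) * Bc (Suc p - i))" if "i \<in> {1..<p}" for i
        using that Bc_step[of "p - i"] by (simp add: Suc_diff_le algebra_simps)
      then show ?thesis unfolding S_def T_def by (simp add: sum_distrib_left sum.distrib[symmetric] distrib_left[symmetric])
    qed
    have b: "(\<Sum>i=1..<Suc p. Dg (int i) * Bc (Suc p - i)) = T + Dg (int p) * Bc 1"
      unfolding T_def using p by simp
    have d: "Dg (int p) = fps_X * (Dg (int (Suc p)) + S + Dg 0 * G)" unfolding S_def G_def by (rule Dg_pos_rec[OF p])
    have e: "R p - gg * R (Suc p) = Dg (int p) + gg * Dg (int p) * Bc 1 - gg * (S + Dg 0 * G + Dg (int (Suc p)))"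
      unfolding R_def a b Bd_step[of p] Bc_gam[of p] G_def[symmetric] by (simp add: algebra_simps)
    have "fps_X * (R p - gg * R (Suc p)) = Dg (int p) * (fps_X * (1 + gg * Bc 1)) - gg * (fps_X * (Dg (int (Suc p)) + S + Dg 0 * G))"
      unfolding e by (simp add: algebra_simps)
    also have "\<dots> = 0" unfolding gg_eq[symmetric] d[symmetric] by simp
    finally show ?thesis by simp
  qed
  have "R p = gg ^ m * R (p + m)" for m
  proof (induction m)
    case (Suc m)
    then show ?case using step[of "p + m"] assms by (simp add: mult_ac)
  qed simp
  then have "fps_X ^ m dvd R p" for m using X_pow_dvd_gg dvd_mult2 by metis
  then have "R p = 0" by (rule fps_eq_0_if_dvd)
  then show ?thesis by (simp add: R_def algebra_simps)
qed

end

subsection \<open>The logarithm in two variables\<close>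

definition bf :: "bfps \<Rightarrow> real fps fps" where
  "bf G = Abs_fps (\<lambda>p. Abs_fps (\<lambda>q. G p q))"

lemma bf_nth: "fps_nth (fps_nth (bf G) p) q = G p q"
  by (simp add: bf_def)

lemma bf_mult: "bf (bfps_mult f g) = bf f * bf g"
  by (intro fps_ext) (simp add: bf_def bfps_mult_def fps_mult_nth fps_sum_nth atLeast0AtMost)

lemma bf_pow: "bf (bfps_pow f m) = bf f ^ m"
proof (induction m)
  case 0
  have "bf bfps_one = 1" by (intro fps_ext) (simp add: bf_def bfps_one_def)
  then show ?case by simp
qed (simp add: bf_mult)

text \<open>The derivation w d/dw; the outer series is in z, the inner ones are in w.\<close>

definition theta :: "real fps fps \<Rightarrow> real fps fps" where
  "theta F = Abs_fps (\<lambda>p. fps_X * fps_deriv (fps_nth F p))"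

lemma theta_nth: "fps_nth (theta F) p = fps_X * fps_deriv (fps_nth F p)"
  by (simp add: theta_def)

lemma theta_mult: "theta (F * G) = theta F * G + F * theta G"
proof (rule fps_ext)
  fix p
  show "fps_nth (theta (F * G)) p = fps_nth (theta F * G + F * theta G) p"
    unfolding fps_add_nth fps_mult_nth theta_nth fps_deriv_sum fps_deriv_mult sum_distrib_left sum.distrib[symmetric]
    by (intro sum.cong refl) (simp add: algebra_simps)
qed

lemma theta_pow: "theta (N ^ Suc m) = of_nat (Suc m) * N ^ m * theta N"
proof (induction m)
  case (Suc m)
  have "theta (N ^ Suc (Suc m)) = theta N * N ^ Suc m + N * theta (N ^ Suc m)"
    by (simp only: power_Suc[of N "Suc m"] theta_mult)
  then show ?case unfolding Suc by (simp add: algebra_simps)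
qed simp

lemma bf_pow_nth_0:
  assumes "fps_nth (N :: real fps fps) 0 = 0" "p < m"
  shows "fps_nth (N ^ m) p = 0"
proof -
  have "N = fps_X * fps_shift 1 N" using assms(1) by (intro fps_ext) auto
  then have "N ^ m = fps_X ^ m * fps_shift 1 N ^ m" by (metis power_mult_distrib)
  then show ?thesis using assms(2) by (simp add: fps_X_power_mult_nth)
qed

lemma theta_log:
  assumes N0: "fps_nth (bf B) 0 = 0"
  shows "(1 + bf B) * theta (bf (bfps_ln1p B)) = theta (bf B)"
proof (rule fps_ext)
  fix p
  let ?N = "bf B"
  let ?K = "Suc p"
  have row: "fps_nth (bf (bfps_ln1p B)) a = (\<Sum>m<?K. fps_const ((-1) ^ m / real (Suc m)) * fps_nth (?N ^ Suc m) a)" if "a \<le> p" for a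
  proof (rule fps_ext)
    fix q
    have "bfps_ln1p B a q = (\<Sum>m\<in>{1..a+q}. (-1) ^ (m - 1) / real m * fps_nth (fps_nth (?N ^ m) a) q)"
      by (simp add: bfps_ln1p_def bf_pow[symmetric] bf_nth)
    also have "\<dots> = (\<Sum>m\<in>{1..a+q+p+1}. (-1) ^ (m - 1) / real m * fps_nth (fps_nth (?N ^ m) a) q)"
      by (intro sum.mono_neutral_left) (auto simp: bf_pow_nth_0[OF N0])
    also have "\<dots> = (\<Sum>m\<in>{1..?K}. (-1) ^ (m - 1) / real m * fps_nth (fps_nth (?N ^ m) a) q)"
      using that by (intro sum.mono_neutral_right) (auto simp: bf_pow_nth_0[OF N0])
    also have "\<dots> = (\<Sum>m<?K. (-1) ^ m / real (Suc m) * fps_nth (fps_nth (?N ^ Suc m) a) q)"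
      by (rule sum.reindex_bij_witness[where i = Suc and j = "\<lambda>m. m - 1"]) auto
    finally show "fps_nth (fps_nth (bf (bfps_ln1p B)) a) q = fps_nth (\<Sum>m<?K. fps_const ((-1) ^ m / real (Suc m)) * fps_nth (?N ^ Suc m) a) q"
      by (simp add: bf_nth fps_sum_nth del: power_Suc sum.lessThan_Suc)
  qed
  have th: "fps_nth (theta (bf (bfps_ln1p B))) a = fps_nth ((\<Sum>m<?K. (- ?N) ^ m) * theta ?N) a" if "a \<le> p" for a
  proof -
    have "fps_X * fps_deriv (fps_const r * f) = fps_const r * (fps_X * fps_deriv f)" for r :: real and f
      by simp
    then have "fps_nth (theta (bf (bfps_ln1p B))) a = (\<Sum>m<?K. fps_const ((-1) ^ m / real (Suc m)) * fps_nth (theta (?N ^ Suc m)) a)"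
      unfolding theta_nth row[OF that] fps_deriv_sum sum_distrib_left by (simp only:)
    also have "\<dots> = (\<Sum>m<?K. fps_nth ((- ?N) ^ m * theta ?N) a)"
    proof (rule sum.cong[OF refl])
      fix m
      have "fps_nth (theta (?N ^ Suc m)) a = of_nat (Suc m) * fps_nth (?N ^ m * theta ?N) a"
        unfolding theta_pow mult.assoc by (metis fps_mult_left_const_nth fps_of_nat)
      then have "fps_const ((-1) ^ m / real (Suc m)) * fps_nth (theta (?N ^ Suc m)) a
        = (fps_const ((-1) ^ m / real (Suc m)) * fps_const (real (Suc m))) * fps_nth (?N ^ m * theta ?N) a"
        by (simp only: fps_of_nat mult.assoc)
      also have "fps_const ((-1) ^ m / real (Suc m)) * fps_const (real (Suc m)) = (fps_const ((-1) ^ m) :: real fps)"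
        by (simp del: of_nat_Suc)
      also have "fps_const ((-1) ^ m) * fps_nth (?N ^ m * theta ?N) a = fps_nth ((- ?N) ^ m * theta ?N) a"
        by (cases "even m") (simp_all add: fps_const_neg[of 1, symmetric] del: fps_const_neg)
      finally show "fps_const ((-1) ^ m / real (Suc m)) * fps_nth (theta (?N ^ Suc m)) a = fps_nth ((- ?N) ^ m * theta ?N) a" .
    qed
    finally show ?thesis by (simp only: sum_distrib_right fps_sum_nth)
  qed
  have "fps_nth ((1 + ?N) * theta (bf (bfps_ln1p B))) p = fps_nth ((1 + ?N) * ((\<Sum>m<?K. (- ?N) ^ m) * theta ?N)) p"
    unfolding fps_mult_nth[of "1 + ?N"] by (intro sum.cong refl) (simp add: th)
  also have "(1 + ?N) * ((\<Sum>m<?K. (- ?N) ^ m) * theta ?N) = theta ?N - (- ?N) ^ ?K * theta ?N"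
  proof -
    have "(1 - (- ?N)) * (\<Sum>m<?K. (- ?N) ^ m) = 1 - (- ?N) ^ ?K" by (rule one_diff_power_eq[symmetric])
    then have "(1 + ?N) * (\<Sum>m<?K. (- ?N) ^ m) = 1 - (- ?N) ^ ?K" by simp
    then show ?thesis by (simp only: mult.assoc[symmetric] left_diff_distrib mult_1)
  qed
  also have "fps_nth (theta ?N - (- ?N) ^ ?K * theta ?N) p = fps_nth (theta ?N) p"
  proof -
    have "fps_nth ((- ?N) ^ ?K * theta ?N) p = 0"
      unfolding fps_mult_nth using N0 by (intro sum.neutral) (auto simp: bf_pow_nth_0 simp del: power_Suc)
    then show ?thesis by simp
  qed
  finally show "fps_nth ((1 + ?N) * theta (bf (bfps_ln1p B))) p = fps_nth (theta ?N) p" .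
qed

lemma bfps_mult_zmw:
  "bfps_mult bfps_zmw D p q = (if p \<ge> 1 then D (p - 1) q else 0) - (if q \<ge> 1 then D p (q - 1) else 0)"
proof -
  have zb: "bfps_zmw a b = (if a = 1 then (if b = 0 then 1 else 0) else 0) - (if a = 0 then (if b = 1 then 1 else 0) else 0)" for a b
    by (simp add: bfps_zmw_def)
  have "bfps_mult bfps_zmw D p q = (\<Sum>a\<le>p. \<Sum>b\<le>q. (if a = 1 then (if b = 0 then D (p - a) (q - b) else 0) else 0)
     - (if a = 0 then (if b = 1 then D (p - a) (q - b) else 0) else 0))"
    unfolding bfps_mult_def zb by (intro sum.cong refl) auto
  also have "\<dots> = (\<Sum>a\<le>p. if a = 1 then \<Sum>b\<le>q. (if b = 0 then D (p - a) (q - b) else 0) else 0)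
     - (\<Sum>a\<le>p. if a = 0 then \<Sum>b\<le>q. (if b = 1 then D (p - a) (q - b) else 0) else 0)"
    unfolding sum_subtractf by (intro arg_cong2[where f = "(-)"] sum.cong refl) auto
  finally show ?thesis by (simp add: sum.delta)
qed

text \<open>The quotient (z^n - w^n) / (z - w) is the sum of all monomials of degree n - 1.
  Uniqueness follows by reading the defining equation along powers of w.\<close>

lemma bfps_quot_eq: "bfps_quot c = (\<lambda>p q. c (p + q + 1))"
  unfolding bfps_quot_def
proof (rule the_equality)
  show "bfps_mult bfps_zmw (\<lambda>p q. c (p + q + 1)) = bfps_zFmwF c"
    by (intro ext) (auto simp: bfps_mult_zmw bfps_zFmwF_def)
next
  fix D assume D: "bfps_mult bfps_zmw D = bfps_zFmwF c"
  have "D p q = c (p + q + 1)" for p q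
  proof (induction q arbitrary: p)
    case 0
    show ?case using fun_cong[OF fun_cong[OF D], of "Suc p" 0] by (simp add: bfps_mult_zmw bfps_zFmwF_def)
  next
    case (Suc q)
    show ?case using fun_cong[OF fun_cong[OF D], of "Suc p" "Suc q"] Suc[of "Suc p"]
      by (simp add: bfps_mult_zmw bfps_zFmwF_def)
  qed
  then show "D = (\<lambda>p q. c (p + q + 1))" by blast
qed

definition log_coef :: "(nat \<Rightarrow> real) \<Rightarrow> bfps" where
  "log_coef c p q = - bfps_ln1p (\<lambda>p' q'. - bfps_z (bfps_w (bfps_quot c)) p' q') p q"

text \<open>\<open>theta_log\<close> read in row p and solved for the p-th row of the derivative;
  the sign in \<open>log_coef\<close> cancels the sign of the argument of the logarithm.\<close>

lemma log_coef_row: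
  fixes c :: "nat \<Rightarrow> real"
  assumes "p \<ge> 1"
  defines "E \<equiv> \<lambda>p. fps_X * fps_deriv (Abs_fps (log_coef c p))"
  shows "E p = (\<Sum>a=1..<p. Abs_fps (\<lambda>q. if q = 0 then 0 else c (a + q - 1)) * E (p - a)) + Abs_fps (\<lambda>q. real q * c (p + q - 1))"
proof -
  define B where "B p' q' = - bfps_z (bfps_w (bfps_quot c)) p' q'" for p' q'
  have B: "B a q = (if a = 0 \<or> q = 0 then 0 else - c (a + q - 1))" for a q
    by (cases a; cases q) (auto simp: B_def bfps_z_def bfps_w_def bfps_quot_eq)
  have Br: "fps_nth (bf B) a = - Abs_fps (\<lambda>q. if q = 0 then 0 else c (a + q - 1))" if "a \<ge> 1" for a
    using that by (intro fps_ext) (simp add: bf_nth B)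
  have B0: "fps_nth (bf B) 0 = 0" by (intro fps_ext) (simp add: bf_nth B)
  have Er: "fps_nth (theta (bf (bfps_ln1p B))) a = - E a" for a
  proof -
    have "fps_nth (bf (bfps_ln1p B)) a = - Abs_fps (log_coef c a)"
      by (rule fps_ext) (simp add: bf_nth log_coef_def B_def[abs_def])
    then show ?thesis unfolding E_def theta_nth by simp
  qed
  have E0: "E 0 = 0"
  proof -
    have "(1 + bf B) * theta (bf (bfps_ln1p B)) = theta (bf B)" by (rule theta_log[OF B0])
    then have "fps_nth ((1 + bf B) * theta (bf (bfps_ln1p B))) 0 = fps_nth (theta (bf B)) 0" by simp
    then have "fps_nth (1 + bf B) 0 * - E 0 = fps_nth (theta (bf B)) 0"
      unfolding fps_mult_nth_0 Er .
    moreover have "fps_nth (theta (bf B)) 0 = 0" by (simp add: theta_nth B0)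
    moreover have "fps_nth (1 + bf B) 0 = 1" by (simp add: B0)
    ultimately have "1 * - E 0 = 0" by metis
    then show ?thesis by (metis mult_1 neg_equal_0_iff_equal)
  qed
  have "fps_nth (theta (bf B)) p = fps_nth ((1 + bf B) * theta (bf (bfps_ln1p B))) p"
    by (simp add: theta_log[OF B0])
  also have "\<dots> = - E p + (\<Sum>a=0..p. fps_nth (bf B) a * (- E (p - a)))"
    by (simp add: distrib_right fps_mult_nth[of "bf B"] Er)
  also have "(\<Sum>a=0..p. fps_nth (bf B) a * (- E (p - a))) = (\<Sum>a=1..<p. Abs_fps (\<lambda>q. if q = 0 then 0 else c (a + q - 1)) * E (p - a))"
  proof (rule sum.mono_neutral_cong_right)
    show "\<forall>i\<in>{0..p} - {1..<p}. fps_nth (bf B) i * - E (p - i) = 0"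
    proof
      fix i assume "i \<in> {0..p} - {1..<p}"
      then have "i = 0 \<or> i = p" by auto
      then show "fps_nth (bf B) i * - E (p - i) = 0" using B0 E0 by auto
    qed
  qed (auto simp: Br)
  finally have "E p = (\<Sum>a=1..<p. Abs_fps (\<lambda>q. if q = 0 then 0 else c (a + q - 1)) * E (p - a)) - fps_nth (theta (bf B)) p"
    by (simp add: algebra_simps)
  also have "fps_nth (theta (bf B)) p = - Abs_fps (\<lambda>q. real q * c (p + q - 1))"
    unfolding theta_nth Br[OF assms(1)] by (rule fps_ext) (auto simp: fps_mult_fps_X_deriv_shift)
  finally show ?thesis by simp
qed

lemma bfps_H_eq:
  "bfps_H c d p q = (if p = 0 \<or> q = 0 then 0 else d p q + real p * real q * (log_coef c p q - c p * c q))"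
  by (auto simp: bfps_H_def bfps_Q_def bfps_z_def bfps_w_def bfps_dz_def bfps_dw_def bfps_G_def bfps_zwFF_def log_coef_def algebra_simps)

text \<open>Index 0 belongs to the binomial factor (1 + x_0/n)^n: its logarithm has second
  derivative -1/n at 0 and there are no mixed derivatives with the other variables.\<close>

definition limit_cov :: "(nat \<Rightarrow> nat \<Rightarrow> real) \<Rightarrow> nat \<Rightarrow> nat \<Rightarrow> real" where
  "limit_cov d i j = (if i = 0 \<and> j = 0 then -1 else if i = 0 \<or> j = 0 then 0 else d j i)"

text \<open>The three parts of the formula have separate sources: d gives Q, the entry -1 of
  \<open>limit_cov\<close> gives the term with F(z) F(w), and the contractions of derivatives with
  variables through \<open>lin_x\<close> give the logarithm.\<close>

theorem lin_cov_eq_clt_b: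
  assumes c0: "c 0 = 1"
  shows "lin_cov c (limit_cov d) k k' = clt_b c d k k'"
proof -
  note [simp] = gg_0[where c = c, OF c0]
  define P where "P k q = fls_nth (U_fls c ^ k) (- 1 - int q)" for k q
  have Pz: "P k q = 0" if "k \<le> q" for k q
    unfolding P_def using that by (intro Usym_pow_low[where c = c, OF c0]) auto
  have nth: "fps_nth (gg c * Dg c 0 * fps_compose a (gg c)) k = (\<Sum>q\<le>k. fps_nth a q * P k q)" for a k
  proof -
    have "gg c * Dg c 0 * gg c ^ q = Dg c 0 * gg c ^ Suc q" for q by simp
    then show ?thesis unfolding gg_compose_nth[where c = c, OF c0] P_def
      by (simp only: Dg0_gg_nth[where c = c, OF c0]) (simp add: algebra_simps)
  qed
  have pd: "lin_pd c k j = P k j" if "j \<ge> 1" for k j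
    using that arg_cong[OF resp_pd_0[where c = c, OF c0, of j], of "\<lambda>f. fps_nth f k"] by (simp add: lin_pd_def P_def Dg_def[where c = c, OF c0])
  have D1: "Dg c (int 1) = Dg c 0 * Bd c 1" using Dg_pos[where c = c, OF c0, of 1] by simp
  have pd0: "lin_pd c k 0 = (\<Sum>q\<le>k. real q * c q * P k q)" for k
  proof -
    have "lin_pd c k 0 = fps_nth (gg c * Dg c (int 1)) k"
      using arg_cong[OF resp_x_0[where c = c, OF c0, of 1], of "\<lambda>f. fps_nth f k"] by (simp add: lin_pd_def)
    then show ?thesis unfolding D1 mult.assoc[symmetric] Bd_def[where c = c, OF c0] nth by simp
  qed
  define E where "E p = fps_X * fps_deriv (Abs_fps (log_coef c p))" for p
  have DE: "Dg c (int p) = Dg c 0 * fps_compose (E p) (gg c)" if "p \<ge> 1" for p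
    using that
  proof (induction p rule: less_induct)
    case (less p)
    have "(\<Sum>i=1..<p. Dg c (int i) * Bc c (p - i)) = Dg c 0 * (\<Sum>i=1..<p. fps_compose (E i) (gg c) * Bc c (p - i))"
      unfolding sum_distrib_left using less by (intro sum.cong refl) (simp add: mult.assoc)
    also have "(\<Sum>i=1..<p. fps_compose (E i) (gg c) * Bc c (p - i)) = (\<Sum>a=1..<p. Bc c a * fps_compose (E (p - a)) (gg c))"
      by (rule sum.reindex_bij_witness[where i = "\<lambda>i. p - i" and j = "\<lambda>i. p - i"]) auto
    finally have "Dg c (int p) = Dg c 0 * ((\<Sum>a=1..<p. Bc c a * fps_compose (E (p - a)) (gg c)) + Bd c p)"
      using Dg_pos[where c = c, OF c0 less.prems] by (simp add: distrib_left)
    also have "(\<Sum>a=1..<p. Bc c a * fps_compose (E (p - a)) (gg c)) + Bd c p = fps_compose (E p) (gg c)"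
      using log_coef_row[OF less.prems, of c]
      by (simp add: E_def[symmetric] fps_compose_add_distrib fps_compose_sum_distrib fps_compose_mult_distrib Bc_def[where c = c, OF c0] Bd_def[where c = c, OF c0])
    finally show ?case .
  qed
  have lx: "lin_x c k j = (\<Sum>q\<le>k. real j * real q * log_coef c j q * P k q)" if "j \<ge> 1" for k j
  proof -
    have "lin_x c k j = real j * fps_nth (gg c * Dg c (int j)) k"
      using arg_cong[OF resp_x_0[where c = c, OF c0, of j], of "\<lambda>f. fps_nth f k"] by (simp add: lin_x_def)
    also have "fps_nth (gg c * Dg c (int j)) k = (\<Sum>q\<le>k. fps_nth (E j) q * P k q)"
      unfolding DE[OF that] mult.assoc[symmetric] nth ..
    finally show ?thesis by (simp add: E_def fps_mult_fps_X_deriv_shift sum_distrib_left mult_ac)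
  qed
  have ins: "{..n} = insert 0 {1..n}" for n :: nat by auto
  have sum0: "(\<Sum>q\<le>n. real q * f q) = (\<Sum>q=1..n. real q * f q)" for n f unfolding ins by simp
  have Hz: "bfps_H c d p 0 = 0" "bfps_H c d 0 p = 0" for p by (simp_all add: bfps_H_eq)
  \<comment> \<open>The ranges 1..k and 0..k-1 give the same sum, as \<open>bfps_H\<close> vanishes
    at exponent 0 and \<open>P k k\<close> = 0.\<close>
  have edge: "(\<Sum>p=1..n. f p) = (\<Sum>p<n. f p)" if "f 0 = 0" "f n = 0" for f :: "nat \<Rightarrow> real" and n
    using that by (intro sum.mono_neutral_cong) (auto simp: Suc_le_eq not_less dest!: le_antisym)
  have pd0': "lin_pd c k 0 = (\<Sum>q=1..k. real q * c q * P k q)" for k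
    unfolding pd0 ins by simp
  have "lin_cov c (limit_cov d) k k' = - (\<Sum>q=1..k. real q * c q * P k q) * (\<Sum>q=1..k'. real q * c q * P k' q)
     + (\<Sum>j=1..k. P k j * ((\<Sum>i=1..k'. P k' i * d j i) + (\<Sum>q=1..k'. real j * real q * log_coef c j q * P k' q)))"
  proof -
    have "(\<Sum>i\<le>k'. lin_pd c k' i * limit_cov d i 0) = - lin_pd c k' 0"
      unfolding ins by (simp add: limit_cov_def)
    moreover have "lin_x c k' 0 = 0" by (simp add: lin_x_def)
    moreover have "(\<Sum>i\<le>k'. lin_pd c k' i * limit_cov d i j) = (\<Sum>i=1..k'. P k' i * d j i)" if "j \<ge> 1" for j
      unfolding ins using that by (simp add: limit_cov_def pd)
    moreover have "lin_x c k' j = (\<Sum>q=1..k'. real j * real q * log_coef c j q * P k' q)" if "j \<ge> 1" for j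
      unfolding lx[OF that] ins by simp
    ultimately show ?thesis unfolding lin_cov_def ins[of k] pd0'[symmetric] by (simp add: pd)
  qed
  also have "\<dots>
     = (\<Sum>p=1..k. \<Sum>q=1..k'. P k p * P k' q * bfps_H c d p q)"
  proof -
    have h: "(\<Sum>p=1..k. \<Sum>q=1..k'. P k p * P k' q * bfps_H c d p q)
      = (\<Sum>p=1..k. \<Sum>q=1..k'. P k p * (P k' q * d p q) + P k p * (real p * real q * log_coef c p q * P k' q)
          - (real p * c p * P k p) * (real q * c q * P k' q))"
      by (intro sum.cong refl) (simp add: bfps_H_eq algebra_simps)
    have x1: "(\<Sum>j=1..k. P k j * ((\<Sum>i=1..k'. P k' i * d j i) + (\<Sum>q=1..k'. real j * real q * log_coef c j q * P k' q)))
      = (\<Sum>p=1..k. \<Sum>q=1..k'. P k p * (P k' q * d p q)) + (\<Sum>p=1..k. \<Sum>q=1..k'. P k p * (real p * real q * log_coef c p q * P k' q))"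
      by (simp only: distrib_left sum_distrib_left sum.distrib)
    have x2: "- (\<Sum>q=1..k. real q * c q * P k q) * (\<Sum>q=1..k'. real q * c q * P k' q)
      = - (\<Sum>p=1..k. \<Sum>q=1..k'. (real p * c p * P k p) * (real q * c q * P k' q))"
      by (simp only: sum_product mult_minus_left)
    show ?thesis unfolding x1 x2 h sum_subtractf sum.distrib by linarith
  qed
  also have "\<dots> = (\<Sum>p<k. \<Sum>q=1..k'. P k p * P k' q * bfps_H c d p q)"
    by (rule edge) (simp_all add: Hz Pz)
  also have "\<dots> = (\<Sum>p<k. \<Sum>q<k'. P k p * P k' q * bfps_H c d p q)"
    by (rule sum.cong[OF refl], rule edge) (simp_all add: Hz Pz)
  finally show ?thesis by (simp add: clt_b_def P_def)
qed

section \<open>Cumulants\<close>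

definition cum :: "(nat set \<Rightarrow> real) \<Rightarrow> nat set \<Rightarrow> real" where
  "cum m S = (\<Sum>P | partition_on S P. (-1) ^ (card P - 1) * fact (card P - 1) * (\<Prod>B\<in>P. m B))"

lemma cum_cong:
  assumes "\<And>B. B \<subseteq> S \<Longrightarrow> m B = m' B"
  shows "cum m S = cum m' S"
  unfolding cum_def
proof (rule sum.cong[OF refl])
  fix P assume "P \<in> {P. partition_on S P}"
  then have "\<Union>P = S" using partition_onD1 by auto
  then have "(\<Prod>B\<in>P. m B) = (\<Prod>B\<in>P. m' B)" using assms by (intro prod.cong) auto
  then show "(- 1) ^ (card P - 1) * fact (card P - 1) * (\<Prod>B\<in>P. m B) = (- 1) ^ (card P - 1) * fact (card P - 1) * (\<Prod>B\<in>P. m' B)"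
    by simp
qed

lemma tendsto_cum:
  assumes "\<And>B. B \<subseteq> S \<Longrightarrow> (\<lambda>n. m n B) \<longlonglongrightarrow> g B"
  shows "(\<lambda>n. cum (m n) S) \<longlonglongrightarrow> cum g S"
  unfolding cum_def
proof (intro tendsto_sum tendsto_mult tendsto_const tendsto_prod assms)
  fix P B assume "P \<in> {P. partition_on S P}" "B \<in> P"
  then show "B \<subseteq> S" using partition_onD1 by auto
qed

lemma cum_scale:
  assumes "finite S"
  shows "cum (\<lambda>B. s ^ card B * m B) S = s ^ card S * cum m S"
proof -
  have "(\<Prod>B\<in>P. s ^ card B * m B) = s ^ card S * (\<Prod>B\<in>P. m B)" if P: "partition_on S P" for P
  proof -
    have "pairwise disjnt P" using partition_onD2[OF P] by (simp add: disjoint_def pairwise_def disjnt_def)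
    moreover have "finite B" if "B \<in> P" for B
      using that assms partition_onD1[OF P] by (metis Sup_upper finite_subset)
    ultimately have "card (\<Union>P) = sum card P" by (intro card_Union_disjoint)
    then show ?thesis using partition_onD1[OF P] by (simp add: prod.distrib power_sum)
  qed
  then show ?thesis
    unfolding cum_def sum_distrib_left by (intro sum.cong refl) (simp add: mult_ac)
qed

text \<open>Merging a block avoiding \<open>x\<close> into a partition of its complement produces every partition
  into \<open>q\<close> blocks \<open>q - 1\<close> times, which cancels the terms with \<open>q \<ge> 2\<close>.\<close>

lemma moment_cum:
  assumes fin: "finite S" and x: "x \<in> S" and m0: "m {} = 1"
  shows "m S = (\<Sum>B | x \<in> B \<and> B \<subseteq> S. cum m B * m (S - B))"
proof -
  define w :: "nat \<Rightarrow> real" where "w q = (-1) ^ (q - 1) * fact (q - 1)" for q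
  define \<pi> where "\<pi> P = (\<Prod>B\<in>P. m B)" for P
  have c: "cum m B = (\<Sum>P | partition_on B P. w (card P) * \<pi> P)" for B
    by (simp add: cum_def w_def \<pi>_def)
  let ?C = "{C. C \<noteq> {} \<and> x \<notin> C \<and> C \<subseteq> S}"
  let ?Q = "{Q. partition_on S Q}"
  have finQ: "finite Q" if "partition_on S Q" for Q using finite_elements[OF fin that] .
  have "{B. x \<in> B \<and> B \<subseteq> S} = insert S {B. x \<in> B \<and> B \<subset> S}" using x by auto
  then have "(\<Sum>B | x \<in> B \<and> B \<subseteq> S. cum m B * m (S - B)) = cum m S + (\<Sum>B | x \<in> B \<and> B \<subset> S. cum m B * m (S - B))"
  proof -
    have "finite {B. x \<in> B \<and> B \<subset> S}" using fin by (auto intro!: finite_subset[of "{B. x \<in> B \<and> B \<subset> S}" "Pow S"])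
    then show ?thesis unfolding \<open>{B. x \<in> B \<and> B \<subseteq> S} = _\<close> by (simp add: m0)
  qed
  also have "(\<Sum>B | x \<in> B \<and> B \<subset> S. cum m B * m (S - B)) = (\<Sum>C\<in>?C. cum m (S - C) * m C)"
    by (rule sum.reindex_bij_witness[where i = "\<lambda>C. S - C" and j = "\<lambda>B. S - B"]) (use x in \<open>auto simp: double_diff\<close>)
  also have "\<dots> = (\<Sum>C\<in>?C. \<Sum>P | partition_on (S - C) P. w (card P) * \<pi> P * m C)"
    by (simp add: c sum_distrib_right)
  also have "\<dots> = (\<Sum>(C, P)\<in>(SIGMA C:?C. {P. partition_on (S - C) P}). w (card P) * \<pi> P * m C)"
    using fin by (intro sum.Sigma) (auto intro: finitely_many_partition_on)
  also have "\<dots> = (\<Sum>(Q, C)\<in>(SIGMA Q:?Q. {C \<in> Q. x \<notin> C}). w (card Q - 1) * \<pi> Q)"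
  proof (rule sum.reindex_bij_witness[where i = "\<lambda>(Q, C). (C, Q - {C})" and j = "\<lambda>(C, P). (insert C P, C)"])
    fix a assume "a \<in> (SIGMA C:?C. {P. partition_on (S - C) P})"
    then obtain C P where a: "a = (C, P)" "C \<noteq> {}" "x \<notin> C" "C \<subseteq> S" and P: "partition_on (S - C) P" by auto
    have U: "\<Union>P = S - C" using partition_onD1[OF P] by simp
    then have dj: "disjnt C (\<Union>P)" by (auto simp: disjnt_def)
    have CP: "C \<notin> P" using U \<open>C \<noteq> {}\<close> by blast
    have finP: "finite P" using finite_elements[OF _ P] fin by auto
    show "(case (case a of (C, P) \<Rightarrow> (insert C P, C)) of (Q, C) \<Rightarrow> (C, Q - {C})) = a" using a CP by simp
    show "(case a of (C, P) \<Rightarrow> (insert C P, C)) \<in> (SIGMA Q:?Q. {C \<in> Q. x \<notin> C})"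
      using a P by (simp add: partition_on_insert[OF dj])
    show "(case (case a of (C, P) \<Rightarrow> (insert C P, C)) of (Q, C) \<Rightarrow> w (card Q - 1) * \<pi> Q) = (case a of (C, P) \<Rightarrow> w (card P) * \<pi> P * m C)"
      using a CP finP by (simp add: \<pi>_def mult_ac)
  next
    fix b assume "b \<in> (SIGMA Q:?Q. {C \<in> Q. x \<notin> C})"
    then obtain Q C where b: "b = (Q, C)" "C \<in> Q" "x \<notin> C" and Q: "partition_on S Q" by auto
    then have ins: "insert C (Q - {C}) = Q" by auto
    have "pairwise disjnt Q" using Q by (simp add: partition_on_def)
    then have dj: "disjnt C (\<Union>(Q - {C}))" using b by (auto simp: pairwise_def disjnt_def)
    have "partition_on (S - C) (Q - {C})" "C \<subseteq> S" "C \<noteq> {}" using partition_on_insert[OF dj, of S] Q unfolding ins by auto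
    then show "(case b of (Q, C) \<Rightarrow> (C, Q - {C})) \<in> (SIGMA C:?C. {P. partition_on (S - C) P})" using b by auto
    show "(case (case b of (Q, C) \<Rightarrow> (C, Q - {C})) of (C, P) \<Rightarrow> (insert C P, C)) = b" using b ins by simp
  qed
  also have "\<dots> = (\<Sum>Q\<in>?Q. \<Sum>C\<in>{C \<in> Q. x \<notin> C}. w (card Q - 1) * \<pi> Q)"
    using fin finQ by (intro sum.Sigma[symmetric]) (auto intro: finitely_many_partition_on)
  also have "\<dots> = (\<Sum>Q\<in>?Q. real (card Q - 1) * w (card Q - 1) * \<pi> Q)"
  proof (rule sum.cong[OF refl])
    fix Q assume "Q \<in> ?Q"
    then have Q: "partition_on S Q" by simp
    obtain B where B: "B \<in> Q" "x \<in> B" using x partition_onD1[OF Q] by auto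
    have "B' = B" if "B' \<in> Q" "x \<in> B'" for B'
      using that B partition_onD2[OF Q] by (auto simp: disjoint_def)
    then have "{C \<in> Q. x \<notin> C} = Q - {B}" using B by blast
    then have k: "card {C \<in> Q. x \<notin> C} = card Q - 1" using B finQ[OF Q] by simp
    show "(\<Sum>C\<in>{C \<in> Q. x \<notin> C}. w (card Q - 1) * \<pi> Q) = real (card Q - 1) * w (card Q - 1) * \<pi> Q"
      by (simp only: sum_constant k mult.assoc)
  qed
  also have "cum m S + \<dots> = (\<Sum>Q\<in>?Q. (w (card Q) + real (card Q - 1) * w (card Q - 1)) * \<pi> Q)"
    unfolding c by (simp only: sum.distrib distrib_right)
  also have "\<dots> = (\<Sum>Q\<in>{{S}}. (w (card Q) + real (card Q - 1) * w (card Q - 1)) * \<pi> Q)"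
  proof (rule sum.mono_neutral_right)
    show "{{S}} \<subseteq> ?Q" using x partition_on_space[of S] by auto
    show "\<forall>Q\<in>?Q - {{S}}. (w (card Q) + real (card Q - 1) * w (card Q - 1)) * \<pi> Q = 0"
    proof
      fix Q assume "Q \<in> ?Q - {{S}}"
      then have Q: "partition_on S Q" and ne: "Q \<noteq> {S}" by auto
      have "Q \<noteq> {}" using x partition_onD1[OF Q] by auto
      moreover have "card Q \<noteq> 1"
      proof
        assume "card Q = 1"
        then obtain B where "Q = {B}" by (rule card_1_singletonE)
        then show False using ne partition_onD1[OF Q] by simp
      qed
      ultimately have "card Q \<noteq> 0" "card Q \<noteq> 1" using finQ[OF Q] by simp_all
      then obtain q where q: "card Q = Suc (Suc q)" by (metis One_nat_def not0_implies_Suc)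
      have "w (card Q) + real (card Q - 1) * w (card Q - 1) = 0"
        unfolding q by (simp add: w_def algebra_simps)
      then show "(w (card Q) + real (card Q - 1) * w (card Q - 1)) * \<pi> Q = 0" by simp
    qed
  qed (use fin in \<open>auto intro: finitely_many_partition_on\<close>)
  also have "\<dots> = m S" by (simp add: w_def \<pi>_def)
  finally show ?thesis by simp
qed

lemma cum_eq:
  assumes "finite S" "x \<in> S" "m {} = 1"
  shows "cum m S = m S - (\<Sum>B | x \<in> B \<and> B \<subset> S. cum m B * m (S - B))"
proof -
  have "{B. x \<in> B \<and> B \<subseteq> S} = insert S {B. x \<in> B \<and> B \<subset> S}" using assms by auto
  moreover have "finite {B. x \<in> B \<and> B \<subset> S}" using assms(1) by (auto intro!: finite_subset[of "{B. x \<in> B \<and> B \<subset> S}" "Pow S"])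
  ultimately show ?thesis using moment_cum[where m = m, OF assms] assms(3) by simp
qed

text \<open>In the moment-cumulant recursion every term except the top moment involves only proper
  subsets.\<close>

lemma cum_diff:
  assumes "finite S" "S \<noteq> {}" "m {} = 1" "m' {} = 1" "\<And>B. B \<subset> S \<Longrightarrow> m B = m' B"
  shows "cum m S - cum m' S = m S - m' S"
proof -
  obtain x where x: "x \<in> S" using assms(2) by auto
  have "(\<Sum>B | x \<in> B \<and> B \<subset> S. cum m B * m (S - B)) = (\<Sum>B | x \<in> B \<and> B \<subset> S. cum m' B * m' (S - B))"
  proof (rule sum.cong[OF refl])
    fix B assume "B \<in> {B. x \<in> B \<and> B \<subset> S}"
    then have B: "B \<subset> S" "S - B \<subset> S" using x by auto
    have "cum m B = cum m' B" using B(1) by (intro cum_cong assms(5)) auto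
    moreover have "m (S - B) = m' (S - B)" by (rule assms(5)[OF B(2)])
    ultimately show "cum m B * m (S - B) = cum m' B * m' (S - B)" by simp
  qed
  then show ?thesis using cum_eq[where m = m, OF assms(1) x assms(3)] cum_eq[where m = m', OF assms(1) x assms(4)] by simp
qed

lemma sum_Pow_nested:
  fixes F :: "nat set \<Rightarrow> nat set \<Rightarrow> real"
  assumes "finite S"
  shows "(\<Sum>B | x \<in> B \<and> B \<subseteq> S. \<Sum>R\<in>Pow (S - B). F B R) = (\<Sum>T | x \<in> T \<and> T \<subseteq> S. \<Sum>B | x \<in> B \<and> B \<subseteq> T. F B (T - B))"
proof -
  have fin: "finite {B. x \<in> B \<and> B \<subseteq> T}" if "T \<subseteq> S" for T
    using finite_subset[of _ "Pow S"] assms that by (auto intro!: finite_subset[of "{B. x \<in> B \<and> B \<subseteq> T}" "Pow S"])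
  have "(\<Sum>B | x \<in> B \<and> B \<subseteq> S. \<Sum>R\<in>Pow (S - B). F B R) = (\<Sum>(B, R)\<in>(SIGMA B:{B. x \<in> B \<and> B \<subseteq> S}. Pow (S - B)). F B R)"
    using assms fin by (intro sum.Sigma) auto
  also have "\<dots> = (\<Sum>(T, B)\<in>(SIGMA T:{T. x \<in> T \<and> T \<subseteq> S}. {B. x \<in> B \<and> B \<subseteq> T}). F B (T - B))"
    by (rule sum.reindex_bij_witness[where i = "\<lambda>(T, B). (B, T - B)" and j = "\<lambda>(B, R). (B \<union> R, B)"])
      (auto simp: Un_Diff Diff_triv intro!: arg_cong2[where f = F])
  also have "\<dots> = (\<Sum>T | x \<in> T \<and> T \<subseteq> S. \<Sum>B | x \<in> B \<and> B \<subseteq> T. F B (T - B))"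
    using fin by (intro sum.Sigma[symmetric]) auto
  finally show ?thesis .
qed

text \<open>Translation invariance of the higher cumulants, stated for set functions because it is
  applied to words in operators rather than to products of random variables.\<close>

lemma cum_shift:
  assumes "finite S" "S \<noteq> {}" "m0 {} = 1"
    and m: "\<And>T. T \<subseteq> S \<Longrightarrow> m T = (\<Sum>R\<in>Pow T. (\<Prod>j\<in>T - R. t j) * m0 R)"
  shows "cum m S = cum m0 S + (if card S = 1 then t (the_elem S) else 0)"
  using assms(1,2) m
proof (induction S rule: finite_psubset_induct)
  case (psubset S)
  define e where "e B = (if card B = 1 then t (the_elem B) else 0)" for B
  obtain x where x: "x \<in> S" using psubset.prems(1) by auto
  have m1: "m {} = 1" using psubset.prems(2)[of "{}"] assms(3) by simp
  have fin: "finite {B. x \<in> B \<and> B \<subseteq> S}" using psubset.hyps by (auto intro!: finite_subset[of "{B. x \<in> B \<and> B \<subseteq> S}" "Pow S"])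
  have IH: "cum m B = cum m0 B + e B" if "x \<in> B" "B \<subset> S" for B
    unfolding e_def using that psubset.prems(2) by (intro psubset.IH) auto
  have "(\<Sum>B | x \<in> B \<and> B \<subseteq> S. (cum m0 B + e B) * m (S - B))
     = (\<Sum>B | x \<in> B \<and> B \<subseteq> S. \<Sum>R\<in>Pow (S - B). cum m0 B * ((\<Prod>j\<in>S - B - R. t j) * m0 R)) + (\<Sum>B | x \<in> B \<and> B \<subseteq> S. e B * m (S - B))"
    using psubset.prems(2) by (simp add: distrib_right sum.distrib sum_distrib_left)
  \<comment> \<open>Regrouping by T = B \<union> R turns the inner sum over B into a moment.\<close>
  also have "(\<Sum>B | x \<in> B \<and> B \<subseteq> S. \<Sum>R\<in>Pow (S - B). cum m0 B * ((\<Prod>j\<in>S - B - R. t j) * m0 R))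
     = (\<Sum>T | x \<in> T \<and> T \<subseteq> S. \<Sum>B | x \<in> B \<and> B \<subseteq> T. cum m0 B * ((\<Prod>j\<in>S - B - (T - B). t j) * m0 (T - B)))"
    by (rule sum_Pow_nested[OF psubset.hyps])
  also have "\<dots> = (\<Sum>T | x \<in> T \<and> T \<subseteq> S. (\<Prod>j\<in>S - T. t j) * m0 T)"
  proof (rule sum.cong[OF refl])
    fix T assume "T \<in> {T. x \<in> T \<and> T \<subseteq> S}"
    then have T: "x \<in> T" "T \<subseteq> S" "finite T" using psubset.hyps by (auto intro: finite_subset)
    have "(\<Sum>B | x \<in> B \<and> B \<subseteq> T. cum m0 B * ((\<Prod>j\<in>S - B - (T - B). t j) * m0 (T - B)))
      = (\<Sum>B | x \<in> B \<and> B \<subseteq> T. (\<Prod>j\<in>S - T. t j) * (cum m0 B * m0 (T - B)))"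
    proof (rule sum.cong[OF refl])
      fix B assume "B \<in> {B. x \<in> B \<and> B \<subseteq> T}"
      then have "S - B - (T - B) = S - T" by auto
      then show "cum m0 B * ((\<Prod>j\<in>S - B - (T - B). t j) * m0 (T - B)) = (\<Prod>j\<in>S - T. t j) * (cum m0 B * m0 (T - B))"
        by simp
    qed
    also have "\<dots> = (\<Prod>j\<in>S - T. t j) * m0 T"
      unfolding sum_distrib_left[symmetric] moment_cum[where m = m0, OF T(3,1) assms(3), symmetric] ..
    finally show "(\<Sum>B | x \<in> B \<and> B \<subseteq> T. cum m0 B * ((\<Prod>j\<in>S - B - (T - B). t j) * m0 (T - B))) = (\<Prod>j\<in>S - T. t j) * m0 T" .
  qed
  also have "(\<Sum>B | x \<in> B \<and> B \<subseteq> S. e B * m (S - B)) = (\<Sum>B\<in>{{x}}. e B * m (S - B))"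
    using fin x by (intro sum.mono_neutral_right) (auto simp: e_def card_1_singleton_iff)
  also have "\<dots> = (\<Sum>R | x \<notin> R \<and> R \<subseteq> S. (\<Prod>j\<in>S - R. t j) * m0 R)"
  proof -
    have "t x * (\<Prod>j\<in>S - {x} - R. t j) = (\<Prod>j\<in>S - R. t j)" if "R \<subseteq> S - {x}" for R
    proof -
      have "S - R = insert x (S - {x} - R)" using x that by auto
      then show ?thesis using psubset.hyps by simp
    qed
    moreover have "Pow (S - {x}) = {R. x \<notin> R \<and> R \<subseteq> S}" by auto
    moreover have "m (S - {x}) = (\<Sum>R\<in>Pow (S - {x}). (\<Prod>j\<in>S - {x} - R. t j) * m0 R)"
      by (rule psubset.prems(2)) auto
    ultimately have "t x * m (S - {x}) = (\<Sum>R\<in>Pow (S - {x}). (\<Prod>j\<in>S - R. t j) * m0 R)"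
      by (simp only: sum_distrib_left mult.assoc[symmetric]) (intro sum.cong, auto)
    then show ?thesis using \<open>Pow (S - {x}) = _\<close> by (simp add: e_def)
  qed
  also have "(\<Sum>T | x \<in> T \<and> T \<subseteq> S. (\<Prod>j\<in>S - T. t j) * m0 T) + \<dots> = (\<Sum>R\<in>Pow S. (\<Prod>j\<in>S - R. t j) * m0 R)"
  proof -
    have "Pow S = {T. x \<in> T \<and> T \<subseteq> S} \<union> {R. x \<notin> R \<and> R \<subseteq> S}" by auto
    moreover have "finite {R. x \<notin> R \<and> R \<subseteq> S}" using psubset.hyps by (auto intro!: finite_subset[of "{R. x \<notin> R \<and> R \<subseteq> S}" "Pow S"])
    ultimately show ?thesis using fin by (simp add: sum.union_disjoint[symmetric] disjoint_iff)
  qed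
  also have "\<dots> = m S" using psubset.prems(2)[of S] by simp
  finally have "m S = (\<Sum>B | x \<in> B \<and> B \<subseteq> S. (cum m0 B + e B) * m (S - B))" by simp
  also have "{B. x \<in> B \<and> B \<subseteq> S} = insert S {B. x \<in> B \<and> B \<subset> S}" using x by auto
  also have "(\<Sum>B\<in>insert S {B. x \<in> B \<and> B \<subset> S}. (cum m0 B + e B) * m (S - B))
    = cum m0 S + e S + (\<Sum>B | x \<in> B \<and> B \<subset> S. cum m B * m (S - B))"
  proof -
    have "finite {B. x \<in> B \<and> B \<subset> S}" using fin by (rule finite_subset[rotated]) auto
    then show ?thesis using m1 IH by simp
  qed
  finally show ?case using cum_eq[where m = m, OF psubset.hyps x m1] by (simp add: e_def)
qed

text \<open>Wick's recursion at the largest index builds the moments from pair terms alone, and the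
  moment-cumulant recursion identifies these terms as the cumulants. Min and Max keep the order of
  the two letters, as b is not assumed symmetric.\<close>

lemma cum_wick:
  assumes "finite S" "S \<noteq> {}" "g {} = 1"
    and g: "\<And>T. T \<subseteq> S \<Longrightarrow> T \<noteq> {} \<Longrightarrow> g T = (\<Sum>j\<in>T - {Max T}. b j (Max T) * g (T - {Max T} - {j}))"
  shows "cum g S = (if card S = 2 then b (Min S) (Max S) else 0)"
  using assms(1,2) g
proof (induction S rule: finite_psubset_induct)
  case (psubset S)
  define x where "x = Max S"
  have x: "x \<in> S" "\<And>y. y \<in> S \<Longrightarrow> y \<le> x" using psubset by (auto simp: x_def)
  define e where "e B = (if card B = 2 then b (Min B) (Max B) else 0)" for B
  have IH: "cum g B = e B" if "x \<in> B" "B \<subset> S" for B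
    unfolding e_def using that psubset.prems(2) by (intro psubset.IH) auto
  have fin: "finite {B. x \<in> B \<and> B \<subset> S}" using psubset.hyps by (auto intro!: finite_subset[of "{B. x \<in> B \<and> B \<subset> S}" "Pow S"])
  have "(\<Sum>B | x \<in> B \<and> B \<subseteq> S. e B * g (S - B)) = (\<Sum>B\<in>(\<lambda>j. {j, x}) ` (S - {x}). e B * g (S - B))"
  proof (rule sum.mono_neutral_right)
    show "finite {B. x \<in> B \<and> B \<subseteq> S}" using psubset.hyps by (auto intro!: finite_subset[of "{B. x \<in> B \<and> B \<subseteq> S}" "Pow S"])
    show "\<forall>B\<in>{B. x \<in> B \<and> B \<subseteq> S} - (\<lambda>j. {j, x}) ` (S - {x}). e B * g (S - B) = 0"
    proof
      fix B assume B: "B \<in> {B. x \<in> B \<and> B \<subseteq> S} - (\<lambda>j. {j, x}) ` (S - {x})"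
      have "card B \<noteq> 2"
      proof
        assume "card B = 2"
        then obtain u v where "B = {u, v}" "u \<noteq> v" by (meson card_2_iff)
        then have "B \<in> (\<lambda>j. {j, x}) ` (S - {x})" using B by (cases "u = x") (auto simp: insert_commute)
        then show False using B by simp
      qed
      then show "e B * g (S - B) = 0" by (simp add: e_def)
    qed
  qed (use x in auto)
  also have "\<dots> = (\<Sum>j\<in>S - {x}. e {j, x} * g (S - {j, x}))"
    by (subst sum.reindex) (auto simp: inj_on_def doubleton_eq_iff)
  also have "\<dots> = (\<Sum>j\<in>S - {x}. b j x * g (S - {x} - {j}))"
  proof (rule sum.cong[OF refl])
    fix j assume j: "j \<in> S - {x}"
    then have "e {j, x} = b j x" using x(2)[of j] by (simp add: e_def min_absorb1 max_absorb2)
    moreover have "S - {j, x} = S - {x} - {j}" by auto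
    ultimately show "e {j, x} * g (S - {j, x}) = b j x * g (S - {x} - {j})" by simp
  qed
  also have "\<dots> = g S" using psubset.prems(2)[of S] psubset.prems(1) by (simp add: x_def)
  finally have "g S = (\<Sum>B | x \<in> B \<and> B \<subseteq> S. e B * g (S - B))" by simp
  also have "{B. x \<in> B \<and> B \<subseteq> S} = insert S {B. x \<in> B \<and> B \<subset> S}" using x by auto
  also have "(\<Sum>B\<in>insert S {B. x \<in> B \<and> B \<subset> S}. e B * g (S - B)) = e S + (\<Sum>B | x \<in> B \<and> B \<subset> S. cum g B * g (S - B))"
    using fin assms(3) IH by simp
  finally show ?case using cum_eq[where m = g, OF psubset.hyps x(1) assms(3)] by (simp add: e_def)
qed

subsection \<open>Cumulants of words in linear operators\<close>

text \<open>The letters stand for operators whose order matters, so the selected ones are kept in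
  their original order.\<close>

definition subword :: "'a list \<Rightarrow> nat set \<Rightarrow> 'a list" where
  "subword ks S = map ((!) ks) (sorted_list_of_set S)"

lemma subword_empty [simp]: "subword ks {} = []"
  by (simp add: subword_def)

lemma subword_insert_min:
  assumes "finite A" "\<forall>a\<in>A. b < a"
  shows "subword ks (insert b A) = ks ! b # subword ks A"
proof -
  have "sorted_list_of_set (insert b A) = b # sorted_list_of_set A"
  proof -
    have "A - {b} = A" using assms(2) by auto
    then show ?thesis using assms by (simp add: sorted_list_of_set_insert_remove insort_is_Cons less_imp_le)
  qed
  then show ?thesis by (simp add: subword_def)
qed

text \<open>Binomial expansion of a word: the scalars chosen at some positions come out, and the
  operators at the others keep their order.\<close>

lemma word_expand:
  fixes T :: "'a \<Rightarrow> mps \<Rightarrow> mps"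
  assumes "finite S"
    and add: "\<And>k f g. T k (f + g) = T k f + T k g" and mult: "\<And>k a f. T k (cst a * f) = cst a * T k f"
  shows "foldr (\<lambda>k f. T k f + cst (t k) * f) (subword ks S) f = (\<Sum>R\<in>Pow S. cst (\<Prod>j\<in>S - R. t (ks ! j)) * foldr T (subword ks R) f)"
  using assms(1)
proof (induction S rule: finite_linorder_min_induct)
  case (insert b A)
  have zero: "T k 0 = 0" for k using mult[of k 0 0] by simp
  have sum: "T k (\<Sum>x\<in>X. F x) = (\<Sum>x\<in>X. T k (F x))" for k X and F :: "nat set \<Rightarrow> mps"
    by (induction X rule: infinite_finite_induct) (auto simp: add zero)
  have bA: "b \<notin> A" using insert by auto
  have b: "b \<notin> R" "finite R" "\<forall>a\<in>R. b < a" if "R \<in> Pow A" for R using that insert by (auto intro: finite_subset)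
  have "foldr (\<lambda>k f. T k f + cst (t k) * f) (subword ks (insert b A)) f
     = (\<Sum>R\<in>Pow A. cst (\<Prod>j\<in>A - R. t (ks ! j)) * foldr T (subword ks (insert b R)) f)
     + (\<Sum>R\<in>Pow A. cst (t (ks ! b)) * cst (\<Prod>j\<in>A - R. t (ks ! j)) * foldr T (subword ks R) f)"
    using insert b by (simp add: subword_insert_min sum mult sum_distrib_left mult.assoc)
  also have "(\<Sum>R\<in>Pow A. cst (\<Prod>j\<in>A - R. t (ks ! j)) * foldr T (subword ks (insert b R)) f)
     = (\<Sum>R\<in>insert b ` Pow A. cst (\<Prod>j\<in>insert b A - R. t (ks ! j)) * foldr T (subword ks R) f)"
  proof (subst sum.reindex)
    show "inj_on (insert b) (Pow A)" using bA by (auto simp: inj_on_def)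
    have "insert b A - insert b R = A - R" if "R \<in> Pow A" for R using that bA by auto
    then show "(\<Sum>R\<in>Pow A. cst (\<Prod>j\<in>A - R. t (ks ! j)) * foldr T (subword ks (insert b R)) f) =
      sum ((\<lambda>R. cst (\<Prod>j\<in>insert b A - R. t (ks ! j)) * foldr T (subword ks R) f) \<circ> insert b) (Pow A)"
      by (intro sum.cong) auto
  qed
  also have "(\<Sum>R\<in>Pow A. cst (t (ks ! b)) * cst (\<Prod>j\<in>A - R. t (ks ! j)) * foldr T (subword ks R) f)
     = (\<Sum>R\<in>Pow A. cst (\<Prod>j\<in>insert b A - R. t (ks ! j)) * foldr T (subword ks R) f)"
  proof (rule sum.cong[OF refl])
    fix R assume R: "R \<in> Pow A"
    then have "insert b A - R = insert b (A - R)" using b[OF R] by auto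
    then show "cst (t (ks ! b)) * cst (\<Prod>j\<in>A - R. t (ks ! j)) * foldr T (subword ks R) f
      = cst (\<Prod>j\<in>insert b A - R. t (ks ! j)) * foldr T (subword ks R) f"
      using insert bA by (simp add: cst_mult)
  qed
  also have "(\<Sum>R\<in>insert b ` Pow A. cst (\<Prod>j\<in>insert b A - R. t (ks ! j)) * foldr T (subword ks R) f)
     + (\<Sum>R\<in>Pow A. cst (\<Prod>j\<in>insert b A - R. t (ks ! j)) * foldr T (subword ks R) f)
     = (\<Sum>R\<in>Pow (insert b A). cst (\<Prod>j\<in>insert b A - R. t (ks ! j)) * foldr T (subword ks R) f)"
    using insert bA by (subst sum.union_disjoint[symmetric]) (auto simp: Pow_insert Un_commute)
  finally show ?case .
qed simp

lemma gaussian_wick_set: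
  assumes g: "gaussian C g" and T: "finite T" "T \<noteq> {}"
  shows "coef (foldr (lin_op c) (subword ks T) g) {#}
    = (\<Sum>j\<in>T - {Max T}. lin_cov c C (ks ! j) (ks ! Max T) * coef (foldr (lin_op c) (subword ks (T - {Max T} - {j})) g) {#})"
proof -
  define x A where "x = Max T" and "A = T - {x}"
  have A: "finite A" "x \<notin> A" "\<forall>a\<in>A. a < x" "T = insert x A"
  proof -
    have "x \<in> T" "\<forall>a\<in>T. a \<le> x" using T by (simp_all add: x_def)
    then show "finite A" "x \<notin> A" "\<forall>a\<in>A. a < x" "T = insert x A" using T by (auto simp: A_def order_less_le)
  qed
  define l where "l = sorted_list_of_set A"
  have l: "sorted l" "distinct l" "set l = A" using A by (simp_all add: l_def)
  have "sorted_list_of_set T = l @ [x]"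
  proof -
    have "sorted (l @ [x])" using l A(3) by (auto simp: sorted_append intro: less_imp_le)
    moreover have "distinct (l @ [x])" "set (l @ [x]) = T" using l A by auto
    ultimately show ?thesis using sorted_list_of_set.idem_if_sorted_distinct by metis
  qed
  then have w: "subword ks T = map ((!) ks) l @ [ks ! x]" by (simp add: subword_def)
  have rm: "take p (map ((!) ks) l) @ drop (Suc p) (map ((!) ks) l) = subword ks (A - {l ! p})" if "p < length l" for p
  proof -
    have e: "l = take p l @ l ! p # drop (Suc p) l" using that by (rule id_take_nth_drop)
    define u v y where "u = take p l" and "v = drop (Suc p) l" and "y = l ! p"
    have "sorted (u @ y # v)" "distinct (u @ y # v)" "set (u @ y # v) = A"
      using l e unfolding u_def v_def y_def by simp_all
    then have "sorted (u @ v)" "distinct (u @ v)" "set (u @ v) = A - {y}"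
      by (auto simp: sorted_append)
    note uv = this[unfolded u_def v_def y_def]
    have "sorted_list_of_set (A - {l ! p}) = take p l @ drop (Suc p) l"
      using uv sorted_list_of_set.idem_if_sorted_distinct by metis
    then show ?thesis by (simp only: subword_def take_map drop_map map_append)
  qed
  have "coef (foldr (lin_op c) (subword ks T) g) {#}
    = (\<Sum>p<length l. lin_cov c C (ks ! (l ! p)) (ks ! x) * coef (foldr (lin_op c) (subword ks (A - {l ! p})) g) {#})"
    unfolding w gaussian_wick[OF g] by (intro sum.cong) (simp_all add: rm)
  also have "\<dots> = (\<Sum>j\<in>A. lin_cov c C (ks ! j) (ks ! x) * coef (foldr (lin_op c) (subword ks (A - {j})) g) {#})"
    using bij_betw_nth[OF l(2) refl l(3)[symmetric]] by (rule sum.reindex_bij_betw)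
  finally show ?thesis by (simp add: A_def x_def)
qed

section \<open>The moments of a series with Gaussian logarithm\<close>

lemma NSx_add: "NSx c t u (\<lambda>i. f i + g i) i = NSx c t u f i + NSx c t u g i"
proof -
  have "xsum (\<lambda>j. cst (real j) * (f (i + j) + g (i + j))) = xsum (\<lambda>j. cst (real j) * f (i + j)) + xsum (\<lambda>j. cst (real j) * g (i + j))"
    unfolding xsum_add[symmetric] by (simp only: distrib_left)
  then show ?thesis by (simp add: NSx_def sum.distrib distrib_left)
qed

lemma NSx_cst: "NSx c t u (\<lambda>i. cst a * f i) i = cst a * NSx c t u f i"
proof -
  have "xsum (\<lambda>j. cst (real j) * (cst a * f (i + j))) = cst a * xsum (\<lambda>j. cst (real j) * f (i + j))"
    unfolding xsum_cst_mult[symmetric] by (simp only: mult.left_commute)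
  then show ?thesis by (simp add: NSx_def sum_distrib_left algebra_simps)
qed

lemma NSx_moment_add: "NSx_moment c t u k (f + g) = NSx_moment c t u k f + NSx_moment c t u k g"
proof -
  have "(NSx c t u ^^ k) (vacx (f + g)) = (\<lambda>i. (NSx c t u ^^ k) (vacx f) i + (NSx c t u ^^ k) (vacx g) i)"
  proof (induction k)
    case 0
    show ?case by (rule ext) (simp add: vacx_def)
  next
    case (Suc k)
    show ?case by (rule ext) (simp add: Suc NSx_add)
  qed
  then show ?thesis by (simp add: NSx_moment_def)
qed

lemma NSx_moment_cst: "NSx_moment c t u k (cst a * f) = cst a * NSx_moment c t u k f"
proof -
  have "(NSx c t u ^^ k) (vacx (cst a * f)) = (\<lambda>i. cst a * (NSx c t u ^^ k) (vacx f) i)"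
  proof (induction k)
    case 0
    show ?case by (rule ext) (simp add: vacx_def)
  next
    case (Suc k)
    show ?case by (rule ext) (simp add: Suc NSx_cst)
  qed
  then show ?thesis by (simp add: NSx_moment_def)
qed

abbreviation Xop :: "nat \<Rightarrow> nat \<Rightarrow> mps \<Rightarrow> mps" where
  "Xop n \<equiv> NSx_moment (\<lambda>k. 0) 1 (1 / real n)"

definition word_moment :: "nat \<Rightarrow> mps \<Rightarrow> nat list \<Rightarrow> nat set \<Rightarrow> real" where
  "word_moment n F ks S = coef (foldr (Xop n) (subword ks S) F) {#}"

lemma foldr_scale:
  fixes T :: "nat \<Rightarrow> mps \<Rightarrow> mps"
  assumes "\<And>k a f. T k (cst a * f) = cst a * T k f"
  shows "foldr (\<lambda>k f. cst s * T k f) ks f = cst (s ^ length ks) * foldr T ks f"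
  by (induction ks) (simp_all add: assms cst_mult mult.assoc)

text \<open>The operators multiplied by sqrt n are the centred ones plus scalars. By
  \<open>cum_shift\<close> the scalars affect only first cumulants, so the higher ones converge to
  the cumulants of the limiting first-order operators, given by Wick's rule.\<close>

theorem word_cumulants_limit:
  fixes A :: "nat \<Rightarrow> mps" and G :: "nat \<Rightarrow> nat \<Rightarrow> mps"
  assumes "\<And>n k. n \<ge> 1 \<Longrightarrow> pd k (A n) = A n * G n k" and A1: "\<And>n. n \<ge> 1 \<Longrightarrow> coef (A n) {#} = 1"
    and c: "\<And>k. (\<lambda>n. coef (G n k) {#}) \<longlonglongrightarrow> c k"
    and "\<And>k M. M \<noteq> {#} \<Longrightarrow> (\<lambda>n. sqrt (real n) ^ (size M + 1) * coef (G n k) M) \<longlonglongrightarrow> coef (lin (C k)) M"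
  shows "(\<lambda>n. word_moment n (A n) [k] {0}) \<longlonglongrightarrow> toep_pow c k 0"
    and "length ks \<ge> 2 \<Longrightarrow> (\<lambda>n. sqrt (real n) ^ length ks * cum (word_moment n (A n) ks) {..<length ks})
      \<longlonglongrightarrow> (if length ks = 2 then lin_cov c C (ks ! 0) (ks ! 1) else 0)"
proof -
  define cn where "cn n k = coef (G n k) {#}" for n k
  obtain g where g: "gaussian C g" and lim: "\<And>ks. (\<lambda>n. coef (foldr (cop n (cn n)) ks (A n)) {#}) \<longlonglongrightarrow> coef (foldr (lin_op c) ks g) {#}"
    using centred_moments_limit[of A G c C] assms unfolding cn_def[abs_def] by blast
  have g1: "coef g {#} = 1" using g by (simp add: gaussian_def)
  define s where "s n = sqrt (real n)" for n :: nat
  have cadd: "cop n a k (f + h) = cop n a k f + cop n a k h" for n a k f h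
    unfolding cop_def NSx_moment_add by (simp add: algebra_simps)
  have ccst: "cop n a k (cst b * f) = cst b * cop n a k f" for n a k b f
    unfolding cop_def NSx_moment_cst by (simp add: algebra_simps)
  define t where "t n k = s n * toep_pow (cn n) k 0" for n k
  have V: "cop n (cn n) k f + cst (t n k) * f = cst (s n) * Xop n k f" for n k f
    by (simp add: cop_def t_def s_def cst_mult algebra_simps)
  define m0 where "m0 ks n R = coef (foldr (cop n (cn n)) (subword ks R) (A n)) {#}" for ks n R
  have scaled: "s n ^ card T * word_moment n (A n) ks T = (\<Sum>R\<in>Pow T. (\<Prod>j\<in>T - R. t n (ks ! j)) * m0 ks n R)" if "finite T" for n T ks
  proof -
    have "foldr (\<lambda>k f. cop n (cn n) k f + cst (t n k) * f) (subword ks T) (A n) = cst (s n ^ card T) * foldr (Xop n) (subword ks T) (A n)"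
      unfolding V by (subst foldr_scale[OF NSx_moment_cst]) (simp add: subword_def)
    then have "coef (cst (s n ^ card T) * foldr (Xop n) (subword ks T) (A n)) {#}
      = coef (\<Sum>R\<in>Pow T. cst (\<Prod>j\<in>T - R. t n (ks ! j)) * foldr (cop n (cn n)) (subword ks R) (A n)) {#}"
      using word_expand[where T = "cop n (cn n)" and t = "t n" and ks = ks and f = "A n", OF that cadd ccst] by simp
    then show ?thesis by (simp add: coef_sum coef_cst word_moment_def m0_def)
  qed
  have m01: "m0 ks n {} = 1" if "n \<ge> 1" for ks n using A1[OF that] by (simp add: m0_def)
  have cumlim: "(\<lambda>n. cum (m0 ks n) S) \<longlonglongrightarrow> cum (\<lambda>R. coef (foldr (lin_op c) (subword ks R) g) {#}) S" for ks S
    by (rule tendsto_cum) (simp add: m0_def lim)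
  have shift: "s n ^ card S * cum (word_moment n (A n) ks) S = cum (m0 ks n) S + (if card S = 1 then t n (ks ! the_elem S) else 0)"
    if "finite S" "S \<noteq> {}" "n \<ge> 1" for ks n S
  proof -
    have "s n ^ card S * cum (word_moment n (A n) ks) S = cum (\<lambda>B. s n ^ card B * word_moment n (A n) ks B) S"
      using cum_scale[OF that(1)] by simp
    also have "\<dots> = cum (m0 ks n) S + (if card S = 1 then t n (ks ! the_elem S) else 0)"
      using that by (intro cum_shift m01 scaled) (auto intro: finite_subset)
    finally show ?thesis .
  qed
  show "(\<lambda>n. sqrt (real n) ^ length ks * cum (word_moment n (A n) ks) {..<length ks})
      \<longlonglongrightarrow> (if length ks = 2 then lin_cov c C (ks ! 0) (ks ! 1) else 0)" if "length ks \<ge> 2"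
  proof -
    have ne: "{..<length ks} \<noteq> {}" using that by (cases ks) (auto simp: lessThan_Suc)
    have "cum (\<lambda>R. coef (foldr (lin_op c) (subword ks R) g) {#}) {..<length ks}
      = (if card {..<length ks} = 2 then lin_cov c C (ks ! Min {..<length ks}) (ks ! Max {..<length ks}) else 0)"
      by (rule cum_wick[where b = "\<lambda>i j. lin_cov c C (ks ! i) (ks ! j)"])
        (use ne g1 in \<open>auto intro!: gaussian_wick_set[OF g] intro: finite_subset\<close>)
    also have "\<dots> = (if length ks = 2 then lin_cov c C (ks ! 0) (ks ! 1) else 0)"
    proof -
      have "Min {..<2::nat} = 0" "Max {..<2::nat} = 1" by (auto simp: numeral_2_eq_2 lessThan_Suc)
      then show ?thesis by auto
    qed
    finally have "(\<lambda>n. cum (m0 ks n) {..<length ks}) \<longlonglongrightarrow> (if length ks = 2 then lin_cov c C (ks ! 0) (ks ! 1) else 0)"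
      using cumlim[of ks "{..<length ks}"] by simp
    moreover have "\<forall>\<^sub>F n in sequentially. cum (m0 ks n) {..<length ks} = sqrt (real n) ^ length ks * cum (word_moment n (A n) ks) {..<length ks}"
      using eventually_ge_at_top[of 1]
    proof eventually_elim
      case (elim n)
      then show ?case using shift[OF _ ne elim, of ks] that by (simp add: s_def)
    qed
    ultimately show ?thesis by (rule Lim_transform_eventually)
  qed
  show "(\<lambda>n. word_moment n (A n) [k] {0}) \<longlonglongrightarrow> toep_pow c k 0"
  proof -
    have s1: "cum m {0} = m {0}" if "m {} = 1" for m
    proof -
      have "{B. (0::nat) \<in> B \<and> B \<subset> {0}} = {}" by auto
      then show ?thesis using cum_eq[where m = m and S = "{0}" and x = 0] that by (simp only:) simp
    qed
    have "(\<lambda>n. cum (m0 [k] n) {0}) \<longlonglongrightarrow> cum (\<lambda>R. coef (foldr (lin_op c) (subword [k] R) g) {#}) {0}" by (rule cumlim)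
    also have "cum (\<lambda>R. coef (foldr (lin_op c) (subword [k] R) g) {#}) {0} = 0"
      using s1[of "\<lambda>R. coef (foldr (lin_op c) (subword [k] R) g) {#}"] gaussian_wick_set[OF g, of "{0}" c "[k]"] g1 by simp
    finally have "(\<lambda>n. cum (m0 [k] n) {0}) \<longlonglongrightarrow> 0" .
    moreover have "(\<lambda>n. 1 / s n) \<longlonglongrightarrow> 0" unfolding s_def by real_asymp
    \<comment> \<open>Dividing by sqrt n removes the centred part, and the scalar
      \<open>toep_pow\<close> is what remains of the mean.\<close>
    ultimately have "(\<lambda>n. 1 / s n * cum (m0 [k] n) {0}) \<longlonglongrightarrow> 0 * 0" by (intro tendsto_mult)
    moreover have "(\<lambda>n. toep_pow (cn n) k 0) \<longlonglongrightarrow> toep_pow c k 0"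
      unfolding cn_def by (rule tendsto_toep_pow[OF c])
    ultimately have "(\<lambda>n. 1 / s n * cum (m0 [k] n) {0} + toep_pow (cn n) k 0) \<longlonglongrightarrow> 0 * 0 + toep_pow c k 0"
      by (intro tendsto_add)
    moreover have "\<forall>\<^sub>F n in sequentially. 1 / s n * cum (m0 [k] n) {0} + toep_pow (cn n) k 0 = word_moment n (A n) [k] {0}"
      using eventually_ge_at_top[of 1]
    proof eventually_elim
      case (elim n)
      then have "s n > 0" by (simp add: s_def)
      moreover have "cum (word_moment n (A n) [k]) {0} = word_moment n (A n) [k] {0}"
        by (rule s1) (use A1[OF elim] in \<open>simp add: word_moment_def\<close>)
      ultimately show ?case using shift[of "{0}" n "[k]"] elim by (simp add: t_def field_simps)
    qed
    ultimately show ?thesis using Lim_transform_eventually by force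
  qed
qed

subsection \<open>Derivatives at the origin\<close>

definition D0 :: "mps \<Rightarrow> nat multiset \<Rightarrow> real" where
  "D0 f M = coef f M * (\<Prod>k\<in>set_mset M. fact (count M k))"

lemma prod_fact_count_add:
  "(\<Prod>k\<in>set_mset (add_mset j M). fact (count (add_mset j M) k)) = real (count M j + 1) * (\<Prod>k\<in>set_mset M. fact (count M k))"
proof -
  define A where "A = set_mset M - {j}"
  have A: "finite A" "j \<notin> A" "set_mset (add_mset j M) = insert j A" by (auto simp: A_def)
  have "(\<Prod>k\<in>set_mset M. fact (count M k)) = (\<Prod>k\<in>insert j A. fact (count M k) :: real)"
    by (rule prod.mono_neutral_left) (auto simp: A_def not_in_iff)
  moreover have "(\<Prod>k\<in>A. fact (count (add_mset j M) k)) = (\<Prod>k\<in>A. fact (count M k) :: real)"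
    using A by (intro prod.cong) auto
  ultimately show ?thesis unfolding A(3) using A by simp
qed

lemma D0_pd: "D0 (pd k f) M = D0 f (add_mset k M)"
  unfolding D0_def prod_fact_count_add by (simp add: coef_pd)

lemma D0_add: "D0 (f + g) M = D0 f M + D0 g M"
  by (simp add: D0_def distrib_right)

lemma D0_0 [simp]: "D0 0 M = 0"
  by (simp add: D0_def)

lemma D0_diff: "D0 (f - g) M = D0 f M - D0 g M"
  by (simp add: D0_def left_diff_distrib)

lemma D0_cst_mult: "D0 (cst a * f) M = a * D0 f M"
  by (simp add: D0_def)

lemma D0_sum: "D0 (\<Sum>x\<in>A. f x) M = (\<Sum>x\<in>A. D0 (f x) M)"
  by (simp add: D0_def coef_sum sum_distrib_right)

lemma sum_mset_count:
  fixes F :: "'a \<Rightarrow> real"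
  assumes "finite A" "set_mset M \<subseteq> A"
  shows "(\<Sum>j\<in>#M. F j) = (\<Sum>j\<in>A. real (count M j) * F j)"
  using assms(2)
proof (induction M)
  case (add k M)
  have "(\<Sum>j\<in>A. real (count (add_mset k M) j) * F j) = (\<Sum>j\<in>A. real (count M j) * F j + (if j = k then F k else 0))"
    by (intro sum.cong) (auto simp: distrib_right)
  then show ?case using add assms(1) by (simp add: sum.distrib)
qed simp

lemma D0_xsum: "D0 (xsum h) M = (\<Sum>j\<in>#M. D0 (h j) (M - {#j#}))"
proof -
  have "(\<Sum>j\<in>#M. D0 (h j) (M - {#j#})) = (\<Sum>j\<in>set_mset M. real (count M j) * D0 (h j) (M - {#j#}))"
    by (rule sum_mset_count) auto
  also have "\<dots> = (\<Sum>j\<in>set_mset M. coef (h j) (M - {#j#}) * (\<Prod>k\<in>set_mset M. fact (count M k)))"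
  proof (rule sum.cong[OF refl])
    fix j assume "j \<in> set_mset M"
    then obtain N where N: "M = add_mset j N" by (meson multi_member_split)
    show "real (count M j) * D0 (h j) (M - {#j#}) = coef (h j) (M - {#j#}) * (\<Prod>k\<in>set_mset M. fact (count M k))"
      unfolding N prod_fact_count_add by (simp add: D0_def)
  qed
  finally show ?thesis by (simp add: D0_def coef_xsum sum_distrib_right)
qed

lemma D0_empty [simp]: "D0 f {#} = coef f {#}"
  by (simp add: D0_def)

lemma D0_NSx:
  "D0 (NSx (\<lambda>k. 0) 1 u h i) M = (\<Sum>m<i. D0 (h m) (add_mset (i - m) M)) + D0 (h (Suc i)) (add_mset 0 M)
     + u * (\<Sum>j\<in>#M. real j * D0 (h (i + j)) (M - {#j#}))"
  by (simp add: NSx_def D0_add D0_sum D0_pd D0_cst_mult D0_xsum)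

subsection \<open>The binomial factor\<close>

text \<open>The variable \<open>x\<^sub>0\<close> records fixed points: \<open>binom_series n\<close> is \<open>(1 + x\<^sub>0/n)\<^sup>n\<close>.\<close>

definition binom_series :: "nat \<Rightarrow> mps" where
  "binom_series n = Mps (\<lambda>M. if set_mset M \<subseteq> {0} then real (n choose size M) / real n ^ size M else 0)"

text \<open>The series 1 / (1 + x_0/n), which is the logarithmic derivative of
  \<open>binom_series n\<close> in x_0.\<close>

definition geom_series :: "nat \<Rightarrow> mps" where
  "geom_series n = Mps (\<lambda>M. if set_mset M \<subseteq> {0} then (- 1 / real n) ^ size M else 0)"

lemma set_mset_subset_0_cases:
  assumes "set_mset M \<subseteq> {0::nat}"
  obtains a where "M = replicate_mset a 0"
  using assms set_mset_subset_singletonD by metis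

lemma one_plus_x0_mult:
  "coef ((1 + cst u * lin (\<lambda>j. if j = 0 then 1 else 0)) * f) M = coef f M + (if 0 \<in># M then u * coef f (M - {#0#}) else 0)"
proof -
  have "coef (lin (\<lambda>j. if j = 0 then 1 else 0) * f) M = (\<Sum>j\<in>set_mset M. if j = 0 then coef f (M - {#j#}) else 0)"
    unfolding lin_mult coef_xsum by (intro sum.cong) simp_all
  then show ?thesis by (simp add: distrib_right mult.assoc sum.delta)
qed

lemma geom_series_inverse:
  assumes "n \<ge> 1"
  shows "(1 + cst (1 / real n) * lin (\<lambda>j. if j = 0 then 1 else 0)) * geom_series n = 1"
proof (rule mps_eqI)
  fix M
  show "coef ((1 + cst (1 / real n) * lin (\<lambda>j. if j = 0 then 1 else 0)) * geom_series n) M = coef 1 M"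
  proof (cases "0 \<in># M")
    case True
    then obtain N where "M = add_mset 0 N" by (meson multi_member_split)
    then show ?thesis unfolding one_plus_x0_mult by (simp add: geom_series_def)
  next
    case False
    then have "M = {#} \<or> \<not> set_mset M \<subseteq> {0}" by (metis all_not_in_conv set_mset_eq_empty_iff subset_singletonD insertI1)
    then show ?thesis using False unfolding one_plus_x0_mult by (auto simp: geom_series_def)
  qed
qed

lemma pd_binom_series:
  assumes "n \<ge> 1"
  shows "pd k (binom_series n) = binom_series n * (if k = 0 then geom_series n else 0)"
proof (cases "k = 0")
  case True
  have "(1 + cst (1 / real n) * lin (\<lambda>j. if j = 0 then 1 else 0)) * pd 0 (binom_series n) = binom_series n"
  proof (rule mps_eqI)
    fix M
    have step: "real (a + 1) * (real (n choose (a + 1)) / real n ^ (a + 1)) = (real n - real a) / real n * (real (n choose a) / real n ^ a)" for a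
    proof -
      have "real (a + 1) * real (n choose (a + 1)) = (real n - real a) * real (n choose a)"
      proof (cases "a \<le> n")
        case True
        have "(a + 1) * (n choose (a + 1)) = (n - a) * (n choose a)"
          by (metis Suc_eq_plus1 binomial_absorb_comp binomial_absorption)
        then show ?thesis using True by (metis of_nat_diff of_nat_mult)
      next
        case False
        then have "n choose a = 0" "n choose (a + 1) = 0" by (simp_all add: not_le)
        then show ?thesis by (simp only: of_nat_0 mult_zero_right)
      qed
      then show ?thesis by (simp add: field_simps)
    qed
    show "coef ((1 + cst (1 / real n) * lin (\<lambda>j. if j = 0 then 1 else 0)) * pd 0 (binom_series n)) M = coef (binom_series n) M"
    proof (cases "set_mset M \<subseteq> {0}")
      case True
      then obtain a where a: "M = replicate_mset a 0" by (rule set_mset_subset_0_cases)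
      have p: "coef (pd 0 (binom_series n)) (replicate_mset b 0) = (real n - real b) / real n * (real (n choose b) / real n ^ b)" for b
        using step[of b] by (simp add: coef_pd binom_series_def)
      show ?thesis
      proof (cases a)
        case 0
        then show ?thesis unfolding one_plus_x0_mult a using assms p[of 0] by (simp add: binom_series_def)
      next
        case (Suc b)
        have "coef (pd 0 (binom_series n)) (replicate_mset a 0) + 1 / real n * coef (pd 0 (binom_series n)) (replicate_mset b 0)
          = (real n - real a) / real n * (real (n choose a) / real n ^ a) + 1 / real n * (real a * (real (n choose a) / real n ^ a))"
          unfolding p step[of b, symmetric] using Suc by simp
        also have "\<dots> = real (n choose a) / real n ^ a" using assms by (simp add: field_simps)
        finally show ?thesis unfolding one_plus_x0_mult a using Suc by (simp add: binom_series_def)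
      qed
    next
      case False
      then have "\<not> set_mset (M - {#0#}) \<subseteq> {0}" by (metis insert_DiffM insert_subset set_mset_add_mset_insert singletonI diff_single_trivial)
      then show ?thesis unfolding one_plus_x0_mult using False by (auto simp: coef_pd binom_series_def)
    qed
  qed
  then have "geom_series n * binom_series n = (1 + cst (1 / real n) * lin (\<lambda>j. if j = 0 then 1 else 0)) * geom_series n * pd 0 (binom_series n)"
    by (metis mult.assoc mult.commute)
  then show ?thesis using True geom_series_inverse[OF assms] by (simp add: mult.commute)
next
  case False
  then show ?thesis by (auto intro!: mps_eqI simp: coef_pd binom_series_def)
qed

text \<open>The series f is free of x_0 and the binomial factor involves only x_0, so the
  derivatives separate.\<close>

lemma D0_binom_mult:
  assumes f: "\<And>M. 0 \<in># M \<Longrightarrow> coef f M = 0" and "0 \<notin># \<nu>"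
  shows "D0 (binom_series n * f) (replicate_mset a 0 + \<nu>) = fact a * real (n choose a) / real n ^ a * D0 f \<nu>"
proof -
  let ?M = "replicate_mset a 0 + \<nu>"
  have "coef (binom_series n * f) ?M = (\<Sum>N\<in>{replicate_mset a 0}. coef (binom_series n) N * coef f (?M - N))"
    unfolding coef_mult
  proof (rule sum.mono_neutral_right)
    show "{replicate_mset a 0} \<subseteq> {N. N \<subseteq># ?M}" by simp
    show "\<forall>N\<in>{N. N \<subseteq># ?M} - {replicate_mset a 0}. coef (binom_series n) N * coef f (?M - N) = 0"
    proof
      fix N assume N: "N \<in> {N. N \<subseteq># ?M} - {replicate_mset a 0}"
      show "coef (binom_series n) N * coef f (?M - N) = 0"
      proof (cases "set_mset N \<subseteq> {0}")
        case True
        then obtain b where b: "N = replicate_mset b 0" by (rule set_mset_subset_0_cases)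
        have "b \<le> a" using N assms(2) unfolding b by (auto simp: subseteq_mset_def not_in_iff dest!: spec[of _ 0])
        moreover have "b \<noteq> a" using N b by auto
        ultimately have "0 \<in># ?M - N" unfolding b count_greater_zero_iff[symmetric] by simp
        then show ?thesis using f by simp
      qed (simp add: binom_series_def)
    qed
  qed auto
  moreover have "(\<Prod>k\<in>set_mset ?M. fact (count ?M k)) = fact a * (\<Prod>k\<in>set_mset \<nu>. fact (count \<nu> k) :: real)"
  proof -
    have "(\<Prod>k\<in>set_mset ?M. fact (count ?M k) :: real) = (\<Prod>k\<in>insert 0 (set_mset \<nu>). fact (count ?M k))"
      using assms(2) by (intro prod.mono_neutral_left) (auto simp: not_in_iff)
    also have "\<dots> = fact a * (\<Prod>k\<in>set_mset \<nu>. fact (count ?M k))"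
      using assms(2) by (simp add: not_in_iff)
    also have "(\<Prod>k\<in>set_mset \<nu>. fact (count ?M k)) = (\<Prod>k\<in>set_mset \<nu>. fact (count \<nu> k) :: real)"
      using assms(2) by (intro prod.cong) auto
    finally show ?thesis .
  qed
  ultimately show ?thesis by (simp add: D0_def binom_series_def mult_ac)
qed

text \<open>The limit formulas read c from index 1 on, so entry 0 is free to carry the mean 1 of the
  binomial factor.\<close>

lemma clt_a_upd: "clt_a (c(0 := a)) k = clt_a c k"
proof -
  have "F_fps (c(0 := a)) = F_fps c" by (simp add: F_fps_def)
  then show ?thesis by (simp add: clt_a_def U_fls_def)
qed

lemma clt_b_upd: "clt_b (c(0 := a)) d k k' = clt_b c d k k'"
proof -
  have "F_fps (c(0 := a)) = F_fps c" by (simp add: F_fps_def)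
  then have 1: "U_fls (c(0 := a)) = U_fls c" by (simp add: U_fls_def)
  have "bfps_zFmwF (c(0 := a)) = bfps_zFmwF c" by (intro ext) (auto simp: bfps_zFmwF_def)
  then have 2: "bfps_quot (c(0 := a)) = bfps_quot c" by (simp only: bfps_quot_def)
  have "bfps_zwFF (c(0 := a)) = bfps_zwFF c" by (intro ext) (auto simp: bfps_zwFF_def)
  then have "bfps_G (c(0 := a)) = bfps_G c" unfolding bfps_G_def 2 by (simp only:)
  then have "bfps_H (c(0 := a)) d p q = bfps_H c d p q" for p q by (simp only: bfps_H_def)
  then show ?thesis unfolding clt_b_def 1 by (simp only:)
qed

section \<open>From limits of logarithmic coefficients to limits of cumulants\<close>

lemma coef_lin_single [simp]: "coef (lin t) {#j#} = t j"
  by (simp add: lin_def coef_xsum coef_cst)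

lemma coef_lin_eq_0:
  assumes "size M \<noteq> 1"
  shows "coef (lin t) M = 0"
proof -
  have "M - {#j#} \<noteq> {#}" if "j \<in># M" for j
  proof
    assume "M - {#j#} = {#}"
    then have "M = {#j#}" using that insert_DiffM[of j M] by simp
    then have "size M = 1" by simp
    then show False using assms by simp
  qed
  then show ?thesis unfolding lin_def coef_xsum by (intro sum.neutral) (simp add: coef_cst)
qed

text \<open>CLT-appropriateness for the logarithms of arbitrary series, so that it can also be asked
  of truncated logarithms.\<close>

definition log_limits :: "(nat \<Rightarrow> mps) \<Rightarrow> (nat \<Rightarrow> real) \<Rightarrow> (nat \<Rightarrow> nat \<Rightarrow> real) \<Rightarrow> bool" where
  "log_limits L c d \<longleftrightarrow> (\<forall>i\<ge>1. (\<lambda>n. D0 (L n) {#i#}) \<longlonglongrightarrow> c i)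
     \<and> (\<forall>i\<ge>1. \<forall>j\<ge>1. (\<lambda>n. real n * D0 (L n) {#i, j#}) \<longlonglongrightarrow> d i j)
     \<and> (\<forall>M. size M \<ge> 3 \<longrightarrow> 0 \<notin># M \<longrightarrow> (\<lambda>n. sqrt (real n) ^ size M * D0 (L n) M) \<longlonglongrightarrow> 0)"

text \<open>At x_0^(b+1) a coefficient of size n^-(b+1) meets the factor n^((b+2)/2), which leaves
  n^(-b/2); only the linear term survives.\<close>

lemma geom_series_limit:
  assumes "M \<noteq> {#}"
  shows "(\<lambda>n. sqrt (real n) ^ (size M + 1) * coef (geom_series n) M) \<longlonglongrightarrow> coef (lin (limit_cov d 0)) M"
proof (cases "set_mset M \<subseteq> {0}")
  case True
  then obtain a where a: "M = replicate_mset a 0" by (rule set_mset_subset_0_cases)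
  then obtain b where b: "a = Suc b" using assms by (cases a) auto
  have "(\<lambda>n. - ((- 1 / sqrt (real n)) ^ b)) \<longlonglongrightarrow> - (0 ^ b)"
    by (intro tendsto_minus tendsto_power) real_asymp
  moreover have "- (0 ^ b) = coef (lin (limit_cov d 0)) M"
    unfolding a b by (cases b) (simp_all add: limit_cov_def coef_lin_eq_0)
  moreover have "\<forall>\<^sub>F n in sequentially. - ((- 1 / sqrt (real n)) ^ b) = sqrt (real n) ^ (size M + 1) * coef (geom_series n) M"
    using eventually_ge_at_top[of 1]
  proof eventually_elim
    case (elim n)
    define s where "s = sqrt (real n)"
    have s: "s > 0" "real n = s * s" using elim by (simp_all add: s_def)
    have "s ^ (Suc b + 1) * (- 1 / (s * s)) ^ Suc b = s * (s * (- 1 / (s * s))) ^ Suc b"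
      by (simp only: power_mult_distrib power_Suc Suc_eq_plus1[symmetric] mult_ac)
    also have "s * (- 1 / (s * s)) = - 1 / s" using s by simp
    also have "s * (- 1 / s) ^ Suc b = - ((- 1 / s) ^ b)" using s by simp
    finally have "s ^ (Suc b + 1) * (- 1 / (s * s)) ^ Suc b = - ((- 1 / s) ^ b)" .
    then show ?case unfolding a b s_def[symmetric] by (simp add: geom_series_def s(2) del: power_Suc)
  qed
  ultimately show ?thesis using Lim_transform_eventually by force
next
  case False
  have "coef (lin (limit_cov d 0)) M = 0"
  proof (cases "size M = 1")
    case True
    then obtain j where "M = {#j#}" using size_1_singleton_mset by blast
    then show ?thesis using \<open>\<not> set_mset M \<subseteq> {0}\<close> by (simp add: limit_cov_def)
  qed (simp add: coef_lin_eq_0)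
  moreover have "coef (geom_series n) M = 0" for n using False by (simp add: geom_series_def)
  ultimately show ?thesis by simp
qed

text \<open>The binomial factor adds \<open>geom_series\<close> as logarithmic derivative in x_0 and
  leaves the others as they are. Its constant term 1 becomes the value \<open>c' 0\<close>, the
  superdiagonal of the Toeplitz operator and the z^-1 of the symbol.\<close>

theorem log_limits_imp_cumulants:
  assumes lim: "log_limits L c d"
    and A: "\<And>n k. n \<ge> 1 \<Longrightarrow> pd k (A n) = A n * pd k (L n)" and A1: "\<And>n. n \<ge> 1 \<Longrightarrow> coef (A n) {#} = 1"
    and L0: "\<And>n M. 0 \<in># M \<Longrightarrow> coef (L n) M = 0"
  shows "(\<lambda>n. word_moment n (binom_series n * A n) [k] {0}) \<longlonglongrightarrow> clt_a c k"
    and "length ks \<ge> 2 \<Longrightarrow> (\<lambda>n. sqrt (real n) ^ length ks * cum (word_moment n (binom_series n * A n) ks) {..<length ks})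
      \<longlonglongrightarrow> (if length ks = 2 then clt_b c d (ks ! 0) (ks ! 1) else 0)"
proof -
  define G where "G n k = (if k = 0 then geom_series n else pd k (L n))" for n k
  define c' where "c' = c(0 := 1)"
  have c'0: "c' 0 = 1" by (simp add: c'_def)
  have pd0: "pd 0 (L n) = 0" for n by (rule mps_eqI) (simp add: coef_pd L0)
  have 1: "pd k (binom_series n * A n) = binom_series n * A n * G n k" if "n \<ge> 1" for n k
    unfolding pd_mult pd_binom_series[OF that] A[OF that] G_def using pd0 by (simp add: mult_ac)
  have 2: "coef (binom_series n * A n) {#} = 1" if "n \<ge> 1" for n
    using A1[OF that] by (simp add: binom_series_def)
  have D: "coef (pd k (L n)) M = D0 (L n) (add_mset k M) / (\<Prod>k\<in>set_mset M. fact (count M k))" for k n M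
    unfolding D0_pd[symmetric] by (simp add: D0_def)
  have 3: "(\<lambda>n. coef (G n k) {#}) \<longlonglongrightarrow> c' k" for k
  proof (cases "k = 0")
    case False
    then show ?thesis using lim by (simp add: G_def D c'_def log_limits_def)
  qed (simp add: G_def geom_series_def c'_def)
  have 4: "(\<lambda>n. sqrt (real n) ^ (size M + 1) * coef (G n k) M) \<longlonglongrightarrow> coef (lin (limit_cov d k)) M" if M: "M \<noteq> {#}" for k M
  proof (cases "k = 0")
    case True
    then show ?thesis using geom_series_limit[OF M, of d] by (simp add: G_def)
  next
    case k: False
    consider "0 \<in># M" | j where "M = {#j#}" "j \<ge> 1" | "0 \<notin># M" "size M \<ge> 2"
    proof -
      have "size M = 1 \<or> size M \<ge> 2" using M by (cases "size M") auto
      then show ?thesis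
      proof
        assume "size M = 1"
        then obtain j where "M = {#j#}" using size_1_singleton_mset by blast
        then show ?thesis using that(1) that(2)[of j] by (cases "j = 0") auto
      next
        assume "size M \<ge> 2"
        then show ?thesis using that(1,3) by blast
      qed
    qed
    then show ?thesis
    proof cases
      case 1
      then have "coef (lin (limit_cov d k)) M = 0"
      proof (cases "size M = 1")
        case True
        then obtain j where "M = {#j#}" using size_1_singleton_mset by blast
        then show ?thesis using 1 k by (simp add: limit_cov_def)
      qed (simp add: coef_lin_eq_0)
      moreover have "coef (G n k) M = 0" for n using 1 k by (simp add: G_def coef_pd L0)
      ultimately show ?thesis by simp
    next
      case (2 j)
      have "(\<lambda>n. real n * D0 (L n) {#j, k#}) \<longlonglongrightarrow> d j k" using lim 2 k unfolding log_limits_def by (metis One_nat_def Suc_leI neq0_conv)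
      then show ?thesis using 2 k by (simp add: G_def D limit_cov_def add_mset_commute)
    next
      case 3
      have "(\<lambda>n. sqrt (real n) ^ size (add_mset k M) * D0 (L n) (add_mset k M)) \<longlonglongrightarrow> 0"
      proof -
        have "size (add_mset k M) \<ge> 3" "0 \<notin># add_mset k M" using 3 k by auto
        then show ?thesis using lim unfolding log_limits_def by blast
      qed
      from tendsto_mult_right[OF this, of "1 / (\<Prod>k\<in>set_mset M. fact (count M k))"]
      show ?thesis using 3 k by (simp add: G_def D coef_lin_eq_0 mult_ac)
    qed
  qed
  show "(\<lambda>n. word_moment n (binom_series n * A n) [k] {0}) \<longlonglongrightarrow> clt_a c k"
  proof -
    have "(\<lambda>n. word_moment n (binom_series n * A n) [k] {0}) \<longlonglongrightarrow> toep_pow c' k 0"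
      by (rule word_cumulants_limit(1)[OF 1 2 3 4])
    moreover have "toep_pow c' k 0 = clt_a c' k" using c'0 by (rule toep_pow_0_eq)
    ultimately show ?thesis by (simp add: c'_def clt_a_upd)
  qed
  show "(\<lambda>n. sqrt (real n) ^ length ks * cum (word_moment n (binom_series n * A n) ks) {..<length ks})
      \<longlonglongrightarrow> (if length ks = 2 then clt_b c d (ks ! 0) (ks ! 1) else 0)" if "length ks \<ge> 2"
  proof -
    have "(\<lambda>n. sqrt (real n) ^ length ks * cum (word_moment n (binom_series n * A n) ks) {..<length ks})
      \<longlonglongrightarrow> (if length ks = 2 then lin_cov c' (limit_cov d) (ks ! 0) (ks ! 1) else 0)"
      by (rule word_cumulants_limit(2)[OF 1 2 3 4 that])
    moreover have "lin_cov c' (limit_cov d) k k' = clt_b c' d k k'" for k k' using c'0 by (rule lin_cov_eq_clt_b)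
    ultimately show ?thesis by (simp only: c'_def clt_b_upd)
  qed
qed

section \<open>Normalised characters as power series\<close>

subsection \<open>Series indexed by functions\<close>

definition of_mfps :: "mfps \<Rightarrow> mps" where
  "of_mfps f = Mps (\<lambda>M. f (count M))"

lemma coef_of_mfps [simp]: "coef (of_mfps f) M = f (count M)"
  by (simp add: of_mfps_def)

lemma mfps_mult_count: "mfps_mult f g (count M) = coef (of_mfps f * of_mfps g) M"
proof -
  have "(\<Sum>\<beta>\<in>{\<beta>. \<forall>k. \<beta> k \<le> count M k}. f \<beta> * g (\<lambda>k. count M k - \<beta> k))
    = (\<Sum>N\<in>{N. N \<subseteq># M}. f (count N) * g (count (M - N)))"
  proof (rule sum.reindex_bij_witness[where i = count and j = Abs_multiset])
    fix \<beta> assume "\<beta> \<in> {\<beta>. \<forall>k. \<beta> k \<le> count M k}"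
    then have le: "\<beta> k \<le> count M k" for k by auto
    have "{k. 0 < \<beta> k} \<subseteq> set_mset M"
    proof
      fix k assume "k \<in> {k. 0 < \<beta> k}"
      then have "count M k \<noteq> 0" using le[of k] by simp
      then show "k \<in># M" by (metis not_in_iff)
    qed
    then have fin: "finite {k. 0 < \<beta> k}" by (rule finite_subset) simp
    show b: "count (Abs_multiset \<beta>) = \<beta>" using fin by (simp add: count_Abs_multiset)
    show "Abs_multiset \<beta> \<in> {N. N \<subseteq># M}" using le by (simp add: subseteq_mset_def b)
    show "f (count (Abs_multiset \<beta>)) * g (count (M - Abs_multiset \<beta>)) = f \<beta> * g (\<lambda>k. count M k - \<beta> k)"
    proof -
      have "count (M - Abs_multiset \<beta>) = (\<lambda>k. count M k - \<beta> k)" by (rule ext) (simp add: b)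
      then show ?thesis by (simp add: b)
    qed
  qed (auto simp: subseteq_mset_def count_inverse)
  then show ?thesis by (simp add: mfps_mult_def coef_mult)
qed

lemma mfps_one_count: "mfps_one (count M) = coef 1 M"
proof -
  have "(\<forall>k. count M k = 0) \<longleftrightarrow> M = {#}" by (metis count_empty multiset_eqI)
  then show ?thesis by (simp add: mfps_one_def)
qed

lemma mfps_pow_count: "mfps_pow f m (count M) = coef (of_mfps f ^ m) M"
proof (induction m arbitrary: M)
  case (Suc m)
  have "of_mfps (mfps_pow f m) = of_mfps f ^ m" by (rule mps_eqI) (simp add: Suc)
  then show ?case by (simp add: mfps_mult_count)
qed (simp add: mfps_one_count)

lemma of_mfps_ln: "of_mfps (mfps_ln A) = mln (of_mfps A)"
proof (rule mps_eqI)
  fix M :: "nat multiset"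
  have "{k. count M k \<noteq> 0} = set_mset M" by (auto simp: not_in_iff)
  then have "(\<Sum>k\<in>{k. count M k \<noteq> 0}. count M k) = size M" by (simp add: size_multiset_overloaded_eq)
  moreover have "of_mfps (\<lambda>\<beta>. A \<beta> - mfps_one \<beta>) = of_mfps A - 1"
    by (rule mps_eqI) (simp add: mfps_one_count)
  ultimately show "coef (of_mfps (mfps_ln A)) M = coef (mln (of_mfps A)) M"
    by (simp add: mfps_ln_def mfps_pow_count mln_def)
qed

lemma mfps_pderiv0_eq: "mfps_pderiv0 f xs = D0 (of_mfps f) (mset xs)"
proof -
  have "mindex xs = count (mset xs)" by (rule ext) (simp add: mindex_def count_mset)
  then show ?thesis by (simp add: mfps_pderiv0_def D0_def)
qed

lemma clt_appropriate_iff: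
  "clt_appropriate rho c d \<longleftrightarrow> log_limits (\<lambda>n. mln (of_mfps (youngA n (rho n)))) c d"
proof -
  let ?L = "\<lambda>n. mln (of_mfps (youngA n (rho n)))"
  have "(\<forall>xs. length xs \<ge> 3 \<longrightarrow> (\<forall>i\<in>set xs. i \<ge> 1) \<longrightarrow> (\<lambda>n. sqrt (real n) ^ length xs * D0 (?L n) (mset xs)) \<longlonglongrightarrow> 0)
    \<longleftrightarrow> (\<forall>M. size M \<ge> 3 \<longrightarrow> 0 \<notin># M \<longrightarrow> (\<lambda>n. sqrt (real n) ^ size M * D0 (?L n) M) \<longlonglongrightarrow> 0)" (is "?l \<longleftrightarrow> ?r")
  proof
    assume ?l
    show ?r
    proof (intro allI impI)
      fix M :: "nat multiset" assume M: "size M \<ge> 3" "0 \<notin># M"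
      obtain xs where xs: "mset xs = M" using ex_mset by blast
      have "\<forall>i\<in>set xs. i \<ge> 1" using M(2) xs by (metis One_nat_def Suc_leI gr0I set_mset_mset)
      then show "(\<lambda>n. sqrt (real n) ^ size M * D0 (?L n) M) \<longlonglongrightarrow> 0"
        using \<open>?l\<close> M(1) xs by (metis size_mset)
    qed
  next
    assume ?r
    show ?l
    proof (intro allI impI)
      fix xs :: "nat list" assume xs: "length xs \<ge> 3" "\<forall>i\<in>set xs. i \<ge> 1"
      then have "size (mset xs) \<ge> 3" "0 \<notin># mset xs" by auto
      from \<open>?r\<close>[rule_format, OF this]
      show "(\<lambda>n. sqrt (real n) ^ length xs * D0 (?L n) (mset xs)) \<longlonglongrightarrow> 0" by (simp only: size_mset)
    qed
  qed
  then show ?thesis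
    unfolding clt_appropriate_def log_limits_def mfps_pderiv0_eq of_mfps_ln by (simp only: mset.simps)
qed

subsection \<open>Moments of transition measures as words\<close>

text \<open>\<open>a\<close> of the \<open>n\<close> fixed points are chosen in order; every chosen point and every marked cycle
  costs a factor \<open>1/sqrt n\<close>.\<close>

definition kap :: "nat \<Rightarrow> nat \<Rightarrow> nat \<Rightarrow> real" where
  "kap n a l = fact a * real (n choose a) / sqrt (real n) ^ (a + l)"

lemma kap_Suc_right: "n \<ge> 1 \<Longrightarrow> kap n a (Suc l) = kap n a l / sqrt (real n)"
  by (simp add: kap_def)

lemma kap_Suc_left: "n \<ge> 1 \<Longrightarrow> kap n (Suc a) l = kap n a l * real (n - a) / sqrt (real n)"
proof -
  have "(a + 1) * (n choose (a + 1)) = (n - a) * (n choose a)"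
    by (metis Suc_eq_plus1 binomial_absorb_comp binomial_absorption)
  then have "real (a + 1) * real (n choose (a + 1)) = real (n - a) * real (n choose a)"
    by (metis of_nat_mult)
  then have e: "fact (Suc a) * real (n choose Suc a) = fact a * real (n choose a) * real (n - a)"
    by (simp add: mult_ac)
  show ?thesis unfolding kap_def e by (simp add: mult_ac)
qed

definition represents :: "nat \<Rightarrow> (nat \<Rightarrow> mps) \<Rightarrow> (nat \<Rightarrow> class_fun) \<Rightarrow> bool" where
  "represents n h H \<longleftrightarrow> (\<forall>i \<nu>. 0 \<notin># \<nu> \<longrightarrow> D0 (h i) (replicate_mset (sum_mset \<nu> + i) 0 + \<nu>)
     = kap n (sum_mset \<nu> + i) (size \<nu>) * H i (replicate_mset (n - (sum_mset \<nu> + i)) 1 + \<nu>))"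

text \<open>The steps of the two operators correspond one by one. Splitting off a cycle matches a
  derivative, and joining a cycle matches a variable if the cycle is a part of \<nu> and a
  derivative in x_0 if it is a remaining fixed point; \<open>kap\<close> absorbs the powers of
  n.\<close>

lemma represents_NSx:
  assumes n: "n \<ge> 1" and r: "represents n h H"
  shows "represents n (NSx (\<lambda>k. 0) 1 (1 / real n) h) (\<lambda>i M. NS H i M / sqrt (real n))"
  unfolding represents_def
proof (intro allI impI)
  fix i and \<nu> :: "nat multiset" assume \<nu>: "0 \<notin># \<nu>"
  have D: "D0 (h i) (replicate_mset a 0 + \<nu>) = kap n a (size \<nu>) * H i (replicate_mset (n - a) 1 + \<nu>)"
    if "0 \<notin># \<nu>" "a = sum_mset \<nu> + i" for i \<nu> a using r that by (simp add: represents_def)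
  define a where "a = sum_mset \<nu> + i"
  define l where "l = size \<nu>"
  define s where "s = sqrt (real n)"
  have s: "s > 0" "s * s = real n" using n by (simp_all add: s_def)
  have t1: "D0 (h m) (add_mset (i - m) (replicate_mset a 0 + \<nu>)) = kap n a l / s * H m (add_mset (i - m) (replicate_mset (n - a) 1 + \<nu>))"
    if "m < i" for m
    using D[of "add_mset (i - m) \<nu>" a m] that \<nu> kap_Suc_right[OF n, of a l] by (simp add: a_def l_def s_def)
  \<comment> \<open>The factor n - a is the number of fixed points still available for joining; it
    comes out of the falling factorial in \<open>kap\<close>.\<close>
  have t2: "D0 (h (Suc i)) (add_mset 0 (replicate_mset a 0 + \<nu>)) = kap n a l * real (n - a) / s * H (Suc i) (replicate_mset (n - a - 1) 1 + \<nu>)"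
    using D[of \<nu> "Suc a" "Suc i"] \<nu> kap_Suc_left[OF n, of a l] by (simp add: a_def l_def s_def)
  have t3: "1 / real n * (real j * D0 (h (i + j)) (replicate_mset a 0 + (\<nu> - {#j#}))) = kap n a l / s * (real j * H (i + j) (replicate_mset (n - a) 1 + (\<nu> - {#j#})))"
    if "j \<in># \<nu>" for j
  proof -
    obtain \<nu>' where \<nu>': "\<nu> = add_mset j \<nu>'" using \<open>j \<in># \<nu>\<close> by (meson multi_member_split)
    have "D0 (h (i + j)) (replicate_mset a 0 + \<nu>') = kap n a (size \<nu>') * H (i + j) (replicate_mset (n - a) 1 + \<nu>')"
      using \<nu> by (intro D) (auto simp: a_def \<nu>')
    then have "1 / (s * s) * (real j * D0 (h (i + j)) (replicate_mset a 0 + \<nu>')) = kap n a (size \<nu>') / (s * s) * (real j * H (i + j) (replicate_mset (n - a) 1 + \<nu>'))"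
      by (simp only: times_divide_eq_left times_divide_eq_right mult_1 mult.assoc mult.left_commute)
    also have "kap n a (size \<nu>') / (s * s) = kap n a l / s"
      using kap_Suc_right[OF n, of a "size \<nu>'"] s by (simp add: l_def \<nu>' s_def)
    finally have "1 / (s * s) * (real j * D0 (h (i + j)) (replicate_mset a 0 + \<nu>'))
      = kap n a l / s * (real j * H (i + j) (replicate_mset (n - a) 1 + \<nu>'))" .
    then show ?thesis unfolding s(2)[symmetric] \<nu>' by simp
  qed
  have z: "(\<Sum>j\<in>#replicate_mset a 0. real j * F j) = 0" for F :: "nat \<Rightarrow> real"
    by (induction a) auto
  have o: "(\<Sum>j\<in>#replicate_mset p 1. real j * F j) = real p * F 1" for p and F :: "nat \<Rightarrow> real"
    by (induction p) (auto simp: algebra_simps)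
  have z': "(\<Sum>j\<in>#replicate_mset a 0 + \<nu>. real j * D0 (h (i + j)) (replicate_mset a 0 + \<nu> - {#j#}))
    = (\<Sum>j\<in>#\<nu>. real j * D0 (h (i + j)) (replicate_mset a 0 + (\<nu> - {#j#})))"
    unfolding image_mset_union sum_mset.union z[where F = "\<lambda>j. D0 (h (i + j)) (replicate_mset a 0 + \<nu> - {#j#})"]
  proof -
    have "(\<Sum>j\<in>#\<nu>. real j * D0 (h (i + j)) (replicate_mset a 0 + \<nu> - {#j#})) = (\<Sum>j\<in>#\<nu>. real j * D0 (h (i + j)) (replicate_mset a 0 + (\<nu> - {#j#})))"
      by (intro arg_cong[where f = sum_mset] image_mset_cong) (auto dest!: multi_member_split)
    then show "0 + (\<Sum>j\<in>#\<nu>. real j * D0 (h (i + j)) (replicate_mset a 0 + \<nu> - {#j#})) = (\<Sum>j\<in>#\<nu>. real j * D0 (h (i + j)) (replicate_mset a 0 + (\<nu> - {#j#})))"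
      by simp
  qed
  have ps: "psum (\<lambda>j. H (i + j)) (replicate_mset p 1 + \<nu>)
    = real p * H (Suc i) (replicate_mset (p - 1) 1 + \<nu>) + (\<Sum>j\<in>#\<nu>. real j * H (i + j) (replicate_mset p 1 + (\<nu> - {#j#})))" for p
  proof -
    have "(\<Sum>j\<in>#replicate_mset p 1. real j * H (i + j) (replicate_mset p 1 + \<nu> - {#j#})) = real p * H (Suc i) (replicate_mset (p - 1) 1 + \<nu>)"
      unfolding o[where F = "\<lambda>j. H (i + j) (replicate_mset p 1 + \<nu> - {#j#})"] by (cases p) simp_all
    moreover have "(\<Sum>j\<in>#\<nu>. real j * H (i + j) (replicate_mset p 1 + \<nu> - {#j#})) = (\<Sum>j\<in>#\<nu>. real j * H (i + j) (replicate_mset p 1 + (\<nu> - {#j#})))"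
      by (intro arg_cong[where f = sum_mset] image_mset_cong) (auto dest!: multi_member_split)
    ultimately show ?thesis by (simp add: psum_def)
  qed
  have "D0 (NSx (\<lambda>k. 0) 1 (1 / real n) h i) (replicate_mset a 0 + \<nu>)
    = (\<Sum>m<i. kap n a l / s * H m (add_mset (i - m) (replicate_mset (n - a) 1 + \<nu>)))
     + kap n a l * real (n - a) / s * H (Suc i) (replicate_mset (n - a - 1) 1 + \<nu>)
     + (\<Sum>j\<in>#\<nu>. 1 / real n * (real j * D0 (h (i + j)) (replicate_mset a 0 + (\<nu> - {#j#}))))"
    unfolding D0_NSx t2 z' by (simp add: t1 sum_mset_distrib_left)
  also have "(\<Sum>j\<in>#\<nu>. 1 / real n * (real j * D0 (h (i + j)) (replicate_mset a 0 + (\<nu> - {#j#}))))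
    = (\<Sum>j\<in>#\<nu>. kap n a l / s * (real j * H (i + j) (replicate_mset (n - a) 1 + (\<nu> - {#j#}))))"
    by (intro arg_cong[where f = sum_mset] image_mset_cong t3)
  also have "(\<Sum>m<i. kap n a l / s * H m (add_mset (i - m) (replicate_mset (n - a) 1 + \<nu>)))
     + kap n a l * real (n - a) / s * H (Suc i) (replicate_mset (n - a - 1) 1 + \<nu>) + \<dots>
     = kap n a l / s * NS H i (replicate_mset (n - a) 1 + \<nu>)"
    unfolding NS_def ps distrib_left sum_distrib_left sum_mset_distrib_left by (simp add: add.assoc mult.assoc)
  finally show "D0 (NSx (\<lambda>k. 0) 1 (1 / real n) h i) (replicate_mset (sum_mset \<nu> + i) 0 + \<nu>)
    = kap n (sum_mset \<nu> + i) (size \<nu>) * (NS H i (replicate_mset (n - (sum_mset \<nu> + i)) 1 + \<nu>) / sqrt (real n))"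
    by (simp add: a_def l_def s_def)
qed

definition represents1 :: "nat \<Rightarrow> mps \<Rightarrow> class_fun \<Rightarrow> bool" where
  "represents1 n f F \<longleftrightarrow> represents n (vacx f) (vac F)"

lemma represents1_iff:
  "represents1 n f F \<longleftrightarrow> (\<forall>\<nu>. 0 \<notin># \<nu> \<longrightarrow> D0 f (replicate_mset (sum_mset \<nu>) 0 + \<nu>)
     = kap n (sum_mset \<nu>) (size \<nu>) * F (replicate_mset (n - sum_mset \<nu>) 1 + \<nu>))"
  (is "_ \<longleftrightarrow> ?r")
proof
  assume "represents1 n f F"
  then have r: "0 \<notin># \<nu> \<Longrightarrow> D0 (vacx f i) (replicate_mset (sum_mset \<nu> + i) 0 + \<nu>)
     = kap n (sum_mset \<nu> + i) (size \<nu>) * vac F i (replicate_mset (n - (sum_mset \<nu> + i)) 1 + \<nu>)" for \<nu> i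
    unfolding represents1_def represents_def by blast
  show ?r using r[where i = 0] by (simp add: vacx_def vac_def)
next
  assume ?r
  then show "represents1 n f F" unfolding represents1_def represents_def by (auto simp: vacx_def vac_def)
qed

lemma represents1_Xop:
  assumes n: "n \<ge> 1" and r: "represents1 n f F"
  shows "represents1 n (Xop n k f) (\<lambda>M. NS_moment k F M / sqrt (real n) ^ k)"
proof -
  have "represents n ((NSx (\<lambda>k. 0) 1 (1 / real n) ^^ t) (vacx f)) (\<lambda>i M. (NS ^^ t) (vac F) i M / sqrt (real n) ^ t)" for t
  proof (induction t)
    case 0
    show ?case using r by (simp add: represents1_def)
  next
    case (Suc t)
    have "NS (\<lambda>i M. (NS ^^ t) (vac F) i M / sqrt (real n) ^ t) = (\<lambda>i M. (1 / sqrt (real n) ^ t) * NS ((NS ^^ t) (vac F)) i M)"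
      unfolding NS_mult[symmetric] by simp
    then show ?case using represents_NSx[OF n Suc] by (simp add: mult.commute)
  qed
  then have r: "0 \<notin># \<nu> \<Longrightarrow> D0 ((NSx (\<lambda>k. 0) 1 (1 / real n) ^^ k) (vacx f) i) (replicate_mset (sum_mset \<nu> + i) 0 + \<nu>)
     = kap n (sum_mset \<nu> + i) (size \<nu>) * ((NS ^^ k) (vac F) i (replicate_mset (n - (sum_mset \<nu> + i)) 1 + \<nu>) / sqrt (real n) ^ k)" for \<nu> i
    unfolding represents_def by blast
  show ?thesis
    unfolding represents1_iff NSx_moment_def NS_moment_def using r[where i = 0] by simp
qed

section \<open>Averaged normalised characters and mixed moments\<close>

lemma finite_Part: "finite (Part n)"
proof (rule finite_subset)
  show "Part n \<subseteq> {xs. set xs \<subseteq> {..n} \<and> length xs \<le> n}"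
    using Part_length member_le_sum_list by (fastforce simp: Part_def)
qed (simp add: finite_lists_length_le)

lemma expectation_Part:
  assumes "set_pmf rho \<subseteq> Part n"
  shows "measure_pmf.expectation rho f = (\<Sum>lam\<in>Part n. f lam * pmf rho lam)"
  by (rule integral_measure_pmf_real[OF finite_Part]) (use assms in blast)

definition mean_char :: "nat \<Rightarrow> nat list pmf \<Rightarrow> class_fun" where
  "mean_char n rho M = (\<Sum>lam\<in>Part n. pmf rho lam / real_of_int (dimY lam) * chi lam M)"

text \<open>The characters are common eigenfunctions, so a word acts on their average by inserting
  the product of the eigenvalues.\<close>

lemma word_mean_char:
  "foldr (\<lambda>k F M. NS_moment k F M / sqrt (real n) ^ k) ks (mean_char n rho)
    = (\<lambda>M. \<Sum>lam\<in>Part n. pmf rho lam / real_of_int (dimY lam) * prod_list (map (\<lambda>k. Xk n k lam) ks) * chi lam M)"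
proof (induction ks)
  case Nil
  show ?case by (rule ext) (simp add: mean_char_def)
next
  case (Cons k ks)
  show ?case
  proof (rule ext)
    fix M
    have "foldr (\<lambda>k F M. NS_moment k F M / sqrt (real n) ^ k) (k # ks) (mean_char n rho) M
      = (\<Sum>lam\<in>Part n. pmf rho lam / real_of_int (dimY lam) * prod_list (map (\<lambda>k. Xk n k lam) ks) * NS_moment k (chi lam) M) / sqrt (real n) ^ k"
      unfolding foldr.simps o_apply Cons NS_moment_sum NS_moment_mult ..
    also have "\<dots> = (\<Sum>lam\<in>Part n. pmf rho lam / real_of_int (dimY lam) * prod_list (map (\<lambda>k. Xk n k lam) (k # ks)) * chi lam M)"
      unfolding sum_divide_distrib by (intro sum.cong refl) (simp add: NS_moment_chi Xk_def)
    finally show "foldr (\<lambda>k F M. NS_moment k F M / sqrt (real n) ^ k) (k # ks) (mean_char n rho) M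
      = (\<Sum>lam\<in>Part n. pmf rho lam / real_of_int (dimY lam) * prod_list (map (\<lambda>k. Xk n k lam) (k # ks)) * chi lam M)" .
  qed
qed

lemma chi_ones: "lam \<in> Part n \<Longrightarrow> chi lam (replicate_mset n 1) = real_of_int (dimY lam)"
  using chi_irr_char[of lam n "replicate n 1"] by (auto simp: dimY_def Part_def)

lemma sum_mset_eq_sum:
  assumes "finite A" "set_mset \<nu> \<subseteq> A"
  shows "sum_mset \<nu> = (\<Sum>k\<in>A. count \<nu> k * k)"
proof -
  have "real (sum_mset \<nu>) = (\<Sum>k\<in>#\<nu>. real k)" by simp
  also have "\<dots> = (\<Sum>k\<in>A. real (count \<nu> k) * real k)" by (rule sum_mset_count[OF assms])
  also have "\<dots> = real (\<Sum>k\<in>A. count \<nu> k * k)" by simp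
  finally show ?thesis by (simp only: of_nat_eq_iff)
qed

lemma count_concat_replicate:
  "distinct xs \<Longrightarrow> count (mset (concat (map (\<lambda>k. replicate (f k) k) xs))) j = (if j \<in> set xs then f j else 0)"
  by (induction xs) auto

text \<open>Each part k carries n^((k-1)/2); the factor sqrt n per part on the left completes this
  to n^(k/2), so the power on the right depends only on the number of points.\<close>

lemma D0_youngA:
  assumes n: "n \<ge> 1" and rho: "set_pmf rho \<subseteq> Part n" and \<nu>: "0 \<notin># \<nu>" "sum_mset \<nu> \<le> n"
  shows "D0 (of_mfps (youngA n rho)) \<nu> * sqrt (real n) ^ size \<nu>
    = sqrt (real n) ^ sum_mset \<nu> * mean_char n rho (replicate_mset (n - sum_mset \<nu>) 1 + \<nu>)"
proof -
  define B where "B = {k. k \<ge> 2 \<and> count \<nu> k \<noteq> 0}"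
  define s where "s = (\<Sum>k\<in>B. k * count \<nu> k)"
  have supp: "{k. count \<nu> k \<noteq> 0} = set_mset \<nu>" by (auto simp: not_in_iff)
  have "B \<subseteq> set_mset \<nu>" unfolding B_def supp[symmetric] by blast
  then have B: "finite B" "1 \<notin> B" by (auto simp: B_def intro: finite_subset)
  have sub: "set_mset \<nu> \<subseteq> insert 1 B"
  proof
    fix k assume k: "k \<in># \<nu>"
    then have "k \<noteq> 0" "count \<nu> k \<noteq> 0" using \<nu>(1) by (metis, metis not_in_iff)
    then show "k \<in> insert 1 B" by (auto simp: B_def)
  qed
  have sm: "sum_mset \<nu> = s + count \<nu> 1"
    using sum_mset_eq_sum[OF _ sub] B by (simp add: s_def mult.commute)
  define mu where "mu = concat (map (\<lambda>k. replicate (count \<nu> k) k) [2..<n+1]) @ replicate (n - s) 1"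
  have mu: "mset mu = replicate_mset (n - sum_mset \<nu>) 1 + \<nu>"
  proof (rule multiset_eqI)
    fix k
    have big: "count \<nu> k = 0" if "k > n"
    proof (rule ccontr)
      assume "count \<nu> k \<noteq> 0"
      then have "k \<in># \<nu>" by (metis not_in_iff)
      then obtain \<nu>' where "\<nu> = add_mset k \<nu>'" by (meson multi_member_split)
      then show False using \<nu>(2) that by simp
    qed
    have z: "count \<nu> 0 = 0" using \<nu>(1) by (simp add: not_in_iff)
    have "count (mset mu) k = (if k \<in> set [2..<n+1] then count \<nu> k else 0) + (if k = 1 then n - s else 0)"
      unfolding mu_def mset_append count_union by (subst count_concat_replicate) auto
    also have "\<dots> = count (replicate_mset (n - sum_mset \<nu>) 1 + \<nu>) k"
    proof -
      consider "k = 0" | "k = 1" | "2 \<le> k" "k \<le> n" | "k > n" by linarith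
      then show ?thesis
      proof cases
        case 2
        then show ?thesis using sm \<nu>(2) by simp
      next
        case 4
        then show ?thesis using big n by auto
      qed (use z in auto)
    qed
    finally show "count (mset mu) k = count (replicate_mset (n - sum_mset \<nu>) 1 + \<nu>) k" .
  qed
  have mu0: "0 \<notin> set mu" by (auto simp: mu_def)
  have "s \<le> n" using sm \<nu>(2) by simp
  then have "M_rho n rho (count \<nu>) = measure_pmf.expectation rho (\<lambda>lam. real_of_int (irr_char lam mu) / real_of_int (dimY lam))"
    by (simp add: M_rho_def Let_def s_def B_def mu_def)
  also have "\<dots> = mean_char n rho (mset mu)"
    unfolding expectation_Part[OF rho] mean_char_def by (intro sum.cong refl) (simp add: chi_irr_char[OF _ mu0])
  finally have M: "M_rho n rho (count \<nu>) = mean_char n rho (replicate_mset (n - sum_mset \<nu>) 1 + \<nu>)" unfolding mu .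
  have "D0 (of_mfps (youngA n rho)) \<nu> = M_rho n rho (count \<nu>) * ((\<Prod>k\<in>set_mset \<nu>. sqrt (real n) ^ (count \<nu> k * (k - 1)) / fact (count \<nu> k)) * (\<Prod>k\<in>set_mset \<nu>. fact (count \<nu> k)))"
    using \<nu>(1) by (simp add: D0_def youngA_def supp not_in_iff)
  also have "(\<Prod>k\<in>set_mset \<nu>. sqrt (real n) ^ (count \<nu> k * (k - 1)) / fact (count \<nu> k)) * (\<Prod>k\<in>set_mset \<nu>. fact (count \<nu> k))
    = sqrt (real n) ^ (\<Sum>k\<in>set_mset \<nu>. count \<nu> k * (k - 1))"
    by (simp add: prod.distrib[symmetric] power_sum)
  finally have "D0 (of_mfps (youngA n rho)) \<nu> * sqrt (real n) ^ size \<nu>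
    = M_rho n rho (count \<nu>) * sqrt (real n) ^ ((\<Sum>k\<in>set_mset \<nu>. count \<nu> k * (k - 1)) + size \<nu>)"
    by (simp add: power_add)
  also have "(\<Sum>k\<in>set_mset \<nu>. count \<nu> k * (k - 1)) + size \<nu> = sum_mset \<nu>"
  proof -
    have "count \<nu> k * (k - 1) + count \<nu> k = count \<nu> k * k" if "k \<in># \<nu>" for k
      using that \<nu>(1) by (cases k) auto
    then show ?thesis
      unfolding size_multiset_overloaded_eq sum_mset_eq_sum[OF finite_set_mset subset_refl] sum.distrib[symmetric]
      by (intro sum.cong) auto
  qed
  finally show ?thesis unfolding M by (simp add: mult.commute)
qed

lemma coef_youngA_0:
  assumes "0 \<in># M"
  shows "coef (of_mfps (youngA n rho)) M = 0"
proof -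
  have "count M 0 \<noteq> 0" using assms by (metis not_in_iff)
  then have "\<not> (count M 0 = 0 \<and> finite {k. count M k \<noteq> 0})" by blast
  then show ?thesis unfolding coef_of_mfps youngA_def by (rule if_not_P)
qed

lemma represents1_youngA:
  assumes n: "n \<ge> 1" and rho: "set_pmf rho \<subseteq> Part n"
  shows "represents1 n (binom_series n * of_mfps (youngA n rho)) (mean_char n rho)"
  unfolding represents1_iff
proof (intro allI impI)
  fix \<nu> :: "nat multiset" assume \<nu>: "0 \<notin># \<nu>"
  define a s where "a = sum_mset \<nu>" and "s = sqrt (real n)"
  have s: "s > 0" "real n = s * s" using n by (simp_all add: s_def)
  have "D0 (binom_series n * of_mfps (youngA n rho)) (replicate_mset a 0 + \<nu>) = fact a * real (n choose a) / real n ^ a * D0 (of_mfps (youngA n rho)) \<nu>"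
    by (rule D0_binom_mult[OF coef_youngA_0 \<nu>])
  also have "\<dots> = kap n a (size \<nu>) * mean_char n rho (replicate_mset (n - a) 1 + \<nu>)"
  proof (cases "a \<le> n")
    case True
    then have "D0 (of_mfps (youngA n rho)) \<nu> * s ^ size \<nu> = s ^ a * mean_char n rho (replicate_mset (n - a) 1 + \<nu>)"
      using D0_youngA[OF n rho \<nu>] by (simp add: a_def s_def)
    then have "D0 (of_mfps (youngA n rho)) \<nu> = s ^ a * mean_char n rho (replicate_mset (n - a) 1 + \<nu>) / s ^ size \<nu>"
      using s by (simp add: field_simps)
    then show ?thesis unfolding kap_def s_def[symmetric] using s by (simp add: power_mult_distrib power_add)
  next
    case False
    then have "n choose a = 0" by simp
    then show ?thesis unfolding kap_def by (simp only: of_nat_0 mult_zero_right mult_zero_left div_0)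
  qed
  finally show "D0 (binom_series n * of_mfps (youngA n rho)) (replicate_mset (sum_mset \<nu>) 0 + \<nu>)
    = kap n (sum_mset \<nu>) (size \<nu>) * mean_char n rho (replicate_mset (n - sum_mset \<nu>) 1 + \<nu>)" by (simp add: a_def)
qed

text \<open>The constant term of the represented series is a value at the identity, where normalised
  characters equal 1 and only the eigenvalues remain.\<close>

theorem word_moment_youngA:
  assumes n: "n \<ge> 1" and rho: "set_pmf rho \<subseteq> Part n" and S: "finite S"
  shows "word_moment n (binom_series n * of_mfps (youngA n rho)) ks S
    = measure_pmf.expectation rho (\<lambda>lam. \<Prod>j\<in>S. Xk n (ks ! j) lam)"
proof -
  define w where "w = subword ks S"
  have rep: "represents1 n (foldr (Xop n) xs (binom_series n * of_mfps (youngA n rho)))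
    (foldr (\<lambda>k F M. NS_moment k F M / sqrt (real n) ^ k) xs (mean_char n rho))" for xs
    by (induction xs) (simp_all add: represents1_youngA[OF n rho] represents1_Xop[OF n])
  have pl: "prod_list (map (\<lambda>k. Xk n k lam) w) = (\<Prod>j\<in>S. Xk n (ks ! j) lam)" for lam
  proof -
    have "prod_list (map (\<lambda>j. Xk n (ks ! j) lam) (sorted_list_of_set S)) = (\<Prod>j\<in>set (sorted_list_of_set S). Xk n (ks ! j) lam)"
      by (rule prod.distinct_set_conv_list[symmetric]) simp
    then show ?thesis using S by (simp add: w_def subword_def o_def)
  qed
  from rep[of w]
  have "coef (foldr (Xop n) w (binom_series n * of_mfps (youngA n rho))) {#}
    = (foldr (\<lambda>k F M. NS_moment k F M / sqrt (real n) ^ k) w (mean_char n rho)) (replicate_mset n 1)"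
    unfolding represents1_iff by (drule_tac x = "{#}" in spec) (simp add: kap_def)
  also have "\<dots> = (\<Sum>lam\<in>Part n. prod_list (map (\<lambda>k. Xk n k lam) w) * pmf rho lam)"
    unfolding word_mean_char
  proof (intro sum.cong refl)
    fix lam assume lam: "lam \<in> Part n"
    then have "real_of_int (dimY lam) > 0" using dimY_pos by simp
    then show "pmf rho lam / real_of_int (dimY lam) * prod_list (map (\<lambda>k. Xk n k lam) w) * chi lam (replicate_mset n 1)
      = prod_list (map (\<lambda>k. Xk n k lam) w) * pmf rho lam" using chi_ones[OF lam] by simp
  qed
  finally show ?thesis unfolding word_moment_def w_def[symmetric] expectation_Part[OF rho] pl .
qed

lemma joint_cumulant_eq_cum:
  assumes "n \<ge> 1" "set_pmf rho \<subseteq> Part n"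
  shows "joint_cumulant rho (map (Xk n) ks) = cum (word_moment n (binom_series n * of_mfps (youngA n rho)) ks) {..<length ks}"
proof -
  have "joint_cumulant rho (map (Xk n) ks) = cum (\<lambda>B. measure_pmf.expectation rho (\<lambda>lam. \<Prod>j\<in>B. (map (Xk n) ks ! j) lam)) {..<length ks}"
    by (simp add: joint_cumulant_def cum_def)
  also have "\<dots> = cum (word_moment n (binom_series n * of_mfps (youngA n rho)) ks) {..<length ks}"
  proof (rule cum_cong)
    fix B assume B: "B \<subseteq> {..<length ks}"
    then have "(\<lambda>lam. \<Prod>j\<in>B. (map (Xk n) ks ! j) lam) = (\<lambda>lam. \<Prod>j\<in>B. Xk n (ks ! j) lam)"
      by (intro ext prod.cong) auto
    then show "measure_pmf.expectation rho (\<lambda>lam. \<Prod>j\<in>B. (map (Xk n) ks ! j) lam)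
      = word_moment n (binom_series n * of_mfps (youngA n rho)) ks B"
      using word_moment_youngA[OF assms finite_subset[OF B]] by simp
  qed
  finally show ?thesis .
qed

lemma coef_youngA_empty:
  assumes "n \<ge> 1" "set_pmf rho \<subseteq> Part n"
  shows "coef (of_mfps (youngA n rho)) {#} = 1"
proof -
  have "D0 (of_mfps (youngA n rho)) {#} = mean_char n rho (replicate_mset n 1)"
    using D0_youngA[OF assms, of "{#}"] by simp
  also have "\<dots> = (\<Sum>lam\<in>Part n. 1 * pmf rho lam)"
    unfolding mean_char_def
  proof (intro sum.cong refl)
    fix lam assume lam: "lam \<in> Part n"
    then have "real_of_int (dimY lam) > 0" using dimY_pos by simp
    then show "pmf rho lam / real_of_int (dimY lam) * chi lam (replicate_mset n 1) = 1 * pmf rho lam" using chi_ones[OF lam] by simp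
  qed
  also have "\<dots> = measure_pmf.expectation rho (\<lambda>_. 1)" by (rule expectation_Part[OF assms(2), symmetric])
  also have "\<dots> = 1" by simp
  finally show ?thesis by simp
qed

section \<open>Recovering the logarithm from the cumulants\<close>

lemma mps_cancel_left:
  assumes "coef f {#} = 1" "f * g = 0"
  shows "g = 0"
proof (rule mps_eqI)
  fix M
  show "coef g M = coef 0 M"
  proof (induction M rule: measure_induct_rule[of size])
    case (less M)
    have "coef (f * g) M = (\<Sum>N\<in>{{#}}. coef f N * coef g (M - N))"
      unfolding coef_mult
    proof (rule sum.mono_neutral_right)
      show "\<forall>N\<in>{N. N \<subseteq># M} - {{#}}. coef f N * coef g (M - N) = 0"
      proof
        fix N assume N: "N \<in> {N. N \<subseteq># M} - {{#}}"
        then have "size N > 0" "size N \<le> size M" by (auto simp: nonempty_has_size[symmetric] size_mset_mono)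
        then have "size (M - N) < size M" using N by (simp add: size_Diff_submset)
        then show "coef f N * coef g (M - N) = 0" using less by simp
      qed
    qed auto
    then show ?case using assms by simp
  qed
qed

text \<open>A coefficient of a series is the same coefficient of its logarithm plus products over
  proper submultisets, and on those the two series agree.\<close>

lemma exp_log_diff:
  assumes A: "\<And>k. pd k A = A * pd k L" "coef A {#} = 1" and A': "\<And>k. pd k A' = A' * pd k L'" "coef A' {#} = 1"
    and M: "M \<noteq> {#}" and L: "\<And>N. N \<subset># M \<Longrightarrow> N \<noteq> {#} \<Longrightarrow> coef L N = coef L' N"
    and eq: "\<And>N. N \<subset># M \<Longrightarrow> coef A N = coef A' N"
  shows "coef A M - coef A' M = coef L M - coef L' M"
proof -
  obtain k P where P: "M = add_mset k P" using M by (cases M) auto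
  have PM: "P \<subset># M" by (simp add: P)
  let ?S = "{N. N \<subseteq># P}"
  have ins: "?S = insert {#} (?S - {{#}})" by auto
  have split: "real (count P k + 1) * coef B M = coef (pd k K) P + (\<Sum>N\<in>?S - {{#}}. coef B N * coef (pd k K) (P - N))"
    if "pd k B = B * pd k K" "coef B {#} = 1" for B K
  proof -
    have "real (count P k + 1) * coef B M = coef (B * pd k K) P" unfolding that(1)[symmetric] by (simp add: P coef_pd)
    also have "\<dots> = (\<Sum>N\<in>insert {#} (?S - {{#}}). coef B N * coef (pd k K) (P - N))" unfolding coef_mult using ins by simp
    also have "\<dots> = coef (pd k K) P + (\<Sum>N\<in>?S - {{#}}. coef B N * coef (pd k K) (P - N))"
      using that(2) by (subst sum.insert) auto
    finally show ?thesis .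
  qed
  have "(\<Sum>N\<in>?S - {{#}}. coef A N * coef (pd k L) (P - N)) = (\<Sum>N\<in>?S - {{#}}. coef A' N * coef (pd k L') (P - N))"
  proof (rule sum.cong[OF refl])
    fix N assume N: "N \<in> ?S - {{#}}"
    then have "N \<subset># M" using PM by (auto intro: subset_mset.le_less_trans)
    moreover have "add_mset k (P - N) \<subset># M"
    proof -
      have "size N > 0" "size N \<le> size P" using N by (auto simp: nonempty_has_size[symmetric] size_mset_mono)
      then have "size (P - N) < size P" using N by (simp add: size_Diff_submset)
      then have "P - N \<noteq> P" by auto
      then have "P - N \<subset># P" by (simp add: subset_mset.less_le)
      then show ?thesis by (simp add: P)
    qed
    ultimately show "coef A N * coef (pd k L) (P - N) = coef A' N * coef (pd k L') (P - N)"
      using L eq by (simp add: coef_pd)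
  qed
  then have "real (count P k + 1) * coef A M - real (count P k + 1) * coef A' M = coef (pd k L) P - coef (pd k L') P"
    unfolding split[OF A] split[OF A'] by simp
  also have "\<dots> = real (count P k + 1) * (coef L M - coef L' M)"
    by (simp add: coef_pd P right_diff_distrib)
  finally have "real (count P k + 1) * (coef A M - coef A' M) = real (count P k + 1) * (coef L M - coef L' M)"
    by (simp only: right_diff_distrib)
  then show ?thesis by (simp del: of_nat_add of_nat_Suc)
qed

lemma exp_log_cong:
  assumes A: "\<And>k. pd k A = A * pd k L" "coef A {#} = 1" and A': "\<And>k. pd k A' = A' * pd k L'" "coef A' {#} = 1"
    and L: "\<And>N. N \<subseteq># M \<Longrightarrow> N \<noteq> {#} \<Longrightarrow> coef L N = coef L' N"
  shows "coef A M = coef A' M"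
  using L
proof (induction M rule: measure_induct_rule[of size])
  case (less M)
  show ?case
  proof (cases "M = {#}")
    case False
    have "coef A M - coef A' M = coef L M - coef L' M"
    proof (rule exp_log_diff[OF A A' False])
      fix N assume N: "N \<subset># M"
      show "N \<noteq> {#} \<Longrightarrow> coef L N = coef L' N" using less.prems N by (simp add: subset_mset.less_imp_le)
      show "coef A N = coef A' N"
        using N by (intro less.IH less.prems) (auto simp: mset_subset_size intro: subset_mset.order_trans subset_mset.less_imp_le)
    qed
    then show ?thesis using less.prems[of M] False by simp
  qed (simp add: A A')
qed

lemma D0_diff_eqI: "coef A M - coef A' M = coef L M - coef L' M \<Longrightarrow> D0 A M - D0 A' M = D0 L M - D0 L' M"
  by (simp add: D0_def left_diff_distrib[symmetric])

subsection \<open>Leading terms of words\<close>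

text \<open>Reading a word in the operators \<open>Xop n k\<close> as a sum over walks, every letter raises
  \<open>rdeg \<nu>\<close> plus the current level by at most one, with equality only if no part of
  size at least 2 is removed and no part of size 1 is created.\<close>

definition rdeg :: "nat multiset \<Rightarrow> nat" where
  "rdeg M = (\<Sum>j\<in>#M. if j \<ge> 2 then j + 1 else 0)"

definition rlen :: "nat multiset \<Rightarrow> nat" where
  "rlen M = size (filter_mset (\<lambda>j. j \<ge> 2) M)"

lemma rdeg_empty [simp]: "rdeg {#} = 0" and rdeg_add [simp]: "rdeg (add_mset j M) = (if j \<ge> 2 then j + 1 else 0) + rdeg M"
  by (simp_all add: rdeg_def)

lemma rlen_empty [simp]: "rlen {#} = 0" and rlen_add [simp]: "rlen (add_mset j M) = (if j \<ge> 2 then 1 else 0) + rlen M"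
  by (simp_all add: rlen_def)

lemma rlen_le_rdeg: "rlen M \<le> rdeg M"
  by (induction M) auto

text \<open>Among multisets of equal \<open>rdeg\<close> those with more parts count as lower.
  Derivatives in x_0 are unrestricted, since the walks add them without affecting
  \<open>rdeg\<close>.\<close>

definition vanishes :: "nat \<Rightarrow> nat \<Rightarrow> mps \<Rightarrow> bool" where
  "vanishes d r F \<longleftrightarrow> (\<forall>a \<nu>. 0 \<notin># \<nu> \<longrightarrow> rdeg \<nu> < d \<or> rdeg \<nu> = d \<and> rlen \<nu> > r \<longrightarrow> D0 F (replicate_mset a 0 + \<nu>) = 0)"

lemma D0_NSx_0:
  assumes "0 \<notin># \<nu>"
  shows "D0 (NSx (\<lambda>k. 0) 1 u h i) (replicate_mset a 0 + \<nu>)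
    = (\<Sum>m<i. D0 (h m) (replicate_mset a 0 + add_mset (i - m) \<nu>)) + D0 (h (Suc i)) (replicate_mset (Suc a) 0 + \<nu>)
     + u * (\<Sum>j\<in>#\<nu>. real j * D0 (h (i + j)) (replicate_mset a 0 + (\<nu> - {#j#})))"
proof -
  have z: "(\<Sum>j\<in>#replicate_mset a 0. real j * F j) = 0" for F :: "nat \<Rightarrow> real"
    by (induction a) auto
  have "(\<Sum>j\<in>#\<nu>. real j * D0 (h (i + j)) (replicate_mset a 0 + \<nu> - {#j#})) = (\<Sum>j\<in>#\<nu>. real j * D0 (h (i + j)) (replicate_mset a 0 + (\<nu> - {#j#})))"
    by (intro arg_cong[where f = sum_mset] image_mset_cong) (auto dest!: multi_member_split)
  then show ?thesis
    unfolding D0_NSx image_mset_union sum_mset.union z[where F = "\<lambda>j. D0 (h (i + j)) (replicate_mset a 0 + \<nu> - {#j#})"] by simp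
qed

text \<open>In t steps the walk gains at most t. The extra 1 next to \<open>rlen\<close> is the part
  of size at least 2 that an extremal walk must still create in order to fall back to level
  0.\<close>

lemma walk_vanishes:
  assumes F: "vanishes d r F"
  shows "0 \<notin># \<nu> \<Longrightarrow> rdeg \<nu> + i + t < d \<or> rdeg \<nu> + i + t = d \<and> rlen \<nu> + (if i > 0 \<or> t > 0 then 1 else 0) > r
    \<Longrightarrow> D0 ((NSx (\<lambda>k. 0) 1 u ^^ t) (vacx F) i) (replicate_mset a 0 + \<nu>) = 0"
proof (induction t arbitrary: i a \<nu>)
  case 0
  then show ?case using F unfolding vanishes_def by (cases "i = 0") (auto simp: vacx_def)
next
  case (Suc t)
  let ?h = "(NSx (\<lambda>k. 0) 1 u ^^ t) (vacx F)"
  have le: "rdeg \<nu> + i + t < d" using Suc.prems(2) by auto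
  have 1: "D0 (?h m) (replicate_mset a 0 + add_mset (i - m) \<nu>) = 0" if "m < i" for m
  proof (rule Suc.IH)
    show "0 \<notin># add_mset (i - m) \<nu>" using Suc.prems(1) that by auto
    show "rdeg (add_mset (i - m) \<nu>) + m + t < d \<or> rdeg (add_mset (i - m) \<nu>) + m + t = d \<and> rlen (add_mset (i - m) \<nu>) + (if m > 0 \<or> t > 0 then 1 else 0) > r"
      using that Suc.prems(2) le by (cases "i - m \<ge> 2") auto
  qed
  have 2: "D0 (?h (Suc i)) (replicate_mset (Suc a) 0 + \<nu>) = 0"
    using Suc.prems by (intro Suc.IH) auto
  have 3: "D0 (?h (i + j)) (replicate_mset a 0 + (\<nu> - {#j#})) = 0" if "j \<in># \<nu>" for j
  proof -
    obtain \<nu>' where \<nu>': "\<nu> = add_mset j \<nu>'" using \<open>j \<in># \<nu>\<close> by (meson multi_member_split)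
    have j: "j \<noteq> 0" "0 \<notin># \<nu>'" using Suc.prems(1) \<nu>' by auto
    have "D0 (?h (i + j)) (replicate_mset a 0 + \<nu>') = 0"
    proof (rule Suc.IH[OF j(2)])
      show "rdeg \<nu>' + (i + j) + t < d \<or> rdeg \<nu>' + (i + j) + t = d \<and> rlen \<nu>' + (if i + j > 0 \<or> t > 0 then 1 else 0) > r"
        using Suc.prems(2) le j unfolding \<nu>' by (cases "j \<ge> 2") auto
    qed
    then show ?thesis by (simp add: \<nu>')
  qed
  have "(\<Sum>j\<in>#\<nu>. real j * D0 (?h (i + j)) (replicate_mset a 0 + (\<nu> - {#j#}))) = 0"
    using 3 by (intro sum_mset.neutral) auto
  then show ?case
    unfolding funpow.simps o_apply D0_NSx_0[OF Suc.prems(1)] using 1 2 by (simp del: replicate_mset_Suc)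
qed

text \<open>The only surviving walk climbs t steps and falls to level 0 in one go, creating the part
  i + t. Any earlier fall creates an additional part, which makes the number of parts too large, and
  using up a part of \<nu> loses \<open>rdeg\<close>.\<close>

lemma walk_leading:
  assumes F: "vanishes d r F"
  shows "0 \<notin># \<nu> \<Longrightarrow> 1 \<notin># \<nu> \<Longrightarrow> rdeg \<nu> + i + Suc t = d \<Longrightarrow> rlen \<nu> + 1 = r \<Longrightarrow> i + t \<ge> 2
    \<Longrightarrow> D0 ((NSx (\<lambda>k. 0) 1 u ^^ Suc t) (vacx F) i) (replicate_mset a 0 + \<nu>) = D0 F (replicate_mset (a + t) 0 + add_mset (i + t) \<nu>)"
proof (induction t arbitrary: i a)
  case 0
  then have i: "i \<ge> 2" by simp
  have "(\<Sum>m<i. D0 (vacx F m) (replicate_mset a 0 + add_mset (i - m) \<nu>)) = (\<Sum>m\<in>{0}. D0 (vacx F m) (replicate_mset a 0 + add_mset (i - m) \<nu>))"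
    using i by (intro sum.mono_neutral_right) (auto simp: vacx_def)
  moreover have "(\<Sum>j\<in>#\<nu>. real j * D0 (vacx F (i + j)) (replicate_mset a 0 + (\<nu> - {#j#}))) = 0"
    using i by (intro sum_mset.neutral) (auto simp: vacx_def)
  ultimately show ?case
    unfolding funpow.simps o_apply id_apply D0_NSx_0[OF 0(1)] by (simp add: vacx_def)
next
  case (Suc t)
  let ?h = "(NSx (\<lambda>k. 0) 1 u ^^ Suc t) (vacx F)"
  have 1: "D0 (?h m) (replicate_mset a 0 + add_mset (i - m) \<nu>) = 0" if "m < i" for m
  proof (rule walk_vanishes[OF F])
    show "0 \<notin># add_mset (i - m) \<nu>" using Suc.prems(1) that by auto
    show "rdeg (add_mset (i - m) \<nu>) + m + Suc t < d \<or> rdeg (add_mset (i - m) \<nu>) + m + Suc t = d \<and> rlen (add_mset (i - m) \<nu>) + (if m > 0 \<or> Suc t > 0 then 1 else 0) > r"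
      using that Suc.prems by (cases "i - m \<ge> 2") auto
  qed
  have 3: "D0 (?h (i + j)) (replicate_mset a 0 + (\<nu> - {#j#})) = 0" if "j \<in># \<nu>" for j
  proof -
    obtain \<nu>' where \<nu>': "\<nu> = add_mset j \<nu>'" using \<open>j \<in># \<nu>\<close> by (meson multi_member_split)
    have j: "j \<noteq> 0" "j \<noteq> 1" "0 \<notin># \<nu>'" using Suc.prems(1,2) \<nu>' by auto
    then have j2: "j \<ge> 2" by simp
    have "D0 (?h (i + j)) (replicate_mset a 0 + \<nu>') = 0"
      by (rule walk_vanishes[OF F j(3)]) (use Suc.prems(3) j2 in \<open>simp add: \<nu>'\<close>)
    then show ?thesis by (simp add: \<nu>')
  qed
  have s1: "(\<Sum>m<i. D0 (?h m) (replicate_mset a 0 + add_mset (i - m) \<nu>)) = 0"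
    using 1 by (intro sum.neutral) blast
  have s3: "(\<Sum>j\<in>#\<nu>. real j * D0 (?h (i + j)) (replicate_mset a 0 + (\<nu> - {#j#}))) = 0"
    using 3 by (intro sum_mset.neutral) auto
  have "D0 ((NSx (\<lambda>k. 0) 1 u ^^ Suc (Suc t)) (vacx F) i) (replicate_mset a 0 + \<nu>) = D0 (?h (Suc i)) (replicate_mset (Suc a) 0 + \<nu>)"
    unfolding funpow.simps(2)[of "Suc t"] o_apply D0_NSx_0[OF Suc.prems(1)] s1 s3 by (simp del: replicate_mset_Suc funpow.simps)
  also have "\<dots> = D0 F (replicate_mset (Suc a + t) 0 + add_mset (Suc i + t) \<nu>)"
    using Suc.prems by (intro Suc.IH) auto
  finally show ?case by simp
qed

lemma vanishes_Xop:
  assumes "vanishes (d + k) (Suc r) F" "k \<ge> 1"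
  shows "vanishes d r (Xop n k F)"
  unfolding vanishes_def NSx_moment_def
proof (intro allI impI)
  fix a and \<nu> :: "nat multiset" assume \<nu>: "0 \<notin># \<nu>" and "rdeg \<nu> < d \<or> rdeg \<nu> = d \<and> r < rlen \<nu>"
  then show "D0 ((NSx (\<lambda>k. 0) 1 (1 / real n) ^^ k) (vacx F) 0) (replicate_mset a 0 + \<nu>) = 0"
    using assms(2) by (intro walk_vanishes[OF assms(1)]) auto
qed

lemma Xop_leading:
  assumes F: "vanishes (d + k) (Suc r) F" and k: "k \<ge> 3"
    and \<nu>: "0 \<notin># \<nu>" "1 \<notin># \<nu>" "rdeg \<nu> = d" "rlen \<nu> = r"
  shows "D0 (Xop n k F) (replicate_mset a 0 + \<nu>) = D0 F (replicate_mset (a + (k - 1)) 0 + add_mset (k - 1) \<nu>)"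
proof -
  obtain t where t: "k = Suc t" "t \<ge> 2" using k by (cases k) auto
  show ?thesis unfolding NSx_moment_def t using walk_leading[OF F \<nu>(1,2), of 0 t "1 / real n" a] \<nu> t by simp
qed

lemma vanishes_word:
  assumes "vanishes (d + sum_list ks) (r + length ks) F" "\<forall>k\<in>set ks. k \<ge> 1"
  shows "vanishes d r (foldr (Xop n) ks F)"
  using assms
proof (induction ks arbitrary: d r)
  case (Cons k ks)
  then have "vanishes (d + k) (Suc r) (foldr (Xop n) ks F)" by (intro Cons.IH) (simp_all add: add_ac)
  then show ?case using Cons.prems(2) by (simp add: vanishes_Xop)
qed simp

text \<open>Each letter k accounts for k units of \<open>rdeg\<close> and one part k - 1, so at the
  extreme order the whole word reduces to a single derivative. Its k - 1 ascending steps appear as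
  derivatives in x_0.\<close>

lemma word_leading:
  assumes "vanishes (d + sum_list ks) (r + length ks) F" "\<forall>k\<in>set ks. k \<ge> 3"
    and "0 \<notin># \<nu>" "1 \<notin># \<nu>" "rdeg \<nu> = d" "rlen \<nu> = r"
  shows "D0 (foldr (Xop n) ks F) (replicate_mset a 0 + \<nu>)
    = D0 F (replicate_mset (a + sum_list (map (\<lambda>k. k - 1) ks)) 0 + (mset (map (\<lambda>k. k - 1) ks) + \<nu>))"
  using assms
proof (induction ks arbitrary: d r a \<nu>)
  case (Cons k ks)
  have v: "vanishes (d + k + sum_list ks) (Suc r + length ks) F" using Cons.prems(1) by (simp add: add_ac)
  have "\<forall>k\<in>set ks. k \<ge> 1" using Cons.prems(2) by auto
  then have "D0 (foldr (Xop n) (k # ks) F) (replicate_mset a 0 + \<nu>) = D0 (foldr (Xop n) ks F) (replicate_mset (a + (k - 1)) 0 + add_mset (k - 1) \<nu>)"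
    using Cons.prems by (simp add: Xop_leading[OF vanishes_word[OF v]])
  also have "\<dots> = D0 F (replicate_mset (a + (k - 1) + sum_list (map (\<lambda>k. k - 1) ks)) 0 + (mset (map (\<lambda>k. k - 1) ks) + add_mset (k - 1) \<nu>))"
    using Cons.prems by (intro Cons.IH[OF v]) auto
  finally show ?case by (simp add: add_ac)
qed simp

section \<open>Independence of x_0 and the factor exp(x_1)\<close>

lemma coef_mult_0:
  assumes f: "\<And>M. 0 \<in># M \<Longrightarrow> coef f M = 0" and g: "\<And>M. 0 \<in># M \<Longrightarrow> coef g M = 0" and M: "0 \<in># M"
  shows "coef (f * g) M = 0"
  unfolding coef_mult
proof (intro sum.neutral ballI)
  fix N assume "N \<in> {N. N \<subseteq># M}"
  then have "M = N + (M - N)" by simp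
  then have "0 \<in># N \<or> 0 \<in># M - N" using M by (metis union_iff)
  then show "coef f N * coef g (M - N) = 0" using f g by auto
qed

lemma coef_mln_0:
  assumes f: "\<And>M. 0 \<in># M \<Longrightarrow> coef f M = 0" and M: "0 \<in># M"
  shows "coef (mln f) M = 0"
proof -
  have "coef ((f - 1) ^ m) M = 0" if "0 \<in># M" for m M
    using that
  proof (induction m arbitrary: M)
    case 0
    then show ?case by auto
  next
    case (Suc m)
    have "coef (f - 1) N = 0" if "0 \<in># N" for N using f[OF that] that by auto
    then show ?case unfolding power_Suc using Suc by (intro coef_mult_0) auto
  qed
  then show ?thesis using M by (simp add: mln_def)
qed

lemma coef_mexp_0:
  assumes L: "\<And>M. 0 \<in># M \<Longrightarrow> coef L M = 0" "coef L {#} = 0" and M: "0 \<in># M"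
  shows "coef (mexp L) M = 0"
proof -
  obtain N where N: "M = add_mset 0 N" using M by (meson multi_member_split)
  have "pd 0 L = 0" by (rule mps_eqI) (simp add: coef_pd L)
  then have "coef (pd 0 (mexp L)) N = 0" by (simp add: pd_mexp[OF L(2)])
  then show ?thesis by (simp add: N coef_pd)
qed

abbreviation log_youngA :: "(nat \<Rightarrow> nat list pmf) \<Rightarrow> nat \<Rightarrow> mps" where
  "log_youngA rho n \<equiv> mln (of_mfps (youngA n (rho n)))"

text \<open>Cycles of length 1 do not change the permutation in \<open>M_rho\<close>, and x_1
  carries no power of n; so the series is exp(x_1) times a series free of x_1.\<close>

lemma pd_youngA_1: "pd 1 (of_mfps (youngA n rho)) = of_mfps (youngA n rho)"
proof (rule mps_eqI)
  fix M :: "nat multiset"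
  let ?M = "add_mset 1 M"
  have c: "count ?M k = count M k" if "k \<ge> 2" for k using that by simp
  have s: "{k. k \<ge> 2 \<and> count ?M k \<noteq> 0} = {k. k \<ge> 2 \<and> count M k \<noteq> 0}" using c by auto
  have s': "(\<Sum>k\<in>{k. k \<ge> 2 \<and> count M k \<noteq> 0}. k * count ?M k) = (\<Sum>k\<in>{k. k \<ge> 2 \<and> count M k \<noteq> 0}. k * count M k)"
    using c by (intro sum.cong) auto
  have mu: "map (\<lambda>k. replicate (count ?M k) k) [2..<n+1] = map (\<lambda>k. replicate (count M k) k) [2..<n+1]"
    using c by (intro map_cong) auto
  have M: "M_rho n rho (count ?M) = M_rho n rho (count M)"
    unfolding M_rho_def s s' mu ..
  have supp: "{k. count N k \<noteq> 0} = set_mset N" for N :: "nat multiset" by (auto simp: not_in_iff)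
  define A where "A = set_mset M - {1}"
  have A: "finite A" "1 \<notin> A" "insert 1 (set_mset M) = insert 1 A" by (auto simp: A_def)
  define f where "f N k = sqrt (real n) ^ (count N k * (k - 1)) / fact (count N k)" for N k
  have "(\<Prod>k\<in>set_mset M. f M k) = (\<Prod>k\<in>insert 1 (set_mset M). f M k)"
    by (rule prod.mono_neutral_left) (auto simp: f_def not_in_iff)
  also have "\<dots> = f M 1 * (\<Prod>k\<in>A. f M k)" using A by simp
  also have "(\<Prod>k\<in>A. f M k) = (\<Prod>k\<in>A. f ?M k)" using A by (intro prod.cong) (auto simp: f_def)
  finally have "real (count M 1 + 1) * (\<Prod>k\<in>set_mset ?M. f ?M k) = (\<Prod>k\<in>set_mset M. f M k)"
    using A by (simp add: f_def)
  note P = this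
  have y: "youngA n rho (count N) = (if count N 0 = 0 then M_rho n rho (count N) * (\<Prod>k\<in>set_mset N. f N k) else 0)" for N
    unfolding youngA_def supp f_def by simp
  have c0: "count ?M 0 = count M 0" by simp
  show "coef (pd 1 (of_mfps (youngA n rho))) M = coef (of_mfps (youngA n rho)) M"
    unfolding coef_pd coef_of_mfps y M c0 P[symmetric]
    by (cases "count M 0 = 0") (simp_all only: if_True if_False simp_thms mult.left_commute mult_zero_right)
qed

text \<open>Taking logarithms of the factor exp(x_1). This settles every multiset containing 1,
  which the leading terms cannot detect because \<open>rdeg\<close> ignores parts 1.\<close>

lemma D0_log_youngA_1:
  assumes "n \<ge> 1" "set_pmf (rho n) \<subseteq> Part n"
  shows "D0 (log_youngA rho n) (add_mset 1 M) = (if M = {#} then 1 else 0)"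
proof -
  let ?A = "of_mfps (youngA n (rho n))"
  have "?A = ?A * pd 1 (mln ?A)"
    using pd_mln[OF coef_youngA_empty[OF assms], of 1] unfolding pd_youngA_1 .
  then have "?A * (pd 1 (mln ?A) - 1) = 0" by (metis right_diff_distrib mult_1_right diff_self)
  then have "pd 1 (mln ?A) - 1 = 0" by (rule mps_cancel_left[OF coef_youngA_empty[OF assms]])
  then have "pd 1 (mln ?A) = 1" by simp
  then have "D0 (mln ?A) (add_mset 1 M) = D0 1 M" unfolding D0_pd[symmetric] by simp
  then show ?thesis by (simp add: D0_def)
qed

text \<open>The conditions of \<open>log_limits\<close> at one multiset, in a form uniform in its
  size, so that an induction over multisets can establish them one at a time.\<close>

definition log_converges :: "(nat \<Rightarrow> mps) \<Rightarrow> nat multiset \<Rightarrow> bool" where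
  "log_converges L M \<longleftrightarrow> (\<exists>l. (\<lambda>n. (if size M = 1 then 1 else sqrt (real n) ^ size M) * D0 (L n) M) \<longlonglongrightarrow> l \<and> (size M \<ge> 3 \<longrightarrow> l = 0))"

lemma log_converges_cong:
  assumes "\<And>n. n \<ge> 1 \<Longrightarrow> D0 (L n) M = D0 (L' n) M"
  shows "log_converges L M \<longleftrightarrow> log_converges L' M"
proof -
  have "(\<lambda>n. (if size M = 1 then 1 else sqrt (real n) ^ size M) * D0 (L n) M) \<longlonglongrightarrow> l \<longleftrightarrow>
    (\<lambda>n. (if size M = 1 then 1 else sqrt (real n) ^ size M) * D0 (L' n) M) \<longlonglongrightarrow> l" for l
    using assms by (intro tendsto_cong) (auto intro!: eventually_mono[OF eventually_ge_at_top[of 1]])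
  then show ?thesis by (simp only: log_converges_def)
qed

lemma log_converges_0: "(\<And>n. D0 (L n) M = 0) \<Longrightarrow> log_converges L M"
  by (auto simp: log_converges_def)

lemma log_limits_if_converges:
  assumes "\<And>M. M \<noteq> {#} \<Longrightarrow> 0 \<notin># M \<Longrightarrow> log_converges L M"
  shows "\<exists>c d. log_limits L c d"
proof -
  have "\<forall>M. \<exists>l. M \<noteq> {#} \<longrightarrow> 0 \<notin># M \<longrightarrow>
    (\<lambda>n. (if size M = 1 then 1 else sqrt (real n) ^ size M) * D0 (L n) M) \<longlonglongrightarrow> l \<and> (size M \<ge> 3 \<longrightarrow> l = 0)"
    using assms unfolding log_converges_def by blast
  from choice[OF this] obtain \<Lambda> where "\<forall>M. M \<noteq> {#} \<longrightarrow> 0 \<notin># M \<longrightarrow>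
    (\<lambda>n. (if size M = 1 then 1 else sqrt (real n) ^ size M) * D0 (L n) M) \<longlonglongrightarrow> \<Lambda> M \<and> (size M \<ge> 3 \<longrightarrow> \<Lambda> M = 0)"
    by blast
  note \<Lambda> = this[rule_format]
  have "log_limits L (\<lambda>i. \<Lambda> {#i#}) (\<lambda>i j. \<Lambda> {#i, j#})"
    unfolding log_limits_def
  proof (intro conjI allI impI)
    fix i :: nat assume "i \<ge> 1"
    then show "(\<lambda>n. D0 (L n) {#i#}) \<longlonglongrightarrow> \<Lambda> {#i#}" using \<Lambda>[of "{#i#}"] by simp
  next
    fix i j :: nat assume "i \<ge> 1" "j \<ge> 1"
    then show "(\<lambda>n. real n * D0 (L n) {#i, j#}) \<longlonglongrightarrow> \<Lambda> {#i, j#}" using \<Lambda>[of "{#i, j#}"] by simp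
  next
    fix M :: "nat multiset" assume M: "size M \<ge> 3" "0 \<notin># M"
    then have "M \<noteq> {#}" "size M \<noteq> 1" by auto
    then show "(\<lambda>n. sqrt (real n) ^ size M * D0 (L n) M) \<longlonglongrightarrow> 0" using \<Lambda>[of M] M by auto
  qed
  then show ?thesis by blast
qed

lemma log_converges_1:
  assumes "\<forall>n\<ge>1. set_pmf (rho n) \<subseteq> Part n" "1 \<in># M"
  shows "log_converges (log_youngA rho) M"
proof -
  obtain N where N: "M = add_mset 1 N" using assms(2) by (meson multi_member_split)
  define L' where "L' n = (if N = {#} then lin (\<lambda>_. 1) else 0)" for n :: nat
  have "D0 (log_youngA rho n) M = D0 (L' n) M" if "n \<ge> 1" for n
    using D0_log_youngA_1[of n rho N] assms(1) that unfolding N L'_def by (simp add: D0_def)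
  then have "log_converges (log_youngA rho) M \<longleftrightarrow> log_converges L' M" by (rule log_converges_cong)
  moreover have "log_converges L' M"
    unfolding log_converges_def N L'_def by (cases "N = {#}") auto
  ultimately show ?thesis by simp
qed

text \<open>Comparing \<open>nr\<close> amounts to comparing \<open>rdeg\<close> first and then, in reverse, the number of parts.\<close>

definition nr :: "nat multiset \<Rightarrow> nat" where
  "nr M = rdeg M * (rdeg M + 1) + (rdeg M - rlen M)"

lemma nr_less:
  assumes "rdeg N < rdeg M"
  shows "nr N < nr M"
proof -
  have "nr N \<le> rdeg N * (rdeg N + 1) + rdeg N" by (simp add: nr_def)
  also have "\<dots> < (rdeg N + 1) * (rdeg N + 2)" by (simp add: algebra_simps)
  also have "\<dots> \<le> rdeg M * (rdeg M + 1)" using assms by (intro mult_le_mono) auto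
  finally show ?thesis by (simp add: nr_def)
qed

lemma nr_less':
  assumes "rdeg N = rdeg M" "rlen M < rlen N"
  shows "nr N < nr M"
  using assms rlen_le_rdeg[of N] by (simp add: nr_def)

lemma rdeg_union: "rdeg (M + N) = rdeg M + rdeg N" and rlen_union: "rlen (M + N) = rlen M + rlen N"
  by (simp_all add: rdeg_def rlen_def)

lemma NSx_moment_diff: "NSx_moment c t u k (f - g) = NSx_moment c t u k f - NSx_moment c t u k g"
  using NSx_moment_add[of c t u k "f - g" g] by simp

lemma foldr_Xop_diff: "foldr (Xop n) ks (f - g) = foldr (Xop n) ks f - foldr (Xop n) ks g"
  by (induction ks) (simp_all add: NSx_moment_diff)

lemma cum_singleton: "m {} = 1 \<Longrightarrow> cum m {0} = m {0}"
proof -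
  assume "m {} = 1"
  moreover have "{B. (0::nat) \<in> B \<and> B \<subset> {0}} = {}" by auto
  ultimately show ?thesis using cum_eq[where m = m and S = "{0}" and x = 0] by (simp only:) simp
qed

lemma binom_coef_limit: "(\<lambda>n. fact w * real (n choose w) / real n ^ w) \<longlonglongrightarrow> 1"
proof (induction w)
  case (Suc w)
  have "(\<lambda>n. fact w * real (n choose w) / real n ^ w * ((real n - real w) / real n)) \<longlonglongrightarrow> 1 * 1"
    by (intro tendsto_mult Suc.IH) real_asymp
  moreover have "\<forall>\<^sub>F n in sequentially. fact w * real (n choose w) / real n ^ w * ((real n - real w) / real n) = fact (Suc w) * real (n choose Suc w) / real n ^ Suc w"
    using eventually_ge_at_top[of "Suc w"]
  proof eventually_elim
    case (elim n)
    have "(w + 1) * (n choose (w + 1)) = (n - w) * (n choose w)"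
      by (metis Suc_eq_plus1 binomial_absorb_comp binomial_absorption)
    then have "real (w + 1) * real (n choose (w + 1)) = (real n - real w) * real (n choose w)"
      using elim by (metis of_nat_mult of_nat_diff Suc_leD)
    then have e: "fact (Suc w) * real (n choose Suc w) = fact w * ((real n - real w) * real (n choose w))"
      by (simp add: mult_ac)
    show ?case unfolding e by (simp add: mult_ac)
  qed
  ultimately show ?case using Lim_transform_eventually by force
qed simp

lemma subword_full: "subword ks {..<length ks} = ks"
proof -
  have "sorted_list_of_set {..<length ks} = [0..<length ks]"
    unfolding lessThan_atLeast0 by (rule sorted_list_of_set_range)
  then show ?thesis by (simp add: subword_def map_nth)
qed

lemma rdeg_mset: "\<forall>x\<in>set xs. x \<ge> 2 \<Longrightarrow> rdeg (mset xs) = sum_list (map Suc xs)"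
  by (induction xs) auto

lemma rlen_eq_size: "0 \<notin># \<nu> \<Longrightarrow> 1 \<notin># \<nu> \<Longrightarrow> rlen \<nu> = size \<nu>"
  by (induction \<nu>) auto

text \<open>Truncating the logarithm below \<open>\<nu>\<close> changes the cumulant indexed by the parts of \<open>\<nu>\<close>, each
  increased by one, exactly by a multiple of the coefficient at \<open>\<nu>\<close>.\<close>

lemma cum_diff_truncated:
  assumes n: "n \<ge> 1" and rho: "set_pmf (rho n) \<subseteq> Part n"
    and \<nu>: "0 \<notin># \<nu>" "1 \<notin># \<nu>" "\<nu> \<noteq> {#}" and xs: "mset xs = \<nu>"
    and L': "\<And>M. coef L' M = (if nr M < nr \<nu> then coef (log_youngA rho n) M else 0)"
  defines "ks \<equiv> map Suc xs" and "w \<equiv> sum_mset \<nu>"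
  shows "cum (word_moment n (binom_series n * of_mfps (youngA n (rho n))) ks) {..<length ks}
      - cum (word_moment n (binom_series n * mexp L') ks) {..<length ks}
    = fact w * real (n choose w) / real n ^ w * D0 (log_youngA rho n) \<nu>"
proof -
  define A L A' where "A = of_mfps (youngA n (rho n))" and "L = log_youngA rho n" and "A' = mexp L'"
  define F where "F = binom_series n * (A - A')"
  have A1: "coef A {#} = 1" unfolding A_def by (rule coef_youngA_empty[OF n rho])
  have A0: "coef A M = 0" if "0 \<in># M" for M unfolding A_def by (rule coef_youngA_0[OF that])
  have "pd k A = A * pd k L" for k using pd_mln[OF A1, of k] by (simp only: A_def L_def)
  note A = this A1 A0
  have L0: "0 \<in># M \<Longrightarrow> coef L M = 0" for M unfolding L_def by (rule coef_mln_0) (simp_all only: coef_youngA_0)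
  have L'0: "coef L' {#} = 0" "\<And>M. 0 \<in># M \<Longrightarrow> coef L' M = 0" using L0 by (simp_all add: L' L_def)
  have A'0: "coef A' M = 0" if "0 \<in># M" for M unfolding A'_def by (rule coef_mexp_0[OF L'0(2,1) that])
  have "pd k A' = A' * pd k L'" for k unfolding A'_def by (rule pd_mexp[OF L'0(1)])
  moreover have "coef A' {#} = 1" by (simp add: A'_def)
  moreover note A'0
  ultimately have A': "\<And>k. pd k A' = A' * pd k L'" "coef A' {#} = 1" "\<And>M. 0 \<in># M \<Longrightarrow> coef A' M = 0" by blast+
  have agree: "D0 A M = D0 A' M" if "\<And>N. N \<subseteq># M \<Longrightarrow> nr N < nr \<nu>" for M
  proof -
    have "coef A M = coef A' M"
      using that by (intro exp_log_cong[OF A(1,2) A'(1,2)]) (simp add: L' L_def)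
    then show ?thesis by (simp add: D0_def)
  qed
  have D0F: "D0 F (replicate_mset a 0 + M) = fact a * real (n choose a) / real n ^ a * (D0 A M - D0 A' M)" if "0 \<notin># M" for a M
    unfolding F_def D0_diff[symmetric] using that A(3) A'(3) by (intro D0_binom_mult) auto
  have van: "vanishes (rdeg \<nu>) (size \<nu>) F"
    unfolding vanishes_def
  proof (intro allI impI)
    fix a M assume M: "0 \<notin># M" "rdeg M < rdeg \<nu> \<or> rdeg M = rdeg \<nu> \<and> size \<nu> < rlen M"
    have "nr N < nr \<nu>" if "N \<subseteq># M" for N
    proof -
      obtain P where P: "M = N + P" using \<open>N \<subseteq># M\<close> by (metis mset_subset_eq_exists_conv)
      show ?thesis
      proof (cases "rdeg N < rdeg \<nu>")
        \<comment> \<open>Here M and N differ only in parts 1, so N has the same large parts as M,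
          more than \<nu> has at equal \<open>rdeg\<close>, and is therefore lower.\<close>
        case False
        then have "rdeg P = 0" "rdeg N = rdeg \<nu>" "size \<nu> < rlen M" using M(2) by (auto simp: P rdeg_union)
        moreover from this have "rlen P = 0" using rlen_le_rdeg[of P] by simp
        ultimately show ?thesis using rlen_eq_size[OF \<nu>(1,2)] by (intro nr_less') (auto simp: P rlen_union)
      qed (rule nr_less)
    qed
    then show "D0 F (replicate_mset a 0 + M) = 0" using agree[of M] D0F[OF M(1)] by simp
  qed
  have lead: "D0 A \<nu> - D0 A' \<nu> = D0 L \<nu>"
  proof -
    \<comment> \<open>All parts of \<nu> are at least 2, so a proper submultiset loses
      \<open>rdeg\<close>.\<close>
    have sub: "nr N < nr \<nu>" if "N \<subset># \<nu>" for N
    proof -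
      obtain P where P: "\<nu> = N + P" using subset_mset.less_imp_le[OF \<open>N \<subset># \<nu>\<close>] by (metis mset_subset_eq_exists_conv)
      have "P \<noteq> {#}" using \<open>N \<subset># \<nu>\<close> unfolding P by auto
      then obtain j P' where j: "P = add_mset j P'" by (cases P) auto
      have "j \<in># \<nu>" by (simp add: P j)
      then have "j \<noteq> 0" "j \<noteq> 1" using \<nu>(1,2) by metis+
      then have "rdeg P > 0" by (simp add: j)
      then show ?thesis by (intro nr_less) (simp add: P rdeg_union)
    qed
    have "coef A \<nu> - coef A' \<nu> = coef L \<nu> - coef L' \<nu>"
    proof (rule exp_log_diff[OF A(1,2) A'(1,2) \<nu>(3)])
      fix N assume N: "N \<subset># \<nu>"
      show "N \<noteq> {#} \<Longrightarrow> coef L N = coef L' N" using sub[OF N] by (simp add: L' L_def)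
      show "coef A N = coef A' N"
        using N sub by (intro exp_log_cong[OF A(1,2) A'(1,2)]) (simp_all add: L' L_def subset_mset.le_less_trans)
    qed
    then have "D0 A \<nu> - D0 A' \<nu> = D0 L \<nu> - D0 L' \<nu>" by (rule D0_diff_eqI)
    also have "D0 L' \<nu> = 0" by (simp add: D0_def L')
    finally show ?thesis by simp
  qed
  have x2: "\<forall>x\<in>set xs. x \<ge> 2"
  proof
    fix x assume "x \<in> set xs"
    then have "x \<in># \<nu>" using xs by auto
    then have "x \<noteq> 0" "x \<noteq> 1" using \<nu> by metis+
    then show "x \<ge> 2" by simp
  qed
  have ks3: "\<forall>k\<in>set ks. k \<ge> 3" using x2 by (auto simp: ks_def)
  have sum: "sum_list ks = rdeg \<nu>" using rdeg_mset[OF x2] xs by (simp add: ks_def)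
  have len: "length ks = size \<nu>" using xs by (auto simp: ks_def)
  have word: "word_moment n (binom_series n * A) ks S - word_moment n (binom_series n * A') ks S = coef (foldr (Xop n) (subword ks S) F) {#}" for S
    by (simp add: word_moment_def F_def right_diff_distrib foldr_Xop_diff)
  \<comment> \<open>The letters of a proper subword sum to less than \<open>rdeg \<nu>\<close>, too
    little to reach the first multiset where the two series differ.\<close>
  have proper: "word_moment n (binom_series n * A) ks S = word_moment n (binom_series n * A') ks S" if S: "S \<subset> {..<length ks}" for S
  proof -
    have finS: "finite S" using S finite_subset by blast
    have sS: "sum_list (subword ks S) = (\<Sum>j\<in>S. ks ! j)"
      using finS by (simp add: subword_def sum_list_distinct_conv_sum_set)
    have lS: "length (subword ks S) = card S" by (simp add: subword_def)
    obtain j where j: "j \<in> {..<length ks}" "j \<notin> S" using S by blast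
    have "sum_list ks = (\<Sum>j<length ks. ks ! j)" by (simp add: sum_list_sum_nth lessThan_atLeast0)
    moreover have "(\<Sum>j\<in>S. ks ! j) < (\<Sum>j<length ks. ks ! j)"
      by (rule sum_strict_mono2[of _ _ j]) (use S j ks3 in \<open>auto dest!: nth_mem\<close>)
    ultimately have less: "sum_list (subword ks S) < rdeg \<nu>" by (simp add: sS sum[symmetric])
    have card: "card S \<le> size \<nu>" using card_mono[of "{..<length ks}" S] S by (simp add: len)
    have ks1: "\<forall>k\<in>set (subword ks S). k \<ge> 1"
    proof
      fix k assume "k \<in> set (subword ks S)"
      then obtain j where "j \<in> S" "k = ks ! j" using finS by (auto simp: subword_def)
      then have "k \<in> set ks" using S by auto
      then show "k \<ge> 1" using ks3 by force
    qed
    have "vanishes (rdeg \<nu> - sum_list (subword ks S)) (size \<nu> - card S) (foldr (Xop n) (subword ks S) F)"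
      by (rule vanishes_word[OF _ ks1]) (use van less card lS in simp)
    then have "D0 (foldr (Xop n) (subword ks S) F) (replicate_mset 0 0 + {#}) = 0"
      unfolding vanishes_def using less by (elim allE[of _ 0] allE[of _ "{#}"] impE) simp_all
    then show ?thesis using word[of S] by simp
  qed
  \<comment> \<open>The full word reaches \<nu> exactly, together with w derivatives in x_0. These
    fall on the binomial factor and produce the prefactor, which tends to 1.\<close>
  have full: "word_moment n (binom_series n * A) ks {..<length ks} - word_moment n (binom_series n * A') ks {..<length ks}
    = fact w * real (n choose w) / real n ^ w * D0 L \<nu>"
  proof -
    have m: "map (\<lambda>k. k - 1) ks = xs" by (simp add: ks_def o_def)
    have sl: "sum_list xs = w" using xs by (metis sum_mset_sum_list w_def)
    have "coef (foldr (Xop n) ks F) {#} = D0 (foldr (Xop n) ks F) (replicate_mset 0 0 + {#})" by simp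
    also have "\<dots> = D0 F (replicate_mset (0 + sum_list (map (\<lambda>k. k - 1) ks)) 0 + (mset (map (\<lambda>k. k - 1) ks) + {#}))"
      by (rule word_leading[where d = 0 and r = 0]) (use van ks3 in \<open>simp_all add: sum len\<close>)
    also have "\<dots> = D0 F (replicate_mset w 0 + \<nu>)" unfolding m xs sl by simp
    also have "\<dots> = fact w * real (n choose w) / real n ^ w * D0 L \<nu>" unfolding D0F[OF \<nu>(1)] lead ..
    finally show ?thesis unfolding word subword_full .
  qed
  have e: "word_moment n (binom_series n * A) ks {} = 1" "word_moment n (binom_series n * A') ks {} = 1"
    using A(2) A'(2) by (simp_all add: word_moment_def binom_series_def)
  have ne: "{..<length ks} \<noteq> {}" using \<nu>(3) xs by (auto simp: ks_def lessThan_empty_iff)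
  show ?thesis
    using cum_diff[where m = "word_moment n (binom_series n * A) ks" and m' = "word_moment n (binom_series n * A') ks", OF _ ne e proper] full
    by (simp add: A_def A'_def L_def)
qed

lemma expectation_Xk:
  assumes "n \<ge> 1" "set_pmf rho \<subseteq> Part n"
  shows "measure_pmf.expectation rho (Xk n k) = word_moment n (binom_series n * of_mfps (youngA n rho)) [k] {0}"
  using word_moment_youngA[OF assms, of "{0}" "[k]"] by simp

lemma satisfies_clt_cumulants:
  assumes clt: "satisfies_clt rho a b" and ks: "\<forall>k\<in>set ks. k \<ge> 1" "length ks \<ge> 2"
  shows "\<exists>l. (\<lambda>n. sqrt (real n) ^ length ks * joint_cumulant (rho n) (map (Xk n) ks)) \<longlonglongrightarrow> l \<and> (length ks \<ge> 3 \<longrightarrow> l = 0)"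
proof (cases "length ks = 2")
  case True
  then obtain k k' where kk: "ks = [k, k']" by (auto simp: numeral_2_eq_2 length_Suc_conv)
  have "(\<lambda>n. real n * joint_cumulant (rho n) [Xk n k, Xk n k']) \<longlonglongrightarrow> b k k'"
    using clt ks(1) unfolding satisfies_clt_def kk by simp
  then show ?thesis unfolding kk by auto
next
  case False
  then have "length ks \<ge> 3" using ks(2) by simp
  then have "(\<lambda>n. sqrt (real n) ^ length ks * joint_cumulant (rho n) (map (Xk n) ks)) \<longlonglongrightarrow> 0"
    using clt ks(1) unfolding satisfies_clt_def by blast
  then show ?thesis by blast
qed

text \<open>By induction the logarithm with all coefficients from \<nu> upwards set to 0 satisfies
  \<open>log_limits\<close>, so its cumulants converge. Subtracting them from the cumulants
  controlled by the CLT isolates the coefficient at \<nu>.\<close>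

lemma log_converges_step:
  assumes rho: "\<forall>n\<ge>1. set_pmf (rho n) \<subseteq> Part n" and clt: "satisfies_clt rho a b"
    and \<nu>: "0 \<notin># \<nu>" "1 \<notin># \<nu>" "\<nu> \<noteq> {#}"
    and IH: "\<And>M. M \<noteq> {#} \<Longrightarrow> 0 \<notin># M \<Longrightarrow> 1 \<notin># M \<Longrightarrow> nr M < nr \<nu> \<Longrightarrow> log_converges (log_youngA rho) M"
  shows "log_converges (log_youngA rho) \<nu>"
proof -
  define L' where "L' n = Mps (\<lambda>M. if nr M < nr \<nu> then coef (log_youngA rho n) M else 0)" for n
  have L': "coef (L' n) M = (if nr M < nr \<nu> then coef (log_youngA rho n) M else 0)" for n M by (simp add: L'_def)
  have conv: "log_converges L' M" if M: "M \<noteq> {#}" "0 \<notin># M" for M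
  proof (cases "nr M < nr \<nu>")
    case True
    have "log_converges (log_youngA rho) M" using log_converges_1[OF rho, of M] IH[OF M] True by blast
    moreover have "log_converges (log_youngA rho) M \<longleftrightarrow> log_converges L' M"
      using True by (intro log_converges_cong) (simp add: D0_def L')
    ultimately show ?thesis by simp
  qed (simp add: log_converges_0 D0_def L')
  obtain c' d' where lim: "log_limits L' c' d'" using log_limits_if_converges[of L'] conv by blast
  have L'1: "coef (L' n) {#} = 0" for n by (simp add: L')
  have L'0: "coef (L' n) M = 0" if "0 \<in># M" for n M
    using coef_mln_0[of "of_mfps (youngA n (rho n))" M] coef_youngA_0 that by (auto simp: L')
  have W1: "(\<lambda>n. word_moment n (binom_series n * mexp (L' n)) [k] {0}) \<longlonglongrightarrow> clt_a c' k" for k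
    by (rule log_limits_imp_cumulants(1)[OF lim]) (simp_all add: pd_mexp[OF L'1] L'0)
  have W2: "(\<lambda>n. sqrt (real n) ^ length ks * cum (word_moment n (binom_series n * mexp (L' n)) ks) {..<length ks})
      \<longlonglongrightarrow> (if length ks = 2 then clt_b c' d' (ks ! 0) (ks ! 1) else 0)" if "length ks \<ge> 2" for ks
    by (rule log_limits_imp_cumulants(2)[OF lim]) (simp_all add: pd_mexp[OF L'1] L'0 that)
  obtain xs where xs: "mset xs = \<nu>" using ex_mset by blast
  define ks where "ks = map Suc xs"
  have len: "length ks = size \<nu>" using xs by (auto simp: ks_def)
  have ks1: "\<forall>k\<in>set ks. k \<ge> 1" by (auto simp: ks_def)
  define w where "w = sum_mset \<nu>"
  define q where "q n = fact w * real (n choose w) / real n ^ w" for n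
  have qlim: "q \<longlonglongrightarrow> 1" using binom_coef_limit[of w] by (simp add: q_def[abs_def])
  \<comment> \<open>For size 1 the CLT controls a mean, without any scaling; from size 2 on it
    controls scaled cumulants.\<close>
  define s where "s n = (if size \<nu> = 1 then 1 else sqrt (real n) ^ size \<nu>)" for n :: nat
  have diff: "cum (word_moment n (binom_series n * of_mfps (youngA n (rho n))) ks) {..<length ks}
      - cum (word_moment n (binom_series n * mexp (L' n)) ks) {..<length ks} = q n * D0 (log_youngA rho n) \<nu>" if "n \<ge> 1" for n
    unfolding q_def w_def ks_def
    by (rule cum_diff_truncated[where rho = rho and L' = "L' n"]) (use that rho \<nu> xs L' in simp_all)
  have "\<exists>l. (\<lambda>n. s n * (q n * D0 (log_youngA rho n) \<nu>)) \<longlonglongrightarrow> l \<and> (size \<nu> \<ge> 3 \<longrightarrow> l = 0)"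
  proof (cases "size \<nu> = 1")
    case True
    then obtain k where k: "ks = [k]" using len by (auto simp: length_Suc_conv)
    have "(\<lambda>n. measure_pmf.expectation (rho n) (Xk n k)) \<longlonglongrightarrow> a k"
      using clt ks1 unfolding satisfies_clt_def k by simp
    then have "(\<lambda>n. measure_pmf.expectation (rho n) (Xk n k) - word_moment n (binom_series n * mexp (L' n)) [k] {0}) \<longlonglongrightarrow> a k - clt_a c' k"
      by (intro tendsto_diff W1)
    moreover have "\<forall>\<^sub>F n in sequentially. measure_pmf.expectation (rho n) (Xk n k) - word_moment n (binom_series n * mexp (L' n)) [k] {0} = s n * (q n * D0 (log_youngA rho n) \<nu>)"
      using eventually_ge_at_top[of 1]
    proof eventually_elim
      case (elim n)
      have r: "set_pmf (rho n) \<subseteq> Part n" using rho elim by simp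
      have c1: "cum (word_moment n (binom_series n * B) [k]) {0} = word_moment n (binom_series n * B) [k] {0}" if "coef B {#} = 1" for B
        using that by (intro cum_singleton) (simp add: word_moment_def binom_series_def)
      have "{..<length ks} = {0}" by (auto simp: k)
      then show ?case
        using diff[OF elim] c1[OF coef_youngA_empty[OF elim r]] c1[OF coef_mexp_empty[of "L' n"]] expectation_Xk[OF elim r, of k] True
        by (simp add: s_def k)
    qed
    ultimately have "(\<lambda>n. s n * (q n * D0 (log_youngA rho n) \<nu>)) \<longlonglongrightarrow> a k - clt_a c' k" by (rule Lim_transform_eventually)
    then show ?thesis using True by auto
  next
    case False
    then have l2: "length ks \<ge> 2" using \<nu>(3) by (cases "size \<nu>") (auto simp: len)
    obtain l where l: "(\<lambda>n. sqrt (real n) ^ length ks * joint_cumulant (rho n) (map (Xk n) ks)) \<longlonglongrightarrow> l" "length ks \<ge> 3 \<longrightarrow> l = 0"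
      using satisfies_clt_cumulants[OF clt ks1 l2] by blast
    define l' where "l' = (if length ks = 2 then clt_b c' d' (ks ! 0) (ks ! 1) else 0)"
    have "(\<lambda>n. sqrt (real n) ^ length ks * joint_cumulant (rho n) (map (Xk n) ks)
        - sqrt (real n) ^ length ks * cum (word_moment n (binom_series n * mexp (L' n)) ks) {..<length ks}) \<longlonglongrightarrow> l - l'"
      unfolding l'_def by (intro tendsto_diff l(1) W2[OF l2])
    moreover have "\<forall>\<^sub>F n in sequentially. sqrt (real n) ^ length ks * joint_cumulant (rho n) (map (Xk n) ks)
        - sqrt (real n) ^ length ks * cum (word_moment n (binom_series n * mexp (L' n)) ks) {..<length ks} = s n * (q n * D0 (log_youngA rho n) \<nu>)"
      using eventually_ge_at_top[of 1]
    proof eventually_elim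
      case (elim n)
      have r: "set_pmf (rho n) \<subseteq> Part n" using rho elim by simp
      show ?case unfolding diff[OF elim, symmetric] joint_cumulant_eq_cum[OF elim r] using False
        by (simp add: s_def len right_diff_distrib)
    qed
    ultimately have "(\<lambda>n. s n * (q n * D0 (log_youngA rho n) \<nu>)) \<longlonglongrightarrow> l - l'" by (rule Lim_transform_eventually)
    \<comment> \<open>From size 3 on both the given cumulant and that of the truncated series tend
      to 0.\<close>
    moreover have "size \<nu> \<ge> 3 \<longrightarrow> l - l' = 0" using l(2) by (simp add: l'_def len)
    ultimately show ?thesis by blast
  qed
  then obtain l where l: "(\<lambda>n. s n * (q n * D0 (log_youngA rho n) \<nu>)) \<longlonglongrightarrow> l" "size \<nu> \<ge> 3 \<longrightarrow> l = 0" by blast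
  have "(\<lambda>n. s n * (q n * D0 (log_youngA rho n) \<nu>) / q n) \<longlonglongrightarrow> l / 1"
    by (intro tendsto_divide l(1) qlim) simp
  moreover have "\<forall>\<^sub>F n in sequentially. s n * (q n * D0 (log_youngA rho n) \<nu>) / q n = s n * D0 (log_youngA rho n) \<nu>"
    using order_tendstoD(1)[OF qlim, of 0, OF zero_less_one] by eventually_elim simp
  ultimately have "(\<lambda>n. s n * D0 (log_youngA rho n) \<nu>) \<longlonglongrightarrow> l / 1" by (rule Lim_transform_eventually)
  then show ?thesis unfolding log_converges_def s_def using l(2) by auto
qed

lemma log_converges_all:
  assumes rho: "\<forall>n\<ge>1. set_pmf (rho n) \<subseteq> Part n" and clt: "satisfies_clt rho a b"
  shows "0 \<notin># \<nu> \<Longrightarrow> 1 \<notin># \<nu> \<Longrightarrow> \<nu> \<noteq> {#} \<Longrightarrow> log_converges (log_youngA rho) \<nu>"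
proof (induction \<nu> rule: measure_induct_rule[of nr])
  case (less \<nu>)
  show ?case by (rule log_converges_step[OF rho clt less.prems]) (rule less.IH)
qed

theorem mainTheorem2:
  fixes rho :: "nat \<Rightarrow> nat list pmf"
  assumes "\<forall>n\<ge>1. set_pmf (rho n) \<subseteq> Part n"
  shows "((\<exists>c d. clt_appropriate rho c d) \<longleftrightarrow> (\<exists>a b. satisfies_clt rho a b)) \<and>
         (\<forall>c d. clt_appropriate rho c d \<longrightarrow> satisfies_clt rho (clt_a c) (clt_b c d))"
proof -
  have forward: "satisfies_clt rho (clt_a c) (clt_b c d)" if "clt_appropriate rho c d" for c d
  proof -
    have lim: "log_limits (log_youngA rho) c d" using that by (simp add: clt_appropriate_iff)
    have A1: "coef (of_mfps (youngA n (rho n))) {#} = 1" if "n \<ge> 1" for n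
      using that assms by (intro coef_youngA_empty) auto
    have L0: "coef (log_youngA rho n) M = 0" if "0 \<in># M" for n M
      by (rule coef_mln_0[OF coef_youngA_0 that])
    have P: "pd k (of_mfps (youngA n (rho n))) = of_mfps (youngA n (rho n)) * pd k (log_youngA rho n)" if "n \<ge> 1" for n k
      by (rule pd_mln[OF A1[OF that]])
    have W1: "(\<lambda>n. word_moment n (binom_series n * of_mfps (youngA n (rho n))) [k] {0}) \<longlonglongrightarrow> clt_a c k" for k
      by (rule log_limits_imp_cumulants(1)[OF lim]) (erule P, erule A1, erule L0)
    have W2: "(\<lambda>n. sqrt (real n) ^ length ks * cum (word_moment n (binom_series n * of_mfps (youngA n (rho n))) ks) {..<length ks})
      \<longlonglongrightarrow> (if length ks = 2 then clt_b c d (ks ! 0) (ks ! 1) else 0)" if "length ks \<ge> 2" for ks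
      by (rule log_limits_imp_cumulants(2)[OF lim]) (erule P, erule A1, erule L0, rule that)
    have c: "(\<lambda>n. sqrt (real n) ^ length ks * joint_cumulant (rho n) (map (Xk n) ks))
      \<longlonglongrightarrow> (if length ks = 2 then clt_b c d (ks ! 0) (ks ! 1) else 0)" if "length ks \<ge> 2" for ks
      using W2[OF that]
    proof (rule Lim_transform_eventually)
      show "\<forall>\<^sub>F n in sequentially. sqrt (real n) ^ length ks * cum (word_moment n (binom_series n * of_mfps (youngA n (rho n))) ks) {..<length ks}
        = sqrt (real n) ^ length ks * joint_cumulant (rho n) (map (Xk n) ks)"
        using eventually_ge_at_top[of 1] by eventually_elim (use assms in \<open>simp add: joint_cumulant_eq_cum\<close>)
    qed
    show ?thesis
      unfolding satisfies_clt_def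
    proof (intro conjI allI impI)
      fix k :: nat
      show "(\<lambda>n. measure_pmf.expectation (rho n) (Xk n k)) \<longlonglongrightarrow> clt_a c k"
        using W1
      proof (rule Lim_transform_eventually)
        show "\<forall>\<^sub>F n in sequentially. word_moment n (binom_series n * of_mfps (youngA n (rho n))) [k] {0} = measure_pmf.expectation (rho n) (Xk n k)"
          using eventually_ge_at_top[of 1] by eventually_elim (use assms in \<open>simp add: expectation_Xk\<close>)
      qed
    next
      fix k k' :: nat
      show "(\<lambda>n. real n * joint_cumulant (rho n) [Xk n k, Xk n k']) \<longlonglongrightarrow> clt_b c d k k'"
        using c[of "[k, k']"] by simp
    next
      fix ks :: "nat list" assume "length ks \<ge> 3"
      then show "(\<lambda>n. sqrt (real n) ^ length ks * joint_cumulant (rho n) (map (Xk n) ks)) \<longlonglongrightarrow> 0"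
        using c[of ks] by auto
    qed
  qed
  have "\<exists>c d. clt_appropriate rho c d" if "satisfies_clt rho a b" for a b
  proof -
    \<comment> \<open>Multisets containing 1 are covered by the factor exp(x_1), all others by
      induction along \<open>nr\<close>.\<close>
    have "log_converges (log_youngA rho) M" if "M \<noteq> {#}" "0 \<notin># M" for M
      using log_converges_1[OF assms, of M] log_converges_all[OF assms \<open>satisfies_clt rho a b\<close> that(2) _ that(1)] by blast
    then show ?thesis unfolding clt_appropriate_iff by (intro log_limits_if_converges)
  qed
  then show ?thesis using forward by blast
qed

end
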